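(* Let $G$ be a finite group. For a Mackey functor $M\colon\mathcal{B}_G^{\mathrm{op}}\to\mathcal{A}b$, regard $M$ as a $\mathbf{PC}$-functor $G\mathcal{E}^{\mathrm{op}}\to\mathrm{Perm}$ and let $K_GM\colon G\mathcal{B}^{\mathrm{op}}\to\mathcal{S}pec$ be the spectral functor $\Phi\circ\mathbb{K}_\bullet M$. Then $K_GM$ represents an Eilenberg--MacLane $G$-spectrum for $M$, that is, $$\underline{\pi}_0(K_GM)\cong M\ \text{ as Mackey functors, and }\ \underline{\pi}_n(K_GM)=0\ \text{ for } n\neq0,$$ and the construction $M\mapsto K_GM$ is functorial in natural transformations of Mackey functors.
   Context: **Permutative categories and multilinear functors.** A permutative category is a symmetric monoidal category whose associativity and unit constraints are identities; product $\oplus$, unit $0$, symmetry $\gamma$. Permutative categories, functors and natural transformations are assumed topologically enriched. A strictly unital lax symmetric monoidal functor $(f,\delta)\colon\mathcal{A}\to\mathcal{B}$ is a functor $f$ with a natural transformation $\delta\colon f(a)\oplus f(a')\to f(a\oplus a')$ (the structure morphism) such that $f(0)=0$; $\delta=\mathrm{id}$ if $a$ or $a'$ is $0$; $\delta\circ(\mathrm{id}\oplus\delta)=\delta\circ(\delta\oplus\mathrm{id})$ as maps $f(a)\oplus f(a')\oplus f(a'')\to f(a\oplus a'\oplus a'')$; and $f(\gamma)\circ\delta=\delta\circ\gamma$. A multilinear functor $(f;\delta_1,\dots,\delta_k)\colon(\mathcal{A}_1,\dots,\mathcal{A}_k)\to\mathcal{B}$ is a functor $f\colon\mathcal{A}_1\times\cdots\times\mathcal{A}_k\to\mathcal{B}$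 with natural transformations (linearity constraints) $\delta_i\colon f(\dots,a_i,\dots)\oplus f(\dots,a_i',\dots)\to f(\dots,a_i\oplus a_i',\dots)$ such that: $f(a_1,\dots,a_k)=0$ if some $a_j=0$ (and likewise $f$ of morphisms is $\mathrm{id}_0$ if one of them is $\mathrm{id}_0$); $\delta_i$ is the identity if $a_i$, $a_i'$ or some other $a_j$ is $0$; each $\delta_i$ satisfies the associativity and symmetry conditions above in the $i$-th variable; and for $i\ne j$ the two maps $f(a_i,a_j)\oplus f(a_i',a_j)\oplus f(a_i,a_j')\oplus f(a_i',a_j')\to f(a_i\oplus a_i',a_j\oplus a_j')$ given by $\delta_j\circ(\delta_i\oplus\delta_i)$ and $\delta_i\circ(\delta_j\oplus\delta_j)\circ(\mathrm{id}\oplus\gamma\oplus\mathrm{id})$ agree. The (symmetric) multicategory $\underline{\mathrm{Perm}}$ has small permutative categories as objects and multilinear functors as $k$-morphisms; a $0$-morphism $()\to\mathcal{A}$ is an object of $\mathcal{A}$. The underlying functor of a composite is the evident one, and its constraint in the $i$-th variable of $f_j$ is $g(\delta_i^{f_j})\circ\delta_j^g$. **$\mathbf{PC}$-categories.** A $\mathbf{PC}$-category (resp. $\mathbf{PC}$-functor, $\mathbf{PC}$-natural transformation) is a category (resp. functor, natural transformation) enriched in $\underline{\mathrm{Perm}}$: hom permutative categories, bilinear strictly associative and unital composition; functors act on homs by strictly unital lax symmetric monoidal functors. Opposites are formed using the symmetry of $\underline{\mathrm{Perm}}$. The $\mathbf{PC}$-category $\mathrm{Perm}$ has small permutative categories as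 objects; $\mathrm{Perm}(\mathcal{A},\mathcal{B})$ is the category of strictly unital lax symmetric monoidal functors and monoidal natural transformations, with pointwise sum and structure morphism $(\delta^f\oplus\delta^g)\circ(1\oplus\gamma\oplus1)$; composition is the usual one, with $\delta_1=\mathrm{id}$ and $\delta_2$ the structure morphism of the outer functor. The bilinear functor $ev\colon(\mathrm{Perm}(\mathcal{A},\mathcal{B}),\mathcal{A})\to\mathcal{B}$ has $ev(f,a)=f(a)$, $\delta_1=\mathrm{id}$, and $\delta_2$ the structure morphism of $f$. **$K$-theory.** $\mathcal{S}pec$ is a closed symmetric monoidal category of spectra ($\wedge$, $S$, $F(-,-)$), viewed as a multicategory and as enriched in itself. $\mathbb{K}\colon\underline{\mathrm{Perm}}\to\mathcal{S}pec$ is a fixed $K$-theory machine that is a multifunctor; $\pi_0\mathbb{K}\mathcal{P}$ is the group completion of the abelian monoid of connected components of objects of $\mathcal{P}$ (the class of an object $p$ being that of $\mathbb{K}(p)\colon S\to\mathbb{K}\mathcal{P}$), and for an abelian group $A$ viewed as a discrete permutative category (objects the elements, only identity morphisms, $\oplus$ addition), $\mathbb{K}A$ is an Eilenberg--MacLane spectrum $HA$. $\mathbb{K}_\bullet$ is the 2-functor from $\mathbf{PC}$-categories to spectral categories applying $\mathbb{K}$ to hom permutative categories. $\Phi\colon\mathbb{K}_\bullet(\mathrm{Perm})\to\mathcal{S}pec$ is the spectrally enriched functor with $\Phi(\mathcal{A})=\mathbb{K}\mathcal{A}$ and with $\mathbb{K}(\mathrm{Perm}(\mathcal{A},\mathcal{B}))\to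 F(\mathbb{K}\mathcal{A},\mathbb{K}\mathcal{B})$ adjoint to $\mathbb{K}(ev)$. **Burnside categories.** A finite $G$-set is a pair $(\mathbf{n},\alpha)$ with $\mathbf{n}=\{1,\dots,n\}$ and $\alpha\colon G\to\Sigma_n$ a homomorphism; disjoint union is by block sum. The $\mathbf{PC}$-category $G\mathcal{E}$ has finite $G$-sets as objects; $G\mathcal{E}(A,B)$ is the category of spans $A\leftarrow C\to B$ of finite $G$-sets and isomorphisms of spans, permutative under disjoint union of the apex. Composition is by pullback: for $A\xrightarrow{f}B\xleftarrow{f'}C$ the chosen pullback is $C$ if $f$ is the identity, $A$ if $f'$ is the identity, and otherwise the subset of $A\times C$ (lexicographically ordered) cut out by the pullback condition. Standing assumption: composition in $G\mathcal{E}$ is strictly associative and unital, so that $G\mathcal{E}$ is a $\mathbf{PC}$-category. Put $G\mathcal{B}=\mathbb{K}_\bullet G\mathcal{E}$. The Burnside category $\mathcal{B}_G$ is the additive category with finite $G$-sets as objects and with morphism groups the group completions of the monoids of isomorphism classes of spans; $\mathcal{B}_G\cong(\pi_0)_\bullet G\mathcal{B}$, where $(\pi_0)_\bullet$ applies $\pi_0$ to morphism spectra. **Mackey functors.** A Mackey functor is an additive functor $M\colon\mathcal{B}_G^{\mathrm{op}}\to\mathcal{A}b$. It is regarded as a $\mathbf{PC}$-functor $G\mathcal{E}^{\mathrm{op}}\to\mathrm{Perm}$ via the composite $G\mathcal{E}^{\mathrm{op}}\to\mathcal{B}_G^{\mathrm{op}}\to\mathcal{A}b\subset\mathrm{Perm}$,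 where the first map sends a span to its class and isomorphisms of spans to identities, and abelian groups (including hom groups) are viewed as discrete permutative categories. **Homotopy Mackey functors.** By Guillou--May, spectral functors $Y\colon G\mathcal{B}^{\mathrm{op}}\to\mathcal{S}pec$ model genuine $G$-spectra, and the homotopy Mackey functor $\underline{\pi}_n(Y)$ is the composite $\mathcal{B}_G^{\mathrm{op}}\cong(\pi_0)_\bullet G\mathcal{B}^{\mathrm{op}}\xrightarrow{(\pi_0)_\bullet Y}\mathrm{Ho}\,\mathcal{S}pec\xrightarrow{\pi_n}\mathcal{A}b$, where $(\pi_0)_\bullet\mathcal{S}pec$ is identified with the homotopy category $\mathrm{Ho}\,\mathcal{S}pec$. *)

theory Defs
  imports "HOL-Algebra.Sym_Groups" "HOL-Analysis.Function_Topology" "HOL-Analysis.Product_Topology"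
    "HOL-Library.Equipollence"
begin

section \<open>Smallness\<close>

text \<open>
  Small permutative categories have their objects and arrows in a fixed type \<open>'v\<close> and form sets
  of cardinality less than that of \<open>'v\<close>. The type is only required to have the cardinality of
  an uncountable strong limit; every Grothendieck universe containing an infinite set is an instance.
  This makes the category of functors between two small categories small again.
\<close>

definition small :: "'v set \<Rightarrow> bool" where
  "small X \<longleftrightarrow> X \<prec> (UNIV :: 'v set)"

definition universe :: "'v itself \<Rightarrow> bool" where
  "universe _ \<longleftrightarrow> (UNIV :: nat set) \<prec> (UNIV :: 'v set) \<and>
     (\<forall>X :: 'v set. small X \<longrightarrow> Pow X \<prec> (UNIV :: 'v set))"

text \<open>
  Categories that are built on other types are copied into \<open>'v\<close> along an arbitrary injection,
  which exists for all sets to which it is applied below.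
\<close>

definition enc :: "'a set \<Rightarrow> 'a \<Rightarrow> 'v" where
  "enc X = (SOME e. inj_on e X)"

definition dec :: "'a set \<Rightarrow> 'v \<Rightarrow> 'a" where
  "dec X = inv_into X (enc X)"


section \<open>Permutative categories\<close>

text \<open>\<open>Cmp P g f\<close> is the composite of first \<open>f\<close>, then \<open>g\<close>; \<open>Twist P a b : a \<oplus> b \<rightarrow> b \<oplus> a\<close>.\<close>

record ('o, 'm) permcat =
  Ob :: "'o set"
  Ar :: "'m set"
  Src :: "'m \<Rightarrow> 'o"
  Tgt :: "'m \<Rightarrow> 'o"
  Idn :: "'o \<Rightarrow> 'm"
  Cmp :: "'m \<Rightarrow> 'm \<Rightarrow> 'm"
  HTop :: "'o \<Rightarrow> 'o \<Rightarrow> 'm topology"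
  Zer :: "'o"
  Add :: "'o \<Rightarrow> 'o \<Rightarrow> 'o"
  AddA :: "'m \<Rightarrow> 'm \<Rightarrow> 'm"
  Twist :: "'o \<Rightarrow> 'o \<Rightarrow> 'm"

definition Hom :: "('o, 'm) permcat \<Rightarrow> 'o \<Rightarrow> 'o \<Rightarrow> 'm set" where
  "Hom P a b = {f \<in> Ar P. Src P f = a \<and> Tgt P f = b}"

locale permutative_category =
  fixes P :: "('o, 'm) permcat"
  assumes arr: "f \<in> Ar P \<Longrightarrow> Src P f \<in> Ob P \<and> Tgt P f \<in> Ob P"
    and idn: "a \<in> Ob P \<Longrightarrow> Idn P a \<in> Hom P a a"
    and cmp: "\<lbrakk>f \<in> Hom P a b; g \<in> Hom P b c\<rbrakk> \<Longrightarrow> Cmp P g f \<in> Hom P a c"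
    and cmp_idn: "f \<in> Hom P a b \<Longrightarrow> Cmp P f (Idn P a) = f \<and> Cmp P (Idn P b) f = f"
    and cmp_assoc: "\<lbrakk>f \<in> Hom P a b; g \<in> Hom P b c; h \<in> Hom P c d\<rbrakk> \<Longrightarrow>
      Cmp P h (Cmp P g f) = Cmp P (Cmp P h g) f"
    and topspace: "\<lbrakk>a \<in> Ob P; b \<in> Ob P\<rbrakk> \<Longrightarrow> topspace (HTop P a b) = Hom P a b"
    and cmp_cont: "\<lbrakk>a \<in> Ob P; b \<in> Ob P; c \<in> Ob P\<rbrakk> \<Longrightarrow>
      continuous_map (prod_topology (HTop P b c) (HTop P a b)) (HTop P a c) (\<lambda>(g, f). Cmp P g f)"
    and zer: "Zer P \<in> Ob P"
    and add: "\<lbrakk>a \<in> Ob P; b \<in> Ob P\<rbrakk> \<Longrightarrow> Add P a b \<in> Ob P"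
    and addA: "\<lbrakk>f \<in> Hom P a b; f' \<in> Hom P a' b'\<rbrakk> \<Longrightarrow>
      AddA P f f' \<in> Hom P (Add P a a') (Add P b b')"
    and addA_idn: "\<lbrakk>a \<in> Ob P; b \<in> Ob P\<rbrakk> \<Longrightarrow> AddA P (Idn P a) (Idn P b) = Idn P (Add P a b)"
    and addA_cmp: "\<lbrakk>f \<in> Hom P a b; g \<in> Hom P b c; f' \<in> Hom P a' b'; g' \<in> Hom P b' c'\<rbrakk> \<Longrightarrow>
      AddA P (Cmp P g f) (Cmp P g' f') = Cmp P (AddA P g g') (AddA P f f')"
    and addA_cont: "\<lbrakk>a \<in> Ob P; b \<in> Ob P; a' \<in> Ob P; b' \<in> Ob P\<rbrakk> \<Longrightarrow>
      continuous_map (prod_topology (HTop P a b) (HTop P a' b'))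
        (HTop P (Add P a a') (Add P b b')) (\<lambda>(f, f'). AddA P f f')"
    and add_assoc: "\<lbrakk>a \<in> Ob P; b \<in> Ob P; c \<in> Ob P\<rbrakk> \<Longrightarrow>
      Add P (Add P a b) c = Add P a (Add P b c)"
    and addA_assoc: "\<lbrakk>f \<in> Ar P; g \<in> Ar P; h \<in> Ar P\<rbrakk> \<Longrightarrow>
      AddA P (AddA P f g) h = AddA P f (AddA P g h)"
    and add_zer: "a \<in> Ob P \<Longrightarrow> Add P a (Zer P) = a \<and> Add P (Zer P) a = a"
    and addA_zer: "f \<in> Ar P \<Longrightarrow>
      AddA P f (Idn P (Zer P)) = f \<and> AddA P (Idn P (Zer P)) f = f"
    and twist: "\<lbrakk>a \<in> Ob P; b \<in> Ob P\<rbrakk> \<Longrightarrow> Twist P a b \<in> Hom P (Add P a b) (Add P b a)"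
    and twist_nat: "\<lbrakk>f \<in> Hom P a b; f' \<in> Hom P a' b'\<rbrakk> \<Longrightarrow>
      Cmp P (Twist P b b') (AddA P f f') = Cmp P (AddA P f' f) (Twist P a a')"
    and twist_twist: "\<lbrakk>a \<in> Ob P; b \<in> Ob P\<rbrakk> \<Longrightarrow>
      Cmp P (Twist P b a) (Twist P a b) = Idn P (Add P a b)"
    and twist_zer: "a \<in> Ob P \<Longrightarrow> Twist P a (Zer P) = Idn P a"
    and twist_add: "\<lbrakk>a \<in> Ob P; b \<in> Ob P; c \<in> Ob P\<rbrakk> \<Longrightarrow>
      Twist P a (Add P b c) =
        Cmp P (AddA P (Idn P b) (Twist P a c)) (AddA P (Twist P a b) (Idn P c))"

definition small_permcat :: "('v, 'v) permcat \<Rightarrow> bool" where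
  "small_permcat P \<longleftrightarrow> permutative_category P \<and> small (Ob P) \<and> small (Ar P)"

definition encode_permcat :: "('o, 'm) permcat \<Rightarrow> ('v, 'v) permcat" where
  "encode_permcat P =
    (let e = enc (Ob P); d = dec (Ob P); E = enc (Ar P); D = dec (Ar P) in
     \<lparr>Ob = e ` Ob P, Ar = E ` Ar P,
      Src = (\<lambda>x. e (Src P (D x))), Tgt = (\<lambda>x. e (Tgt P (D x))),
      Idn = (\<lambda>x. E (Idn P (d x))), Cmp = (\<lambda>y x. E (Cmp P (D y) (D x))),
      HTop = (\<lambda>x y. pullback_topology (E ` Hom P (d x) (d y)) D (HTop P (d x) (d y))),
      Zer = e (Zer P), Add = (\<lambda>x y. e (Add P (d x) (d y))),
      AddA = (\<lambda>x y. E (AddA P (D x) (D y))),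
      Twist = (\<lambda>x y. E (Twist P (d x) (d y)))\<rparr>)"

text \<open>Abelian groups are written multiplicatively, as everywhere in \<open>HOL-Algebra\<close>.\<close>

definition disc :: "('v, 'z) monoid_scheme \<Rightarrow> ('v, 'v) permcat" where
  "disc A = \<lparr>Ob = carrier A, Ar = carrier A, Src = id, Tgt = id, Idn = id, Cmp = (\<lambda>y x. y),
     HTop = (\<lambda>a b. discrete_topology (if a = b then {a} else {})),
     Zer = \<one>\<^bsub>A\<^esub>, Add = (\<otimes>\<^bsub>A\<^esub>), AddA = (\<otimes>\<^bsub>A\<^esub>), Twist = (\<lambda>a b. a \<otimes>\<^bsub>A\<^esub> b)\<rparr>"


section \<open>Multilinear functors\<close>

text \<open>
  Tuples of objects or arrows are lists. \<open>Lin f i xs a'\<close> is the component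
  \<open>f(\<dots>,a\<^sub>i,\<dots>) \<oplus> f(\<dots>,a',\<dots>) \<rightarrow> f(\<dots>,a\<^sub>i \<oplus> a',\<dots>)\<close> of the linearity constraint in the variable
  number \<open>i\<close> (counted from 0), where \<open>xs\<close> is the list of the \<open>a\<^sub>j\<close>.
\<close>

record 'v mfun =
  Srcs :: "('v, 'v) permcat list"
  Target :: "('v, 'v) permcat"
  FO :: "'v list \<Rightarrow> 'v"
  FA :: "'v list \<Rightarrow> 'v"
  Lin :: "nat \<Rightarrow> 'v list \<Rightarrow> 'v \<Rightarrow> 'v"

abbreviation Obs :: "('v, 'v) permcat list \<Rightarrow> 'v list set" where
  "Obs As \<equiv> listset (map Ob As)"

abbreviation Ars :: "('v, 'v) permcat list \<Rightarrow> 'v list set" where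
  "Ars As \<equiv> listset (map Ar As)"

text \<open>The data are \<open>undefined\<close> outside their domains, so that equal functors are equal records.\<close>

definition mk_mfun :: "('v, 'v) permcat list \<Rightarrow> ('v, 'v) permcat \<Rightarrow> ('v list \<Rightarrow> 'v) \<Rightarrow>
    ('v list \<Rightarrow> 'v) \<Rightarrow> (nat \<Rightarrow> 'v list \<Rightarrow> 'v \<Rightarrow> 'v) \<Rightarrow> 'v mfun" where
  "mk_mfun As B fo fa l = \<lparr>Srcs = As, Target = B, FO = restrict fo (Obs As), FA = restrict fa (Ars As),
     Lin = (\<lambda>i xs a'. if i < length As \<and> xs \<in> Obs As \<and> a' \<in> Ob (As ! i) then l i xs a' else undefined)\<rparr>"

locale multilinear_functor =
  fixes f :: "'v mfun" and As B k
  defines "As \<equiv> Srcs f" and "B \<equiv> Target f" and "k \<equiv> length (Srcs f)"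
  assumes permutative: "\<And>A. A \<in> set As \<Longrightarrow> permutative_category A" "permutative_category B"
    and extensional: "f = mk_mfun As B (FO f) (FA f) (Lin f)"
    and FO: "xs \<in> Obs As \<Longrightarrow> FO f xs \<in> Ob B"
    and FA: "us \<in> Ars As \<Longrightarrow>
      FA f us \<in> Hom B (FO f (map2 Src As us)) (FO f (map2 Tgt As us))"
    and FA_idn: "xs \<in> Obs As \<Longrightarrow> FA f (map2 Idn As xs) = Idn B (FO f xs)"
    and FA_cmp: "\<lbrakk>us \<in> Ars As; vs \<in> Ars As; map2 Tgt As us = map2 Src As vs\<rbrakk> \<Longrightarrow>
      FA f (map (\<lambda>i. Cmp (As ! i) (vs ! i) (us ! i)) [0..<k]) = Cmp B (FA f vs) (FA f us)"
    and FA_cont: "\<lbrakk>xs \<in> Obs As; ys \<in> Obs As\<rbrakk> \<Longrightarrow>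
      continuous_map (product_topology (\<lambda>i. HTop (As ! i) (xs ! i) (ys ! i)) {..<k})
        (HTop B (FO f xs) (FO f ys)) (\<lambda>u. FA f (map u [0..<k]))"
    and FO_zer: "\<lbrakk>xs \<in> Obs As; i < k; xs ! i = Zer (As ! i)\<rbrakk> \<Longrightarrow> FO f xs = Zer B"
    and FA_zer: "\<lbrakk>us \<in> Ars As; i < k; us ! i = Idn (As ! i) (Zer (As ! i))\<rbrakk> \<Longrightarrow>
      FA f us = Idn B (Zer B)"
    and Lin: "\<lbrakk>i < k; xs \<in> Obs As; a' \<in> Ob (As ! i)\<rbrakk> \<Longrightarrow>
      Lin f i xs a' \<in> Hom B (Add B (FO f xs) (FO f (xs[i := a'])))
                            (FO f (xs[i := Add (As ! i) (xs ! i) a']))"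
    and Lin_nat: "\<lbrakk>i < k; us \<in> Ars As; u' \<in> Ar (As ! i)\<rbrakk> \<Longrightarrow>
      Cmp B (Lin f i (map2 Tgt As us) (Tgt (As ! i) u')) (AddA B (FA f us) (FA f (us[i := u']))) =
      Cmp B (FA f (us[i := AddA (As ! i) (us ! i) u']))
            (Lin f i (map2 Src As us) (Src (As ! i) u'))"
    and Lin_zer: "\<lbrakk>i < k; xs \<in> Obs As; a' \<in> Ob (As ! i);
        a' = Zer (As ! i) \<or> (\<exists>j<k. xs ! j = Zer (As ! j))\<rbrakk> \<Longrightarrow>
      Lin f i xs a' = Idn B (FO f (xs[i := Add (As ! i) (xs ! i) a']))"
    and Lin_assoc: "\<lbrakk>i < k; xs \<in> Obs As; a' \<in> Ob (As ! i); a'' \<in> Ob (As ! i)\<rbrakk> \<Longrightarrow>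
      Cmp B (Lin f i xs (Add (As ! i) a' a''))
            (AddA B (Idn B (FO f xs)) (Lin f i (xs[i := a']) a'')) =
      Cmp B (Lin f i (xs[i := Add (As ! i) (xs ! i) a']) a'')
            (AddA B (Lin f i xs a') (Idn B (FO f (xs[i := a'']))))"
    and Lin_twist: "\<lbrakk>i < k; xs \<in> Obs As; a' \<in> Ob (As ! i)\<rbrakk> \<Longrightarrow>
      Cmp B (FA f ((map2 Idn As xs)[i := Twist (As ! i) (xs ! i) a'])) (Lin f i xs a') =
      Cmp B (Lin f i (xs[i := a']) (xs ! i)) (Twist B (FO f xs) (FO f (xs[i := a'])))"
    and Lin_Lin: "\<lbrakk>i < k; j < k; i \<noteq> j; xs \<in> Obs As; a' \<in> Ob (As ! i); b' \<in> Ob (As ! j)\<rbrakk> \<Longrightarrow>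
      Cmp B (Lin f j (xs[i := Add (As ! i) (xs ! i) a']) b')
            (AddA B (Lin f i xs a') (Lin f i (xs[j := b']) a')) =
      Cmp B (Lin f i (xs[j := Add (As ! j) (xs ! j) b']) a')
        (Cmp B (AddA B (Lin f j xs b') (Lin f j (xs[i := a']) b'))
               (AddA B (Idn B (FO f xs))
                 (AddA B (Twist B (FO f (xs[i := a'])) (FO f (xs[j := b'])))
                         (Idn B (FO f (xs[i := a', j := b']))))))"

definition Perm_morphism :: "'v mfun \<Rightarrow> bool" where
  "Perm_morphism f \<longleftrightarrow> multilinear_functor f \<and>
     (\<forall>A\<in>set (Srcs f). small_permcat A) \<and> small_permcat (Target f)"

definition mid :: "('v, 'v) permcat \<Rightarrow> 'v mfun" where
  "mid A = mk_mfun [A] A hd hd (\<lambda>i xs a'. Idn A (Add A (hd xs) a'))"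

definition mpoint :: "('v, 'v) permcat \<Rightarrow> 'v \<Rightarrow> 'v mfun" where
  "mpoint A a = mk_mfun [] A (\<lambda>_. a) (\<lambda>_. Idn A a) (\<lambda>_ _ _. undefined)"

text \<open>
  \<open>chop ns xs\<close> cuts \<open>xs\<close> into pieces of lengths \<open>ns\<close>; \<open>locate ns p\<close> is the pair (piece, position
  in the piece) of the entry number \<open>p\<close> of \<open>xs\<close>.
\<close>

fun chop :: "nat list \<Rightarrow> 'a list \<Rightarrow> 'a list list" where
  "chop [] xs = []"
| "chop (n # ns) xs = take n xs # chop ns (drop n xs)"

fun locate :: "nat list \<Rightarrow> nat \<Rightarrow> nat \<times> nat" where
  "locate [] p = (0, p)"
| "locate (n # ns) p = (if p < n then (0, p) else apfst Suc (locate ns (p - n)))"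

definition mcomp :: "'v mfun \<Rightarrow> 'v mfun list \<Rightarrow> 'v mfun" where
  "mcomp g fs =
    (let ns = map (length \<circ> Srcs) fs;
         fo = (\<lambda>xs. map2 FO fs (chop ns xs));
         fa = (\<lambda>us. map2 FA fs (chop ns us)) in
     mk_mfun (concat (map Srcs fs)) (Target g)
       (\<lambda>xs. FO g (fo xs)) (\<lambda>us. FA g (fa us))
       (\<lambda>p xs a'. let (j, i) = locate ns p; xs\<^sub>j = chop ns xs ! j; f = fs ! j in
          Cmp (Target g)
            (FA g ((map2 Idn (Srcs g) (fo xs))[j := Lin f i xs\<^sub>j a']))
            (Lin g j (fo xs) (FO f (xs\<^sub>j[i := a'])))))"

definition swap_at :: "nat \<Rightarrow> 'a list \<Rightarrow> 'a list" where
  "swap_at i xs = xs[i := xs ! Suc i, Suc i := xs ! i]"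

text \<open>
  The symmetric groups act on the \<open>k\<close>-morphisms of a symmetric multicategory; it suffices to
  specify the action of the adjacent transpositions.
\<close>

definition mswap :: "nat \<Rightarrow> 'v mfun \<Rightarrow> 'v mfun" where
  "mswap i f = mk_mfun (swap_at i (Srcs f)) (Target f)
     (\<lambda>xs. FO f (swap_at i xs)) (\<lambda>us. FA f (swap_at i us))
     (\<lambda>p xs a'. Lin f (if p = i then Suc i else if p = Suc i then i else p) (swap_at i xs) a')"


section \<open>Categories enriched in permutative categories\<close>

text \<open>\<open>PComp C a b c : (C(b,c), C(a,b)) \<rightarrow> C(a,c)\<close>; the unit \<open>PUnit C a\<close> is an object of \<open>C(a,a)\<close>.\<close>

record ('a, 'v) pccat =
  PObj :: "'a set"
  PHom :: "'a \<Rightarrow> 'a \<Rightarrow> ('v, 'v) permcat"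
  PComp :: "'a \<Rightarrow> 'a \<Rightarrow> 'a \<Rightarrow> 'v mfun"
  PUnit :: "'a \<Rightarrow> 'v"

locale pc_category =
  fixes C :: "('a, 'v) pccat"
  assumes hom: "\<lbrakk>a \<in> PObj C; b \<in> PObj C\<rbrakk> \<Longrightarrow> small_permcat (PHom C a b)"
    and comp: "\<lbrakk>a \<in> PObj C; b \<in> PObj C; c \<in> PObj C\<rbrakk> \<Longrightarrow>
      multilinear_functor (PComp C a b c) \<and>
      Srcs (PComp C a b c) = [PHom C b c, PHom C a b] \<and> Target (PComp C a b c) = PHom C a c"
    and unit: "a \<in> PObj C \<Longrightarrow> PUnit C a \<in> Ob (PHom C a a)"
    and assoc: "\<lbrakk>a \<in> PObj C; b \<in> PObj C; c \<in> PObj C; d \<in> PObj C\<rbrakk> \<Longrightarrow>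
      mcomp (PComp C a b d) [PComp C b c d, mid (PHom C a b)] =
      mcomp (PComp C a c d) [mid (PHom C c d), PComp C a b c]"
    and unit_right: "\<lbrakk>a \<in> PObj C; b \<in> PObj C\<rbrakk> \<Longrightarrow>
      mcomp (PComp C a a b) [mid (PHom C a b), mpoint (PHom C a a) (PUnit C a)] = mid (PHom C a b)"
    and unit_left: "\<lbrakk>a \<in> PObj C; b \<in> PObj C\<rbrakk> \<Longrightarrow>
      mcomp (PComp C a b b) [mpoint (PHom C b b) (PUnit C b), mid (PHom C a b)] = mid (PHom C a b)"

definition pc_op :: "('a, 'v) pccat \<Rightarrow> ('a, 'v) pccat" where
  "pc_op C = \<lparr>PObj = PObj C, PHom = (\<lambda>a b. PHom C b a),
     PComp = (\<lambda>a b c. mswap 0 (PComp C c b a)), PUnit = PUnit C\<rparr>"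

record ('a, 'b, 'v) pcfun =
  PFob :: "'a \<Rightarrow> 'b"
  PFhom :: "'a \<Rightarrow> 'a \<Rightarrow> 'v mfun"

locale pc_functor =
  fixes C :: "('a, 'v) pccat" and D :: "('b, 'v) pccat" and F :: "('a, 'b, 'v) pcfun"
  assumes ob: "a \<in> PObj C \<Longrightarrow> PFob F a \<in> PObj D"
    and hom: "\<lbrakk>a \<in> PObj C; b \<in> PObj C\<rbrakk> \<Longrightarrow>
      multilinear_functor (PFhom F a b) \<and> Srcs (PFhom F a b) = [PHom C a b] \<and>
      Target (PFhom F a b) = PHom D (PFob F a) (PFob F b)"
    and unit: "a \<in> PObj C \<Longrightarrow> FO (PFhom F a a) [PUnit C a] = PUnit D (PFob F a)"
    and comp: "\<lbrakk>a \<in> PObj C; b \<in> PObj C; c \<in> PObj C\<rbrakk> \<Longrightarrow>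
      mcomp (PFhom F a c) [PComp C a b c] =
      mcomp (PComp D (PFob F a) (PFob F b) (PFob F c)) [PFhom F b c, PFhom F a b]"

text \<open>\<open>t a\<close> is an object of \<open>D(F a, G a)\<close>.\<close>

locale pc_natural =
  fixes C :: "('a, 'v) pccat" and D :: "('b, 'v) pccat"
    and F G :: "('a, 'b, 'v) pcfun" and t :: "'a \<Rightarrow> 'v"
  assumes component: "a \<in> PObj C \<Longrightarrow> t a \<in> Ob (PHom D (PFob F a) (PFob G a))"
    and natural: "\<lbrakk>a \<in> PObj C; b \<in> PObj C\<rbrakk> \<Longrightarrow>
      mcomp (PComp D (PFob F a) (PFob F b) (PFob G b))
        [mpoint (PHom D (PFob F b) (PFob G b)) (t b), PFhom F a b] =
      mcomp (PComp D (PFob F a) (PFob G a) (PFob G b))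
        [PFhom G a b, mpoint (PHom D (PFob F a) (PFob G a)) (t a)]"


subsection \<open>The \<open>PC\<close>-category of permutative categories\<close>

text \<open>
  A strictly unital lax symmetric monoidal functor is a 1-linear functor; its structure morphism
  is \<open>\<lambda>a a'. Lin f 0 [a] a'\<close>.
\<close>

record 'v montrans =
  Dom :: "'v mfun"
  Codom :: "'v mfun"
  Cpt :: "'v \<Rightarrow> 'v"

definition lax_functors :: "('v, 'v) permcat \<Rightarrow> ('v, 'v) permcat \<Rightarrow> 'v mfun set" where
  "lax_functors A B = {f. multilinear_functor f \<and> Srcs f = [A] \<and> Target f = B}"

definition monoidal_trans :: "('v, 'v) permcat \<Rightarrow> ('v, 'v) permcat \<Rightarrow> 'v montrans set" where
  "monoidal_trans A B = {t. Dom t \<in> lax_functors A B \<and> Codom t \<in> lax_functors A B \<and>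
     Cpt t \<in> extensional (Ob A) \<and>
     (\<forall>a\<in>Ob A. Cpt t a \<in> Hom B (FO (Dom t) [a]) (FO (Codom t) [a])) \<and>
     (\<forall>u\<in>Ar A. Cmp B (Cpt t (Tgt A u)) (FA (Dom t) [u]) =
                Cmp B (FA (Codom t) [u]) (Cpt t (Src A u))) \<and>
     Cpt t (Zer A) = Idn B (Zer B) \<and>
     (\<forall>a\<in>Ob A. \<forall>a'\<in>Ob A. Cmp B (Cpt t (Add A a a')) (Lin (Dom t) 0 [a] a') =
                Cmp B (Lin (Codom t) 0 [a] a') (AddA B (Cpt t a) (Cpt t a')))}"

definition lax_zero :: "('v, 'v) permcat \<Rightarrow> ('v, 'v) permcat \<Rightarrow> 'v mfun" where
  "lax_zero A B = mk_mfun [A] B (\<lambda>_. Zer B) (\<lambda>_. Idn B (Zer B)) (\<lambda>_ _ _. Idn B (Zer B))"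

definition lax_add :: "('v, 'v) permcat \<Rightarrow> ('v, 'v) permcat \<Rightarrow> 'v mfun \<Rightarrow> 'v mfun \<Rightarrow> 'v mfun" where
  "lax_add A B f g = mk_mfun [A] B
     (\<lambda>xs. Add B (FO f xs) (FO g xs)) (\<lambda>us. AddA B (FA f us) (FA g us))
     (\<lambda>i xs a'. Cmp B (AddA B (Lin f i xs a') (Lin g i xs a'))
        (AddA B (Idn B (FO f xs))
          (AddA B (Twist B (FO g xs) (FO f [a'])) (Idn B (FO g [a'])))))"

definition functor_category ::
    "('v, 'v) permcat \<Rightarrow> ('v, 'v) permcat \<Rightarrow> ('v mfun, 'v montrans) permcat" where
  "functor_category A B =
    \<lparr>Ob = lax_functors A B, Ar = monoidal_trans A B, Src = Dom, Tgt = Codom,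
     Idn = (\<lambda>f. \<lparr>Dom = f, Codom = f, Cpt = (\<lambda>a\<in>Ob A. Idn B (FO f [a]))\<rparr>),
     Cmp = (\<lambda>s t. \<lparr>Dom = Dom t, Codom = Codom s, Cpt = (\<lambda>a\<in>Ob A. Cmp B (Cpt s a) (Cpt t a))\<rparr>),
     HTop = (\<lambda>f g. pullback_topology {t \<in> monoidal_trans A B. Dom t = f \<and> Codom t = g} Cpt
        (product_topology (\<lambda>a. HTop B (FO f [a]) (FO g [a])) (Ob A))),
     Zer = lax_zero A B, Add = lax_add A B,
     AddA = (\<lambda>s t. \<lparr>Dom = lax_add A B (Dom s) (Dom t), Codom = lax_add A B (Codom s) (Codom t),
        Cpt = (\<lambda>a\<in>Ob A. AddA B (Cpt s a) (Cpt t a))\<rparr>),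
     Twist = (\<lambda>f g. \<lparr>Dom = lax_add A B f g, Codom = lax_add A B g f,
        Cpt = (\<lambda>a\<in>Ob A. Twist B (FO f [a]) (FO g [a]))\<rparr>)\<rparr>"

definition Perm_hom :: "('v, 'v) permcat \<Rightarrow> ('v, 'v) permcat \<Rightarrow> ('v, 'v) permcat" where
  "Perm_hom A B = encode_permcat (functor_category A B)"

abbreviation enc_fun :: "('v, 'v) permcat \<Rightarrow> ('v, 'v) permcat \<Rightarrow> 'v mfun \<Rightarrow> 'v" where
  "enc_fun A B \<equiv> enc (lax_functors A B)"

abbreviation dec_fun :: "('v, 'v) permcat \<Rightarrow> ('v, 'v) permcat \<Rightarrow> 'v \<Rightarrow> 'v mfun" where
  "dec_fun A B \<equiv> dec (lax_functors A B)"

abbreviation enc_trans :: "('v, 'v) permcat \<Rightarrow> ('v, 'v) permcat \<Rightarrow> 'v montrans \<Rightarrow> 'v" where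
  "enc_trans A B \<equiv> enc (monoidal_trans A B)"

abbreviation dec_trans :: "('v, 'v) permcat \<Rightarrow> ('v, 'v) permcat \<Rightarrow> 'v \<Rightarrow> 'v montrans" where
  "dec_trans A B \<equiv> dec (monoidal_trans A B)"

definition whisker_add :: "('v, 'v) permcat \<Rightarrow> ('v, 'v) permcat \<Rightarrow> ('v, 'v) permcat \<Rightarrow>
    'v mfun \<Rightarrow> 'v mfun \<Rightarrow> 'v mfun \<Rightarrow> 'v montrans" where
  "whisker_add A B C g f f' =
    \<lparr>Dom = lax_add A C (mcomp g [f]) (mcomp g [f']), Codom = mcomp g [lax_add A B f f'],
     Cpt = (\<lambda>a\<in>Ob A. Lin g 0 [FO f [a]] (FO f' [a]))\<rparr>"

definition horizontal :: "('v, 'v) permcat \<Rightarrow> ('v, 'v) permcat \<Rightarrow>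
    'v montrans \<Rightarrow> 'v montrans \<Rightarrow> 'v montrans" where
  "horizontal A C s t = \<lparr>Dom = mcomp (Dom s) [Dom t], Codom = mcomp (Codom s) [Codom t],
     Cpt = (\<lambda>a\<in>Ob A. Cmp C (Cpt s (FO (Codom t) [a])) (FA (Dom s) [Cpt t a]))\<rparr>"

definition Perm_comp :: "('v, 'v) permcat \<Rightarrow> ('v, 'v) permcat \<Rightarrow> ('v, 'v) permcat \<Rightarrow> 'v mfun" where
  "Perm_comp A B C = mk_mfun [Perm_hom B C, Perm_hom A B] (Perm_hom A C)
     (\<lambda>xs. enc_fun A C (mcomp (dec_fun B C (xs ! 0)) [dec_fun A B (xs ! 1)]))
     (\<lambda>us. enc_trans A C (horizontal A C (dec_trans B C (us ! 0)) (dec_trans A B (us ! 1))))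
     (\<lambda>i xs x'. if i = 0
        then Idn (Perm_hom A C)
          (enc_fun A C (mcomp (lax_add B C (dec_fun B C (xs ! 0)) (dec_fun B C x'))
                              [dec_fun A B (xs ! 1)]))
        else enc_trans A C
          (whisker_add A B C (dec_fun B C (xs ! 0)) (dec_fun A B (xs ! 1)) (dec_fun A B x')))"

definition Perm :: "(('v, 'v) permcat, 'v) pccat" where
  "Perm = \<lparr>PObj = {A. small_permcat A}, PHom = Perm_hom, PComp = Perm_comp,
     PUnit = (\<lambda>A. enc_fun A A (mid A))\<rparr>"

definition ev :: "('v, 'v) permcat \<Rightarrow> ('v, 'v) permcat \<Rightarrow> 'v mfun" where
  "ev A B = mk_mfun [Perm_hom A B, A] B
     (\<lambda>xs. FO (dec_fun A B (xs ! 0)) [xs ! 1])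
     (\<lambda>us. let t = dec_trans A B (us ! 0) in
        Cmp B (Cpt t (Tgt A (us ! 1))) (FA (Dom t) [us ! 1]))
     (\<lambda>i xs x'. let f = dec_fun A B (xs ! 0) in
        if i = 0 then Idn B (Add B (FO f [xs ! 1]) (FO (dec_fun A B x') [xs ! 1]))
        else Lin f 0 [xs ! 1] x')"


section \<open>Components and group completion\<close>

definition component_rel :: "('o, 'm) permcat \<Rightarrow> ('o \<times> 'o) set" where
  "component_rel P = {(a, b). a \<in> Ob P \<and> b \<in> Ob P \<and>
     (a, b) \<in> ((\<lambda>f. (Src P f, Tgt P f)) ` Ar P \<union> (\<lambda>f. (Tgt P f, Src P f)) ` Ar P)\<^sup>*}"

definition components :: "('o, 'm) permcat \<Rightarrow> 'o set monoid" where
  "components P = \<lparr>carrier = Ob P // component_rel P,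
     mult = (\<lambda>X Y. component_rel P `` {Add P a b | a b. a \<in> X \<and> b \<in> Y}),
     one = component_rel P `` {Zer P}\<rparr>"

text \<open>The Grothendieck group; the pair \<open>(a, b)\<close> stands for the formal difference of \<open>a\<close> and \<open>b\<close>.\<close>

definition groth_rel :: "('a, 'z) monoid_scheme \<Rightarrow> (('a \<times> 'a) \<times> ('a \<times> 'a)) set" where
  "groth_rel M = {((a, b), (c, d)). a \<in> carrier M \<and> b \<in> carrier M \<and> c \<in> carrier M \<and> d \<in> carrier M \<and>
     (\<exists>k\<in>carrier M. a \<otimes>\<^bsub>M\<^esub> d \<otimes>\<^bsub>M\<^esub> k = c \<otimes>\<^bsub>M\<^esub> b \<otimes>\<^bsub>M\<^esub> k)}"

definition group_completion :: "('a, 'z) monoid_scheme \<Rightarrow> ('a \<times> 'a) set monoid" where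
  "group_completion M = \<lparr>carrier = (carrier M \<times> carrier M) // groth_rel M,
     mult = (\<lambda>X Y. groth_rel M `` {(a \<otimes>\<^bsub>M\<^esub> c, b \<otimes>\<^bsub>M\<^esub> d) | a b c d. (a, b) \<in> X \<and> (c, d) \<in> Y}),
     one = groth_rel M `` {(\<one>\<^bsub>M\<^esub>, \<one>\<^bsub>M\<^esub>)}\<rparr>"

definition to_completion :: "('a, 'z) monoid_scheme \<Rightarrow> 'a \<Rightarrow> ('a \<times> 'a) set" where
  "to_completion M a = groth_rel M `` {(a, \<one>\<^bsub>M\<^esub>)}"

text \<open>The extension of \<open>u : M \<rightarrow> H\<close> to the group completion of \<open>M\<close>.\<close>

definition completion_lift :: "('h, 'z) monoid_scheme \<Rightarrow> ('a \<Rightarrow> 'h) \<Rightarrow> ('a \<times> 'a) set \<Rightarrow> 'h" where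
  "completion_lift H u c = the_elem ((\<lambda>(a, b). u a \<otimes>\<^bsub>H\<^esub> inv\<^bsub>H\<^esub> (u b)) ` c)"


section \<open>Spectra\<close>

subsection \<open>Closed symmetric monoidal categories\<close>

text \<open>
  \<open>sAssoc S X Y Z : (X \<and> Y) \<and> Z \<rightarrow> X \<and> (Y \<and> Z)\<close>, \<open>sLun S X : S \<and> X \<rightarrow> X\<close>,
  \<open>sRun S X : X \<and> S \<rightarrow> X\<close>, \<open>sSym S X Y : X \<and> Y \<rightarrow> Y \<and> X\<close>, \<open>sEv S X Y : F(X,Y) \<and> X \<rightarrow> Y\<close>.
\<close>

record ('s, 't) smcat =
  sOb :: "'s set"
  sAr :: "'t set"
  sSrc :: "'t \<Rightarrow> 's"
  sTgt :: "'t \<Rightarrow> 's"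
  sIdn :: "'s \<Rightarrow> 't"
  sCmp :: "'t \<Rightarrow> 't \<Rightarrow> 't"
  sTen :: "'s \<Rightarrow> 's \<Rightarrow> 's"
  sTenA :: "'t \<Rightarrow> 't \<Rightarrow> 't"
  sUnit :: "'s"
  sAssoc :: "'s \<Rightarrow> 's \<Rightarrow> 's \<Rightarrow> 't"
  sLun :: "'s \<Rightarrow> 't"
  sRun :: "'s \<Rightarrow> 't"
  sSym :: "'s \<Rightarrow> 's \<Rightarrow> 't"
  sFun :: "'s \<Rightarrow> 's \<Rightarrow> 's"
  sEv :: "'s \<Rightarrow> 's \<Rightarrow> 't"

definition sHom :: "('s, 't, 'z) smcat_scheme \<Rightarrow> 's \<Rightarrow> 's \<Rightarrow> 't set" where
  "sHom S X Y = {f \<in> sAr S. sSrc S f = X \<and> sTgt S f = Y}"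

definition sIso :: "('s, 't, 'z) smcat_scheme \<Rightarrow> 's \<Rightarrow> 's \<Rightarrow> 't \<Rightarrow> bool" where
  "sIso S X Y f \<longleftrightarrow> f \<in> sHom S X Y \<and>
     (\<exists>g\<in>sHom S Y X. sCmp S g f = sIdn S X \<and> sCmp S f g = sIdn S Y)"

definition sInv :: "('s, 't, 'z) smcat_scheme \<Rightarrow> 't \<Rightarrow> 't" where
  "sInv S f = (THE g. g \<in> sHom S (sTgt S f) (sSrc S f) \<and>
     sCmp S g f = sIdn S (sSrc S f) \<and> sCmp S f g = sIdn S (sTgt S f))"

locale closed_symmetric_monoidal =
  fixes S :: "('s, 't, 'z) smcat_scheme"
  assumes arr: "f \<in> sAr S \<Longrightarrow> sSrc S f \<in> sOb S \<and> sTgt S f \<in> sOb S"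
    and idn: "X \<in> sOb S \<Longrightarrow> sIdn S X \<in> sHom S X X"
    and cmp: "\<lbrakk>f \<in> sHom S X Y; g \<in> sHom S Y Z\<rbrakk> \<Longrightarrow> sCmp S g f \<in> sHom S X Z"
    and cmp_idn: "f \<in> sHom S X Y \<Longrightarrow> sCmp S f (sIdn S X) = f \<and> sCmp S (sIdn S Y) f = f"
    and cmp_assoc: "\<lbrakk>f \<in> sHom S X Y; g \<in> sHom S Y Z; h \<in> sHom S Z W\<rbrakk> \<Longrightarrow>
      sCmp S h (sCmp S g f) = sCmp S (sCmp S h g) f"
    and ten: "\<lbrakk>X \<in> sOb S; Y \<in> sOb S\<rbrakk> \<Longrightarrow> sTen S X Y \<in> sOb S"
    and unit: "sUnit S \<in> sOb S"
    and tenA: "\<lbrakk>f \<in> sHom S X Y; f' \<in> sHom S X' Y'\<rbrakk> \<Longrightarrow>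
      sTenA S f f' \<in> sHom S (sTen S X X') (sTen S Y Y')"
    and tenA_idn: "\<lbrakk>X \<in> sOb S; Y \<in> sOb S\<rbrakk> \<Longrightarrow>
      sTenA S (sIdn S X) (sIdn S Y) = sIdn S (sTen S X Y)"
    and tenA_cmp: "\<lbrakk>f \<in> sHom S X Y; g \<in> sHom S Y Z; f' \<in> sHom S X' Y'; g' \<in> sHom S Y' Z'\<rbrakk> \<Longrightarrow>
      sTenA S (sCmp S g f) (sCmp S g' f') = sCmp S (sTenA S g g') (sTenA S f f')"
    and assoc_iso: "\<lbrakk>X \<in> sOb S; Y \<in> sOb S; Z \<in> sOb S\<rbrakk> \<Longrightarrow>
      sIso S (sTen S (sTen S X Y) Z) (sTen S X (sTen S Y Z)) (sAssoc S X Y Z)"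
    and assoc_nat: "\<lbrakk>f \<in> sHom S X X'; g \<in> sHom S Y Y'; h \<in> sHom S Z Z'\<rbrakk> \<Longrightarrow>
      sCmp S (sAssoc S X' Y' Z') (sTenA S (sTenA S f g) h) =
      sCmp S (sTenA S f (sTenA S g h)) (sAssoc S X Y Z)"
    and lun_iso: "X \<in> sOb S \<Longrightarrow> sIso S (sTen S (sUnit S) X) X (sLun S X)"
    and lun_nat: "f \<in> sHom S X Y \<Longrightarrow>
      sCmp S (sLun S Y) (sTenA S (sIdn S (sUnit S)) f) = sCmp S f (sLun S X)"
    and run_iso: "X \<in> sOb S \<Longrightarrow> sIso S (sTen S X (sUnit S)) X (sRun S X)"
    and run_nat: "f \<in> sHom S X Y \<Longrightarrow>
      sCmp S (sRun S Y) (sTenA S f (sIdn S (sUnit S))) = sCmp S f (sRun S X)"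
    and pentagon: "\<lbrakk>X \<in> sOb S; Y \<in> sOb S; Z \<in> sOb S; W \<in> sOb S\<rbrakk> \<Longrightarrow>
      sCmp S (sAssoc S X Y (sTen S Z W)) (sAssoc S (sTen S X Y) Z W) =
      sCmp S (sTenA S (sIdn S X) (sAssoc S Y Z W))
        (sCmp S (sAssoc S X (sTen S Y Z) W) (sTenA S (sAssoc S X Y Z) (sIdn S W)))"
    and triangle: "\<lbrakk>X \<in> sOb S; Y \<in> sOb S\<rbrakk> \<Longrightarrow>
      sCmp S (sTenA S (sIdn S X) (sLun S Y)) (sAssoc S X (sUnit S) Y) =
      sTenA S (sRun S X) (sIdn S Y)"
    and sym: "\<lbrakk>X \<in> sOb S; Y \<in> sOb S\<rbrakk> \<Longrightarrow> sSym S X Y \<in> sHom S (sTen S X Y) (sTen S Y X)"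
    and sym_nat: "\<lbrakk>f \<in> sHom S X X'; g \<in> sHom S Y Y'\<rbrakk> \<Longrightarrow>
      sCmp S (sSym S X' Y') (sTenA S f g) = sCmp S (sTenA S g f) (sSym S X Y)"
    and sym_sym: "\<lbrakk>X \<in> sOb S; Y \<in> sOb S\<rbrakk> \<Longrightarrow>
      sCmp S (sSym S Y X) (sSym S X Y) = sIdn S (sTen S X Y)"
    and hexagon: "\<lbrakk>X \<in> sOb S; Y \<in> sOb S; Z \<in> sOb S\<rbrakk> \<Longrightarrow>
      sCmp S (sAssoc S Y Z X) (sCmp S (sSym S X (sTen S Y Z)) (sAssoc S X Y Z)) =
      sCmp S (sTenA S (sIdn S Y) (sSym S X Z))
        (sCmp S (sAssoc S Y X Z) (sTenA S (sSym S X Y) (sIdn S Z)))"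
    and "fun": "\<lbrakk>X \<in> sOb S; Y \<in> sOb S\<rbrakk> \<Longrightarrow> sFun S X Y \<in> sOb S"
    and ev: "\<lbrakk>X \<in> sOb S; Y \<in> sOb S\<rbrakk> \<Longrightarrow> sEv S X Y \<in> sHom S (sTen S (sFun S X Y) X) Y"
    and closed: "\<lbrakk>X \<in> sOb S; Y \<in> sOb S; Z \<in> sOb S; h \<in> sHom S (sTen S X Y) Z\<rbrakk> \<Longrightarrow>
      \<exists>!k. k \<in> sHom S X (sFun S Y Z) \<and> sCmp S (sEv S Y Z) (sTenA S k (sIdn S Y)) = h"

text \<open>\<open>sCurry S X Y Z h : X \<rightarrow> F(Y,Z)\<close> is the adjoint of \<open>h : X \<and> Y \<rightarrow> Z\<close>.\<close>

definition sCurry :: "('s, 't, 'z) smcat_scheme \<Rightarrow> 's \<Rightarrow> 's \<Rightarrow> 's \<Rightarrow> 't \<Rightarrow> 't" where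
  "sCurry S X Y Z h =
    (THE k. k \<in> sHom S X (sFun S Y Z) \<and> sCmp S (sEv S Y Z) (sTenA S k (sIdn S Y)) = h)"


subsection \<open>The underlying symmetric multicategory\<close>

text \<open>A \<open>k\<close>-morphism \<open>(X\<^sub>1,\<dots>,X\<^sub>k) \<rightarrow> Y\<close> is a morphism \<open>smash [X\<^sub>1,\<dots>,X\<^sub>k] \<rightarrow> Y\<close>.\<close>

fun smash :: "('s, 't, 'z) smcat_scheme \<Rightarrow> 's list \<Rightarrow> 's" where
  "smash S [] = sUnit S"
| "smash S [X] = X"
| "smash S (X # Y # Ys) = sTen S X (smash S (Y # Ys))"

fun smashA :: "('s, 't, 'z) smcat_scheme \<Rightarrow> 't list \<Rightarrow> 't" where
  "smashA S [] = sIdn S (sUnit S)"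
| "smashA S [f] = f"
| "smashA S (f # g # gs) = sTenA S f (smashA S (g # gs))"

text \<open>\<open>smash_split S Xs Ys : smash (Xs @ Ys) \<rightarrow> smash Xs \<and> smash Ys\<close>\<close>

fun smash_split :: "('s, 't, 'z) smcat_scheme \<Rightarrow> 's list \<Rightarrow> 's list \<Rightarrow> 't" where
  "smash_split S [] Ys = sInv S (sLun S (smash S Ys))"
| "smash_split S [X] [] = sInv S (sRun S X)"
| "smash_split S [X] (Y # Ys) = sIdn S (smash S (X # Y # Ys))"
| "smash_split S (X # X' # Xs) Ys =
     sCmp S (sInv S (sAssoc S X (smash S (X' # Xs)) (smash S Ys)))
            (sTenA S (sIdn S X) (smash_split S (X' # Xs) Ys))"

text \<open>\<open>regroup S Xss : smash (concat Xss) \<rightarrow> smash (map smash Xss)\<close>\<close>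

fun regroup :: "('s, 't, 'z) smcat_scheme \<Rightarrow> 's list list \<Rightarrow> 't" where
  "regroup S [] = sIdn S (sUnit S)"
| "regroup S [Xs] = sIdn S (smash S Xs)"
| "regroup S (Xs # Ys # Yss) =
     sCmp S (sTenA S (sIdn S (smash S Xs)) (regroup S (Ys # Yss)))
            (smash_split S Xs (concat (Ys # Yss)))"

text \<open>\<open>smash_swap S i Xs : smash (swap_at i Xs) \<rightarrow> smash Xs\<close>\<close>

fun smash_swap :: "('s, 't, 'z) smcat_scheme \<Rightarrow> nat \<Rightarrow> 's list \<Rightarrow> 't" where
  "smash_swap S 0 [X, Y] = sSym S Y X"
| "smash_swap S 0 (X # Y # Z # Zs) =
     (let W = smash S (Z # Zs) in
      sCmp S (sAssoc S X Y W)
        (sCmp S (sTenA S (sSym S Y X) (sIdn S W)) (sInv S (sAssoc S Y X W))))"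
| "smash_swap S (Suc i) (X # Xs) = sTenA S (sIdn S X) (smash_swap S i Xs)"
| "smash_swap S _ _ = undefined"


subsection \<open>Homotopy groups\<close>

text \<open>
  \<open>hPair S m n X Y : \<pi>\<^sub>m X \<times> \<pi>\<^sub>n Y \<rightarrow> \<pi>\<^sub>m\<^sub>+\<^sub>n (X \<and> Y)\<close> is the exterior product and \<open>hOne S\<close>
  in \<open>\<pi>\<^sub>0 S\<close> is the class of the identity of the sphere spectrum.
\<close>

record ('s, 't, 'h) spectra = "('s, 't) smcat" +
  hGrp :: "int \<Rightarrow> 's \<Rightarrow> 'h monoid"
  hMap :: "int \<Rightarrow> 't \<Rightarrow> 'h \<Rightarrow> 'h"
  hPair :: "int \<Rightarrow> int \<Rightarrow> 's \<Rightarrow> 's \<Rightarrow> 'h \<Rightarrow> 'h \<Rightarrow> 'h"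
  hOne :: "'h"

locale category_of_spectra = closed_symmetric_monoidal S
  for S :: "('s, 't, 'h) spectra" +
  assumes hGrp: "X \<in> sOb S \<Longrightarrow> comm_group (hGrp S n X)"
    and hMap: "f \<in> sHom S X Y \<Longrightarrow> hMap S n f \<in> hom (hGrp S n X) (hGrp S n Y)"
    and hMap_idn: "\<lbrakk>X \<in> sOb S; x \<in> carrier (hGrp S n X)\<rbrakk> \<Longrightarrow> hMap S n (sIdn S X) x = x"
    and hMap_cmp: "\<lbrakk>f \<in> sHom S X Y; g \<in> sHom S Y Z; x \<in> carrier (hGrp S n X)\<rbrakk> \<Longrightarrow>
      hMap S n (sCmp S g f) x = hMap S n g (hMap S n f x)"
    and hOne: "hOne S \<in> carrier (hGrp S 0 (sUnit S))"
    and hPair_left: "\<lbrakk>X \<in> sOb S; Y \<in> sOb S; y \<in> carrier (hGrp S n Y)\<rbrakk> \<Longrightarrow>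
      (\<lambda>x. hPair S m n X Y x y) \<in> hom (hGrp S m X) (hGrp S (m + n) (sTen S X Y))"
    and hPair_right: "\<lbrakk>X \<in> sOb S; Y \<in> sOb S; x \<in> carrier (hGrp S m X)\<rbrakk> \<Longrightarrow>
      (\<lambda>y. hPair S m n X Y x y) \<in> hom (hGrp S n Y) (hGrp S (m + n) (sTen S X Y))"
    and hPair_nat: "\<lbrakk>f \<in> sHom S X X'; g \<in> sHom S Y Y';
        x \<in> carrier (hGrp S m X); y \<in> carrier (hGrp S n Y)\<rbrakk> \<Longrightarrow>
      hMap S (m + n) (sTenA S f g) (hPair S m n X Y x y) =
      hPair S m n X' Y' (hMap S m f x) (hMap S n g y)"
    and hPair_assoc: "\<lbrakk>X \<in> sOb S; Y \<in> sOb S; Z \<in> sOb S;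
        x \<in> carrier (hGrp S m X); y \<in> carrier (hGrp S n Y); z \<in> carrier (hGrp S p Z)\<rbrakk> \<Longrightarrow>
      hMap S (m + n + p) (sAssoc S X Y Z)
        (hPair S (m + n) p (sTen S X Y) Z (hPair S m n X Y x y) z) =
      hPair S m (n + p) X (sTen S Y Z) x (hPair S n p Y Z y z)"
    and hPair_lun: "\<lbrakk>X \<in> sOb S; x \<in> carrier (hGrp S n X)\<rbrakk> \<Longrightarrow>
      hMap S n (sLun S X) (hPair S 0 n (sUnit S) X (hOne S) x) = x"
    and hPair_run: "\<lbrakk>X \<in> sOb S; x \<in> carrier (hGrp S n X)\<rbrakk> \<Longrightarrow>
      hMap S n (sRun S X) (hPair S n 0 X (sUnit S) x (hOne S)) = x"
    and hPair_sym: "\<lbrakk>X \<in> sOb S; Y \<in> sOb S;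
        x \<in> carrier (hGrp S m X); y \<in> carrier (hGrp S n Y)\<rbrakk> \<Longrightarrow>
      hMap S (m + n) (sSym S X Y) (hPair S m n X Y x y) =
      (if odd m \<and> odd n then inv\<^bsub>hGrp S (n + m) (sTen S Y X)\<^esub> (hPair S n m Y X y x)
       else hPair S n m Y X y x)"

text \<open>
  The homotopy category has the morphism groups \<open>\<pi>\<^sub>0 F(X,Y)\<close>; \<open>ho_act S n X Y w\<close> is the map
  \<open>\<pi>\<^sub>n X \<rightarrow> \<pi>\<^sub>n Y\<close> induced by the morphism \<open>w\<close> of the homotopy category.
\<close>

definition ho_act :: "('s, 't, 'h) spectra \<Rightarrow> int \<Rightarrow> 's \<Rightarrow> 's \<Rightarrow> 'h \<Rightarrow> 'h \<Rightarrow> 'h" where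
  "ho_act S n X Y w x = hMap S n (sEv S X Y) (hPair S 0 n (sFun S X Y) X w x)"

definition Eilenberg_MacLane ::
    "('s, 't, 'h) spectra \<Rightarrow> 's \<Rightarrow> ('v, 'z) monoid_scheme \<Rightarrow> bool" where
  "Eilenberg_MacLane S X A \<longleftrightarrow> hGrp S 0 X \<cong> A \<and>
     (\<forall>n. n \<noteq> 0 \<longrightarrow> carrier (hGrp S n X) = {\<one>\<^bsub>hGrp S n X\<^esub>})"


subsection \<open>Spectral categories\<close>

record ('a, 's, 't) scat =
  SObj :: "'a set"
  SHom :: "'a \<Rightarrow> 'a \<Rightarrow> 's"
  SComp :: "'a \<Rightarrow> 'a \<Rightarrow> 'a \<Rightarrow> 't"
  SUnit :: "'a \<Rightarrow> 't"

record ('a, 'b, 't) sfun =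
  SFob :: "'a \<Rightarrow> 'b"
  SFhom :: "'a \<Rightarrow> 'a \<Rightarrow> 't"

locale spectral_category =
  fixes S :: "('s, 't, 'z) smcat_scheme" and C :: "('a, 's, 't) scat"
  assumes hom: "\<lbrakk>a \<in> SObj C; b \<in> SObj C\<rbrakk> \<Longrightarrow> SHom C a b \<in> sOb S"
    and comp: "\<lbrakk>a \<in> SObj C; b \<in> SObj C; c \<in> SObj C\<rbrakk> \<Longrightarrow>
      SComp C a b c \<in> sHom S (sTen S (SHom C b c) (SHom C a b)) (SHom C a c)"
    and unit: "a \<in> SObj C \<Longrightarrow> SUnit C a \<in> sHom S (sUnit S) (SHom C a a)"
    and assoc: "\<lbrakk>a \<in> SObj C; b \<in> SObj C; c \<in> SObj C; d \<in> SObj C\<rbrakk> \<Longrightarrow>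
      sCmp S (SComp C a b d) (sTenA S (SComp C b c d) (sIdn S (SHom C a b))) =
      sCmp S (SComp C a c d) (sCmp S (sTenA S (sIdn S (SHom C c d)) (SComp C a b c))
        (sAssoc S (SHom C c d) (SHom C b c) (SHom C a b)))"
    and unit_right: "\<lbrakk>a \<in> SObj C; b \<in> SObj C\<rbrakk> \<Longrightarrow>
      sCmp S (SComp C a a b) (sTenA S (sIdn S (SHom C a b)) (SUnit C a)) = sRun S (SHom C a b)"
    and unit_left: "\<lbrakk>a \<in> SObj C; b \<in> SObj C\<rbrakk> \<Longrightarrow>
      sCmp S (SComp C a b b) (sTenA S (SUnit C b) (sIdn S (SHom C a b))) = sLun S (SHom C a b)"

locale spectral_functor = C: spectral_category S C + D: spectral_category S D
  for S :: "('s, 't, 'z) smcat_scheme" and C :: "('a, 's, 't) scat" and D :: "('b, 's, 't) scat" +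
  fixes F :: "('a, 'b, 't) sfun"
  assumes F_ob: "a \<in> SObj C \<Longrightarrow> SFob F a \<in> SObj D"
    and F_hom: "\<lbrakk>a \<in> SObj C; b \<in> SObj C\<rbrakk> \<Longrightarrow>
      SFhom F a b \<in> sHom S (SHom C a b) (SHom D (SFob F a) (SFob F b))"
    and F_unit: "a \<in> SObj C \<Longrightarrow> sCmp S (SFhom F a a) (SUnit C a) = SUnit D (SFob F a)"
    and F_comp: "\<lbrakk>a \<in> SObj C; b \<in> SObj C; c \<in> SObj C\<rbrakk> \<Longrightarrow>
      sCmp S (SFhom F a c) (SComp C a b c) =
      sCmp S (SComp D (SFob F a) (SFob F b) (SFob F c)) (sTenA S (SFhom F b c) (SFhom F a b))"

locale spectral_natural = F: spectral_functor S C D F + G: spectral_functor S C D G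
  for S :: "('s, 't, 'z) smcat_scheme" and C :: "('a, 's, 't) scat" and D :: "('b, 's, 't) scat"
    and F G :: "('a, 'b, 't) sfun" +
  fixes t :: "'a \<Rightarrow> 't"
  assumes component: "a \<in> SObj C \<Longrightarrow> t a \<in> sHom S (sUnit S) (SHom D (SFob F a) (SFob G a))"
    and natural: "\<lbrakk>a \<in> SObj C; b \<in> SObj C\<rbrakk> \<Longrightarrow>
      sCmp S (SComp D (SFob F a) (SFob F b) (SFob G b))
        (sCmp S (sTenA S (t b) (SFhom F a b)) (sInv S (sLun S (SHom C a b)))) =
      sCmp S (SComp D (SFob F a) (SFob G a) (SFob G b))
        (sCmp S (sTenA S (SFhom G a b) (t a)) (sInv S (sRun S (SHom C a b))))"

definition snat_comp :: "('s, 't, 'z) smcat_scheme \<Rightarrow> ('b, 's, 't) scat \<Rightarrow> ('a, 'b, 't) sfun \<Rightarrow>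
    ('a, 'b, 't) sfun \<Rightarrow> ('a, 'b, 't) sfun \<Rightarrow> ('a \<Rightarrow> 't) \<Rightarrow> ('a \<Rightarrow> 't) \<Rightarrow> 'a \<Rightarrow> 't" where
  "snat_comp S D F G H u t = (\<lambda>a. sCmp S (SComp D (SFob F a) (SFob G a) (SFob H a))
     (sCmp S (sTenA S (u a) (t a)) (sInv S (sLun S (sUnit S)))))"

definition scat_op :: "('s, 't, 'z) smcat_scheme \<Rightarrow> ('a, 's, 't) scat \<Rightarrow> ('a, 's, 't) scat" where
  "scat_op S C = \<lparr>SObj = SObj C, SHom = (\<lambda>a b. SHom C b a),
     SComp = (\<lambda>a b c. sCmp S (SComp C c b a) (sSym S (SHom C c b) (SHom C b a))),
     SUnit = SUnit C\<rparr>"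

definition Spec :: "('s, 't, 'z) smcat_scheme \<Rightarrow> ('s, 's, 't) scat" where
  "Spec S = \<lparr>SObj = sOb S, SHom = sFun S,
     SComp = (\<lambda>X Y Z. sCurry S (sTen S (sFun S Y Z) (sFun S X Y)) X Z
       (sCmp S (sEv S Y Z) (sCmp S (sTenA S (sIdn S (sFun S Y Z)) (sEv S X Y))
         (sAssoc S (sFun S Y Z) (sFun S X Y) X)))),
     SUnit = (\<lambda>X. sCurry S (sUnit S) X X (sLun S X))\<rparr>"

definition sfun_comp :: "('s, 't, 'z) smcat_scheme \<Rightarrow> ('b, 'c, 't) sfun \<Rightarrow> ('a, 'b, 't) sfun \<Rightarrow>
    ('a, 'c, 't) sfun" where
  "sfun_comp S G F = \<lparr>SFob = (\<lambda>a. SFob G (SFob F a)),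
     SFhom = (\<lambda>a b. sCmp S (SFhom G (SFob F a) (SFob F b)) (SFhom F a b))\<rparr>"

text \<open>Applying \<open>H\<close> to a transformation \<open>t : F \<rightarrow> G\<close>.\<close>

definition snat_whisker :: "('s, 't, 'z) smcat_scheme \<Rightarrow> ('b, 'c, 't) sfun \<Rightarrow> ('a, 'b, 't) sfun \<Rightarrow>
    ('a, 'b, 't) sfun \<Rightarrow> ('a \<Rightarrow> 't) \<Rightarrow> 'a \<Rightarrow> 't" where
  "snat_whisker S H F G t = (\<lambda>a. sCmp S (SFhom H (SFob F a) (SFob G a)) (t a))"


section \<open>The K-theory machine\<close>

record ('v, 's, 't) machine =
  KOb :: "('v, 'v) permcat \<Rightarrow> 's"
  KMor :: "'v mfun \<Rightarrow> 't"

locale multifunctor =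
  fixes S :: "('s, 't, 'z) smcat_scheme" and K :: "('v, 's, 't) machine"
  assumes KOb: "small_permcat A \<Longrightarrow> KOb K A \<in> sOb S"
    and KMor: "Perm_morphism f \<Longrightarrow>
      KMor K f \<in> sHom S (smash S (map (KOb K) (Srcs f))) (KOb K (Target f))"
    and KMor_mid: "small_permcat A \<Longrightarrow> KMor K (mid A) = sIdn S (KOb K A)"
    and KMor_mcomp: "\<lbrakk>Perm_morphism g; \<forall>f\<in>set fs. Perm_morphism f; map Target fs = Srcs g\<rbrakk> \<Longrightarrow>
      KMor K (mcomp g fs) = sCmp S (KMor K g) (sCmp S (smashA S (map (KMor K) fs))
        (regroup S (map (\<lambda>f. map (KOb K) (Srcs f)) fs)))"
    and KMor_mswap: "\<lbrakk>Perm_morphism f; Suc i < length (Srcs f)\<rbrakk> \<Longrightarrow>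
      KMor K (mswap i f) = sCmp S (KMor K f) (smash_swap S i (map (KOb K) (Srcs f)))"

definition K_class :: "('s, 't, 'h) spectra \<Rightarrow> ('v, 's, 't) machine \<Rightarrow>
    ('v, 'v) permcat \<Rightarrow> 'v \<Rightarrow> 'h" where
  "K_class S K A a = hMap S 0 (KMor K (mpoint A a)) (hOne S)"

locale K_theory_machine = multifunctor S K
  for S :: "('s, 't, 'h) spectra" and K :: "('v, 's, 't) machine" +
  assumes \<pi>\<^sub>0_K: "small_permcat A \<Longrightarrow>
      \<exists>\<phi>\<in>iso (group_completion (components A)) (hGrp S 0 (KOb K A)).
        \<forall>a\<in>Ob A. \<phi> (to_completion (components A) (component_rel A `` {a})) = K_class S K A a"
    and K_disc: "\<And>A :: 'v monoid. \<lbrakk>comm_group A; small (carrier A)\<rbrakk> \<Longrightarrow>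
      Eilenberg_MacLane S (KOb K (disc A)) A"

definition K_cat :: "('v, 's, 't) machine \<Rightarrow> ('a, 'v) pccat \<Rightarrow> ('a, 's, 't) scat" where
  "K_cat K C = \<lparr>SObj = PObj C, SHom = (\<lambda>a b. KOb K (PHom C a b)),
     SComp = (\<lambda>a b c. KMor K (PComp C a b c)),
     SUnit = (\<lambda>a. KMor K (mpoint (PHom C a a) (PUnit C a)))\<rparr>"

definition K_fun :: "('v, 's, 't) machine \<Rightarrow> ('a, 'b, 'v) pcfun \<Rightarrow> ('a, 'b, 't) sfun" where
  "K_fun K F = \<lparr>SFob = PFob F, SFhom = (\<lambda>a b. KMor K (PFhom F a b))\<rparr>"

definition K_nat :: "('v, 's, 't) machine \<Rightarrow> ('b, 'v) pccat \<Rightarrow> ('a, 'b, 'v) pcfun \<Rightarrow>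
    ('a, 'b, 'v) pcfun \<Rightarrow> ('a \<Rightarrow> 'v) \<Rightarrow> 'a \<Rightarrow> 't" where
  "K_nat K D F G t = (\<lambda>a. KMor K (mpoint (PHom D (PFob F a) (PFob G a)) (t a)))"

definition \<Phi> :: "('s, 't, 'z) smcat_scheme \<Rightarrow> ('v, 's, 't) machine \<Rightarrow>
    (('v, 'v) permcat, 's, 't) sfun" where
  "\<Phi> S K = \<lparr>SFob = KOb K,
     SFhom = (\<lambda>A B. sCurry S (KOb K (Perm_hom A B)) (KOb K A) (KOb K B) (KMor K (ev A B)))\<rparr>"


section \<open>Finite G-sets and spans\<close>

text \<open>A finite \<open>G\<close>-set \<open>(n, \<alpha>)\<close>; \<open>sym_group n\<close> is the symmetric group of \<open>{1..n}\<close>.\<close>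

type_synonym 'g gset = "nat \<times> ('g \<Rightarrow> nat \<Rightarrow> nat)"

definition fin_gset :: "('g, 'z) monoid_scheme \<Rightarrow> 'g gset \<Rightarrow> bool" where
  "fin_gset G A \<longleftrightarrow> snd A \<in> hom G (sym_group (fst A)) \<and> snd A \<in> extensional (carrier G)"

abbreviation points :: "'g gset \<Rightarrow> nat set" where
  "points A \<equiv> {1..fst A}"

definition gmaps :: "('g, 'z) monoid_scheme \<Rightarrow> 'g gset \<Rightarrow> 'g gset \<Rightarrow> (nat \<Rightarrow> nat) set" where
  "gmaps G A B = {f \<in> points A \<rightarrow>\<^sub>E points B.
     \<forall>g\<in>carrier G. \<forall>x\<in>points A. f (snd A g x) = snd B g (f x)}"

definition gset_empty :: "('g, 'z) monoid_scheme \<Rightarrow> 'g gset" where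
  "gset_empty G = (0, \<lambda>g\<in>carrier G. id)"

definition gset_sum :: "('g, 'z) monoid_scheme \<Rightarrow> 'g gset \<Rightarrow> 'g gset \<Rightarrow> 'g gset" where
  "gset_sum G A B = (fst A + fst B, \<lambda>g\<in>carrier G. \<lambda>x.
     if x \<le> fst A then snd A g x else if x \<le> fst A + fst B then fst A + snd B g (x - fst A) else x)"

text \<open>A span from \<open>Left X\<close> to \<open>Right X\<close>.\<close>

record 'g gspan =
  Left :: "'g gset"
  Right :: "'g gset"
  Apex :: "'g gset"
  LLeg :: "nat \<Rightarrow> nat"
  RLeg :: "nat \<Rightarrow> nat"

record 'g gspan_iso =
  ISrc :: "'g gspan"
  ITgt :: "'g gspan"
  IMap :: "nat \<Rightarrow> nat"

definition spans :: "('g, 'z) monoid_scheme \<Rightarrow> 'g gset \<Rightarrow> 'g gset \<Rightarrow> 'g gspan set" where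
  "spans G A B = {X. Left X = A \<and> Right X = B \<and> fin_gset G (Apex X) \<and>
     LLeg X \<in> gmaps G (Apex X) A \<and> RLeg X \<in> gmaps G (Apex X) B}"

definition span_isos :: "('g, 'z) monoid_scheme \<Rightarrow> 'g gset \<Rightarrow> 'g gset \<Rightarrow> 'g gspan_iso set" where
  "span_isos G A B = {u. ISrc u \<in> spans G A B \<and> ITgt u \<in> spans G A B \<and>
     IMap u \<in> gmaps G (Apex (ISrc u)) (Apex (ITgt u)) \<and>
     bij_betw (IMap u) (points (Apex (ISrc u))) (points (Apex (ITgt u))) \<and>
     (\<forall>x\<in>points (Apex (ISrc u)). LLeg (ITgt u) (IMap u x) = LLeg (ISrc u) x \<and>
                                 RLeg (ITgt u) (IMap u x) = RLeg (ISrc u) x)}"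

definition span_id :: "'g gset \<Rightarrow> 'g gspan" where
  "span_id A = \<lparr>Left = A, Right = A, Apex = A, LLeg = (\<lambda>x\<in>points A. x), RLeg = (\<lambda>x\<in>points A. x)\<rparr>"

definition span_empty :: "('g, 'z) monoid_scheme \<Rightarrow> 'g gset \<Rightarrow> 'g gset \<Rightarrow> 'g gspan" where
  "span_empty G A B = \<lparr>Left = A, Right = B, Apex = gset_empty G,
     LLeg = (\<lambda>_. undefined), RLeg = (\<lambda>_. undefined)\<rparr>"

definition span_sum :: "('g, 'z) monoid_scheme \<Rightarrow> 'g gspan \<Rightarrow> 'g gspan \<Rightarrow> 'g gspan" where
  "span_sum G X Y = (let n = fst (Apex X); Z = gset_sum G (Apex X) (Apex Y) in
     \<lparr>Left = Left X, Right = Right X, Apex = Z,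
      LLeg = (\<lambda>x\<in>points Z. if x \<le> n then LLeg X x else LLeg Y (x - n)),
      RLeg = (\<lambda>x\<in>points Z. if x \<le> n then RLeg X x else RLeg Y (x - n))\<rparr>)"

definition mk_iso :: "'g gspan \<Rightarrow> 'g gspan \<Rightarrow> (nat \<Rightarrow> nat) \<Rightarrow> 'g gspan_iso" where
  "mk_iso X Y f = \<lparr>ISrc = X, ITgt = Y, IMap = restrict f (points (Apex X))\<rparr>"

definition span_category ::
    "('g, 'z) monoid_scheme \<Rightarrow> 'g gset \<Rightarrow> 'g gset \<Rightarrow> ('g gspan, 'g gspan_iso) permcat" where
  "span_category G A B =
    \<lparr>Ob = spans G A B, Ar = span_isos G A B, Src = ISrc, Tgt = ITgt,
     Idn = (\<lambda>X. mk_iso X X id),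
     Cmp = (\<lambda>v u. mk_iso (ISrc u) (ITgt v) (IMap v \<circ> IMap u)),
     HTop = (\<lambda>X Y. discrete_topology {u \<in> span_isos G A B. ISrc u = X \<and> ITgt u = Y}),
     Zer = span_empty G A B, Add = span_sum G,
     AddA = (\<lambda>u v. let n = fst (Apex (ISrc u)); n' = fst (Apex (ITgt u)) in
        mk_iso (span_sum G (ISrc u) (ISrc v)) (span_sum G (ITgt u) (ITgt v))
          (\<lambda>x. if x \<le> n then IMap u x else n' + IMap v (x - n))),
     Twist = (\<lambda>X Y. let n = fst (Apex X); m = fst (Apex Y) in
        mk_iso (span_sum G X Y) (span_sum G Y X) (\<lambda>x. if x \<le> n then m + x else x - n))\<rparr>"


subsection \<open>Composition by chosen pullbacks\<close>

text \<open>
  For a span \<open>X\<close> from \<open>A\<close> to \<open>B\<close> and a span \<open>Y\<close> from \<open>B\<close> to \<open>C\<close>, a choice of pullbacks supplies a pullback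
  of \<open>RLeg X\<close> and \<open>LLeg Y\<close> with its projections to the apexes of \<open>X\<close> and \<open>Y\<close>.
\<close>

type_synonym 'g pullbacks = "'g gspan \<Rightarrow> 'g gspan \<Rightarrow> 'g gset \<times> (nat \<Rightarrow> nat) \<times> (nat \<Rightarrow> nat)"

definition matching :: "'g gspan \<Rightarrow> 'g gspan \<Rightarrow> (nat \<times> nat) set" where
  "matching X Y = {(x, y). x \<in> points (Apex X) \<and> y \<in> points (Apex Y) \<and> RLeg X x = LLeg Y y}"

definition pullback_choice :: "('g, 'z) monoid_scheme \<Rightarrow> 'g pullbacks \<Rightarrow> bool" where
  "pullback_choice G pb \<longleftrightarrow> (\<forall>A B C. \<forall>X\<in>spans G A B. \<forall>Y\<in>spans G B C.
     fin_gset G A \<longrightarrow> fin_gset G B \<longrightarrow> fin_gset G C \<longrightarrow>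
     (case pb X Y of (T, p, q) \<Rightarrow>
        fin_gset G T \<and> p \<in> gmaps G T (Apex X) \<and> q \<in> gmaps G T (Apex Y) \<and>
        bij_betw (\<lambda>t. (p t, q t)) (points T) (matching X Y)))"

text \<open>
  The standard choice: the apex of \<open>Y\<close> if \<open>RLeg X\<close> is an identity, the apex of \<open>X\<close> if \<open>LLeg Y\<close> is an
  identity, and otherwise the set of matching pairs in lexicographic order. Taken literally it is
  unital but not strictly associative: on a trivial \<open>G\<close>-set \<open>{1, 2}\<close> with swap \<open>s\<close>, the spans
  \<open>(id, s)\<close>, \<open>(id, s)\<close>, \<open>(s, id)\<close> (left leg, right leg) have the composites \<open>(s, id)\<close> and \<open>(id, s)\<close>.
  The choice of pullbacks is therefore a parameter of the category of spans.
\<close>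

definition lex_pullback :: "('g, 'z) monoid_scheme \<Rightarrow> 'g pullbacks" where
  "lex_pullback G X Y =
    (if Apex X = Right X \<and> RLeg X = (\<lambda>x\<in>points (Apex X). x)
     then (Apex Y, LLeg Y, \<lambda>y\<in>points (Apex Y). y)
     else if Apex Y = Left Y \<and> LLeg Y = (\<lambda>y\<in>points (Apex Y). y)
     then (Apex X, \<lambda>x\<in>points (Apex X). x, RLeg X)
     else
       let L = filter (\<lambda>(x, y). RLeg X x = LLeg Y y)
                 (List.product [1..<Suc (fst (Apex X))] [1..<Suc (fst (Apex Y))]);
           pr = (\<lambda>t. L ! (t - 1)); T = {1..length L} in
       ((length L, \<lambda>g\<in>carrier G. \<lambda>t. if t \<in> T
           then (THE t'. t' \<in> T \<and> pr t' = (snd (Apex X) g (fst (pr t)), snd (Apex Y) g (snd (pr t))))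
           else t),
        \<lambda>t\<in>T. fst (pr t), \<lambda>t\<in>T. snd (pr t)))"

lemma fin_gset_action:
  assumes "group G" "fin_gset G A" "g \<in> carrier G"
  shows "snd A g permutes points A"
  using assms by (auto simp: fin_gset_def hom_def sym_group_def Pi_iff)

lemma fin_gset_mult:
  assumes "fin_gset G A" "g \<in> carrier G" "h \<in> carrier G"
  shows "snd A (g \<otimes>\<^bsub>G\<^esub> h) = snd A g \<circ> snd A h"
  using assms by (auto simp: fin_gset_def hom_def sym_group_def)

lemma lex_pullback_choice:
  assumes "group G"
  shows "pullback_choice G (lex_pullback G)"
  unfolding pullback_choice_def
proof (intro allI ballI impI)
  fix A B C X Y
  assume X: "X \<in> spans G A B" and Y: "Y \<in> spans G B C" and B: "fin_gset G B"
  interpret group G by fact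
  have gX: "fin_gset G (Apex X)" and gY: "fin_gset G (Apex Y)"
    using X Y by (auto simp: spans_def)
  have rX: "RLeg X \<in> gmaps G (Apex X) B" and lY: "LLeg Y \<in> gmaps G (Apex Y) B"
    using X Y by (auto simp: spans_def)
  have aX: "snd (Apex X) g x \<in> points (Apex X) \<longleftrightarrow> x \<in> points (Apex X)" if "g \<in> carrier G" for g x
    using permutes_in_image[OF fin_gset_action[OF assms gX that]] by auto
  have aY: "snd (Apex Y) g y \<in> points (Apex Y) \<longleftrightarrow> y \<in> points (Apex Y)" if "g \<in> carrier G" for g y
    using permutes_in_image[OF fin_gset_action[OF assms gY that]] by auto
  let ?id = "\<lambda>A. \<lambda>x\<in>points A. x"
  show "case lex_pullback G X Y of (T, p, q) \<Rightarrow>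
        fin_gset G T \<and> p \<in> gmaps G T (Apex X) \<and> q \<in> gmaps G T (Apex Y) \<and>
        bij_betw (\<lambda>t. (p t, q t)) (points T) (matching X Y)"
  proof (cases "Apex X = Right X \<and> RLeg X = ?id (Apex X)")
    case True
    have AB: "Apex X = B" using True X by (simp add: spans_def)
    have "?id (Apex Y) \<in> gmaps G (Apex Y) (Apex Y)"
      using aY unfolding gmaps_def by simp
    moreover have "bij_betw (\<lambda>t. (LLeg Y t, ?id (Apex Y) t)) (points (Apex Y)) (matching X Y)"
      using True lY AB by (auto simp: bij_betw_def inj_on_def matching_def gmaps_def image_iff)
    moreover have "lex_pullback G X Y = (Apex Y, LLeg Y, ?id (Apex Y))"
      by (simp only: lex_pullback_def if_P[OF True])
    moreover have "LLeg Y \<in> gmaps G (Apex Y) (Apex X)"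
      using lY by (simp only: AB)
    ultimately show ?thesis
      using gY by simp
  next
    case F: False
    show ?thesis
    proof (cases "Apex Y = Left Y \<and> LLeg Y = ?id (Apex Y)")
      case True
      have AB: "Apex Y = B" using True Y by (simp add: spans_def)
      have "?id (Apex X) \<in> gmaps G (Apex X) (Apex X)"
        using aX unfolding gmaps_def by simp
      moreover have "bij_betw (\<lambda>t. (?id (Apex X) t, RLeg X t)) (points (Apex X)) (matching X Y)"
        using True rX AB by (auto simp: bij_betw_def inj_on_def matching_def gmaps_def image_iff)
      moreover have "lex_pullback G X Y = (Apex X, ?id (Apex X), RLeg X)"
        by (simp only: lex_pullback_def if_not_P[OF F] if_P[OF True])
      moreover have "RLeg X \<in> gmaps G (Apex X) (Apex Y)"
        using rX by (simp only: AB)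
      ultimately show ?thesis
        using gX by simp
    next
      case F': False
      define L where "L = filter (\<lambda>(x, y). RLeg X x = LLeg Y y)
                 (List.product [1..<Suc (fst (Apex X))] [1..<Suc (fst (Apex Y))])"
      define T where "T = {1..length L}"
      define pr where "pr = (\<lambda>t. L ! (t - 1))"
      define act where "act = (\<lambda>g (x, y). (snd (Apex X) g x, snd (Apex Y) g y))"
      define \<alpha> where "\<alpha> = (\<lambda>g\<in>carrier G. \<lambda>t. if t \<in> T
           then (THE t'. t' \<in> T \<and> pr t' = act g (pr t)) else t)"
      have pb: "lex_pullback G X Y = ((length L, \<alpha>), \<lambda>t\<in>T. fst (pr t), \<lambda>t\<in>T. snd (pr t))"
        unfolding lex_pullback_def if_not_P[OF F] if_not_P[OF F'] Let_def L_def[symmetric]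
        unfolding T_def[symmetric] pr_def \<alpha>_def act_def case_prod_beta ..
      have "distinct L" unfolding L_def by (simp add: distinct_product)
      then have "bij_betw (\<lambda>i. L ! i) {..<length L} (set L)"
        by (rule bij_betw_nth) auto
      moreover have "bij_betw (\<lambda>t. t - 1) T {..<length L}"
        unfolding T_def by (rule bij_betwI[where g = Suc]) auto
      moreover have "set L = matching X Y"
        unfolding L_def matching_def by auto
      ultimately have bij: "bij_betw pr T (matching X Y)"
        unfolding pr_def using bij_betw_trans[of "\<lambda>t. t - 1" T _ "\<lambda>i. L ! i"]
        by (auto simp: comp_def)
      have act: "act g m \<in> matching X Y" if "g \<in> carrier G" "m \<in> matching X Y" for g m
        using that aX[of g] aY[of g] rX lY by (auto simp: act_def matching_def gmaps_def)
      have m: "pr t \<in> matching X Y" if "t \<in> T" for t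
        using bij that by (auto simp: bij_betw_def)
      have \<alpha>: "\<alpha> g t \<in> T" "pr (\<alpha> g t) = act g (pr t)" if "g \<in> carrier G" "t \<in> T" for g t
      proof -
        have "act g (pr t) \<in> matching X Y" using act[OF that(1) m[OF that(2)]] .
        then have "\<exists>!t'. t' \<in> T \<and> pr t' = act g (pr t)"
          using bij unfolding bij_betw_def inj_on_def by (metis imageE)
        from theI'[OF this] show "\<alpha> g t \<in> T" "pr (\<alpha> g t) = act g (pr t)"
          using that by (simp_all add: \<alpha>_def)
      qed
      have out: "\<alpha> g t = t" if "g \<in> carrier G" "t \<notin> T" for g t
        using that by (simp add: \<alpha>_def)
      have act_mult: "act (g \<otimes>\<^bsub>G\<^esub> h) m = act g (act h m)" if "g \<in> carrier G" "h \<in> carrier G" for g h m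
        using that by (simp add: act_def fin_gset_mult[OF gX] fin_gset_mult[OF gY] split: prod.split)
      have inj: "t = t'" if "t \<in> T" "t' \<in> T" "pr t = pr t'" for t t'
        using bij that by (auto simp: bij_betw_def inj_on_def)
      have mult: "\<alpha> (g \<otimes>\<^bsub>G\<^esub> h) = \<alpha> g \<circ> \<alpha> h" if "g \<in> carrier G" "h \<in> carrier G" for g h
      proof
        fix t show "\<alpha> (g \<otimes>\<^bsub>G\<^esub> h) t = (\<alpha> g \<circ> \<alpha> h) t"
        proof (cases "t \<in> T")
          case True
          then show ?thesis using that by (intro inj) (auto simp: \<alpha> act_mult)
        next
          case False
          then show ?thesis using that by (simp add: out)
        qed
      qed
      have inj_act: "m = m'" if g: "g \<in> carrier G" and eq: "act g m = act g m'" for g m m'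
      proof -
        have "inj (snd (Apex X) g)" "inj (snd (Apex Y) g)"
          using fin_gset_action[OF assms gX g] fin_gset_action[OF assms gY g] by (metis permutes_inj)+
        moreover have "snd (Apex X) g (fst m) = snd (Apex X) g (fst m')"
          "snd (Apex Y) g (snd m) = snd (Apex Y) g (snd m')"
          using eq unfolding act_def case_prod_beta by (metis prod.inject)+
        ultimately show ?thesis by (meson injD prod_eqI)
      qed
      have perm: "\<alpha> g permutes T" if "g \<in> carrier G" for g
      proof (rule bij_imp_permutes)
        have "inj_on (\<alpha> g) T"
          proof (rule inj_onI)
          fix t t' assume "t \<in> T" "t' \<in> T" "\<alpha> g t = \<alpha> g t'"
          then have "act g (pr t) = act g (pr t')" using \<alpha>(2)[OF that] by metis
          then show "t = t'" using inj_act[OF that] inj \<open>t \<in> T\<close> \<open>t' \<in> T\<close> by blast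
        qed
        moreover have "\<alpha> g ` T \<subseteq> T" using that \<alpha>(1) by auto
        ultimately show "bij_betw (\<alpha> g) T T"
          by (simp add: T_def bij_betw_def endo_inj_surj)
      qed (use that out in auto)
      have "fin_gset G (length L, \<alpha>)"
        using perm mult unfolding fin_gset_def hom_def sym_group_def
        by (auto simp: T_def) (simp add: \<alpha>_def)
      moreover have "(\<lambda>t\<in>T. fst (pr t)) \<in> gmaps G (length L, \<alpha>) (Apex X)"
        unfolding gmaps_def fst_conv snd_conv T_def[symmetric]
        using m \<alpha> by (auto simp: act_def matching_def case_prod_beta mem_Times_iff)
      moreover have "(\<lambda>t\<in>T. snd (pr t)) \<in> gmaps G (length L, \<alpha>) (Apex Y)"
        unfolding gmaps_def fst_conv snd_conv T_def[symmetric]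
        using m \<alpha> by (auto simp: act_def matching_def case_prod_beta mem_Times_iff)
      moreover have "bij_betw (\<lambda>t. ((\<lambda>t\<in>T. fst (pr t)) t, (\<lambda>t\<in>T. snd (pr t)) t)) T (matching X Y)"
        using bij by (rule iffD1[OF bij_betw_cong, rotated]) simp
      ultimately show ?thesis
        unfolding pb by (simp add: T_def)
    qed
  qed
qed

text \<open>\<open>span_comp pb X Y\<close> is the composite of first \<open>X\<close>, then \<open>Y\<close>.\<close>

definition span_comp :: "'g pullbacks \<Rightarrow> 'g gspan \<Rightarrow> 'g gspan \<Rightarrow> 'g gspan" where
  "span_comp pb X Y = (case pb X Y of (T, p, q) \<Rightarrow>
     \<lparr>Left = Left X, Right = Right Y, Apex = T,
      LLeg = (\<lambda>t\<in>points T. LLeg X (p t)), RLeg = (\<lambda>t\<in>points T. RLeg Y (q t))\<rparr>)"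

text \<open>The point of the chosen pullback of \<open>X\<close> and \<open>Y\<close> lying over \<open>x\<close> and \<open>y\<close>.\<close>

definition pb_point :: "'g pullbacks \<Rightarrow> 'g gspan \<Rightarrow> 'g gspan \<Rightarrow> nat \<Rightarrow> nat \<Rightarrow> nat" where
  "pb_point pb X Y x y = (case pb X Y of (T, p, q) \<Rightarrow> THE t. t \<in> points T \<and> p t = x \<and> q t = y)"

definition span_comp_iso :: "'g pullbacks \<Rightarrow> 'g gspan_iso \<Rightarrow> 'g gspan_iso \<Rightarrow> 'g gspan_iso" where
  "span_comp_iso pb u v = (case pb (ISrc u) (ISrc v) of (T, p, q) \<Rightarrow>
     mk_iso (span_comp pb (ISrc u) (ISrc v)) (span_comp pb (ITgt u) (ITgt v))
       (\<lambda>t. pb_point pb (ITgt u) (ITgt v) (IMap u (p t)) (IMap v (q t))))"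

text \<open>The canonical isomorphisms expressing that pullback distributes over disjoint unions.\<close>

definition span_distrib_left ::
    "('g, 'z) monoid_scheme \<Rightarrow> 'g pullbacks \<Rightarrow> 'g gspan \<Rightarrow> 'g gspan \<Rightarrow> 'g gspan \<Rightarrow> 'g gspan_iso" where
  "span_distrib_left G pb X X' Y =
    (case (pb X Y, pb X' Y) of ((T, p, q), (T', p', q')) \<Rightarrow>
     mk_iso (span_sum G (span_comp pb X Y) (span_comp pb X' Y)) (span_comp pb (span_sum G X X') Y)
       (\<lambda>t. if t \<le> fst T then pb_point pb (span_sum G X X') Y (p t) (q t)
            else pb_point pb (span_sum G X X') Y (fst (Apex X) + p' (t - fst T)) (q' (t - fst T))))"

definition span_distrib_right ::
    "('g, 'z) monoid_scheme \<Rightarrow> 'g pullbacks \<Rightarrow> 'g gspan \<Rightarrow> 'g gspan \<Rightarrow> 'g gspan \<Rightarrow> 'g gspan_iso" where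
  "span_distrib_right G pb X Y Y' =
    (case (pb X Y, pb X Y') of ((T, p, q), (T', p', q')) \<Rightarrow>
     mk_iso (span_sum G (span_comp pb X Y) (span_comp pb X Y')) (span_comp pb X (span_sum G Y Y'))
       (\<lambda>t. if t \<le> fst T then pb_point pb X (span_sum G Y Y') (p t) (q t)
            else pb_point pb X (span_sum G Y Y') (p' (t - fst T)) (fst (Apex Y) + q' (t - fst T))))"

definition GE_hom :: "('g, 'z) monoid_scheme \<Rightarrow> 'g gset \<Rightarrow> 'g gset \<Rightarrow> ('v, 'v) permcat" where
  "GE_hom G A B = encode_permcat (span_category G A B)"

definition GE_comp :: "('g, 'z) monoid_scheme \<Rightarrow> 'g pullbacks \<Rightarrow>
    'g gset \<Rightarrow> 'g gset \<Rightarrow> 'g gset \<Rightarrow> 'v mfun" where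
  "GE_comp G pb A B C =
    (let e = enc (spans G A C); d = dec (spans G B C); d' = dec (spans G A B);
         E = enc (span_isos G A C); D = dec (span_isos G B C); D' = dec (span_isos G A B) in
     mk_mfun [GE_hom G B C, GE_hom G A B] (GE_hom G A C)
       (\<lambda>xs. e (span_comp pb (d' (xs ! 1)) (d (xs ! 0))))
       (\<lambda>us. E (span_comp_iso pb (D' (us ! 1)) (D (us ! 0))))
       (\<lambda>i xs x'. E (if i = 0 then span_distrib_right G pb (d' (xs ! 1)) (d (xs ! 0)) (d x')
                      else span_distrib_left G pb (d' (xs ! 1)) (d' x') (d (xs ! 0)))))"

definition GE :: "('g, 'z) monoid_scheme \<Rightarrow> 'g pullbacks \<Rightarrow> ('g gset, 'v) pccat" where
  "GE G pb = \<lparr>PObj = {A. fin_gset G A}, PHom = GE_hom G, PComp = GE_comp G pb,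
     PUnit = (\<lambda>A. enc (spans G A A) (span_id A))\<rparr>"

definition GB :: "('v, 's, 't) machine \<Rightarrow> ('g, 'z) monoid_scheme \<Rightarrow> 'g pullbacks \<Rightarrow>
    ('g gset, 's, 't) scat" where
  "GB K G pb = K_cat K (GE G pb)"


section \<open>The Burnside category and Mackey functors\<close>

definition iso_rel :: "('g, 'z) monoid_scheme \<Rightarrow> 'g gset \<Rightarrow> 'g gset \<Rightarrow> ('g gspan \<times> 'g gspan) set" where
  "iso_rel G A B = (\<lambda>u. (ISrc u, ITgt u)) ` span_isos G A B"

definition span_classes ::
    "('g, 'z) monoid_scheme \<Rightarrow> 'g gset \<Rightarrow> 'g gset \<Rightarrow> 'g gspan set monoid" where
  "span_classes G A B = \<lparr>carrier = spans G A B // iso_rel G A B,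
     mult = (\<lambda>P Q. iso_rel G A B `` {span_sum G X Y | X Y. X \<in> P \<and> Y \<in> Q}),
     one = iso_rel G A B `` {span_empty G A B}\<rparr>"

type_synonym 'g burnside = "('g gspan set \<times> 'g gspan set) set"

definition burnside_hom ::
    "('g, 'z) monoid_scheme \<Rightarrow> 'g gset \<Rightarrow> 'g gset \<Rightarrow> 'g burnside monoid" where
  "burnside_hom G A B = group_completion (span_classes G A B)"

definition span_class ::
    "('g, 'z) monoid_scheme \<Rightarrow> 'g gset \<Rightarrow> 'g gset \<Rightarrow> 'g gspan \<Rightarrow> 'g burnside" where
  "span_class G A B X = to_completion (span_classes G A B) (iso_rel G A B `` {X})"

definition burnside_id :: "('g, 'z) monoid_scheme \<Rightarrow> 'g gset \<Rightarrow> 'g burnside" where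
  "burnside_id G A = span_class G A A (span_id A)"

text \<open>
  The biadditive extension of the composition of spans; \<open>burnside_comp G pb A B C d c\<close> is the
  composite of \<open>c : A \<rightarrow> B\<close> and \<open>d : B \<rightarrow> C\<close>.
\<close>

definition burnside_comp :: "('g, 'z) monoid_scheme \<Rightarrow> 'g pullbacks \<Rightarrow>
    'g gset \<Rightarrow> 'g gset \<Rightarrow> 'g gset \<Rightarrow> 'g burnside \<Rightarrow> 'g burnside \<Rightarrow> 'g burnside" where
  "burnside_comp G pb A B C d c =
    (let M = span_classes G A C;
         m = (\<lambda>P Q. iso_rel G A C `` {span_comp pb X Y | X Y. X \<in> P \<and> Y \<in> Q}) in
     groth_rel M `` {(m P Q \<otimes>\<^bsub>M\<^esub> m P' Q', m P Q' \<otimes>\<^bsub>M\<^esub> m P' Q) | P P' Q Q'.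
       (P, P') \<in> c \<and> (Q, Q') \<in> d})"

text \<open>\<open>MMap M A B c : M(B) \<rightarrow> M(A)\<close> for \<open>c : A \<rightarrow> B\<close>.\<close>

record ('g, 'h) mackey =
  MOb :: "'g gset \<Rightarrow> 'h monoid"
  MMap :: "'g gset \<Rightarrow> 'g gset \<Rightarrow> 'g burnside \<Rightarrow> 'h \<Rightarrow> 'h"

locale mackey_functor =
  fixes G :: "('g, 'z) monoid_scheme" and pb :: "'g pullbacks" and M :: "('g, 'h) mackey"
  assumes ob: "fin_gset G A \<Longrightarrow> comm_group (MOb M A)"
    and map: "\<lbrakk>fin_gset G A; fin_gset G B; c \<in> carrier (burnside_hom G A B)\<rbrakk> \<Longrightarrow>
      MMap M A B c \<in> hom (MOb M B) (MOb M A)"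
    and id: "\<lbrakk>fin_gset G A; x \<in> carrier (MOb M A)\<rbrakk> \<Longrightarrow> MMap M A A (burnside_id G A) x = x"
    and comp: "\<lbrakk>fin_gset G A; fin_gset G B; fin_gset G C; c \<in> carrier (burnside_hom G A B);
        d \<in> carrier (burnside_hom G B C); x \<in> carrier (MOb M C)\<rbrakk> \<Longrightarrow>
      MMap M A C (burnside_comp G pb A B C d c) x = MMap M A B c (MMap M B C d x)"
    and additive: "\<lbrakk>fin_gset G A; fin_gset G B; c \<in> carrier (burnside_hom G A B);
        c' \<in> carrier (burnside_hom G A B); x \<in> carrier (MOb M B)\<rbrakk> \<Longrightarrow>
      MMap M A B (c \<otimes>\<^bsub>burnside_hom G A B\<^esub> c') x = MMap M A B c x \<otimes>\<^bsub>MOb M A\<^esub> MMap M A B c' x"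

definition small_mackey_functor ::
    "('g, 'z) monoid_scheme \<Rightarrow> 'g pullbacks \<Rightarrow> ('g, 'v) mackey \<Rightarrow> bool" where
  "small_mackey_functor G pb M \<longleftrightarrow>
     mackey_functor G pb M \<and> (\<forall>A. fin_gset G A \<longrightarrow> small (carrier (MOb M A)))"

definition mackey_natural :: "('g, 'z) monoid_scheme \<Rightarrow> ('g, 'h) mackey \<Rightarrow> ('g, 'k) mackey \<Rightarrow>
    ('g gset \<Rightarrow> 'h \<Rightarrow> 'k) \<Rightarrow> bool" where
  "mackey_natural G M N \<eta> \<longleftrightarrow>
     (\<forall>A. fin_gset G A \<longrightarrow> \<eta> A \<in> hom (MOb M A) (MOb N A)) \<and>
     (\<forall>A B. fin_gset G A \<longrightarrow> fin_gset G B \<longrightarrow> (\<forall>c\<in>carrier (burnside_hom G A B).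
        \<forall>x\<in>carrier (MOb M B). \<eta> A (MMap M A B c x) = MMap N A B c (\<eta> B x)))"

definition mackey_isomorphic :: "('g, 'z) monoid_scheme \<Rightarrow> 'g pullbacks \<Rightarrow>
    ('g, 'h) mackey \<Rightarrow> ('g, 'k) mackey \<Rightarrow> bool" where
  "mackey_isomorphic G pb M N \<longleftrightarrow> mackey_functor G pb M \<and> mackey_functor G pb N \<and>
     (\<exists>\<eta>. mackey_natural G M N \<eta> \<and> (\<forall>A. fin_gset G A \<longrightarrow> \<eta> A \<in> iso (MOb M A) (MOb N A)))"


subsection \<open>Mackey functors as \<open>PC\<close>-functors\<close>

definition disc_fun :: "('v, 'y) monoid_scheme \<Rightarrow> ('v, 'z) monoid_scheme \<Rightarrow> ('v \<Rightarrow> 'v) \<Rightarrow> 'v mfun" where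
  "disc_fun A B h = mk_mfun [disc A] (disc B) (\<lambda>xs. h (hd xs)) (\<lambda>us. h (hd us))
     (\<lambda>i xs a'. h (hd xs \<otimes>\<^bsub>A\<^esub> a'))"

text \<open>The point of \<open>Perm(A,B)\<close> given by a homomorphism of abelian groups.\<close>

definition hom_point :: "('v, 'y) monoid_scheme \<Rightarrow> ('v, 'z) monoid_scheme \<Rightarrow> ('v \<Rightarrow> 'v) \<Rightarrow> 'v" where
  "hom_point A B h = enc_fun (disc A) (disc B) (disc_fun A B h)"

text \<open>
  On \<open>GE(A,B)\<close>, the morphisms from \<open>B\<close> to \<open>A\<close> in the opposite category, a span goes to its class
  and then to a homomorphism \<open>M(B) \<rightarrow> M(A)\<close>. All arrows, linearity constraints included, go to identities.
\<close>

definition mackey_pc_hom :: "('g, 'z) monoid_scheme \<Rightarrow> ('g, 'v) mackey \<Rightarrow>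
    'g gset \<Rightarrow> 'g gset \<Rightarrow> 'v mfun" where
  "mackey_pc_hom G M A B =
    (let Q = Perm_hom (disc (MOb M B)) (disc (MOb M A)); P = GE_hom G A B;
         m = (\<lambda>x. hom_point (MOb M B) (MOb M A)
                (MMap M A B (span_class G A B (dec (spans G A B) x)))) in
     mk_mfun [P] Q (\<lambda>xs. m (hd xs)) (\<lambda>us. Idn Q (m (Src P (hd us))))
       (\<lambda>i xs x'. Idn Q (m (Add P (hd xs) x'))))"

definition mackey_pc ::
    "('g, 'z) monoid_scheme \<Rightarrow> ('g, 'v) mackey \<Rightarrow> ('g gset, ('v, 'v) permcat, 'v) pcfun" where
  "mackey_pc G M = \<lparr>PFob = (\<lambda>A. disc (MOb M A)), PFhom = (\<lambda>B A. mackey_pc_hom G M A B)\<rparr>"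

definition mackey_pc_nat :: "('g, 'v) mackey \<Rightarrow> ('g, 'v) mackey \<Rightarrow>
    ('g gset \<Rightarrow> 'v \<Rightarrow> 'v) \<Rightarrow> 'g gset \<Rightarrow> 'v" where
  "mackey_pc_nat M N \<eta> = (\<lambda>A. hom_point (MOb M A) (MOb N A) (\<eta> A))"

definition K_G :: "('s, 't, 'y) smcat_scheme \<Rightarrow> ('v, 's, 't) machine \<Rightarrow> ('g, 'z) monoid_scheme \<Rightarrow>
    ('g, 'v) mackey \<Rightarrow> ('g gset, 's, 't) sfun" where
  "K_G S K G M = sfun_comp S (\<Phi> S K) (K_fun K (mackey_pc G M))"

definition K_G_nat :: "('s, 't, 'y) smcat_scheme \<Rightarrow> ('v, 's, 't) machine \<Rightarrow>
    ('g, 'z) monoid_scheme \<Rightarrow> ('g, 'v) mackey \<Rightarrow> ('g, 'v) mackey \<Rightarrow>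
    ('g gset \<Rightarrow> 'v \<Rightarrow> 'v) \<Rightarrow> 'g gset \<Rightarrow> 't" where
  "K_G_nat S K G M N \<eta> =
     snat_whisker S (\<Phi> S K) (K_fun K (mackey_pc G M)) (K_fun K (mackey_pc G N))
       (K_nat K Perm (mackey_pc G M) (mackey_pc G N) (mackey_pc_nat M N \<eta>))"


subsection \<open>Homotopy Mackey functors\<close>

text \<open>The isomorphism from the Burnside group of \<open>A\<close> and \<open>B\<close> to \<open>\<pi>\<^sub>0\<close> of \<open>GB(A,B)\<close>.\<close>

definition burnside_to_\<pi>\<^sub>0 :: "('s, 't, 'h) spectra \<Rightarrow> ('v, 's, 't) machine \<Rightarrow>
    ('g, 'z) monoid_scheme \<Rightarrow> 'g gset \<Rightarrow> 'g gset \<Rightarrow> 'g burnside \<Rightarrow> 'h" where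
  "burnside_to_\<pi>\<^sub>0 S K G A B = completion_lift (hGrp S 0 (KOb K (GE_hom G A B)))
     (\<lambda>P. the_elem ((\<lambda>X. K_class S K (GE_hom G A B) (enc (spans G A B) X)) ` P))"

definition homotopy_mackey :: "('s, 't, 'h) spectra \<Rightarrow> ('v, 's, 't) machine \<Rightarrow>
    ('g, 'z) monoid_scheme \<Rightarrow> int \<Rightarrow> ('g gset, 's, 't) sfun \<Rightarrow> ('g, 'h) mackey" where
  "homotopy_mackey S K G n Y =
    \<lparr>MOb = (\<lambda>A. hGrp S n (SFob Y A)),
     MMap = (\<lambda>A B c. ho_act S n (SFob Y B) (SFob Y A)
        (hMap S 0 (SFhom Y B A) (burnside_to_\<pi>\<^sub>0 S K G A B c)))\<rparr>"

end

theory Submission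
  imports Defs
begin

text \<open>
  The permutative categories \<open>disc A\<close> and \<open>Perm_hom (disc A) (disc B)\<close> have only identity arrows, so
  a multilinear functor into one of them is determined by its values on objects, which may be any
  multiadditive function constant on components. All identities between composites of such functors
  therefore reduce to identities between functions, and the coherence theory of the
  \<open>PC\<close>-category of all permutative categories is not needed.

  For a Mackey functor \<open>M\<close> the composite of \<open>ev\<close> with the \<open>PC\<close>-functor \<open>M\<close> is the bilinear functor
  \<open>GE(A,B) \<times> M(B) \<rightarrow> M(A)\<close> given by the action of spans. The maps on morphism spectra of \<open>K_G M\<close>
  are the adjoints of \<open>\<bbbK>\<close> of these actions, so functoriality and naturality of \<open>K_G M\<close> are the uncurried forms
  of the axioms of a Mackey functor. On \<open>\<pi>\<^sub>0\<close> the classes of objects identify \<open>M(A)\<close> with \<open>\<pi>\<^sub>0 \<bbbK> M(A)\<close>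
  and turn the action of spans into the one of the Burnside category; a general
  element of a Burnside group is a difference of spans.
\<close>

section \<open>Closed symmetric monoidal categories\<close>

text \<open>Beyond closure properties and the equivalence relation, nothing is computed with spans.
  The assumption that \<open>GE G pb\<close> is a \<open>pc_category\<close> contains the rest: its
  structure arrows are isomorphisms of spans, so their types yield distributivity over sums and
  invariance under isomorphism, and strictness at zero settles empty spans.

  Equations about \<open>Spec\<close> and \<open>K_G\<close> take place in function spectra and are
  checked after evaluation. Opposites and units then require coherence facts that are not among the
  axioms: \<open>lun_tensor\<close>, \<open>lun_symm\<close> and \<open>symm_reverse\<close>.

  The identification of the zeroth homotopy with M has to be compatible with all spans.
  \<open>K_disc\<close> gives only some isomorphism, so \<open>K_class\<close> itself is shown to be
  one, and the Mackey laws of the homotopy side are transported along it. A difference of spans X -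
  X' is treated by adding X' and cancelling in the target group.

  The encoding \<open>enc\<close> is an arbitrary choice that is injective only if some injection
  exists, so cardinality bounds come before its use.\<close>

context closed_symmetric_monoidal
begin

abbreviation compose (infixr "\<odot>" 70) where "g \<odot> f \<equiv> sCmp S g f"
abbreviation tensor (infixr "\<boxtimes>" 75) where "X \<boxtimes> Y \<equiv> sTen S X Y"
abbreviation tensor_arrow (infixr "\<boxdot>" 75) where "f \<boxdot> g \<equiv> sTenA S f g"
abbreviation "I \<equiv> sUnit S"
abbreviation "idt \<equiv> sIdn S"
abbreviation "assc \<equiv> sAssoc S"
abbreviation "assci X Y Z \<equiv> sInv S (sAssoc S X Y Z)"
abbreviation "lun \<equiv> sLun S"
abbreviation "luni X \<equiv> sInv S (sLun S X)"
abbreviation "run \<equiv> sRun S"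
abbreviation "runi X \<equiv> sInv S (sRun S X)"
abbreviation "symm \<equiv> sSym S"

text \<open>\<open>sInv\<close> is a definite description, so nothing is known about it before
  uniqueness. A right inverse \<open>h\<close> of \<open>f\<close> equals the given inverse
  \<open>g\<close>, since \<open>g \<odot> (f \<odot> h)\<close> and
  \<open>(g \<odot> f) \<odot> h\<close> agree.\<close>

lemma sIso_sInv:
  assumes "sIso S X Y f"
  shows "sInv S f \<in> sHom S Y X" "sCmp S (sInv S f) f = sIdn S X" "sCmp S f (sInv S f) = sIdn S Y"
proof -
  obtain g where f: "f \<in> sHom S X Y" and g: "g \<in> sHom S Y X" "g \<odot> f = idt X" "f \<odot> g = idt Y"
    using assms by (auto simp: sIso_def)
  have "h = g" if "h \<in> sHom S Y X" "f \<odot> h = idt Y" for h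
    using cmp_assoc[OF that(1) f g(1)] that cmp_idn[OF that(1)] cmp_idn[OF g(1)] g(2) by metis
  moreover have ends: "sSrc S f = X" "sTgt S f = Y" using f by (auto simp: sHom_def)
  ultimately have "\<exists>!g. g \<in> sHom S (sTgt S f) (sSrc S f) \<and> g \<odot> f = idt (sSrc S f) \<and> f \<odot> g = idt (sTgt S f)"
    using g by metis
  from theI'[OF this, folded sInv_def]
  show "sInv S f \<in> sHom S Y X" "sCmp S (sInv S f) f = sIdn S X" "sCmp S f (sInv S f) = sIdn S Y"
    unfolding ends by blast+
qed

lemma sHomD: "f \<in> sHom S X Y \<Longrightarrow> f \<in> sAr S \<and> sSrc S f = X \<and> sTgt S f = Y \<and> X \<in> sOb S \<and> Y \<in> sOb S"
  using arr by (auto simp: sHom_def)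

lemma sHomI: "\<lbrakk>f \<in> sAr S; sSrc S f = X; sTgt S f = Y\<rbrakk> \<Longrightarrow> f \<in> sHom S X Y"
  by (simp add: sHom_def)

lemma arr_ob [simp]: "f \<in> sAr S \<Longrightarrow> sSrc S f \<in> sOb S" "f \<in> sAr S \<Longrightarrow> sTgt S f \<in> sOb S"
  using arr by auto

text \<open>The locale axiom \<open>cmp\<close> has a middle object that is absent from its
  conclusion, and rewriting cannot guess it. Typing is therefore restated by equations for
  \<open>sSrc\<close> and \<open>sTgt\<close>, which simp evaluates from the inside.\<close>

lemma cmp_arr [simp]:
  assumes "f \<in> sAr S" "g \<in> sAr S" "sTgt S f = sSrc S g"
  shows "g \<odot> f \<in> sAr S" "sSrc S (g \<odot> f) = sSrc S f" "sTgt S (g \<odot> f) = sTgt S g"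
  using cmp[of f "sSrc S f" "sTgt S f" g "sTgt S g"] assms by (auto simp: sHom_def)

lemma tenA_arr [simp]:
  assumes "f \<in> sAr S" "g \<in> sAr S"
  shows "f \<boxdot> g \<in> sAr S" "sSrc S (f \<boxdot> g) = sSrc S f \<boxtimes> sSrc S g" "sTgt S (f \<boxdot> g) = sTgt S f \<boxtimes> sTgt S g"
  using tenA[of f "sSrc S f" "sTgt S f" g "sSrc S g" "sTgt S g"] assms by (auto simp: sHom_def)

lemma idt_arr [simp]:
  assumes "X \<in> sOb S"
  shows "idt X \<in> sAr S" "sSrc S (idt X) = X" "sTgt S (idt X) = X"
  using idn[OF assms] by (auto simp: sHom_def)

lemma obs [simp]: "X \<in> sOb S \<Longrightarrow> Y \<in> sOb S \<Longrightarrow> X \<boxtimes> Y \<in> sOb S" "I \<in> sOb S"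
    "X \<in> sOb S \<Longrightarrow> Y \<in> sOb S \<Longrightarrow> sFun S X Y \<in> sOb S"
  using ten unit "fun" by auto

lemma assc_arr [simp]:
  assumes "X \<in> sOb S" "Y \<in> sOb S" "Z \<in> sOb S"
  shows "assc X Y Z \<in> sAr S" "sSrc S (assc X Y Z) = (X \<boxtimes> Y) \<boxtimes> Z" "sTgt S (assc X Y Z) = X \<boxtimes> (Y \<boxtimes> Z)"
    "assci X Y Z \<in> sAr S" "sTgt S (assci X Y Z) = (X \<boxtimes> Y) \<boxtimes> Z" "sSrc S (assci X Y Z) = X \<boxtimes> (Y \<boxtimes> Z)"
    "assc X Y Z \<odot> assci X Y Z = idt (X \<boxtimes> (Y \<boxtimes> Z))" "assci X Y Z \<odot> assc X Y Z = idt ((X \<boxtimes> Y) \<boxtimes> Z)"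
  using assoc_iso[OF assms] sIso_sInv[OF assoc_iso[OF assms]] by (auto simp: sHom_def sIso_def)

lemma lun_arr [simp]:
  assumes "X \<in> sOb S"
  shows "lun X \<in> sAr S" "sSrc S (lun X) = I \<boxtimes> X" "sTgt S (lun X) = X"
    "luni X \<in> sAr S" "sTgt S (luni X) = I \<boxtimes> X" "sSrc S (luni X) = X"
    "lun X \<odot> luni X = idt X" "luni X \<odot> lun X = idt (I \<boxtimes> X)"
  using lun_iso[OF assms] sIso_sInv[OF lun_iso[OF assms]] by (auto simp: sHom_def sIso_def)

lemma run_arr [simp]:
  assumes "X \<in> sOb S"
  shows "run X \<in> sAr S" "sSrc S (run X) = X \<boxtimes> I" "sTgt S (run X) = X"
    "runi X \<in> sAr S" "sTgt S (runi X) = X \<boxtimes> I" "sSrc S (runi X) = X"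
    "run X \<odot> runi X = idt X" "runi X \<odot> run X = idt (X \<boxtimes> I)"
  using run_iso[OF assms] sIso_sInv[OF run_iso[OF assms]] by (auto simp: sHom_def sIso_def)

lemma symm_arr [simp]:
  assumes "X \<in> sOb S" "Y \<in> sOb S"
  shows "symm X Y \<in> sAr S" "sSrc S (symm X Y) = X \<boxtimes> Y" "sTgt S (symm X Y) = Y \<boxtimes> X"
    "symm Y X \<odot> symm X Y = idt (X \<boxtimes> Y)"
  using sym[OF assms] sym_sym[OF assms] by (auto simp: sHom_def)

lemma ev_arr [simp]:
  assumes "X \<in> sOb S" "Y \<in> sOb S"
  shows "sEv S X Y \<in> sAr S" "sSrc S (sEv S X Y) = sFun S X Y \<boxtimes> X" "sTgt S (sEv S X Y) = Y"
  using ev[OF assms] by (auto simp: sHom_def)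

lemma comp_assoc [simp]:
  "\<lbrakk>f \<in> sAr S; g \<in> sAr S; h \<in> sAr S; sTgt S f = sSrc S g; sTgt S g = sSrc S h\<rbrakk> \<Longrightarrow>
    (h \<odot> g) \<odot> f = h \<odot> (g \<odot> f)"
  by (rule cmp_assoc[symmetric]) (auto simp: sHom_def)

lemma comp_idt [simp]:
  "f \<in> sAr S \<Longrightarrow> sSrc S f = X \<Longrightarrow> f \<odot> idt X = f" "f \<in> sAr S \<Longrightarrow> sTgt S f = X \<Longrightarrow> idt X \<odot> f = f"
  using cmp_idn[of f "sSrc S f" "sTgt S f"] by (auto simp: sHom_def)

lemma ten_idt [simp]: "X \<in> sOb S \<Longrightarrow> Y \<in> sOb S \<Longrightarrow> idt X \<boxdot> idt Y = idt (X \<boxtimes> Y)"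
  by (rule tenA_idn)

lemma ten_cmp:
  "\<lbrakk>f \<in> sAr S; g \<in> sAr S; sTgt S f = sSrc S g; f' \<in> sAr S; g' \<in> sAr S; sTgt S f' = sSrc S g'\<rbrakk> \<Longrightarrow>
    (g \<boxdot> g') \<odot> (f \<boxdot> f') = (g \<odot> f) \<boxdot> (g' \<odot> f')"
  by (rule tenA_cmp[symmetric]) (auto simp: sHom_def)

text \<open>The simp normal form nests composites to the right, where \<open>h \<odot> g\<close> no
  longer occurs as a subterm. This form applies an equation for it in front of a further arrow
  \<open>f\<close>.\<close>

lemma comp_cancel:
  assumes "h \<odot> g = k" "f \<in> sAr S" "g \<in> sAr S" "h \<in> sAr S" "sTgt S f = sSrc S g" "sTgt S g = sSrc S h"
  shows "h \<odot> (g \<odot> f) = k \<odot> f"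
  using assms comp_assoc by metis

text \<open>Interchange as a rule that merges adjacent tensor products, also inside a right-nested
  composite. It is switched off in steps where a product must stay split, as when only the factor
  \<open>t \<boxdot> idt Y\<close> has a known composite with \<open>sEv\<close>.\<close>

lemma ten_cmp' [simp]:
  "\<lbrakk>f \<in> sAr S; g \<in> sAr S; sTgt S f = sSrc S g; f' \<in> sAr S; g' \<in> sAr S; sTgt S f' = sSrc S g'\<rbrakk> \<Longrightarrow>
    (g \<boxdot> g') \<odot> (f \<boxdot> f') = (g \<odot> f) \<boxdot> (g' \<odot> f')"
  "\<lbrakk>f \<in> sAr S; g \<in> sAr S; sTgt S f = sSrc S g; f' \<in> sAr S; g' \<in> sAr S; sTgt S f' = sSrc S g';
     h \<in> sAr S; sTgt S h = sSrc S f \<boxtimes> sSrc S f'\<rbrakk> \<Longrightarrow>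
    (g \<boxdot> g') \<odot> ((f \<boxdot> f') \<odot> h) = ((g \<odot> f) \<boxdot> (g' \<odot> f')) \<odot> h"
  by (rule ten_cmp; assumption) (subst comp_cancel[OF ten_cmp]; simp)

lemma iso_cancel [simp]:
  assumes "f \<in> sAr S"
  shows
    "X \<in> sOb S \<Longrightarrow> Y \<in> sOb S \<Longrightarrow> Z \<in> sOb S \<Longrightarrow> sTgt S f = X \<boxtimes> (Y \<boxtimes> Z) \<Longrightarrow> assc X Y Z \<odot> (assci X Y Z \<odot> f) = f"
    "X \<in> sOb S \<Longrightarrow> Y \<in> sOb S \<Longrightarrow> Z \<in> sOb S \<Longrightarrow> sTgt S f = (X \<boxtimes> Y) \<boxtimes> Z \<Longrightarrow> assci X Y Z \<odot> (assc X Y Z \<odot> f) = f"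
    "X \<in> sOb S \<Longrightarrow> sTgt S f = X \<Longrightarrow> lun X \<odot> (luni X \<odot> f) = f"
    "X \<in> sOb S \<Longrightarrow> sTgt S f = I \<boxtimes> X \<Longrightarrow> luni X \<odot> (lun X \<odot> f) = f"
    "X \<in> sOb S \<Longrightarrow> sTgt S f = X \<Longrightarrow> run X \<odot> (runi X \<odot> f) = f"
    "X \<in> sOb S \<Longrightarrow> sTgt S f = X \<boxtimes> I \<Longrightarrow> runi X \<odot> (run X \<odot> f) = f"
    "X \<in> sOb S \<Longrightarrow> Y \<in> sOb S \<Longrightarrow> sTgt S f = X \<boxtimes> Y \<Longrightarrow> symm Y X \<odot> (symm X Y \<odot> f) = f"
  using assms by (simp_all flip: comp_assoc)

section \<open>Naturality and coherence of the associativity and unit constraints\<close>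

lemma assc_nat:
  "\<lbrakk>f \<in> sHom S X X'; g \<in> sHom S Y Y'; h \<in> sHom S Z Z'\<rbrakk> \<Longrightarrow>
     assc X' Y' Z' \<odot> ((f \<boxdot> g) \<boxdot> h) = (f \<boxdot> (g \<boxdot> h)) \<odot> assc X Y Z"
  by (rule assoc_nat)

lemma assc_nat':
  "\<lbrakk>f \<in> sHom S X X'; g \<in> sHom S Y Y'; h \<in> sHom S Z Z'; k \<in> sAr S; sTgt S k = (X \<boxtimes> Y) \<boxtimes> Z\<rbrakk> \<Longrightarrow>
     assc X' Y' Z' \<odot> (((f \<boxdot> g) \<boxdot> h) \<odot> k) = (f \<boxdot> (g \<boxdot> h)) \<odot> (assc X Y Z \<odot> k)"
  using comp_cancel[OF assoc_nat, of f X X' g Y Y' h Z Z' k] by (simp add: sHom_def) (auto simp: sHom_def)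

lemma epi_cancel:
  assumes "f \<odot> e = g \<odot> e" "e \<odot> e' = idt Y" "f \<in> sAr S" "g \<in> sAr S" "e \<in> sAr S" "e' \<in> sAr S"
    "sSrc S f = Y" "sSrc S g = Y" "sTgt S e = Y" "sTgt S e' = sSrc S e"
  shows "f = g"
  using assms comp_assoc[of e' e f] comp_assoc[of e' e g] comp_idt by metis

lemma mono_cancel:
  assumes "e \<odot> f = e \<odot> g" "e' \<odot> e = idt Y" "f \<in> sAr S" "g \<in> sAr S" "e \<in> sAr S" "e' \<in> sAr S"
    "sTgt S f = Y" "sTgt S g = Y" "sSrc S e = Y" "sSrc S e' = sTgt S e"
  shows "f = g"
  using assms comp_assoc[of f e e'] comp_assoc[of g e e'] comp_idt by metis

text \<open>Naturality of the unit constraint gives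
  \<open>f \<odot> lun X = lun Y \<odot> (idt I \<boxdot> f)\<close>, and \<open>lun X\<close> is
  invertible; likewise on the right. Coherence equations may thus be proved after tensoring with
  \<open>I\<close>, where the pentagon or the hexagon applies.\<close>

lemma tensor_unit_faithful:
  assumes "f \<in> sHom S X Y" "g \<in> sHom S X Y"
  shows "idt I \<boxdot> f = idt I \<boxdot> g \<Longrightarrow> f = g" "f \<boxdot> idt I = g \<boxdot> idt I \<Longrightarrow> f = g"
proof -
  note [simp] = sHomD[OF assms(1)] sHomD[OF assms(2)]
  show "f = g" if "idt I \<boxdot> f = idt I \<boxdot> g"
    by (rule epi_cancel[where e = "lun X" and e' = "luni X" and Y = X])
      (use that lun_nat[OF assms(1)] lun_nat[OF assms(2)] in auto)
  show "f = g" if "f \<boxdot> idt I = g \<boxdot> idt I"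
    by (rule epi_cancel[where e = "run X" and e' = "runi X" and Y = X])
      (use that run_nat[OF assms(1)] run_nat[OF assms(2)] in auto)
qed

text \<open>Kelly's argument that this identity follows from pentagon and triangle: tensor with
  \<open>I\<close> on the left and compare the two sides of the pentagon for \<open>I\<close>,
  \<open>I\<close>, \<open>X\<close>, \<open>Y\<close>.\<close>

lemma lun_tensor:
  assumes [simp]: "X \<in> sOb S" "Y \<in> sOb S"
  shows "lun (X \<boxtimes> Y) \<odot> assc I X Y = lun X \<boxdot> idt Y"
proof (rule tensor_unit_faithful(1))
  \<comment> \<open>The rebracketing of
    \<open>((I \<boxtimes> I) \<boxtimes> X) \<boxtimes> Y\<close> by the first two factors of the
    longer side of the pentagon; \<open>?e'\<close> is its inverse.\<close>
  let ?e = "assc I (I \<boxtimes> X) Y \<odot> (assc I I X \<boxdot> idt Y)"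
  let ?e' = "(assci I I X \<boxdot> idt Y) \<odot> assci I (I \<boxtimes> X) Y"
  have "(idt I \<boxdot> (lun (X \<boxtimes> Y) \<odot> assc I X Y)) \<odot> ?e
      = (idt I \<boxdot> lun (X \<boxtimes> Y)) \<odot> ((idt I \<boxdot> assc I X Y) \<odot> ?e)"
    by simp
  also have "\<dots> = (idt I \<boxdot> lun (X \<boxtimes> Y)) \<odot> (assc I I (X \<boxtimes> Y) \<odot> assc (I \<boxtimes> I) X Y)"
    by (simp add: pentagon)
  also have "\<dots> = (run I \<boxdot> idt (X \<boxtimes> Y)) \<odot> assc (I \<boxtimes> I) X Y"
    by (subst comp_assoc[symmetric]) (simp_all add: triangle)
  also have "\<dots> = assc I X Y \<odot> ((run I \<boxdot> idt X) \<boxdot> idt Y)"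
    by (subst assc_nat[of _ "I \<boxtimes> I" _ _ X _ _ Y]) (simp_all add: sHom_def)
  also have "\<dots> = assc I X Y \<odot> (((idt I \<boxdot> lun X) \<boxdot> idt Y) \<odot> (assc I I X \<boxdot> idt Y))"
    by (simp add: triangle)
  also have "\<dots> = (idt I \<boxdot> (lun X \<boxdot> idt Y)) \<odot> ?e"
    by (subst assc_nat'[of _ "I" _ _ "I \<boxtimes> X" _ _ Y]) (simp_all add: sHom_def)
  finally show "idt I \<boxdot> (lun (X \<boxtimes> Y) \<odot> assc I X Y) = idt I \<boxdot> (lun X \<boxdot> idt Y)"
    by (rule epi_cancel[where e' = ?e']) (simp_all)
qed (simp_all add: sHom_def)

text \<open>The hexagon for \<open>X\<close>, \<open>I\<close>, \<open>I\<close>, together with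
  \<open>lun_tensor\<close> and the triangle, gives the identity after tensoring with
  \<open>I\<close> and composing with the invertible \<open>symm X I\<close>.\<close>

lemma lun_symm:
  assumes [simp]: "X \<in> sOb S"
  shows "lun X \<odot> symm X I = run X"
proof (rule tensor_unit_faithful(2))
  \<comment> \<open>The third object of the hexagon is the unit too. The separate name tells the
    copy added by tensoring from the one that is exchanged with \<open>X\<close>.\<close>
  let ?Z = I
  have "symm X ?Z \<odot> ((lun X \<odot> symm X I) \<boxdot> idt ?Z)
      = symm X ?Z \<odot> (lun (X \<boxtimes> ?Z) \<odot> (assc I X ?Z \<odot> (symm X I \<boxdot> idt ?Z)))"
    by (subst comp_cancel[OF lun_tensor]) simp_all
  also have "\<dots> = lun (?Z \<boxtimes> X) \<odot> ((idt I \<boxdot> symm X ?Z) \<odot> (assc I X ?Z \<odot> (symm X I \<boxdot> idt ?Z)))"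
    by (subst comp_cancel[OF lun_nat[of "symm X ?Z" "X \<boxtimes> ?Z" "?Z \<boxtimes> X"]]) (simp_all add: sHom_def)
  also have "\<dots> = lun (?Z \<boxtimes> X) \<odot> (assc I ?Z X \<odot> (symm X (I \<boxtimes> ?Z) \<odot> assc X I ?Z))"
    by (simp add: hexagon)
  also have "\<dots> = (lun ?Z \<boxdot> idt X) \<odot> (symm X (I \<boxtimes> ?Z) \<odot> assc X I ?Z)"
    by (subst comp_cancel[OF lun_tensor]) simp_all
  also have "\<dots> = symm X ?Z \<odot> ((idt X \<boxdot> lun ?Z) \<odot> assc X I ?Z)"
    by (subst comp_assoc[symmetric]) (simp_all add: sym_nat[symmetric, of _ X X _ "I \<boxtimes> I"] sHom_def)
  also have "\<dots> = symm X ?Z \<odot> (run X \<boxdot> idt ?Z)"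
    by (simp add: triangle)
  finally show "(lun X \<odot> symm X I) \<boxdot> idt ?Z = run X \<boxdot> idt ?Z"
    by (rule mono_cancel[where e' = "symm ?Z X"]) simp_all
qed (simp_all add: sHom_def)

lemma run_symm: "X \<in> sOb S \<Longrightarrow> run X \<odot> symm I X = lun X"
  by (simp flip: lun_symm)

section \<open>Currying and the enrichment of spectra in themselves\<close>

lemma sCurry:
  assumes "h \<in> sHom S (X \<boxtimes> Y) Z" "X \<in> sOb S" "Y \<in> sOb S"
  shows "sCurry S X Y Z h \<in> sHom S X (sFun S Y Z)" "sEv S Y Z \<odot> (sCurry S X Y Z h \<boxdot> idt Y) = h"
  using theI'[OF closed[OF assms(2,3) _ assms(1)], folded sCurry_def] sHomD[OF assms(1)] by auto

text \<open>The uniqueness half of the adjunction. Equations between maps into function spectra are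
  reduced by it to equations between evaluated maps.\<close>

lemma curry_eqI:
  assumes "k \<in> sHom S X (sFun S Y Z)" "k' \<in> sHom S X (sFun S Y Z)" "Y \<in> sOb S" "Z \<in> sOb S"
    "sEv S Y Z \<odot> (k \<boxdot> idt Y) = sEv S Y Z \<odot> (k' \<boxdot> idt Y)"
  shows "k = k'"
proof -
  have "sEv S Y Z \<odot> (k \<boxdot> idt Y) \<in> sHom S (X \<boxtimes> Y) Z"
    using assms(3,4) sHomD[OF assms(1)] by (simp add: sHom_def)
  from closed[OF _ assms(3,4) this] show ?thesis
    using assms(1,2,5) sHomD[OF assms(1)] by metis
qed

lemma sCurry_cmp:
  assumes "h \<in> sHom S (X \<boxtimes> Y) Z" "X \<in> sOb S" "Y \<in> sOb S" "g \<in> sHom S W X"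
  shows "sEv S Y Z \<odot> ((sCurry S X Y Z h \<odot> g) \<boxdot> idt Y) = h \<odot> (g \<boxdot> idt Y)"
proof -
  note [simp] = sHomD[OF assms(4)] sHomD[OF assms(1)] assms(2,3) sHomD[OF sCurry(1)[OF assms(1-3)]]
  show ?thesis
    using comp_cancel[OF sCurry(2)[OF assms(1-3)], of "g \<boxdot> idt Y"] by simp
qed

text \<open>Composition in \<open>Spec S\<close> is defined by currying, so evaluating it means
  evaluating twice. The maps \<open>f\<close> and \<open>g\<close> are included so that the rule
  applies to composition after maps into the two function spectra; for identities it is the defining
  equation.\<close>

lemma Spec_comp:
  assumes "f \<in> sHom S X (sFun S B C)" "g \<in> sHom S Y (sFun S A B)" "A \<in> sOb S" "B \<in> sOb S" "C \<in> sOb S"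
  shows "sEv S A C \<odot> ((SComp (Spec S) A B C \<odot> (f \<boxdot> g)) \<boxdot> idt A)
    = sEv S B C \<odot> ((f \<boxdot> (sEv S A B \<odot> (g \<boxdot> idt A))) \<odot> assc X Y A)"
proof -
  note [simp] = sHomD[OF assms(1)] sHomD[OF assms(2)] assms(3-5)
  have "sEv S A C \<odot> ((SComp (Spec S) A B C \<odot> (f \<boxdot> g)) \<boxdot> idt A)
    = (sEv S B C \<odot> ((idt (sFun S B C) \<boxdot> sEv S A B) \<odot> assc (sFun S B C) (sFun S A B) A)) \<odot> ((f \<boxdot> g) \<boxdot> idt A)"
    unfolding Spec_def scat.simps by (rule sCurry_cmp) (simp_all add: sHom_def)
  also have "\<dots> = sEv S B C \<odot> ((idt (sFun S B C) \<boxdot> sEv S A B) \<odot> (assc (sFun S B C) (sFun S A B) A \<odot> ((f \<boxdot> g) \<boxdot> idt A)))"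
    by simp
  also have "assc (sFun S B C) (sFun S A B) A \<odot> ((f \<boxdot> g) \<boxdot> idt A) = (f \<boxdot> (g \<boxdot> idt A)) \<odot> assc X Y A"
    by (rule assc_nat) (simp_all add: sHom_def)
  finally show ?thesis by simp
qed

lemma Spec_comp_typed:
  assumes "A \<in> sOb S" "B \<in> sOb S" "C \<in> sOb S"
  shows "SComp (Spec S) A B C \<in> sHom S (sFun S B C \<boxtimes> sFun S A B) (sFun S A C)"
  unfolding Spec_def scat.simps by (rule sCurry) (simp_all add: assms sHom_def)

lemma Spec_unit:
  assumes "A \<in> sOb S"
  shows "SUnit (Spec S) A \<in> sHom S I (sFun S A A)" "sEv S A A \<odot> (SUnit (Spec S) A \<boxdot> idt A) = lun A"
  unfolding Spec_def scat.simps by (rule sCurry; simp add: assms sHom_def)+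

text \<open>After evaluation the right unit law is the triangle, the left unit law is
  \<open>lun_tensor\<close>, and associativity is the pentagon for the three function spectra and
  \<open>a\<close>.\<close>

lemma Spec_category: "spectral_category S (Spec S)"
proof
  fix a b c d assume "a \<in> SObj (Spec S)" "b \<in> SObj (Spec S)"
  then have [simp]: "a \<in> sOb S" "b \<in> sOb S" by (auto simp: Spec_def)
  have [simp]: "SHom (Spec S) = sFun S" by (simp add: Spec_def)
  note m [simp] = sHomD[OF Spec_comp_typed]
  note u [simp] = sHomD[OF Spec_unit(1)]
  show "SHom (Spec S) a b \<in> sOb S" by simp
  show "SUnit (Spec S) a \<in> sHom S (sUnit S) (SHom (Spec S) a a)" by (simp add: sHom_def)
  show "SComp (Spec S) a a b \<odot> (idt (SHom (Spec S) a b) \<boxdot> SUnit (Spec S) a) = run (SHom (Spec S) a b)"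
    by (rule curry_eqI[where Y = a and Z = b])
       (simp_all add: sHom_def Spec_comp Spec_unit triangle)
  show "SComp (Spec S) a b b \<odot> (SUnit (Spec S) b \<boxdot> idt (SHom (Spec S) a b)) = lun (SHom (Spec S) a b)"
  proof (rule curry_eqI[where Y = a and Z = b])
    have "sEv S a b \<odot> ((SComp (Spec S) a b b \<odot> (SUnit (Spec S) b \<boxdot> idt (SHom (Spec S) a b))) \<boxdot> idt a)
      = sEv S b b \<odot> ((SUnit (Spec S) b \<boxdot> (sEv S a b)) \<odot> assc I (sFun S a b) a)"
      by (subst Spec_comp) (simp_all add: sHom_def)
    \<comment> \<open>The evaluation is split off so that the unit meets \<open>sEv S b b\<close>
      alone and \<open>Spec_unit\<close> applies.\<close>
    also have "SUnit (Spec S) b \<boxdot> sEv S a b = (SUnit (Spec S) b \<boxdot> idt b) \<odot> (idt I \<boxdot> sEv S a b)" by simp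
    also have "sEv S b b \<odot> (((SUnit (Spec S) b \<boxdot> idt b) \<odot> (idt I \<boxdot> sEv S a b)) \<odot> assc I (sFun S a b) a)
       = sEv S b b \<odot> ((SUnit (Spec S) b \<boxdot> idt b) \<odot> ((idt I \<boxdot> sEv S a b) \<odot> assc I (sFun S a b) a))"
      by (simp del: ten_cmp')
    also have "\<dots> = lun b \<odot> ((idt I \<boxdot> sEv S a b) \<odot> assc I (sFun S a b) a)"
      by (subst comp_cancel[OF Spec_unit(2)]) simp_all
    also have "\<dots> = sEv S a b \<odot> (lun (sFun S a b \<boxtimes> a) \<odot> assc I (sFun S a b) a)"
      by (subst comp_cancel[OF lun_nat[of "sEv S a b" "sFun S a b \<boxtimes> a" b]]) (simp_all add: sHom_def)
    finally show "sEv S a b \<odot> ((SComp (Spec S) a b b \<odot> (SUnit (Spec S) b \<boxdot> idt (SHom (Spec S) a b))) \<boxdot> idt a)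
      = sEv S a b \<odot> (lun (SHom (Spec S) a b) \<boxdot> idt a)"
      by (simp add: lun_tensor)
  qed (simp_all add: sHom_def)
  assume "c \<in> SObj (Spec S)"
  then have [simp]: "c \<in> sOb S" by (auto simp: Spec_def)
  show "SComp (Spec S) a b c \<in> sHom S (SHom (Spec S) b c \<boxtimes> SHom (Spec S) a b) (SHom (Spec S) a c)"
    by (simp add: Spec_comp_typed)
  assume "d \<in> SObj (Spec S)"
  then have [simp]: "d \<in> sOb S" by (auto simp: Spec_def)
  show "SComp (Spec S) a b d \<odot> (SComp (Spec S) b c d \<boxdot> idt (SHom (Spec S) a b)) =
      SComp (Spec S) a c d \<odot> ((idt (SHom (Spec S) c d) \<boxdot> SComp (Spec S) a b c) \<odot>
        assc (SHom (Spec S) c d) (SHom (Spec S) b c) (SHom (Spec S) a b))"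
  proof (rule curry_eqI[where Y = a and Z = d])
    let ?F = "sFun S c d" and ?G = "sFun S b c" and ?H = "sFun S a b"
    have "sEv S a d \<odot> ((SComp (Spec S) a b d \<odot> (SComp (Spec S) b c d \<boxdot> idt ?H)) \<boxdot> idt a)
      = sEv S b d \<odot> ((SComp (Spec S) b c d \<boxdot> sEv S a b) \<odot> assc (?F \<boxtimes> ?G) ?H a)"
      by (subst Spec_comp) (simp_all add: sHom_def)
    also have "SComp (Spec S) b c d \<boxdot> sEv S a b = (SComp (Spec S) b c d \<boxdot> idt b) \<odot> (idt (?F \<boxtimes> ?G) \<boxdot> sEv S a b)"
      by simp
    also have "sEv S b d \<odot> (((SComp (Spec S) b c d \<boxdot> idt b) \<odot> (idt (?F \<boxtimes> ?G) \<boxdot> sEv S a b)) \<odot> assc (?F \<boxtimes> ?G) ?H a)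
      = (sEv S b d \<odot> (SComp (Spec S) b c d \<boxdot> idt b)) \<odot> ((idt (?F \<boxtimes> ?G) \<boxdot> sEv S a b) \<odot> assc (?F \<boxtimes> ?G) ?H a)"
      by (simp del: ten_cmp')
    also have "sEv S b d \<odot> (SComp (Spec S) b c d \<boxdot> idt b) = sEv S c d \<odot> ((idt ?F \<boxdot> sEv S b c) \<odot> assc ?F ?G b)"
      using Spec_comp[of "idt ?F" ?F c d "idt ?G" ?G b] by (simp add: sHom_def)
    also have "(sEv S c d \<odot> ((idt ?F \<boxdot> sEv S b c) \<odot> assc ?F ?G b)) \<odot> ((idt (?F \<boxtimes> ?G) \<boxdot> sEv S a b) \<odot> assc (?F \<boxtimes> ?G) ?H a)
      = sEv S c d \<odot> ((idt ?F \<boxdot> sEv S b c) \<odot> (assc ?F ?G b \<odot> (((idt ?F \<boxdot> idt ?G) \<boxdot> sEv S a b) \<odot> assc (?F \<boxtimes> ?G) ?H a)))"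
      by simp
    also have "\<dots> = sEv S c d \<odot> ((idt ?F \<boxdot> sEv S b c) \<odot> ((idt ?F \<boxdot> (idt ?G \<boxdot> sEv S a b)) \<odot> (assc ?F ?G (?H \<boxtimes> a) \<odot> assc (?F \<boxtimes> ?G) ?H a)))"
      by (subst assc_nat'[of _ ?F _ _ ?G _ _ "?H \<boxtimes> a"]) (simp_all add: sHom_def del: ten_idt)
    also have "\<dots> = sEv S c d \<odot> ((idt ?F \<boxdot> sEv S b c) \<odot> ((idt ?F \<boxdot> (idt ?G \<boxdot> sEv S a b)) \<odot>
        ((idt ?F \<boxdot> assc ?G ?H a) \<odot> (assc ?F (?G \<boxtimes> ?H) a \<odot> (assc ?F ?G ?H \<boxdot> idt a)))))"
      by (subst pentagon) simp_all
    also have "\<dots> = sEv S c d \<odot> ((idt ?F \<boxdot> (sEv S b c \<odot> ((idt ?G \<boxdot> sEv S a b) \<odot> assc ?G ?H a))) \<odot>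
        (assc ?F (?G \<boxtimes> ?H) a \<odot> (assc ?F ?G ?H \<boxdot> idt a)))"
      by simp
    also have "sEv S b c \<odot> ((idt ?G \<boxdot> sEv S a b) \<odot> assc ?G ?H a) = sEv S a c \<odot> (SComp (Spec S) a b c \<boxdot> idt a)"
      using Spec_comp[of "idt ?G" ?G b c "idt ?H" ?H a] by (simp add: sHom_def)
    also have "sEv S c d \<odot> ((idt ?F \<boxdot> (sEv S a c \<odot> (SComp (Spec S) a b c \<boxdot> idt a))) \<odot>
        (assc ?F (?G \<boxtimes> ?H) a \<odot> (assc ?F ?G ?H \<boxdot> idt a)))
      = (sEv S c d \<odot> ((idt ?F \<boxdot> (sEv S a c \<odot> (SComp (Spec S) a b c \<boxdot> idt a))) \<odot>
        assc ?F (?G \<boxtimes> ?H) a)) \<odot> (assc ?F ?G ?H \<boxdot> idt a)"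
      by simp
    also have "\<dots> = (sEv S a d \<odot> ((SComp (Spec S) a c d \<odot> (idt ?F \<boxdot> SComp (Spec S) a b c)) \<boxdot> idt a)) \<odot> (assc ?F ?G ?H \<boxdot> idt a)"
      by (subst Spec_comp[of _ ?F _ _ _ "?G \<boxtimes> ?H"]) (simp_all add: sHom_def)
    finally show "sEv S a d \<odot> ((SComp (Spec S) a b d \<odot> (SComp (Spec S) b c d \<boxdot> idt (SHom (Spec S) a b))) \<boxdot> idt a) =
      sEv S a d \<odot> ((SComp (Spec S) a c d \<odot> ((idt (SHom (Spec S) c d) \<boxdot> SComp (Spec S) a b c) \<odot>
        assc (SHom (Spec S) c d) (SHom (Spec S) b c) (SHom (Spec S) a b))) \<boxdot> idt a)"
      by simp
  qed (simp_all add: sHom_def)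
qed

section \<open>Opposite spectral categories\<close>

lemma symm_nat:
  "\<lbrakk>f \<in> sHom S X X'; g \<in> sHom S Y Y'\<rbrakk> \<Longrightarrow> symm X' Y' \<odot> (f \<boxdot> g) = (g \<boxdot> f) \<odot> symm X Y"
  by (rule sym_nat)

lemma symm_nat':
  "\<lbrakk>f \<in> sHom S X X'; g \<in> sHom S Y Y'; k \<in> sAr S; sTgt S k = X \<boxtimes> Y\<rbrakk> \<Longrightarrow>
    symm X' Y' \<odot> ((f \<boxdot> g) \<odot> k) = (g \<boxdot> f) \<odot> (symm X Y \<odot> k)"
  using comp_cancel[OF sym_nat, of f X X' g Y Y' k] by (simp add: sHom_def) (auto simp: sHom_def)

text \<open>Both sides reverse the order of three factors. In the opposite of a spectral category
  this is what matches the two bracketings of a triple composite.\<close>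

lemma symm_reverse:
  assumes [simp]: "X \<in> sOb S" "Y \<in> sOb S" "Z \<in> sOb S"
  shows "assc Z Y X \<odot> ((symm Y Z \<boxdot> idt X) \<odot> (symm X (Y \<boxtimes> Z) \<odot> assc X Y Z))
    = (idt Z \<boxdot> symm X Y) \<odot> symm (X \<boxtimes> Y) Z"
proof -
  have "assc Z Y X \<odot> ((symm Y Z \<boxdot> idt X) \<odot> (symm X (Y \<boxtimes> Z) \<odot> assc X Y Z))
    = assc Z Y X \<odot> (symm X (Z \<boxtimes> Y) \<odot> ((idt X \<boxdot> symm Y Z) \<odot> assc X Y Z))"
    by (subst symm_nat'[of _ X X _ "Y \<boxtimes> Z"]) (simp_all add: sHom_def)
  also have "\<dots> = (assc Z Y X \<odot> (symm X (Z \<boxtimes> Y) \<odot> assc X Z Y)) \<odot> (assci X Z Y \<odot> ((idt X \<boxdot> symm Y Z) \<odot> assc X Y Z))"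
    by simp
  also have "\<dots> = ((idt Z \<boxdot> symm X Y) \<odot> (assc Z X Y \<odot> (symm X Z \<boxdot> idt Y))) \<odot> (assci X Z Y \<odot> ((idt X \<boxdot> symm Y Z) \<odot> assc X Y Z))"
    by (simp add: hexagon)
  also have "\<dots> = (idt Z \<boxdot> symm X Y) \<odot> (assc Z X Y \<odot> ((symm X Z \<boxdot> idt Y) \<odot> (assci X Z Y \<odot> ((idt X \<boxdot> symm Y Z) \<odot> assc X Y Z))))"
    by simp
  \<comment> \<open>This is the second hexagon, which carries \<open>Z\<close> past
    \<open>X \<boxtimes> Y\<close>. It is the inverse form of the first hexagon for
    \<open>Z\<close>, \<open>X\<close>, \<open>Y\<close>, whose composite, up to an associator, is
    the arrow \<open>e\<close> cancelled below.\<close>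
  also have "assc Z X Y \<odot> ((symm X Z \<boxdot> idt Y) \<odot> (assci X Z Y \<odot> ((idt X \<boxdot> symm Y Z) \<odot> assc X Y Z))) = symm (X \<boxtimes> Y) Z"
    (is "?l = _")
  proof (rule epi_cancel[where e = "assci X Y Z \<odot> ((idt X \<boxdot> symm Z Y) \<odot> (assc X Z Y \<odot> (symm Z X \<boxdot> idt Y)))"
        and e' = "(symm X Z \<boxdot> idt Y) \<odot> (assci X Z Y \<odot> ((idt X \<boxdot> symm Y Z) \<odot> assc X Y Z))" and Y = "(X \<boxtimes> Y) \<boxtimes> Z"])
    have "?l \<odot> (assci X Y Z \<odot> ((idt X \<boxdot> symm Z Y) \<odot> (assc X Z Y \<odot> (symm Z X \<boxdot> idt Y)))) = assc Z X Y"
      by simp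
    also have "\<dots> = symm (X \<boxtimes> Y) Z \<odot> (assci X Y Z \<odot> (assc X Y Z \<odot> (symm Z (X \<boxtimes> Y) \<odot> assc Z X Y)))"
      by simp
    finally show "?l \<odot> (assci X Y Z \<odot> ((idt X \<boxdot> symm Z Y) \<odot> (assc X Z Y \<odot> (symm Z X \<boxdot> idt Y))))
      = symm (X \<boxtimes> Y) Z \<odot> (assci X Y Z \<odot> ((idt X \<boxdot> symm Z Y) \<odot> (assc X Z Y \<odot> (symm Z X \<boxdot> idt Y))))"
      by (simp only: hexagon assms)
    show "(assci X Y Z \<odot> ((idt X \<boxdot> symm Z Y) \<odot> (assc X Z Y \<odot> (symm Z X \<boxdot> idt Y)))) \<odot>
       ((symm X Z \<boxdot> idt Y) \<odot> (assci X Z Y \<odot> ((idt X \<boxdot> symm Y Z) \<odot> assc X Y Z))) = idt ((X \<boxtimes> Y) \<boxtimes> Z)"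
      by simp
  qed simp_all
  finally show ?thesis .
qed

text \<open>\<open>lun_symm\<close> and \<open>run_symm\<close> exchange the two unit laws of
  \<open>C\<close>; associativity combines \<open>symm_reverse\<close> with the associativity of
  \<open>C\<close>.\<close>

lemma scat_op_category:
  assumes "spectral_category S C"
  shows "spectral_category S (scat_op S C)"
proof -
  interpret C: spectral_category S C by fact
  note [simp] = C.hom sHomD[OF C.comp] sHomD[OF C.unit]
  show ?thesis
  proof (unfold_locales, unfold scat_op_def scat.simps)
    fix a b assume [simp]: "a \<in> SObj C" "b \<in> SObj C"
    show "SHom C b a \<in> sOb S" by simp
    show "SUnit C a \<in> sHom S (sUnit S) (SHom C a a)" by (simp add: C.unit)
    have "(SComp C b a a \<odot> symm (SHom C b a) (SHom C a a)) \<odot> (idt (SHom C b a) \<boxdot> SUnit C a) =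
       SComp C b a a \<odot> ((SUnit C a \<boxdot> idt (SHom C b a)) \<odot> symm (SHom C b a) I)"
      by (subst symm_nat[of _ "SHom C b a" _ _ I, symmetric]) (simp_all add: sHom_def)
    then show "(SComp C b a a \<odot> symm (SHom C b a) (SHom C a a)) \<odot> (idt (SHom C b a) \<boxdot> SUnit C a) = run (SHom C b a)"
      using comp_cancel[OF C.unit_left[of b a], of "symm (SHom C b a) I"] by (simp add: lun_symm)
    have "(SComp C b b a \<odot> symm (SHom C b b) (SHom C b a)) \<odot> (SUnit C b \<boxdot> idt (SHom C b a)) =
       SComp C b b a \<odot> ((idt (SHom C b a) \<boxdot> SUnit C b) \<odot> symm I (SHom C b a))"
      by (subst symm_nat[of _ I _ _ "SHom C b a", symmetric]) (simp_all add: sHom_def)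
    then show "(SComp C b b a \<odot> symm (SHom C b b) (SHom C b a)) \<odot> (SUnit C b \<boxdot> idt (SHom C b a)) = lun (SHom C b a)"
      using comp_cancel[OF C.unit_right[of b a], of "symm I (SHom C b a)"] by (simp add: run_symm)
    fix c assume [simp]: "c \<in> SObj C"
    show "SComp C c b a \<odot> symm (SHom C c b) (SHom C b a) \<in> sHom S (SHom C c b \<boxtimes> SHom C b a) (SHom C c a)"
      by (simp add: sHom_def)
    fix d assume [simp]: "d \<in> SObj C"
    let ?X = "SHom C d c" and ?Y = "SHom C c b" and ?Z = "SHom C b a"
    have "(SComp C d b a \<odot> symm (SHom C d b) ?Z) \<odot> ((SComp C d c b \<odot> symm ?X ?Y) \<boxdot> idt ?Z)
      = SComp C d b a \<odot> ((idt ?Z \<boxdot> (SComp C d c b \<odot> symm ?X ?Y)) \<odot> symm (?X \<boxtimes> ?Y) ?Z)"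
      by (subst symm_nat[of _ "?X \<boxtimes> ?Y" _ _ ?Z, symmetric]) (simp_all add: sHom_def)
    also have "\<dots> = SComp C d b a \<odot> ((idt ?Z \<boxdot> SComp C d c b) \<odot> ((idt ?Z \<boxdot> symm ?X ?Y) \<odot> symm (?X \<boxtimes> ?Y) ?Z))"
      by simp
    also have "\<dots> = (SComp C d b a \<odot> ((idt ?Z \<boxdot> SComp C d c b) \<odot> assc ?Z ?Y ?X)) \<odot>
        ((symm ?Y ?Z \<boxdot> idt ?X) \<odot> (symm ?X (?Y \<boxtimes> ?Z) \<odot> assc ?X ?Y ?Z))"
      by (subst symm_reverse[symmetric]) simp_all
    also have "\<dots> = (SComp C d c a \<odot> (SComp C c b a \<boxdot> idt ?X)) \<odot>
        ((symm ?Y ?Z \<boxdot> idt ?X) \<odot> (symm ?X (?Y \<boxtimes> ?Z) \<odot> assc ?X ?Y ?Z))"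
      by (simp only: C.assoc \<open>a \<in> SObj C\<close> \<open>b \<in> SObj C\<close> \<open>c \<in> SObj C\<close> \<open>d \<in> SObj C\<close>)
    also have "\<dots> = SComp C d c a \<odot> (((SComp C c b a \<odot> symm ?Y ?Z) \<boxdot> idt ?X) \<odot> (symm ?X (?Y \<boxtimes> ?Z) \<odot> assc ?X ?Y ?Z))"
      by simp
    also have "\<dots> = SComp C d c a \<odot> (symm ?X (SHom C c a) \<odot> ((idt ?X \<boxdot> (SComp C c b a \<odot> symm ?Y ?Z)) \<odot> assc ?X ?Y ?Z))"
      by (subst symm_nat'[of _ ?X _ _ "?Y \<boxtimes> ?Z"]) (simp_all add: sHom_def)
    finally show "(SComp C d b a \<odot> symm (SHom C d b) ?Z) \<odot> ((SComp C d c b \<odot> symm ?X ?Y) \<boxdot> idt ?Z) =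
       (SComp C d c a \<odot> symm ?X (SHom C c a)) \<odot> ((idt ?X \<boxdot> (SComp C c b a \<odot> symm ?Y ?Z)) \<odot> assc ?X ?Y ?Z)"
      by simp
  qed
qed

end

section \<open>Multilinear functors into discrete permutative categories\<close>

lemma listset_iff: "xs \<in> listset Xs \<longleftrightarrow> length xs = length Xs \<and> (\<forall>i<length Xs. xs ! i \<in> Xs ! i)"
proof (induction Xs arbitrary: xs)
  case (Cons X Xs)
  then show ?case
    by (cases xs) (auto simp: set_Cons_def nth_Cons split: nat.splits, blast?)
qed simp

lemma listset_sing [simp]: "xs \<in> listset [X] \<longleftrightarrow> (\<exists>x\<in>X. xs = [x])"
  by (auto simp: set_Cons_def)

lemma mk_mfun_fields [simp]: "Srcs (mk_mfun As B fo fa l) = As" "Target (mk_mfun As B fo fa l) = B"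
    "xs \<in> Obs As \<Longrightarrow> FO (mk_mfun As B fo fa l) xs = fo xs"
    "us \<in> Ars As \<Longrightarrow> FA (mk_mfun As B fo fa l) us = fa us"
    "i < length As \<Longrightarrow> xs \<in> Obs As \<Longrightarrow> a' \<in> Ob (As ! i) \<Longrightarrow> Lin (mk_mfun As B fo fa l) i xs a' = l i xs a'"
  by (simp_all add: mk_mfun_def)

lemma mk_mfun_cong:
  assumes "\<And>xs. xs \<in> Obs As \<Longrightarrow> fo xs = fo' xs" "\<And>us. us \<in> Ars As \<Longrightarrow> fa us = fa' us"
    "\<And>i xs a'. i < length As \<Longrightarrow> xs \<in> Obs As \<Longrightarrow> a' \<in> Ob (As ! i) \<Longrightarrow> l i xs a' = l' i xs a'"
  shows "mk_mfun As B fo fa l = mk_mfun As B fo' fa' l'"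
  using assms by (auto simp: mk_mfun_def restrict_def intro!: ext)

text \<open>Truncating data to their domain twice is the same as doing it once. This discharges the
  extensionality axiom for every functor built by \<open>mk_mfun\<close>.\<close>

lemma mk_mfun_idem: "f = mk_mfun As B fo fa l \<Longrightarrow> f = mk_mfun As B (FO f) (FA f) (Lin f)"
  by (auto intro: mk_mfun_cong)

lemma Hom_iff: "f \<in> Hom P a b \<longleftrightarrow> f \<in> Ar P \<and> Src P f = a \<and> Tgt P f = b"
  by (simp add: Hom_def)

section \<open>Discrete permutative categories\<close>

lemma continuous_map_constant_on:
  assumes "\<And>x. x \<in> topspace X \<Longrightarrow> f x = c \<and> c \<in> topspace Y"
  shows "continuous_map X Y f"
proof (cases "topspace X = {}")
  case False
  then have "c \<in> topspace Y" using assms by (metis ex_in_conv)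
  then have "continuous_map X Y (\<lambda>_. c)" by simp
  then show ?thesis by (rule continuous_map_eq) (use assms in auto)
qed (simp add: continuous_map_on_empty)

text \<open>All arrows are identities, so what remains is a commutative monoid of objects and
  bookkeeping for \<open>Idn\<close>. Only the underlying sets of the hom spaces are prescribed: a
  space with at most one point has a unique topology.\<close>

locale discrete_permcat =
  fixes P :: "('o, 'm) permcat"
  assumes Ar_eq: "Ar P = Idn P ` Ob P"
    and ends [simp]: "a \<in> Ob P \<Longrightarrow> Src P (Idn P a) = a" "a \<in> Ob P \<Longrightarrow> Tgt P (Idn P a) = a"
    and cmp_idn [simp]: "a \<in> Ob P \<Longrightarrow> Cmp P (Idn P a) (Idn P a) = Idn P a"
    and zer [simp]: "Zer P \<in> Ob P"
    and add [simp]: "\<lbrakk>a \<in> Ob P; b \<in> Ob P\<rbrakk> \<Longrightarrow> Add P a b \<in> Ob P"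
    and add_assoc: "\<lbrakk>a \<in> Ob P; b \<in> Ob P; c \<in> Ob P\<rbrakk> \<Longrightarrow> Add P (Add P a b) c = Add P a (Add P b c)"
    and add_comm: "\<lbrakk>a \<in> Ob P; b \<in> Ob P\<rbrakk> \<Longrightarrow> Add P a b = Add P b a"
    and add_zer: "a \<in> Ob P \<Longrightarrow> Add P a (Zer P) = a"
    and addA_idn [simp]: "\<lbrakk>a \<in> Ob P; b \<in> Ob P\<rbrakk> \<Longrightarrow> AddA P (Idn P a) (Idn P b) = Idn P (Add P a b)"
    and twist [simp]: "\<lbrakk>a \<in> Ob P; b \<in> Ob P\<rbrakk> \<Longrightarrow> Twist P a b = Idn P (Add P a b)"
    and topspace: "\<lbrakk>a \<in> Ob P; b \<in> Ob P\<rbrakk> \<Longrightarrow> topspace (HTop P a b) = Hom P a b"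
begin

lemma idn_arr [simp]: "a \<in> Ob P \<Longrightarrow> Idn P a \<in> Ar P"
  by (simp add: Ar_eq)

lemma arr_idn: "u \<in> Ar P \<Longrightarrow> u = Idn P (Src P u) \<and> Src P u \<in> Ob P \<and> Tgt P u = Src P u"
  by (auto simp: Ar_eq)

lemma Hom_eq: "u \<in> Hom P a b \<longleftrightarrow> u = Idn P a \<and> a = b \<and> a \<in> Ob P"
  using arr_idn by (auto simp: Hom_iff)

lemma add_zer' [simp]: "a \<in> Ob P \<Longrightarrow> Add P a (Zer P) = a" "a \<in> Ob P \<Longrightarrow> Add P (Zer P) a = a"
  using add_zer add_comm[of a "Zer P"] by auto

lemma add_left_comm:
  "\<lbrakk>a \<in> Ob P; b \<in> Ob P; c \<in> Ob P\<rbrakk> \<Longrightarrow> Add P a (Add P b c) = Add P b (Add P a c)"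
  using add_assoc add_comm by metis

lemmas add_ac = add_assoc add_comm add_left_comm

lemma permutative: "permutative_category P"
proof
  fix a b c assume ab: "a \<in> Ob P" "b \<in> Ob P" and c: "c \<in> Ob P"
  show "continuous_map (prod_topology (HTop P b c) (HTop P a b)) (HTop P a c) (\<lambda>(g, f). Cmp P g f)"
    by (rule continuous_map_constant_on[where c = "Idn P a"]) (use ab c in \<open>auto simp: topspace Hom_eq\<close>)
  fix d assume d: "d \<in> Ob P"
  show "continuous_map (prod_topology (HTop P a b) (HTop P c d)) (HTop P (Add P a c) (Add P b d)) (\<lambda>(f, f'). AddA P f f')"
    by (rule continuous_map_constant_on[where c = "Idn P (Add P a c)"]) (use ab c d in \<open>auto simp: topspace Hom_eq\<close>)
qed (auto simp: Hom_eq topspace add_assoc add_comm Ar_eq add_left_comm)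

end

text \<open>The types of the data of a multilinear functor, separated from its coherence conditions.
  Types already determine a composite into a discrete category, and for \<open>mswap 0 f\<close>
  they are the part that is established.\<close>

locale typed_mfun =
  fixes f :: "'v mfun"
  assumes t_FO: "xs \<in> Obs (Srcs f) \<Longrightarrow> FO f xs \<in> Ob (Target f)"
    and t_FA: "us \<in> Ars (Srcs f) \<Longrightarrow>
      FA f us \<in> Hom (Target f) (FO f (map2 Src (Srcs f) us)) (FO f (map2 Tgt (Srcs f) us))"
    and t_Lin: "\<lbrakk>i < length (Srcs f); xs \<in> Obs (Srcs f); a' \<in> Ob (Srcs f ! i)\<rbrakk> \<Longrightarrow>
      Lin f i xs a' \<in> Hom (Target f) (Add (Target f) (FO f xs) (FO f (xs[i := a'])))
                            (FO f (xs[i := Add (Srcs f ! i) (xs ! i) a']))"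

lemma multilinear_typed: "multilinear_functor f \<Longrightarrow> typed_mfun f"
  by unfold_locales (simp_all add: multilinear_functor.FO multilinear_functor.FA multilinear_functor.Lin)

text \<open>The second condition is constancy on connected components, stated for single arrows. The
  condition at zero stands by itself because the objects of a discrete \<open>B\<close> form only a
  commutative monoid, where additivity does not imply it.\<close>

definition multiadditive :: "('v, 'v) permcat list \<Rightarrow> ('v, 'v) permcat \<Rightarrow> ('v list \<Rightarrow> 'v) \<Rightarrow> bool" where
  "multiadditive As B h \<longleftrightarrow> (\<forall>xs\<in>Obs As. h xs \<in> Ob B) \<and>
     (\<forall>us\<in>Ars As. h (map2 Src As us) = h (map2 Tgt As us)) \<and>
     (\<forall>xs\<in>Obs As. \<forall>i<length As. xs ! i = Zer (As ! i) \<longrightarrow> h xs = Zer B) \<and>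
     (\<forall>xs\<in>Obs As. \<forall>i<length As. \<forall>a'\<in>Ob (As ! i).
        h (xs[i := Add (As ! i) (xs ! i) a']) = Add B (h xs) (h (xs[i := a'])))"

definition lin_map :: "('v, 'v) permcat list \<Rightarrow> ('v, 'v) permcat \<Rightarrow> ('v list \<Rightarrow> 'v) \<Rightarrow> 'v mfun" where
  "lin_map As B h = mk_mfun As B h (\<lambda>us. Idn B (h (map2 Src As us)))
     (\<lambda>i xs a'. Idn B (h (xs[i := Add (As ! i) (xs ! i) a'])))"

lemma lin_map_fields [simp]: "Srcs (lin_map As B h) = As" "Target (lin_map As B h) = B"
    "xs \<in> Obs As \<Longrightarrow> FO (lin_map As B h) xs = h xs"
  by (simp_all add: lin_map_def)

lemma Obs_update: "\<lbrakk>xs \<in> Obs As; i < length As; a \<in> Ob (As ! i)\<rbrakk> \<Longrightarrow> xs[i := a] \<in> Obs As"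
  by (auto simp: listset_iff nth_list_update)

lemma Ars_update: "\<lbrakk>us \<in> Ars As; i < length As; u \<in> Ar (As ! i)\<rbrakk> \<Longrightarrow> us[i := u] \<in> Ars As"
  by (auto simp: listset_iff nth_list_update)

lemma map2_update: "map2 F As (us[i := u]) = (map2 F As us)[i := F (As ! i) u]"
  by (induction As arbitrary: us i) (auto split: nat.splits simp: zip_Cons1 split: list.splits)

context
  fixes As :: "('v, 'v) permcat list"
  assumes perm: "\<And>A. A \<in> set As \<Longrightarrow> permutative_category A"
begin

lemma perm_nth: "i < length As \<Longrightarrow> permutative_category (As ! i)"
  using perm by simp

lemma add_Obs: "\<lbrakk>i < length As; a \<in> Ob (As ! i); a' \<in> Ob (As ! i)\<rbrakk> \<Longrightarrow> Add (As ! i) a a' \<in> Ob (As ! i)"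
  by (rule permutative_category.add[OF perm_nth])

lemma Src_Obs: "us \<in> Ars As \<Longrightarrow> map2 Src As us \<in> Obs As" "us \<in> Ars As \<Longrightarrow> map2 Tgt As us \<in> Obs As"
  using permutative_category.arr[OF perm_nth] by (auto simp: listset_iff)

lemma Idn_Ars:
  assumes "xs \<in> Obs As"
  shows "map2 Idn As xs \<in> Ars As" "map2 Src As (map2 Idn As xs) = xs" "map2 Tgt As (map2 Idn As xs) = xs"
  using permutative_category.idn[OF perm_nth] assms
  by (auto simp: listset_iff Hom_iff intro!: nth_equalityI)

lemma lin_map_cong:
  assumes "\<And>xs. xs \<in> Obs As \<Longrightarrow> h xs = h' xs"
  shows "lin_map As B h = lin_map As B h'"
  unfolding lin_map_def using assms add_Obs
  by (intro mk_mfun_cong)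
    (auto simp: Src_Obs intro!: arg_cong[of _ _ "Idn B"] assms Obs_update add_Obs, auto simp: listset_iff)

text \<open>Each coherence condition compares two identity arrows of \<open>B\<close>, so it holds
  as soon as these belong to the same object. For the compatibility of two constraints this object
  is a sum of four values of \<open>h\<close>, rearranged by commutativity.\<close>

lemma multilinear_lin_map:
  assumes B: "discrete_permcat B" and h: "multiadditive As B h"
  shows "multilinear_functor (lin_map As B h)"
proof -
  interpret B: discrete_permcat B by fact
  have h_ob [simp]: "xs \<in> Obs As \<Longrightarrow> h xs \<in> Ob B" for xs using h by (simp add: multiadditive_def)
  have h_inv: "us \<in> Ars As \<Longrightarrow> h (map2 Tgt As us) = h (map2 Src As us)" for us
    using h by (simp add: multiadditive_def)
  have h_zer: "\<lbrakk>xs \<in> Obs As; i < length As; xs ! i = Zer (As ! i)\<rbrakk> \<Longrightarrow> h xs = Zer B" for xs i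
    using h by (auto simp: multiadditive_def)
  have h_add: "\<lbrakk>xs \<in> Obs As; i < length As; a \<in> Ob (As ! i); a' \<in> Ob (As ! i)\<rbrakk> \<Longrightarrow>
      h (xs[i := Add (As ! i) a a']) = Add B (h (xs[i := a])) (h (xs[i := a']))" for xs i a a'
  proof -
    assume *: "xs \<in> Obs As" "i < length As" "a \<in> Ob (As ! i)" "a' \<in> Ob (As ! i)"
    have "xs[i := a] ! i = a" using * by (simp add: listset_iff)
    then show ?thesis
      using h[unfolded multiadditive_def] Obs_update[OF *(1-3)] *(2,4) by (metis list_update_overwrite)
  qed
  have nth: "xs \<in> Obs As \<Longrightarrow> i < length As \<Longrightarrow> xs ! i \<in> Ob (As ! i)" for xs i
    by (auto simp: listset_iff)
  have nthA: "us \<in> Ars As \<Longrightarrow> i < length As \<Longrightarrow> us ! i \<in> Ar (As ! i)" for us i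
    by (auto simp: listset_iff)
  have FA: "us \<in> Ars As \<Longrightarrow> FA (lin_map As B h) us = Idn B (h (map2 Src As us))" for us
    by (simp add: lin_map_def)
  have Lin: "\<lbrakk>i < length As; xs \<in> Obs As; a' \<in> Ob (As ! i)\<rbrakk> \<Longrightarrow>
      Lin (lin_map As B h) i xs a' = Idn B (Add B (h xs) (h (xs[i := a'])))" for i xs a'
    using h_add[of xs i "xs ! i" a'] nth by (simp add: lin_map_def)
  note [simp] = Src_Obs Idn_Ars add_Obs Obs_update Ars_update map2_update h_inv nth nthA
  show ?thesis
  proof (rule multilinear_functor.intro; unfold lin_map_fields(1,2))
    show "lin_map As B h = mk_mfun As B (FO (lin_map As B h)) (FA (lin_map As B h)) (Lin (lin_map As B h))"
      by (rule mk_mfun_idem[OF lin_map_def])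
    show "permutative_category A" if "A \<in> set As" for A using that by (rule perm)
    show "permutative_category B" by (rule B.permutative)
    fix xs assume xs [simp]: "xs \<in> Obs As"
    show "FO (lin_map As B h) xs \<in> Ob B" by simp
    show "FA (lin_map As B h) (map2 Idn As xs) = Idn B (FO (lin_map As B h) xs)" by (simp add: FA)
    fix ys assume ys [simp]: "ys \<in> Obs As"
    have "map u [0..<length As] \<in> Ars As" "map2 Src As (map u [0..<length As]) = xs"
        "map2 Tgt As (map u [0..<length As]) = ys"
      if "u \<in> topspace (product_topology (\<lambda>i. HTop (As ! i) (xs ! i) (ys ! i)) {..<length As})" for u
      using that nth[OF xs] nth[OF ys] xs ys permutative_category.topspace[OF perm_nth]
      by (auto simp: listset_iff Hom_iff PiE_iff intro!: nth_equalityI)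
    note u = this h_inv[OF this(1)]
    \<comment> \<open>A tuple of arrows from \<open>xs\<close> to \<open>ys\<close> forces
      \<open>h xs = h ys\<close>, so the map takes the single value
      \<open>Idn B (h xs)\<close>.\<close>
    show "continuous_map (product_topology (\<lambda>i. HTop (As ! i) (xs ! i) (ys ! i)) {..<length As})
        (HTop B (FO (lin_map As B h) xs) (FO (lin_map As B h) ys)) (\<lambda>u. FA (lin_map As B h) (map u [0..<length As]))"
      by (rule continuous_map_constant_on[where c = "Idn B (h xs)"]) (use u in \<open>auto simp: FA B.topspace B.Hom_eq\<close>)
  next
    fix us assume us [simp]: "us \<in> Ars As"
    show "FA (lin_map As B h) us \<in> Hom B (FO (lin_map As B h) (map2 Src As us)) (FO (lin_map As B h) (map2 Tgt As us))"
      by (simp add: FA B.Hom_eq)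
    fix vs assume vs [simp]: "vs \<in> Ars As" and eq: "map2 Tgt As us = map2 Src As vs"
    let ?ws = "map (\<lambda>i. Cmp (As ! i) (vs ! i) (us ! i)) [0..<length As]"
    have "Tgt (As ! i) (us ! i) = Src (As ! i) (vs ! i)" if "i < length As" for i
      using that us vs arg_cong[OF eq, of "\<lambda>x. x ! i"] by (simp add: listset_iff)
    then have "?ws ! i \<in> Hom (As ! i) (Src (As ! i) (us ! i)) (Tgt (As ! i) (vs ! i))" if "i < length As" for i
      using that permutative_category.cmp[OF perm_nth[OF that]] us vs by (simp add: listset_iff Hom_iff)
    then have "?ws \<in> Ars As" "map2 Src As ?ws = map2 Src As us"
      using us vs by (auto simp: listset_iff Hom_iff intro!: nth_equalityI)
    then show "FA (lin_map As B h) ?ws = Cmp B (FA (lin_map As B h) vs) (FA (lin_map As B h) us)"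
      using h_inv[OF us] by (simp add: FA flip: eq)
  next
    fix xs i assume "xs \<in> Obs As" "i < length As" "xs ! i = Zer (As ! i)"
    then show "FO (lin_map As B h) xs = Zer B" using h_zer by simp
  next
    fix us i assume us: "us \<in> Ars As" "i < length As" "us ! i = Idn (As ! i) (Zer (As ! i))"
    then have "map2 Src As us ! i = Zer (As ! i)"
      using permutative_category.idn[OF perm_nth permutative_category.zer[OF perm_nth]]
      by (auto simp: listset_iff Hom_iff)
    then show "FA (lin_map As B h) us = Idn B (Zer B)" using us h_zer[of "map2 Src As us" i] by (simp add: FA)
  next
    fix xs i a' assume *[simp]: "i < length As" "xs \<in> Obs As" "a' \<in> Ob (As ! i)"
    note h_add' = h_add[of xs i "xs ! i"] h_add[of xs i a']
    have tw: "Twist (As ! i) (xs ! i) a' \<in> Ar (As ! i)" "Src (As ! i) (Twist (As ! i) (xs ! i) a') = Add (As ! i) (xs ! i) a'"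
      using permutative_category.twist[OF perm_nth, of i "xs ! i" a'] by (auto simp: Hom_iff)
    show "Lin (lin_map As B h) i xs a' \<in> Hom B (Add B (FO (lin_map As B h) xs) (FO (lin_map As B h) (xs[i := a'])))
                            (FO (lin_map As B h) (xs[i := Add (As ! i) (xs ! i) a']))"
      by (simp add: Lin B.Hom_eq h_add)
    show "Lin (lin_map As B h) i xs a' = Idn B (FO (lin_map As B h) (xs[i := Add (As ! i) (xs ! i) a']))"
      by (simp add: Lin h_add)
    show "Cmp B (FA (lin_map As B h) ((map2 Idn As xs)[i := Twist (As ! i) (xs ! i) a'])) (Lin (lin_map As B h) i xs a') =
      Cmp B (Lin (lin_map As B h) i (xs[i := a']) (xs ! i)) (Twist B (FO (lin_map As B h) xs) (FO (lin_map As B h) (xs[i := a'])))"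
      using * tw by (simp add: FA Lin h_add B.add_comm)
    fix a'' assume [simp]: "a'' \<in> Ob (As ! i)"
    show "Cmp B (Lin (lin_map As B h) i xs (Add (As ! i) a' a''))
            (AddA B (Idn B (FO (lin_map As B h) xs)) (Lin (lin_map As B h) i (xs[i := a']) a'')) =
      Cmp B (Lin (lin_map As B h) i (xs[i := Add (As ! i) (xs ! i) a']) a'')
            (AddA B (Lin (lin_map As B h) i xs a') (Idn B (FO (lin_map As B h) (xs[i := a'']))))"
      by (simp add: FA Lin h_add B.add_assoc)
  next
    fix i us u' assume *[simp]: "i < length As" "us \<in> Ars As" "u' \<in> Ar (As ! i)"
    have so [simp]: "Src (As ! i) u' \<in> Ob (As ! i)" "Tgt (As ! i) u' \<in> Ob (As ! i)"
       "Src (As ! i) (us ! i) \<in> Ob (As ! i)"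
      using permutative_category.arr[OF perm_nth] by auto
    have a [simp]: "AddA (As ! i) (us ! i) u' \<in> Ar (As ! i)"
      "Src (As ! i) (AddA (As ! i) (us ! i) u') = Add (As ! i) (Src (As ! i) (us ! i)) (Src (As ! i) u')"
      using permutative_category.addA[OF perm_nth, of i "us ! i" "Src (As ! i) (us ! i)" "Tgt (As ! i) (us ! i)" u' "Src (As ! i) u'" "Tgt (As ! i) u'"]
      by (auto simp: Hom_iff)
    have i: "(map2 Src As us)[i := Src (As ! i) (us ! i)] = map2 Src As us"
      by (simp flip: map2_update)
    have inv: "h ((map2 Tgt As us)[i := Tgt (As ! i) u']) = h ((map2 Src As us)[i := Src (As ! i) u'])"
      using h_inv[of "us[i := u']"] by (simp add: Ars_update)
    show "Cmp B (Lin (lin_map As B h) i (map2 Tgt As us) (Tgt (As ! i) u'))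
            (AddA B (FA (lin_map As B h) us) (FA (lin_map As B h) (us[i := u']))) =
      Cmp B (FA (lin_map As B h) (us[i := AddA (As ! i) (us ! i) u']))
            (Lin (lin_map As B h) i (map2 Src As us) (Src (As ! i) u'))"
      by (simp add: FA Lin h_add inv i)
  next
    fix i j xs a' b' assume *[simp]: "i < length As" "j < length As" "i \<noteq> j" "xs \<in> Obs As" "a' \<in> Ob (As ! i)" "b' \<in> Ob (As ! j)"
    have [simp]: "xs[i := a'] ! j = xs ! j" "xs[j := b'] ! i = xs ! i" "xs[i := Add (As ! i) (xs ! i) a'] ! j = xs ! j"
        "xs[j := Add (As ! j) (xs ! j) b'] ! i = xs ! i" using *(3) by (metis nth_list_update_neq)+
    have [simp]: "xs[i := a, j := b] \<in> Obs As" "xs[j := b, i := a] \<in> Obs As" if "a \<in> Ob (As ! i)" "b \<in> Ob (As ! j)" for a b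
      using that by (auto intro!: Obs_update)
    have sw: "xs[j := b, i := a] = xs[i := a, j := b]" for a b by (rule list_update_swap) (rule *(3)[symmetric])
    have 1: "h (xs[i := Add (As ! i) (xs ! i) a']) = Add B (h xs) (h (xs[i := a']))"
      "h (xs[j := Add (As ! j) (xs ! j) b']) = Add B (h xs) (h (xs[j := b']))"
      using h_add[of xs i "xs ! i" a'] h_add[of xs j "xs ! j" b'] by simp_all
    \<comment> \<open>Additivity in variable \<open>i\<close> at the tuple with \<open>b'\<close> in
      place \<open>j\<close>. Writing back the old entry at \<open>i\<close> changes nothing because
      \<open>i \<noteq> j\<close>.\<close>
    have 2: "h (xs[i := Add (As ! i) (xs ! i) a', j := b']) = Add B (h (xs[j := b'])) (h (xs[i := a', j := b']))"
    proof -
      have "xs[j := b', i := xs ! i] = xs[j := b']"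
        using *(3) by (metis list_update_id nth_list_update_neq)
      then show ?thesis
        using h_add[of "xs[j := b']" i "xs ! i" a'] by (simp only: sw * Obs_update nth)
    qed
    have 3: "h (xs[i := a', j := Add (As ! j) (xs ! j) b']) = Add B (h (xs[i := a'])) (h (xs[i := a', j := b']))"
    proof -
      have "xs[i := a', j := xs ! j] = xs[i := a']"
        using *(3) by (metis list_update_id nth_list_update_neq)
      then show ?thesis
        using h_add[of "xs[i := a']" j "xs ! j" b'] by (simp only: * Obs_update nth)
    qed
    show "Cmp B (Lin (lin_map As B h) j (xs[i := Add (As ! i) (xs ! i) a']) b')
            (AddA B (Lin (lin_map As B h) i xs a') (Lin (lin_map As B h) i (xs[j := b']) a')) =
      Cmp B (Lin (lin_map As B h) i (xs[j := Add (As ! j) (xs ! j) b']) a')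
        (Cmp B (AddA B (Lin (lin_map As B h) j xs b') (Lin (lin_map As B h) j (xs[i := a']) b'))
               (AddA B (Idn B (FO (lin_map As B h) xs))
                 (AddA B (Twist B (FO (lin_map As B h) (xs[i := a'])) (FO (lin_map As B h) (xs[j := b'])))
                         (Idn B (FO (lin_map As B h) (xs[i := a', j := b']))))))"
      by (simp add: Lin sw 1 2 3 B.add_ac)
  qed
qed

end

text \<open>An arrow of a discrete category is the identity of its source, so the types of
  \<open>FA\<close> and \<open>Lin\<close> determine both of them from \<open>FO\<close>.\<close>

lemma typed_discrete:
  assumes "typed_mfun f" "discrete_permcat (Target f)"
    and "f = mk_mfun (Srcs f) (Target f) (FO f) (FA f) (Lin f)"
  shows "f = lin_map (Srcs f) (Target f) (FO f)"
proof -
  interpret typed_mfun f by fact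
  interpret B: discrete_permcat "Target f" by fact
  have "FA f us = Idn (Target f) (FO f (map2 Src (Srcs f) us))" if "us \<in> Ars (Srcs f)" for us
    using t_FA[OF that] by (simp add: B.Hom_eq)
  moreover have "Lin f i xs a' = Idn (Target f) (FO f (xs[i := Add (Srcs f ! i) (xs ! i) a']))"
    if "i < length (Srcs f)" "xs \<in> Obs (Srcs f)" "a' \<in> Ob (Srcs f ! i)" for i xs a'
    using t_Lin[OF that] by (simp add: B.Hom_eq)
  ultimately show ?thesis
    by (subst assms(3), unfold lin_map_def) (rule mk_mfun_cong; simp)
qed

text \<open>The converse of \<open>multilinear_lin_map\<close>. An arrow of a discrete category
  exists only between equal objects, so the types of \<open>FA\<close> and \<open>Lin\<close> say
  that \<open>FO f\<close> is invariant along arrows and additive.\<close>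

lemma multilinear_discrete:
  assumes f: "multilinear_functor f" "discrete_permcat (Target f)"
  shows "f = lin_map (Srcs f) (Target f) (FO f)" "multiadditive (Srcs f) (Target f) (FO f)"
proof -
  interpret B: discrete_permcat "Target f" by fact
  show "f = lin_map (Srcs f) (Target f) (FO f)"
    using f multilinear_functor.extensional by (intro typed_discrete multilinear_typed)
  show "multiadditive (Srcs f) (Target f) (FO f)"
    unfolding multiadditive_def
    using multilinear_functor.FO[OF f(1)] multilinear_functor.FA[OF f(1)] multilinear_functor.Lin[OF f(1)]
      multilinear_functor.FO_zer[OF f(1)] by (simp add: B.Hom_eq)
qed

section \<open>Composites with values in a discrete category\<close>

lemma chop_listset:
  "xs \<in> listset (concat Xss) \<Longrightarrow> length (chop (map length Xss) xs) = length Xss \<and>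
    (\<forall>j<length Xss. chop (map length Xss) xs ! j \<in> listset (Xss ! j))"
proof (induction Xss arbitrary: xs)
  case (Cons X Xss)
  have l: "length xs = length X + length (concat Xss)"
    and n: "\<And>i. i < length X + length (concat Xss) \<Longrightarrow> xs ! i \<in> (X @ concat Xss) ! i"
    using Cons.prems by (auto simp: listset_iff)
  have "xs ! i \<in> X ! i" if "i < length X" for i
    using n[of i] that by (simp add: nth_append)
  then have "take (length X) xs \<in> listset X"
    using l by (auto simp: listset_iff)
  moreover have "drop (length X) xs \<in> listset (concat Xss)"
    using l n[of "length X + _"] by (auto simp: listset_iff nth_append)
  ultimately show ?case using Cons.IH[of "drop (length X) xs"]
    by (auto simp: nth_Cons split: nat.splits)
qed simp

lemma chop_map2:
  "length xs = length (concat Ass) \<Longrightarrow>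
    chop (map length Ass) (map2 F (concat Ass) xs) = map2 (map2 F) Ass (chop (map length Ass) xs)"
proof (induction Ass arbitrary: xs)
  case (Cons As Ass)
  obtain ys zs where xs: "xs = ys @ zs" and l: "length ys = length As" "length zs = length (concat Ass)"
  proof
    show "xs = take (length As) xs @ drop (length As) xs" by simp
  qed (use Cons.prems in auto)
  then show ?case using Cons.IH[OF l(2)] by simp
qed simp

text \<open>Translates the numbering of the variables of a composite into that of its inner
  functors. The last conjunct carries the argument in \<open>mcomp_discrete\<close>: a change of
  entry \<open>p\<close> stays within block \<open>j\<close>.\<close>

lemma locate_chop:
  assumes "p < length (concat Ass)" "locate (map length Ass) p = (j, i)" "length xs = length (concat Ass)"
  shows "j < length Ass \<and> i < length (Ass ! j) \<and> concat Ass ! p = Ass ! j ! i \<and>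
    chop (map length Ass) xs ! j ! i = xs ! p \<and>
    chop (map length Ass) (xs[p := v]) = (chop (map length Ass) xs)[j := (chop (map length Ass) xs ! j)[i := v]]"
  using assms
proof (induction Ass arbitrary: xs p i j)
  case (Cons As Ass)
  obtain ys zs where xs: "xs = ys @ zs" and l: "length ys = length As" "length zs = length (concat Ass)"
  proof
    show "xs = take (length As) xs @ drop (length As) xs" by simp
  qed (use Cons.prems in auto)
  show ?case
  proof (cases "p < length As")
    case True
    then show ?thesis using Cons.prems l xs by (auto simp: nth_append list_update_append)
  next
    case False
    then obtain j' where j': "locate (map length Ass) (p - length As) = (j', i)" "j = Suc j'"
      using Cons.prems(2) by (cases "locate (map length Ass) (p - length As)") auto
    have "p - length As < length (concat Ass)" using Cons.prems False by auto
    from Cons.IH[OF this j'(1) l(2)] show ?thesis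
      using False j' xs l by (auto simp: nth_append list_update_append)
  qed
qed simp

lemma (in discrete_permcat) cmp_Hom: "u \<in> Hom P b c \<Longrightarrow> v \<in> Hom P a b \<Longrightarrow> Cmp P u v = Idn P c"
  by (auto simp: Hom_eq)

text \<open>In variable \<open>p\<close> the constraint of a composite is an inner constraint under
  \<open>g\<close>, composed with a constraint of \<open>g\<close>. Both factors are arrows of the
  discrete target, so their composite is an identity, and its target is the value of the composite
  at the summed tuple. This argument uses the types of the inner functors, hence
  \<open>typed_mfun\<close>.\<close>

lemma mcomp_discrete:
  assumes g: "multilinear_functor g" and B: "discrete_permcat (Target g)"
    and fs: "\<And>f. f \<in> set fs \<Longrightarrow> typed_mfun f" and tgt: "map Target fs = Srcs g"
    and perm: "\<And>f A. f \<in> set fs \<Longrightarrow> A \<in> set (Srcs f) \<Longrightarrow> permutative_category A"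
  shows "mcomp g fs = lin_map (concat (map Srcs fs)) (Target g)
    (\<lambda>xs. FO g (map2 FO fs (chop (map (length \<circ> Srcs) fs) xs)))"
proof -
  interpret B: discrete_permcat "Target g" by fact
  let ?As = "concat (map Srcs fs)" and ?ns = "map (length \<circ> Srcs) fs"
  have pG: "permutative_category A" if "A \<in> set (Srcs g)" for A
    using multilinear_functor.permutative(1)[OF g that] .
  have ns: "?ns = map length (map Srcs fs)" "map length (map (map Ob) (map Srcs fs)) = ?ns"
     "map length (map (map Ar) (map Srcs fs)) = ?ns"
    by simp_all
  have len: "length (Srcs g) = length fs" and nthT: "j < length fs \<Longrightarrow> Srcs g ! j = Target (fs ! j)" for j
    using tgt by (metis length_map) (metis tgt nth_map)
  have ch: "length (chop ?ns xs) = length fs" "\<And>j. j < length fs \<Longrightarrow> chop ?ns xs ! j \<in> Obs (Srcs (fs ! j))"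
    if "xs \<in> Obs ?As" for xs
    using chop_listset[of xs "map (map Ob) (map Srcs fs)"] that unfolding ns by (simp_all add: map_concat)
  have chA: "length (chop ?ns xs) = length fs" "\<And>j. j < length fs \<Longrightarrow> chop ?ns xs ! j \<in> Ars (Srcs (fs ! j))"
    if "xs \<in> Ars ?As" for xs
    using chop_listset[of xs "map (map Ar) (map Srcs fs)"] that unfolding ns by (simp_all add: map_concat)
  have fo: "map2 FO fs (chop ?ns xs) \<in> Obs (Srcs g)" if "xs \<in> Obs ?As" for xs
    using typed_mfun.t_FO[OF fs] ch[OF that] by (auto simp: listset_iff len nthT)
  have fa: "map2 FA fs (chop ?ns us) \<in> Ars (Srcs g)"
     "map2 Src (Srcs g) (map2 FA fs (chop ?ns us)) = map2 FO fs (chop ?ns (map2 Src ?As us))"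
    if "us \<in> Ars ?As" for us
  proof -
    have *: "FA (fs ! j) (chop ?ns us ! j) \<in> Ar (Srcs g ! j)"
      "Src (Srcs g ! j) (FA (fs ! j) (chop ?ns us ! j)) = FO (fs ! j) (map2 Src (Srcs (fs ! j)) (chop ?ns us ! j))"
      if "j < length fs" for j
      using typed_mfun.t_FA[OF fs chA(2)[OF \<open>us \<in> Ars ?As\<close> that]] that by (auto simp: Hom_iff nthT)
    show "map2 FA fs (chop ?ns us) \<in> Ars (Srcs g)"
      using * chA(1)[OF that] by (auto simp: listset_iff len)
    have "length us = length ?As" using that by (simp add: listset_iff)
    then have "chop ?ns (map2 Src ?As us) = map2 (map2 Src) (map Srcs fs) (chop ?ns us)"
      using chop_map2[of us "map Srcs fs" Src] by simp
    then show "map2 Src (Srcs g) (map2 FA fs (chop ?ns us)) = map2 FO fs (chop ?ns (map2 Src ?As us))"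
      using * chA(1)[OF that] by (auto simp: len intro!: nth_equalityI)
  qed
  show ?thesis
    unfolding mcomp_def lin_map_def Let_def
  proof (rule mk_mfun_cong, goal_cases)
    case (2 us)
    show ?case
      using multilinear_functor.FA[OF g fa(1)[OF 2]] fa(2)[OF 2] by (simp add: B.Hom_eq)
  next
    case (3 p xs a')
    obtain j i where ji: "locate ?ns p = (j, i)" by (cases "locate ?ns p")
    have p: "p < length (concat (map Srcs fs))" and l: "length xs = length (concat (map Srcs fs))"
      using 3 by (auto simp: listset_iff)
    note loc = locate_chop[OF p ji[unfolded ns(1)] l, folded ns(1)]
    let ?fo = "map2 FO fs (chop ?ns xs)" and ?xs = "chop ?ns xs ! j" and ?f = "fs ! j"
    \<comment> \<open>\<open>loc\<close> holds for every new value of the entry; the conjuncts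
      independent of it are taken at \<open>undefined\<close>.\<close>
    have j: "j < length fs" "i < length (Srcs ?f)" "?As ! p = Srcs ?f ! i" using loc[of undefined] by auto
    have f: "typed_mfun ?f" using fs j by simp
    have ob: "?xs \<in> Obs (Srcs ?f)" "a' \<in> Ob (Srcs ?f ! i)" "?xs ! i = xs ! p"
      using ch(2)[OF 3(2) j(1)] 3(3) j(3) loc[of undefined] by auto
    have pf: "\<And>A. A \<in> set (Srcs ?f) \<Longrightarrow> permutative_category A" using perm nth_mem[OF j(1)] by blast
    have ob': "?xs[i := a'] \<in> Obs (Srcs ?f)" using ob j by (auto intro: Obs_update)
    \<comment> \<open>The values of the \<open>j\<close>-th inner functor at the second summand and
      at the sum. The constraint in \<open>L\<close> below runs from the sum of its values to
      \<open>?z\<close>.\<close>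
    let ?y = "FO ?f (?xs[i := a'])"
    let ?z = "FO ?f (?xs[i := Add (Srcs ?f ! i) (?xs ! i) a'])"
    have y: "?y \<in> Ob (Srcs g ! j)" using typed_mfun.t_FO[OF f ob'] j nthT by simp
    have foj: "?fo ! j = FO ?f ?xs" using j ch(1)[OF 3(2)] by simp
    have L: "Lin ?f i ?xs a' \<in> Hom (Srcs g ! j) (Add (Srcs g ! j) (?fo ! j) ?y) ?z"
      using typed_mfun.t_Lin[OF f j(2) ob(1,2)] j foj nthT by simp
    have I: "map2 Idn (Srcs g) ?fo \<in> Ars (Srcs g)" "map2 Src (Srcs g) (map2 Idn (Srcs g) ?fo) = ?fo"
       "map2 Tgt (Srcs g) (map2 Idn (Srcs g) ?fo) = ?fo"
      using Idn_Ars[of "Srcs g", OF pG fo[OF 3(2)]] by auto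
    have upd: "map2 FO fs (chop ?ns (xs[p := v])) = ?fo[j := FO ?f (?xs[i := v])]" for v
    proof -
      have "chop ?ns (xs[p := v]) = (chop ?ns xs)[j := ?xs[i := v]]"
        using locate_chop[OF p ji[unfolded ns(1)] l, folded ns(1)] by blast
      then show ?thesis by (simp add: map2_update)
    qed
    have "FA g ((map2 Idn (Srcs g) ?fo)[j := Lin ?f i ?xs a']) \<in>
        Hom (Target g) (FO g (?fo[j := Add (Srcs g ! j) (?fo ! j) ?y])) (FO g (?fo[j := ?z]))"
      using multilinear_functor.FA[OF g Ars_update[OF I(1), of j "Lin ?f i ?xs a'"]] L j len
      by (simp add: map2_update I Hom_iff)
    moreover have "Lin g j ?fo ?y \<in> Hom (Target g) (Add (Target g) (FO g ?fo) (FO g (?fo[j := ?y])))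
        (FO g (?fo[j := Add (Srcs g ! j) (?fo ! j) ?y]))"
      using multilinear_functor.Lin[OF g, of j ?fo ?y] j len y fo[OF 3(2)] by simp
    ultimately have "Cmp (Target g) (FA g ((map2 Idn (Srcs g) ?fo)[j := Lin ?f i ?xs a'])) (Lin g j ?fo ?y)
        = Idn (Target g) (FO g (?fo[j := ?z]))"
      by (rule B.cmp_Hom)
    then show ?case
      using ob j by (simp add: ji upd)
  qed simp
qed

text \<open>Proved for every permutative category, since identities of the categories of spans occur
  and those are not discrete. The constraint is an identity, so each axiom is a law of
  \<open>A\<close> up to composing with identities.\<close>

lemma multilinear_mid:
  assumes "permutative_category A"
  shows "multilinear_functor (mid A)"
proof -
  interpret permutative_category A by fact
  have S: "Srcs (mid A) = [A]" "Target (mid A) = A" by (simp_all add: mid_def)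
  have F [simp]: "a \<in> Ob A \<Longrightarrow> FO (mid A) [a] = a" "u \<in> Ar A \<Longrightarrow> FA (mid A) [u] = u"
     "a \<in> Ob A \<Longrightarrow> a' \<in> Ob A \<Longrightarrow> Lin (mid A) 0 [a] a' = Idn A (Add A a a')" for a a' u
    by (simp_all add: mid_def)
  have tw: "Cmp A (Idn A (Add A b a)) (Twist A a b) = Twist A a b"
     "Cmp A (Twist A a b) (Idn A (Add A a b)) = Twist A a b" if "a \<in> Ob A" "b \<in> Ob A" for a b
    using cmp_idn[OF twist[OF that]] by auto
  have tw': "Twist A a b \<in> Ar A" if "a \<in> Ob A" "b \<in> Ob A" for a b
    using twist[OF that] by (simp add: Hom_iff)
  have ends: "Src A (Idn A a) = a" "Tgt A (Idn A a) = a" "Idn A a \<in> Ar A" if "a \<in> Ob A" for a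
    using idn[OF that] by (auto simp: Hom_iff)
  have aA: "AddA A u v \<in> Ar A" "Src A (AddA A u v) = Add A (Src A u) (Src A v)"
     "Tgt A (AddA A u v) = Add A (Tgt A u) (Tgt A v)" if "u \<in> Ar A" "v \<in> Ar A" for u v
    using addA[of u _ _ v] that by (auto simp: Hom_iff)
  have cA: "Cmp A v u \<in> Ar A" if "u \<in> Ar A" "v \<in> Ar A" "Tgt A u = Src A v" for u v
    using cmp[of u _ _ v] that by (auto simp: Hom_iff)
  have cI: "Cmp A f (Idn A (Src A f)) = f" "Cmp A (Idn A (Tgt A f)) f = f" if "f \<in> Ar A" for f
    using cmp_idn[of f] that by (auto simp: Hom_iff)
  have aI: "Cmp A (AddA A f g) (Idn A (Add A (Src A f) (Src A g))) = AddA A f g"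
      "Cmp A (Idn A (Add A (Tgt A f) (Tgt A g))) (AddA A f g) = AddA A f g" if "f \<in> Ar A" "g \<in> Ar A" for f g
    using cI[OF aA(1)[OF that]] that by (simp_all add: aA)
  show ?thesis
  proof (rule multilinear_functor.intro; unfold S)
    show "mid A = mk_mfun [A] A (FO (mid A)) (FA (mid A)) (Lin (mid A))"
      by (rule mk_mfun_idem[OF mid_def])
  next
    fix xs ys assume "xs \<in> Obs [A]" "ys \<in> Obs [A]"
    then obtain x y where xy: "xs = [x]" "ys = [y]" "x \<in> Ob A" "y \<in> Ob A" by auto
    have "continuous_map (product_topology (\<lambda>i. HTop ([A] ! i) (xs ! i) (ys ! i)) {..<length [A]})
        (HTop A x y) (\<lambda>u. u 0)"
      using continuous_map_product_projection[of 0 "{..<length [A]}" "\<lambda>i. HTop ([A] ! i) (xs ! i) (ys ! i)"] xy by simp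
    then show "continuous_map (product_topology (\<lambda>i. HTop ([A] ! i) (xs ! i) (ys ! i)) {..<length [A]})
        (HTop A (FO (mid A) xs) (FO (mid A) ys)) (\<lambda>u. FA (mid A) (map u [0..<length [A]]))"
      using xy topspace by (auto simp: PiE_iff Hom_iff elim!: continuous_map_eq)
  qed (use assms in \<open>auto simp: Hom_iff add arr ends aA cA addA_idn add_zer cI aI tw tw' add_assoc twist_zer
      zer idn intro: cmp_assoc\<close>)
qed


lemma multilinear_mpoint:
  assumes "permutative_category A" "a \<in> Ob A"
  shows "multilinear_functor (mpoint A a)"
proof -
  interpret permutative_category A by fact
  have S: "Srcs (mpoint A a) = []" "Target (mpoint A a) = A" by (simp_all add: mpoint_def)
  have F [simp]: "FO (mpoint A a) [] = a" "FA (mpoint A a) [] = Idn A a"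
    by (simp_all add: mpoint_def)
  show ?thesis
  proof (rule multilinear_functor.intro; unfold S)
    show "mpoint A a = mk_mfun [] A (FO (mpoint A a)) (FA (mpoint A a)) (Lin (mpoint A a))"
      by (rule mk_mfun_idem[OF mpoint_def])
  next
    fix xs ys :: "'a list" assume xy: "xs \<in> Obs []" "ys \<in> Obs []"
    show "continuous_map (product_topology (\<lambda>i. HTop ([] ! i) (xs ! i) (ys ! i)) {..<length []})
        (HTop A (FO (mpoint A a) xs) (FO (mpoint A a) ys)) (\<lambda>u. FA (mpoint A a) (map u [0..<length []]))"
      by (rule continuous_map_constant_on[where c = "Idn A a"]) (use xy assms idn topspace in auto)
  qed (use assms idn cmp_idn[OF idn] in auto)
qed

lemma mid_fields [simp]: "Srcs (mid A) = [A]" "Target (mid A) = A" "a \<in> Ob A \<Longrightarrow> FO (mid A) [a] = a"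
  by (simp_all add: mid_def)

lemma mpoint_fields [simp]: "Srcs (mpoint A a) = []" "Target (mpoint A a) = A" "FO (mpoint A a) [] = a"
  by (simp_all add: mpoint_def)

lemma Perm_morphism_mid: "small_permcat A \<Longrightarrow> Perm_morphism (mid A)"
  using multilinear_mid[of A] by (simp add: Perm_morphism_def small_permcat_def)

lemma Perm_morphism_mpoint: "small_permcat A \<Longrightarrow> a \<in> Ob A \<Longrightarrow> Perm_morphism (mpoint A a)"
  using multilinear_mpoint[of A a] by (simp add: Perm_morphism_def small_permcat_def)

section \<open>Smallness\<close>

text \<open>The universe is uncountable, so countable sets are strictly smaller. This serves the
  finite case of the next lemma and the countable sets of spans.\<close>

lemma countable_lesspoll_universe:
  fixes X :: "'a set"
  assumes "universe TYPE('v)" "countable X"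
  shows "X \<prec> (UNIV :: 'v set)"
proof -
  have "X \<lesssim> (UNIV :: nat set)"
    using assms(2) by (auto simp: countable_def lepoll_def)
  also have "(UNIV :: nat set) \<prec> (UNIV :: 'v set)"
    using assms(1) by (simp add: universe_def)
  finally show ?thesis .
qed

text \<open>A function is a subset of a product, and the strong limit condition bounds power sets of
  small subsets of \<open>'v\<close>. It remains to inject the product into such a subset: if one of
  two nonempty factors is infinite, the larger factor dominates the product. Two finite factors fall
  under countability.\<close>

lemma Pow_Times_lesspoll_universe:
  fixes X Y :: "'v set"
  assumes u: "universe TYPE('v)" and X: "small X" and Y: "small Y"
  shows "Pow (X \<times> Y) \<prec> (UNIV :: 'v set)"
proof (cases "finite X \<and> finite Y")
  case True
  then show ?thesis
    by (intro countable_lesspoll_universe u countable_finite) simp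
next
  case False
  have "\<exists>Z :: 'v set. small Z \<and> X \<times> Y \<lesssim> Z"
  proof (cases "X = {} \<or> Y = {}")
    case True
    then have "X \<times> Y \<lesssim> X" by (cases "X = {}") auto
    with X show ?thesis by (intro exI[of _ X] conjI)
  next
    case ne: False
    show ?thesis
    proof (cases "(card_of Y, card_of X) \<in> ordLeq")
      case True
      then have "infinite X" using False card_of_ordLeq_finite[of Y X] True by argo
      then have "(card_of (X \<times> Y), card_of X) \<in> ordLeq"
        using card_of_Times_infinite[of X Y] True ne ordIso_imp_ordLeq by metis
      then have "X \<times> Y \<lesssim> X" unfolding lepoll_def card_of_ordLeq .
      with X show ?thesis by (intro exI[of _ X] conjI)
    next
      case F: False
      have le: "(card_of X, card_of Y) \<in> ordLeq"
        using F ordLeq_total[OF card_of_Well_order card_of_Well_order, of X Y] by argo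
      then have "infinite Y" using False card_of_ordLeq_finite[of X Y] by argo
      then have "(card_of (X \<times> Y), card_of Y) \<in> ordLeq"
        using card_of_Times_infinite[of Y X] le ne ordIso_imp_ordLeq by metis
      then have "X \<times> Y \<lesssim> Y" unfolding lepoll_def card_of_ordLeq .
      with Y show ?thesis by (intro exI[of _ Y] conjI)
    qed
  qed
  then obtain Z :: "'v set" and f where Z: "small Z" and f: "inj_on f (X \<times> Y)" "f ` (X \<times> Y) \<subseteq> Z"
    unfolding lepoll_def by metis
  have "inj_on ((`) f) (Pow (X \<times> Y))" using f(1) by (rule inj_on_image_Pow)
  moreover have "((`) f) ` Pow (X \<times> Y) \<subseteq> Pow Z" using f(2) by fast
  ultimately have "Pow (X \<times> Y) \<lesssim> Pow Z" unfolding lepoll_def by (intro exI conjI)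
  also have "Pow Z \<prec> (UNIV :: 'v set)" using u Z by (simp add: universe_def)
  finally show ?thesis .
qed

section \<open>Permutative categories of homomorphisms of abelian groups\<close>

lemma set_Cons_sing_image [simp]: "xs \<in> set_Cons X ((\<lambda>y. [y]) ` Y) \<longleftrightarrow> (\<exists>x\<in>X. \<exists>y\<in>Y. xs = [x, y])"
  by (auto simp: set_Cons_def)

text \<open>\<open>enc\<close> is chosen by \<open>SOME\<close>, so it is injective only when an
  injection into \<open>'v\<close> exists. The cardinality lemmas serve to provide one in each
  case.\<close>

lemma dec_enc:
  assumes "\<exists>e :: 'a \<Rightarrow> 'v. inj_on e X"
  shows "inj_on (enc X :: 'a \<Rightarrow> 'v) X" "x \<in> X \<Longrightarrow> dec X (enc X x :: 'v) = x"
proof -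
  show *: "inj_on (enc X :: 'a \<Rightarrow> 'v) X"
    using assms unfolding enc_def by (rule someI_ex)
  show "x \<in> X \<Longrightarrow> dec X (enc X x :: 'v) = x"
    using * unfolding dec_def by (rule inv_into_f_f)
qed

lemma encode_permcat_fields:
  assumes "\<exists>e :: 'o \<Rightarrow> 'v. inj_on e (Ob P)" "\<exists>e :: 'm \<Rightarrow> 'v. inj_on e (Ar P)"
  defines "e \<equiv> enc (Ob P) :: 'o \<Rightarrow> 'v" and "E \<equiv> enc (Ar P) :: 'm \<Rightarrow> 'v"
  shows "Ob (encode_permcat P) = e ` Ob P" "Ar (encode_permcat P) = E ` Ar P"
    "u \<in> Ar P \<Longrightarrow> Src (encode_permcat P) (E u) = e (Src P u)"
    "u \<in> Ar P \<Longrightarrow> Tgt (encode_permcat P) (E u) = e (Tgt P u)"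
    "a \<in> Ob P \<Longrightarrow> Idn (encode_permcat P) (e a) = E (Idn P a)"
    "u \<in> Ar P \<Longrightarrow> v \<in> Ar P \<Longrightarrow> Cmp (encode_permcat P) (E u) (E v) = E (Cmp P u v)"
    "Zer (encode_permcat P) = e (Zer P)"
    "a \<in> Ob P \<Longrightarrow> b \<in> Ob P \<Longrightarrow> Add (encode_permcat P) (e a) (e b) = e (Add P a b)"
    "u \<in> Ar P \<Longrightarrow> v \<in> Ar P \<Longrightarrow> AddA (encode_permcat P) (E u) (E v) = E (AddA P u v)"
    "a \<in> Ob P \<Longrightarrow> b \<in> Ob P \<Longrightarrow> Twist (encode_permcat P) (e a) (e b) = E (Twist P a b)"
    "a \<in> Ob P \<Longrightarrow> b \<in> Ob P \<Longrightarrow> topspace (HTop (encode_permcat P) (e a) (e b)) =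
      dec (Ar P) -` topspace (HTop P a b) \<inter> E ` Hom P a b"
  using dec_enc(2)[OF assms(1)] dec_enc(2)[OF assms(2)]
  by (simp_all add: encode_permcat_def Let_def e_def E_def topspace_pullback_topology)

lemma encode_discrete:
  fixes P :: "('o, 'm) permcat"
  assumes "discrete_permcat P" "\<exists>e :: 'o \<Rightarrow> 'v. inj_on e (Ob P)" "\<exists>e :: 'm \<Rightarrow> 'v. inj_on e (Ar P)"
  shows "discrete_permcat (encode_permcat P :: ('v, 'v) permcat)"
proof -
  interpret discrete_permcat P by fact
  note [simp] = encode_permcat_fields[OF assms(2,3)]
  note dE = dec_enc[OF assms(3)]
  note de = dec_enc[OF assms(2)]
  show ?thesis
  proof
    show "Ar (encode_permcat P :: ('v, 'v) permcat) = Idn (encode_permcat P) ` Ob (encode_permcat P)"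
      by (auto simp: Ar_eq image_iff)
    fix a b :: 'v
    assume "a \<in> Ob (encode_permcat P)" "b \<in> Ob (encode_permcat P)"
    then obtain x y where xy [simp]: "a = enc (Ob P) x" "x \<in> Ob P" "b = enc (Ob P) y" "y \<in> Ob P" by auto
    have "Hom (encode_permcat P) a b = (enc (Ar P) ` Hom P x y :: 'v set)"
      using inj_on_eq_iff[OF de(1)] arr_idn by (auto simp: Hom_iff)
    then show "topspace (HTop (encode_permcat P) a b) = Hom (encode_permcat P) a b"
      using dE(2) by (auto simp: topspace Hom_iff)
  qed (auto simp: add_ac)
qed

lemma disc_fields [simp]: "Ob (disc A) = carrier A" "Ar (disc A) = carrier A" "Src (disc A) = id" "Tgt (disc A) = id"
    "Idn (disc A) = id" "Cmp (disc A) y x = y" "Zer (disc A) = \<one>\<^bsub>A\<^esub>" "Add (disc A) = (\<otimes>\<^bsub>A\<^esub>)"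
    "AddA (disc A) = (\<otimes>\<^bsub>A\<^esub>)" "Twist (disc A) a b = a \<otimes>\<^bsub>A\<^esub> b"
  by (simp_all add: disc_def)

lemma disc_discrete:
  assumes "comm_group A"
  shows "discrete_permcat (disc A)"
proof -
  interpret comm_group A by fact
  show ?thesis
    by unfold_locales (auto simp: m_assoc intro: m_comm, auto simp: disc_def Hom_def split: if_splits)
qed

lemma small_permcat_disc: "comm_group A \<Longrightarrow> small (carrier A) \<Longrightarrow> small_permcat (disc A)"
  using discrete_permcat.permutative[OF disc_discrete] by (simp add: small_permcat_def)

lemma disc_fun_lin_map:
  "disc_fun A B h = lin_map [disc A] (disc B) (\<lambda>xs. h (hd xs))"
  unfolding disc_fun_def lin_map_def by (rule mk_mfun_cong) auto

lemma disc_fun_fields [simp]: "Srcs (disc_fun A B h) = [disc A]" "Target (disc_fun A B h) = disc B"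
    "a \<in> carrier A \<Longrightarrow> FO (disc_fun A B h) [a] = h a" "a \<in> carrier A \<Longrightarrow> FA (disc_fun A B h) [a] = h a"
    "a \<in> carrier A \<Longrightarrow> b \<in> carrier A \<Longrightarrow> Lin (disc_fun A B h) 0 [a] b = h (a \<otimes>\<^bsub>A\<^esub> b)"
  by (simp_all add: disc_fun_def)

lemma disc_fun_cong: "comm_group A \<Longrightarrow> (\<And>a. a \<in> carrier A \<Longrightarrow> h a = h' a) \<Longrightarrow> disc_fun A B h = disc_fun A B h'"
  unfolding disc_fun_lin_map
  by (rule lin_map_cong) (auto intro: discrete_permcat.permutative disc_discrete)

lemma disc_fun_eq_iff:
  assumes "comm_group A"
  shows "disc_fun A B h = disc_fun A B h' \<longleftrightarrow> (\<forall>a\<in>carrier A. h a = h' a)"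
  using disc_fun_cong[OF assms, of h h'] disc_fun_fields(3) by metis

context
  fixes A B :: "'v monoid"
  assumes A: "comm_group A" and B: "comm_group B"
begin

interpretation A: comm_group A by (rule A)
interpretation B: comm_group B by (rule B)
interpretation dA: discrete_permcat "disc A" by (rule disc_discrete[OF A])
interpretation dB: discrete_permcat "disc B" by (rule disc_discrete[OF B])

lemma hom_closed': "h \<in> hom A B \<Longrightarrow> a \<in> carrier A \<Longrightarrow> h a \<in> carrier B"
  by (auto simp: hom_def)

lemma hom_one': "h \<in> hom A B \<Longrightarrow> h \<one>\<^bsub>A\<^esub> = \<one>\<^bsub>B\<^esub>"
  by (rule hom_one) (simp_all add: A.is_group B.is_group)

lemma hom_mult': "h \<in> hom A B \<Longrightarrow> a \<in> carrier A \<Longrightarrow> b \<in> carrier A \<Longrightarrow> h (a \<otimes>\<^bsub>A\<^esub> b) = h a \<otimes>\<^bsub>B\<^esub> h b"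
  by (auto simp: hom_def)

lemma multilinear_disc_fun:
  assumes "h \<in> hom A B"
  shows "multilinear_functor (disc_fun A B h)"
  unfolding disc_fun_lin_map using assms
  by (intro multilinear_lin_map dB.discrete_permcat_axioms)
    (auto simp: multiadditive_def hom_closed' hom_one' hom_mult' intro: dA.permutative)

text \<open>The structure morphism of a lax functor is here an arrow of \<open>disc B\<close>, so
  its source and target coincide, which is additivity of the functor on objects.\<close>

lemma lax_functors_disc: "lax_functors (disc A) (disc B) = disc_fun A B ` hom A B"
proof safe
  fix f assume "f \<in> lax_functors (disc A) (disc B)"
  then have f: "multilinear_functor f" "Srcs f = [disc A]" "Target f = disc B"
    by (auto simp: lax_functors_def)
  have d: "discrete_permcat (Target f)" using f(3) dB.discrete_permcat_axioms by simp
  note m = multilinear_discrete[OF f(1) d, unfolded f(2,3)]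
  have m': "FO f [a] \<in> carrier B" "b \<in> carrier A \<Longrightarrow> FO f [a \<otimes>\<^bsub>A\<^esub> b] = FO f [a] \<otimes>\<^bsub>B\<^esub> FO f [b]"
    if "a \<in> carrier A" for a b
    using m(2) that by (auto simp: multiadditive_def)
  have "f = disc_fun A B (\<lambda>a. FO f [a])"
    unfolding disc_fun_lin_map by (subst m(1), rule lin_map_cong) (auto intro: dA.permutative)
  moreover have "(\<lambda>a. FO f [a]) \<in> hom A B" using m' by (auto simp: hom_def)
  ultimately show "f \<in> disc_fun A B ` hom A B" by blast
qed (auto simp: lax_functors_def multilinear_disc_fun)

lemma lax_add_disc:
  assumes h: "h \<in> hom A B" "h' \<in> hom A B"
  shows "lax_add (disc A) (disc B) (disc_fun A B h) (disc_fun A B h') = disc_fun A B (\<lambda>a. h a \<otimes>\<^bsub>B\<^esub> h' a)"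
  unfolding lax_add_def disc_fun_def[of A B "\<lambda>a. h a \<otimes>\<^bsub>B\<^esub> h' a"]
proof (rule mk_mfun_cong, goal_cases)
  case (3 i xs b)
  then show ?case
    using hom_mult'[OF h(1)] hom_mult'[OF h(2)] hom_closed'[OF h(1)] hom_closed'[OF h(2)]
    by (auto simp: B.m_assoc B.m_lcomm)
qed auto

lemma lax_zero_disc: "lax_zero (disc A) (disc B) = disc_fun A B (\<lambda>_. \<one>\<^bsub>B\<^esub>)"
  unfolding lax_zero_def disc_fun_def by (rule mk_mfun_cong) auto

lemma hom_pointwise_mult:
  "h \<in> hom A B \<Longrightarrow> h' \<in> hom A B \<Longrightarrow> (\<lambda>a. h a \<otimes>\<^bsub>B\<^esub> h' a) \<in> hom A B" "(\<lambda>_. \<one>\<^bsub>B\<^esub>) \<in> hom A B"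
  by (auto simp: hom_def Pi_iff B.m_ac)

abbreviation "hom_category \<equiv> functor_category (disc A) (disc B)"

lemma hom_category_fields: "Ob hom_category = lax_functors (disc A) (disc B)" "Ar hom_category = monoidal_trans (disc A) (disc B)"
   "Src hom_category = Dom" "Tgt hom_category = Codom" "Zer hom_category = lax_zero (disc A) (disc B)" "Add hom_category = lax_add (disc A) (disc B)"
  by (simp_all add: functor_category_def)

lemma Idn_hom_category: "Idn hom_category (disc_fun A B h) = \<lparr>Dom = disc_fun A B h, Codom = disc_fun A B h, Cpt = (\<lambda>a\<in>carrier A. h a)\<rparr>"
  by (simp add: functor_category_def cong: restrict_cong)

text \<open>Components are arrows of \<open>disc B\<close>, so the two functors agree on objects. A
  \<open>disc_fun\<close> is determined by its values there, hence they are equal as records and the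
  transformation is an identity.\<close>

lemma monoidal_trans_disc: "monoidal_trans (disc A) (disc B) = Idn hom_category ` lax_functors (disc A) (disc B)"
proof safe
  fix t assume t: "t \<in> monoidal_trans (disc A) (disc B)"
  then obtain h h' where h: "h \<in> hom A B" "Dom t = disc_fun A B h" "Codom t = disc_fun A B h'"
    by (auto simp: monoidal_trans_def lax_functors_disc)
  have c: "Cpt t a = h a \<and> h' a = h a" if "a \<in> carrier A" for a
    using t that by (auto simp: monoidal_trans_def h Hom_def)
  then have "Codom t = Dom t" by (auto simp: h disc_fun_eq_iff[OF A])
  moreover have "Cpt t \<in> extensional (carrier A)" using t by (simp add: monoidal_trans_def)
  then have "Cpt t = (\<lambda>a\<in>carrier A. h a)" using c by (auto simp: extensional_def)
  ultimately have "t = Idn hom_category (disc_fun A B h)"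
    unfolding Idn_hom_category by (intro montrans.equality) (simp_all add: h(2))
  then show "t \<in> Idn hom_category ` lax_functors (disc A) (disc B)"
    using h by (auto simp: lax_functors_disc)
next
  fix f assume "f \<in> lax_functors (disc A) (disc B)"
  then obtain h where h: "h \<in> hom A B" "f = disc_fun A B h" by (auto simp: lax_functors_disc)
  show "Idn hom_category f \<in> monoidal_trans (disc A) (disc B)"
    using h unfolding h(2) Idn_hom_category
    by (auto simp: monoidal_trans_def lax_functors_disc Hom_def hom_one' hom_mult' hom_closed')
qed

lemma Cmp_hom_category: "Cmp hom_category s t = \<lparr>Dom = Dom t, Codom = Codom s, Cpt = (\<lambda>a\<in>carrier A. Cpt s a)\<rparr>"
  and AddA_hom_category: "AddA hom_category s t = \<lparr>Dom = lax_add (disc A) (disc B) (Dom s) (Dom t),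
    Codom = lax_add (disc A) (disc B) (Codom s) (Codom t), Cpt = (\<lambda>a\<in>carrier A. Cpt s a \<otimes>\<^bsub>B\<^esub> Cpt t a)\<rparr>"
  and Twist_hom_category: "Twist hom_category f g = \<lparr>Dom = lax_add (disc A) (disc B) f g, Codom = lax_add (disc A) (disc B) g f,
    Cpt = (\<lambda>a\<in>carrier A. FO f [a] \<otimes>\<^bsub>B\<^esub> FO g [a])\<rparr>"
  by (simp_all add: functor_category_def)

lemma functor_category_discrete: "discrete_permcat hom_category"
proof
  show "Ar hom_category = Idn hom_category ` Ob hom_category" by (simp add: hom_category_fields monoidal_trans_disc)
  show "Zer hom_category \<in> Ob hom_category" by (auto simp: hom_category_fields lax_functors_disc lax_zero_disc hom_pointwise_mult)
  fix f g assume "f \<in> Ob hom_category" "g \<in> Ob hom_category"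
  then obtain h k where h [simp]: "h \<in> hom A B" "k \<in> hom A B" and [simp]: "f = disc_fun A B h" "g = disc_fun A B k"
    by (auto simp: hom_category_fields lax_functors_disc)
  note [simp] = hom_category_fields Idn_hom_category lax_add_disc lax_zero_disc hom_pointwise_mult disc_fun_eq_iff[OF A] hom_closed'[OF h(1)]
    hom_closed'[OF h(2)]
  show "Src hom_category (Idn hom_category f) = f" "Tgt hom_category (Idn hom_category f) = f" by simp_all
  show "Cmp hom_category (Idn hom_category f) (Idn hom_category f) = Idn hom_category f"
    by (simp add: Cmp_hom_category cong: restrict_cong)
  show "Add hom_category f g \<in> Ob hom_category" by (auto simp: lax_functors_disc)
  show "Add hom_category f g = Add hom_category g f" by (simp add: B.m_comm)
  show "Add hom_category f (Zer hom_category) = f" by simp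
  show "AddA hom_category (Idn hom_category f) (Idn hom_category g) = Idn hom_category (Add hom_category f g)"
    by (simp add: AddA_hom_category cong: restrict_cong)
  show "Twist hom_category f g = Idn hom_category (Add hom_category f g)"
    by (simp add: Twist_hom_category B.m_comm cong: restrict_cong)
  \<comment> \<open>Pulling back along \<open>Cpt\<close> keeps only the transformations whose
    components lie in the product space. The next step shows that this excludes none.\<close>
  have t: "topspace (HTop hom_category f g) = {t \<in> monoidal_trans (disc A) (disc B). Dom t = f \<and> Codom t = g \<and>
      Cpt t \<in> (\<Pi>\<^sub>E a\<in>carrier A. topspace (HTop (disc B) (FO f [a]) (FO g [a])))}"
    unfolding functor_category_def by (auto simp only: topspace_pullback_topology permcat.simps topspace_product_topology disc_fields)
  have "Cpt t \<in> (\<Pi>\<^sub>E a\<in>carrier A. topspace (HTop (disc B) (FO f [a]) (FO g [a])))"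
    if "t \<in> monoidal_trans (disc A) (disc B)" "Dom t = f" "Codom t = g" for t
    using that dB.topspace by (auto simp: monoidal_trans_def PiE_iff)
  then show "topspace (HTop hom_category f g) = Hom hom_category f g" unfolding t by (simp only: Hom_def hom_category_fields) blast
  fix f' assume "f' \<in> Ob hom_category"
  then obtain l where l: "l \<in> hom A B" and [simp]: "f' = disc_fun A B l"
    by (auto simp: hom_category_fields lax_functors_disc)
  show "Add hom_category (Add hom_category f g) f' = Add hom_category f (Add hom_category g f')" using l by (simp add: B.m_assoc hom_closed'[OF l])
qed

end

definition small_ab :: "'v monoid \<Rightarrow> bool" where
  "small_ab A \<longleftrightarrow> comm_group A \<and> small (carrier A)"

lemma lesspoll_inj: "(X :: 'a set) \<prec> (UNIV :: 'v set) \<Longrightarrow> \<exists>e :: 'a \<Rightarrow> 'v. inj_on e X"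
  using lesspoll_imp_lepoll unfolding lepoll_def by metis

lemma small_image: "(X :: 'a set) \<prec> (UNIV :: 'v set) \<Longrightarrow> small (e ` X :: 'v set)"
  unfolding small_def by (rule lesspoll_trans1[OF image_lepoll])

lemma multiadditive_pairI:
  assumes "\<And>x y. x \<in> Ob A \<Longrightarrow> y \<in> Ob B \<Longrightarrow> h [x, y] \<in> Ob C"
    "\<And>u v. u \<in> Ar A \<Longrightarrow> v \<in> Ar B \<Longrightarrow> h [Src A u, Src B v] = h [Tgt A u, Tgt B v]"
    "\<And>y. y \<in> Ob B \<Longrightarrow> Zer A \<in> Ob A \<Longrightarrow> h [Zer A, y] = Zer C"
    "\<And>x. x \<in> Ob A \<Longrightarrow> Zer B \<in> Ob B \<Longrightarrow> h [x, Zer B] = Zer C"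
    "\<And>x x' y. x \<in> Ob A \<Longrightarrow> x' \<in> Ob A \<Longrightarrow> y \<in> Ob B \<Longrightarrow> h [Add A x x', y] = Add C (h [x, y]) (h [x', y])"
    "\<And>x y y'. x \<in> Ob A \<Longrightarrow> y \<in> Ob B \<Longrightarrow> y' \<in> Ob B \<Longrightarrow> h [x, Add B y y'] = Add C (h [x, y]) (h [x, y'])"
  shows "multiadditive [A, B] C h"
  using assms by (auto simp: multiadditive_def less_Suc_eq)

lemma mcomp_disc_fun:
  fixes A B C :: "'v monoid"
  assumes "comm_group A" "comm_group B" "comm_group C" "h \<in> hom A B" "k \<in> hom B C"
  shows "mcomp (disc_fun B C k) [disc_fun A B h] = disc_fun A C (\<lambda>a. k (h a))"
proof -
  have "mcomp (disc_fun B C k) [disc_fun A B h] = lin_map [disc A] (disc C)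
    (\<lambda>xs. FO (disc_fun B C k) (map2 FO [disc_fun A B h] (chop [1] xs)))"
    using mcomp_discrete[of "disc_fun B C k" "[disc_fun A B h]"] assms
    by (simp add: multilinear_disc_fun disc_discrete multilinear_typed discrete_permcat.permutative)
  also have "\<dots> = disc_fun A C (\<lambda>a. k (h a))"
    unfolding disc_fun_lin_map using assms
    by (intro lin_map_cong) (auto simp: disc_discrete discrete_permcat.permutative hom_closed')
  finally show ?thesis .
qed

lemma mid_disc:
  assumes "comm_group A"
  shows "mid (disc A) = disc_fun A A (\<lambda>a. a)"
  unfolding mid_def disc_fun_def by (rule mk_mfun_cong) auto

context
  assumes univ: "universe TYPE('v)"
begin

context
  fixes A B :: "'v monoid"
  assumes AB: "small_ab A" "small_ab B"
begin

interpretation A: comm_group A using AB by (simp add: small_ab_def)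
interpretation B: comm_group B using AB by (simp add: small_ab_def)

lemma comm_groups_AB: "comm_group A" "comm_group B" by unfold_locales

text \<open>A homomorphism is recovered from its graph, a subset of
  \<open>carrier A \<times> carrier B\<close>, so the bound on power sets of products
  applies.\<close>

lemma lax_functors_lesspoll: "lax_functors (disc A) (disc B) \<prec> (UNIV :: 'v set)"
proof -
  let ?g = "\<lambda>f. (\<lambda>a. (a, FO f [a])) ` carrier A"
  have "inj_on ?g (lax_functors (disc A) (disc B))"
  proof (rule inj_onI)
    fix f f' assume f: "f \<in> lax_functors (disc A) (disc B)" "f' \<in> lax_functors (disc A) (disc B)" "?g f = ?g f'"
    then obtain h h' where h: "f = disc_fun A B h" "f' = disc_fun A B h'"
      by (auto simp: lax_functors_disc[OF comm_groups_AB])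
    have "h a = h' a" if "a \<in> carrier A" for a
    proof -
      have "(a, FO f [a]) \<in> ?g f'" using f(3) that by blast
      then show ?thesis using that by (auto simp: h)
    qed
    then show "f = f'" by (simp add: h disc_fun_eq_iff[OF comm_groups_AB(1)])
  qed
  moreover have "?g ` lax_functors (disc A) (disc B) \<subseteq> Pow (carrier A \<times> carrier B)"
    by (auto simp: lax_functors_disc[OF comm_groups_AB] hom_closed'[OF comm_groups_AB])
  ultimately have "lax_functors (disc A) (disc B) \<lesssim> Pow (carrier A \<times> carrier B)"
    unfolding lepoll_def by (intro exI conjI)
  also have "\<dots> \<prec> (UNIV :: 'v set)"
    using AB by (intro Pow_Times_lesspoll_universe univ) (auto simp: small_ab_def)
  finally show ?thesis .
qed

lemma monoidal_trans_lesspoll: "monoidal_trans (disc A) (disc B) \<prec> (UNIV :: 'v set)"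
  unfolding monoidal_trans_disc[OF comm_groups_AB] by (rule lesspoll_trans1[OF image_lepoll lax_functors_lesspoll])

lemmas lax_inj = lesspoll_inj[OF lax_functors_lesspoll]
lemmas trans_inj = lesspoll_inj[OF monoidal_trans_lesspoll]

lemma Perm_hom_discrete: "discrete_permcat (Perm_hom (disc A) (disc B))"
  unfolding Perm_hom_def
  by (intro encode_discrete functor_category_discrete comm_groups_AB)
    (use lax_inj trans_inj in \<open>simp_all add: hom_category_fields[OF comm_groups_AB]\<close>)

lemmas enc_fields = encode_permcat_fields[where P = "functor_category (disc A) (disc B)",
    unfolded hom_category_fields[OF comm_groups_AB], OF lax_inj trans_inj, folded Perm_hom_def]

lemma small_permcat_Perm_hom: "small_permcat (Perm_hom (disc A) (disc B))"
  using discrete_permcat.permutative[OF Perm_hom_discrete]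
    small_image[OF lax_functors_lesspoll] small_image[OF monoidal_trans_lesspoll]
  by (simp add: small_permcat_def enc_fields(1,2))

lemma Ob_Perm_hom: "Ob (Perm_hom (disc A) (disc B)) = hom_point A B ` hom A B"
  by (simp add: enc_fields(1) lax_functors_disc[OF comm_groups_AB] image_image hom_point_def)

lemma dec_hom_point: "h \<in> hom A B \<Longrightarrow> dec_fun (disc A) (disc B) (hom_point A B h) = disc_fun A B h"
  unfolding hom_point_def by (rule dec_enc(2)[OF lax_inj]) (simp add: lax_functors_disc[OF comm_groups_AB])

lemma hom_point_cong: "(\<And>a. a \<in> carrier A \<Longrightarrow> h a = h' a) \<Longrightarrow> hom_point A B h = hom_point A B h'"
  unfolding hom_point_def by (rule arg_cong[OF disc_fun_cong[OF comm_groups_AB(1)]])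

lemma Add_Perm_hom:
  "h \<in> hom A B \<Longrightarrow> k \<in> hom A B \<Longrightarrow>
    Add (Perm_hom (disc A) (disc B)) (hom_point A B h) (hom_point A B k) = hom_point A B (\<lambda>a. h a \<otimes>\<^bsub>B\<^esub> k a)"
  using enc_fields(8)[of "disc_fun A B h" "disc_fun A B k"]
  by (simp add: hom_point_def lax_functors_disc[OF comm_groups_AB] lax_add_disc[OF comm_groups_AB])

lemma Zer_Perm_hom: "Zer (Perm_hom (disc A) (disc B)) = hom_point A B (\<lambda>_. \<one>\<^bsub>B\<^esub>)"
  using enc_fields(7) by (simp add: hom_point_def lax_zero_disc[OF comm_groups_AB])

lemma Idn_Perm_hom:
  assumes "h \<in> hom A B"
  shows "Idn (Perm_hom (disc A) (disc B)) (hom_point A B h) =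
      enc_trans (disc A) (disc B) (Idn (functor_category (disc A) (disc B)) (disc_fun A B h))"
    "dec_trans (disc A) (disc B) (Idn (Perm_hom (disc A) (disc B)) (hom_point A B h)) =
      Idn (functor_category (disc A) (disc B)) (disc_fun A B h)"
proof -
  have f: "disc_fun A B h \<in> lax_functors (disc A) (disc B)" using assms by (simp add: lax_functors_disc[OF comm_groups_AB])
  show 1: "Idn (Perm_hom (disc A) (disc B)) (hom_point A B h) =
      enc_trans (disc A) (disc B) (Idn (functor_category (disc A) (disc B)) (disc_fun A B h))"
    using enc_fields(5)[OF f] by (simp add: hom_point_def)
  show "dec_trans (disc A) (disc B) (Idn (Perm_hom (disc A) (disc B)) (hom_point A B h)) =
      Idn (functor_category (disc A) (disc B)) (disc_fun A B h)"
    unfolding 1 by (rule dec_enc(2)[OF trans_inj]) (use f in \<open>simp add: monoidal_trans_disc[OF comm_groups_AB]\<close>)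
qed

lemma Perm_hom_arrE:
  assumes "u \<in> Ar (Perm_hom (disc A) (disc B))"
  obtains h where "h \<in> hom A B" "u = Idn (Perm_hom (disc A) (disc B)) (hom_point A B h)"
    "Src (Perm_hom (disc A) (disc B)) u = hom_point A B h" "Tgt (Perm_hom (disc A) (disc B)) u = hom_point A B h"
  using discrete_permcat.arr_idn[OF Perm_hom_discrete assms] that by (auto simp: Ob_Perm_hom)

lemma ev_lin_map:
  "ev (disc A) (disc B) = lin_map [Perm_hom (disc A) (disc B), disc A] (disc B)
     (\<lambda>xs. FO (dec_fun (disc A) (disc B) (xs ! 0)) [xs ! 1])"
  unfolding ev_def lin_map_def
proof (rule mk_mfun_cong, goal_cases)
  case (2 us)
  then show ?case
    by (auto elim!: Perm_hom_arrE simp: Let_def Idn_Perm_hom(2) dec_hom_point Idn_hom_category[OF comm_groups_AB])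
next
  case (3 i xs x)
  then consider "i = 0" | "i = 1" by fastforce
  then show ?case
    using 3 by cases (auto simp: Let_def Ob_Perm_hom Add_Perm_hom dec_hom_point hom_pointwise_mult[OF comm_groups_AB])
qed simp

lemma multiadditive_ev:
  "multiadditive [Perm_hom (disc A) (disc B), disc A] (disc B) (\<lambda>xs. FO (dec_fun (disc A) (disc B) (xs ! 0)) [xs ! 1])"
  by (rule multiadditive_pairI)
    (auto elim!: Perm_hom_arrE simp: Ob_Perm_hom Add_Perm_hom Zer_Perm_hom dec_hom_point hom_pointwise_mult[OF comm_groups_AB]
      hom_closed'[OF comm_groups_AB] hom_one'[OF comm_groups_AB] hom_mult'[OF comm_groups_AB])

lemma Perm_morphism_ev: "Perm_morphism (ev (disc A) (disc B))"
proof -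
  have "multilinear_functor (ev (disc A) (disc B))"
    unfolding ev_lin_map
    by (intro multilinear_lin_map multiadditive_ev disc_discrete comm_groups_AB)
      (auto intro: discrete_permcat.permutative Perm_hom_discrete disc_discrete comm_groups_AB)
  then show ?thesis
    using small_permcat_Perm_hom AB small_permcat_disc
    by (auto simp: Perm_morphism_def ev_def small_ab_def)
qed

lemma Perm_morphism_disc_fun: "h \<in> hom A B \<Longrightarrow> Perm_morphism (disc_fun A B h)"
  using AB small_permcat_disc multilinear_disc_fun[OF comm_groups_AB] by (auto simp: Perm_morphism_def small_ab_def)

end

section \<open>Composition of homomorphisms inside \<open>Perm\<close>\<close>

context
  fixes A B C :: "'v monoid"
  assumes ABC: "small_ab A" "small_ab B" "small_ab C"
begin

lemma comm_groups_ABC: "comm_group A" "comm_group B" "comm_group C"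
  using ABC by (auto simp: small_ab_def)

lemma horizontal_disc:
  assumes "k \<in> hom B C" "h \<in> hom A B"
  shows "horizontal (disc A) (disc C) (Idn (functor_category (disc B) (disc C)) (disc_fun B C k))
      (Idn (functor_category (disc A) (disc B)) (disc_fun A B h))
    = Idn (functor_category (disc A) (disc C)) (disc_fun A C (\<lambda>a. k (h a)))"
  using assms hom_closed'[OF comm_groups_ABC(1,2) assms(2)]
  by (simp add: Idn_hom_category comm_groups_ABC horizontal_def mcomp_disc_fun cong: restrict_cong)

lemma whisker_add_disc:
  assumes k: "k \<in> hom B C" and h: "h \<in> hom A B" "h' \<in> hom A B"
  shows "whisker_add (disc A) (disc B) (disc C) (disc_fun B C k) (disc_fun A B h) (disc_fun A B h')
    = Idn (functor_category (disc A) (disc C)) (disc_fun A C (\<lambda>a. k (h a \<otimes>\<^bsub>B\<^esub> h' a)))"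
proof -
  have c: "(\<lambda>a. k (h a)) \<in> hom A C" "(\<lambda>a. k (h' a)) \<in> hom A C"
    using hom_compose[OF h(1) k] hom_compose[OF h(2) k] by (simp_all add: comp_def)
  show ?thesis
    using assms c hom_pointwise_mult(1)[OF comm_groups_ABC(1,2) h] hom_closed'[OF comm_groups_ABC(1,2) h(1)] hom_closed'[OF comm_groups_ABC(1,2) h(2)]
    by (simp add: Idn_hom_category comm_groups_ABC whisker_add_def mcomp_disc_fun lax_add_disc disc_fun_eq_iff hom_mult'[OF comm_groups_ABC(2,3) k]
        cong: restrict_cong)
qed

abbreviation "comp_ob \<equiv> \<lambda>xs. enc_fun (disc A) (disc C) (mcomp (dec_fun (disc B) (disc C) (xs ! 0)) [dec_fun (disc A) (disc B) (xs ! 1)])"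

lemma comp_ob:
  "k \<in> hom B C \<Longrightarrow> h \<in> hom A B \<Longrightarrow> comp_ob [hom_point B C k, hom_point A B h] = hom_point A C (\<lambda>a. k (h a))"
  using ABC by (simp add: dec_hom_point mcomp_disc_fun comm_groups_ABC) (simp add: hom_point_def)

lemma hom_comp: "k \<in> hom B C \<Longrightarrow> h \<in> hom A B \<Longrightarrow> (\<lambda>a. k (h a)) \<in> hom A C"
  using hom_compose[of h A B k C] by (simp add: comp_def)

text \<open>In variable 0 the constraint of the composition is an identity by definition. In
  variable 1 it is the whiskered structure morphism of the outer functor, which
  \<open>whisker_add_disc\<close> recognises as an identity.\<close>

lemma Perm_comp_lin_map:
  "Perm_comp (disc A) (disc B) (disc C) =
    lin_map [Perm_hom (disc B) (disc C), Perm_hom (disc A) (disc B)] (Perm_hom (disc A) (disc C)) comp_ob"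
  unfolding Perm_comp_def lin_map_def
proof (rule mk_mfun_cong, goal_cases)
  case (2 us)
  then obtain k h where kh: "k \<in> hom B C" "h \<in> hom A B"
    and us: "us = [Idn (Perm_hom (disc B) (disc C)) (hom_point B C k), Idn (Perm_hom (disc A) (disc B)) (hom_point A B h)]"
    and ends: "map2 Src [Perm_hom (disc B) (disc C), Perm_hom (disc A) (disc B)] us = [hom_point B C k, hom_point A B h]"
    by (auto elim!: Perm_hom_arrE[OF ABC(2,3)] Perm_hom_arrE[OF ABC(1,2)])
  show ?case
    unfolding ends comp_ob[OF kh] unfolding us using ABC kh
    by (simp add: Idn_Perm_hom(2) horizontal_disc Idn_Perm_hom(1)[OF ABC(1,3) hom_comp[OF kh]])
next
  case (3 i xs x)
  then obtain k h where kh: "k \<in> hom B C" "h \<in> hom A B" "xs = [hom_point B C k, hom_point A B h]"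
    using ABC by (auto simp: Ob_Perm_hom)
  consider "i = 0" | "i = 1" using 3(1) by fastforce
  then show ?case
  proof cases
    case 1
    then obtain k' where "k' \<in> hom B C" "x = hom_point B C k'" using 3 ABC by (auto simp: Ob_Perm_hom)
    then show ?thesis
      using kh 1 ABC
      by (simp add: Add_Perm_hom dec_hom_point hom_pointwise_mult comm_groups_ABC lax_add_disc)
  next
    case 2
    then obtain h' where h': "h' \<in> hom A B" "x = hom_point A B h'" using 3 ABC by (auto simp: Ob_Perm_hom)
    have c: "(\<lambda>a. h a \<otimes>\<^bsub>B\<^esub> h' a) \<in> hom A B" using kh h' by (simp add: hom_pointwise_mult comm_groups_ABC)
    then show ?thesis
      using kh h' 2 ABC comp_ob[OF kh(1) c]
      by (simp add: Add_Perm_hom dec_hom_point whisker_add_disc Idn_Perm_hom(1)[OF ABC(1,3) hom_comp[OF kh(1) c]])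
  qed
qed simp

text \<open>In the outer variable additivity is the pointwise definition of sums; in the inner
  variable it is additivity of the outer homomorphism \<open>k\<close>.\<close>

lemma multiadditive_comp_ob:
  "multiadditive [Perm_hom (disc B) (disc C), Perm_hom (disc A) (disc B)] (Perm_hom (disc A) (disc C)) comp_ob"
proof (rule multiadditive_pairI, goal_cases)
  case (1 x y)
  then show ?case using ABC comp_ob hom_comp by (auto simp: Ob_Perm_hom)
next
  case (2 u v)
  then show ?case by (auto elim!: Perm_hom_arrE[OF ABC(2,3)] Perm_hom_arrE[OF ABC(1,2)])
next
  case (3 y)
  then show ?case using ABC comp_ob[OF hom_pointwise_mult(2)] by (auto simp: Zer_Perm_hom Ob_Perm_hom comm_groups_ABC)
next
  case (4 x)
  then obtain k where k: "k \<in> hom B C" "x = hom_point B C k" using ABC by (auto simp: Ob_Perm_hom)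
  show ?case
    using comp_ob[OF k(1) hom_pointwise_mult(2)] ABC by (simp add: Zer_Perm_hom comm_groups_ABC k hom_one'[OF comm_groups_ABC(2,3) k(1)])
next
  case (5 x x' y)
  then obtain k k' h where kh: "k \<in> hom B C" "k' \<in> hom B C" "h \<in> hom A B"
    "x = hom_point B C k" "x' = hom_point B C k'" "y = hom_point A B h" using ABC by (auto simp: Ob_Perm_hom)
  show ?case
    using comp_ob[OF _ kh(3)] kh ABC by (simp add: Add_Perm_hom hom_pointwise_mult comm_groups_ABC hom_comp)
next
  case (6 x y y')
  then obtain k h h' where kh: "k \<in> hom B C" "h \<in> hom A B" "h' \<in> hom A B"
    "x = hom_point B C k" "y = hom_point A B h" "y' = hom_point A B h'" using ABC by (auto simp: Ob_Perm_hom)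
  have "hom_point A C (\<lambda>a. k (h a \<otimes>\<^bsub>B\<^esub> h' a)) = hom_point A C (\<lambda>a. k (h a) \<otimes>\<^bsub>C\<^esub> k (h' a))"
    using kh ABC by (intro hom_point_cong) (auto simp: hom_mult'[OF comm_groups_ABC(2,3) kh(1)] hom_closed'[OF comm_groups_ABC(1,2) kh(2)] hom_closed'[OF comm_groups_ABC(1,2) kh(3)])
  then show ?case
    using comp_ob[OF kh(1)] kh ABC by (simp add: Add_Perm_hom hom_pointwise_mult comm_groups_ABC hom_comp)
qed

lemma multilinear_Perm_comp: "multilinear_functor (Perm_comp (disc A) (disc B) (disc C))"
  unfolding Perm_comp_lin_map using ABC
  by (intro multilinear_lin_map multiadditive_comp_ob Perm_hom_discrete)
    (auto intro: discrete_permcat.permutative Perm_hom_discrete)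

lemma FO_Perm_comp:
  assumes "k \<in> hom B C" "h \<in> hom A B"
  shows "FO (Perm_comp (disc A) (disc B) (disc C)) [hom_point B C k, hom_point A B h] = hom_point A C (\<lambda>a. k (h a))"
  unfolding Perm_comp_lin_map using comp_ob[OF assms] assms ABC by (simp add: Ob_Perm_hom)

end

lemma FO_ev:
  fixes A B :: "'v monoid"
  assumes "small_ab A" "small_ab B" "h \<in> hom A B" "a \<in> carrier A"
  shows "FO (ev (disc A) (disc B)) [hom_point A B h, a] = h a"
  unfolding ev_lin_map[OF assms(1,2)] using assms by (simp add: Ob_Perm_hom dec_hom_point)

end

section \<open>Group completion and connected components\<close>

text \<open>Operations on quotients are defined here by saturating the set of results over all
  representatives. Once all results are equivalent to a fixed one, the saturation is the class of
  that one.\<close>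

lemma equiv_Image_eq:
  assumes "equiv A r" "S \<noteq> {}" "\<And>s. s \<in> S \<Longrightarrow> (x, s) \<in> r"
  shows "r `` S = r `` {x}"
proof -
  have "r `` {s} = r `` {x}" if "s \<in> S" for s
    using equiv_class_eq[OF assms(1) assms(3)[OF that]] by simp
  then show ?thesis using assms(2) by blast
qed

lemma (in comm_group) quotient_eq:
  assumes [simp]: "a \<in> carrier G" "b \<in> carrier G" "c \<in> carrier G" "d \<in> carrier G"
    and eq: "a \<otimes> d = c \<otimes> b"
  shows "c \<otimes> inv d = a \<otimes> inv b"
proof -
  have "c = a \<otimes> d \<otimes> inv b" using inv_solve_right[of c "a \<otimes> d" b] eq by simp
  then have "c \<otimes> inv d = a \<otimes> (d \<otimes> inv d) \<otimes> inv b"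
    by (simp only: m_assoc m_closed inv_closed assms(1-4) m_comm[of "inv b" "inv d"])
  then show ?thesis by simp
qed

context comm_monoid
begin

lemma equiv_groth_rel: "equiv (carrier G \<times> carrier G) (groth_rel G)"
proof (rule equivI)
  show "refl_on (carrier G \<times> carrier G) (groth_rel G)"
    by (auto simp: refl_on_def groth_rel_def intro: bexI[of _ \<one>])
  show "groth_rel G \<subseteq> (carrier G \<times> carrier G) \<times> carrier G \<times> carrier G"
    by (auto simp: groth_rel_def)
  show "sym (groth_rel G)"
    unfolding sym_def groth_rel_def by clarsimp (metis m_comm)
  show "trans (groth_rel G)"
    unfolding trans_def
  proof clarify
    fix a b c d e f
    assume "((a, b), (c, d)) \<in> groth_rel G" "((c, d), (e, f)) \<in> groth_rel G"
    then obtain k l where c [simp]: "a \<in> carrier G" "b \<in> carrier G" "c \<in> carrier G" "d \<in> carrier G"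
      "e \<in> carrier G" "f \<in> carrier G" "k \<in> carrier G" "l \<in> carrier G"
      and k: "a \<otimes> d \<otimes> k = c \<otimes> b \<otimes> k" and l: "c \<otimes> f \<otimes> l = e \<otimes> d \<otimes> l"
      by (auto simp: groth_rel_def)
    \<comment> \<open>The monoid need not be cancellative, so the middle denominator
      \<open>d\<close> is absorbed into the new witness together with \<open>k\<close> and
      \<open>l\<close>.\<close>
    have "a \<otimes> f \<otimes> (d \<otimes> k \<otimes> l) = (a \<otimes> d \<otimes> k) \<otimes> (f \<otimes> l)" by (simp add: m_ac)
    also have "\<dots> = (c \<otimes> f \<otimes> l) \<otimes> (b \<otimes> k)" unfolding k by (simp add: m_ac)
    also have "\<dots> = e \<otimes> b \<otimes> (d \<otimes> k \<otimes> l)" unfolding l by (simp add: m_ac)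
    finally have "\<exists>m\<in>carrier G. a \<otimes> f \<otimes> m = e \<otimes> b \<otimes> m"
      by (intro bexI[of _ "d \<otimes> k \<otimes> l"]) simp_all
    then show "((a, b), (e, f)) \<in> groth_rel G" by (simp add: groth_rel_def)
  qed
qed

lemma groth_class_mult:
  assumes [simp]: "a \<in> carrier G" "b \<in> carrier G" "c \<in> carrier G" "d \<in> carrier G"
  shows "groth_rel G `` {(a, b)} \<otimes>\<^bsub>group_completion G\<^esub> groth_rel G `` {(c, d)} = groth_rel G `` {(a \<otimes> c, b \<otimes> d)}"
  unfolding group_completion_def monoid.simps
proof (rule equiv_Image_eq[OF equiv_groth_rel])
  have "(a, b) \<in> groth_rel G `` {(a, b)}" "(c, d) \<in> groth_rel G `` {(c, d)}"
    using equiv_class_self[OF equiv_groth_rel] by simp_all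
  then show "{(a' \<otimes> c', b' \<otimes> d') |a' b' c' d'. (a', b') \<in> groth_rel G `` {(a, b)} \<and> (c', d') \<in> groth_rel G `` {(c, d)}} \<noteq> {}"
    by blast
  fix s assume "s \<in> {(a' \<otimes> c', b' \<otimes> d') |a' b' c' d'. (a', b') \<in> groth_rel G `` {(a, b)} \<and> (c', d') \<in> groth_rel G `` {(c, d)}}"
  then obtain a' b' c' d' k l where s: "s = (a' \<otimes> c', b' \<otimes> d')"
    and [simp]: "a' \<in> carrier G" "b' \<in> carrier G" "c' \<in> carrier G" "d' \<in> carrier G" "k \<in> carrier G" "l \<in> carrier G"
    and k: "a \<otimes> b' \<otimes> k = a' \<otimes> b \<otimes> k" and l: "c \<otimes> d' \<otimes> l = c' \<otimes> d \<otimes> l"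
    by (auto simp: groth_rel_def)
  have "a \<otimes> c \<otimes> (b' \<otimes> d') \<otimes> (k \<otimes> l) = (a \<otimes> b' \<otimes> k) \<otimes> (c \<otimes> d' \<otimes> l)" by (simp add: m_ac)
  also have "\<dots> = a' \<otimes> c' \<otimes> (b \<otimes> d) \<otimes> (k \<otimes> l)" unfolding k l by (simp add: m_ac)
  finally have "\<exists>m\<in>carrier G. a \<otimes> c \<otimes> (b' \<otimes> d') \<otimes> m = a' \<otimes> c' \<otimes> (b \<otimes> d) \<otimes> m"
    by (intro bexI[of _ "k \<otimes> l"]) simp_all
  then show "((a \<otimes> c, b \<otimes> d), s) \<in> groth_rel G" by (simp add: groth_rel_def s)
qed

lemma group_completion_carrierE:
  assumes "x \<in> carrier (group_completion G)"
  obtains a b where "a \<in> carrier G" "b \<in> carrier G" "x = groth_rel G `` {(a, b)}"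
  using assms by (auto simp: group_completion_def quotient_def)

lemma groth_class_closed:
  "a \<in> carrier G \<Longrightarrow> b \<in> carrier G \<Longrightarrow> groth_rel G `` {(a, b)} \<in> carrier (group_completion G)"
  by (auto simp: group_completion_def quotient_def)

lemma groth_class_eq:
  assumes "a \<in> carrier G" "b \<in> carrier G" "c \<in> carrier G" "d \<in> carrier G"
  shows "groth_rel G `` {(a, b)} = groth_rel G `` {(c, d)} \<longleftrightarrow> (\<exists>k\<in>carrier G. a \<otimes> d \<otimes> k = c \<otimes> b \<otimes> k)"
  using eq_equiv_class_iff[OF equiv_groth_rel, of "(a, b)" "(c, d)"] assms by (simp add: groth_rel_def)

lemma group_completion_one: "\<one>\<^bsub>group_completion G\<^esub> = groth_rel G `` {(\<one>, \<one>)}"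
  by (simp add: group_completion_def)

lemma comm_group_group_completion: "comm_group (group_completion G)"
proof (rule comm_groupI)
  let ?C = "group_completion G"
  show "\<one>\<^bsub>?C\<^esub> \<in> carrier ?C" by (simp add: group_completion_one groth_class_closed)
  fix x y assume "x \<in> carrier ?C" "y \<in> carrier ?C"
  then obtain a b c d where [simp]: "a \<in> carrier G" "b \<in> carrier G" "c \<in> carrier G" "d \<in> carrier G"
    and xy: "x = groth_rel G `` {(a, b)}" "y = groth_rel G `` {(c, d)}"
    by (metis group_completion_carrierE)
  show "x \<otimes>\<^bsub>?C\<^esub> y \<in> carrier ?C" by (simp add: xy groth_class_mult groth_class_closed)
  show "x \<otimes>\<^bsub>?C\<^esub> y = y \<otimes>\<^bsub>?C\<^esub> x" by (simp add: xy groth_class_mult m_comm)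
  show "\<one>\<^bsub>?C\<^esub> \<otimes>\<^bsub>?C\<^esub> x = x" by (simp add: xy groth_class_mult group_completion_one)
  have "groth_rel G `` {(b, a)} \<otimes>\<^bsub>?C\<^esub> x = \<one>\<^bsub>?C\<^esub>"
    by (simp add: xy groth_class_mult group_completion_one groth_class_eq m_comm) (use one_closed in blast)
  then show "\<exists>y\<in>carrier ?C. y \<otimes>\<^bsub>?C\<^esub> x = \<one>\<^bsub>?C\<^esub>"
    by (rule bexI) (simp add: groth_class_closed)
  fix z assume "z \<in> carrier ?C"
  then obtain e f where [simp]: "e \<in> carrier G" "f \<in> carrier G" and z: "z = groth_rel G `` {(e, f)}"
    by (metis group_completion_carrierE)
  show "x \<otimes>\<^bsub>?C\<^esub> y \<otimes>\<^bsub>?C\<^esub> z = x \<otimes>\<^bsub>?C\<^esub> (y \<otimes>\<^bsub>?C\<^esub> z)"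
    by (simp add: xy z groth_class_mult m_assoc)
qed

lemma to_completion_hom: "to_completion G \<in> hom G (group_completion G)"
  by (auto simp: hom_def to_completion_def groth_class_closed groth_class_mult)

lemma to_completion_eq:
  "a \<in> carrier G \<Longrightarrow> b \<in> carrier G \<Longrightarrow>
    to_completion G a = to_completion G b \<longleftrightarrow> (\<exists>k\<in>carrier G. a \<otimes> k = b \<otimes> k)"
  by (simp add: to_completion_def groth_class_eq)

lemma groth_class_to_completion:
  "a \<in> carrier G \<Longrightarrow> b \<in> carrier G \<Longrightarrow>
    groth_rel G `` {(a, b)} \<otimes>\<^bsub>group_completion G\<^esub> to_completion G b = to_completion G a"
  by (simp add: to_completion_def groth_class_mult groth_class_eq m_ac) (use one_closed in blast)

text \<open>The lift is defined by \<open>the_elem\<close>, so the difference of values must be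
  constant on a class: the image of the witness \<open>k\<close> lies in the group \<open>H\<close>
  and cancels there.\<close>

lemma completion_lift:
  assumes H: "comm_group H" and u: "u \<in> hom G H" and ab: "a \<in> carrier G" "b \<in> carrier G"
  shows "completion_lift H u (groth_rel G `` {(a, b)}) = u a \<otimes>\<^bsub>H\<^esub> inv\<^bsub>H\<^esub> (u b)"
proof -
  interpret H: comm_group H by fact
  have uc: "x \<in> carrier G \<Longrightarrow> u x \<in> carrier H" for x using u by (auto simp: hom_def)
  have um: "x \<in> carrier G \<Longrightarrow> y \<in> carrier G \<Longrightarrow> u (x \<otimes> y) = u x \<otimes>\<^bsub>H\<^esub> u y" for x y
    using u by (auto simp: hom_def)
  have eq: "u c \<otimes>\<^bsub>H\<^esub> inv\<^bsub>H\<^esub> (u d) = u a \<otimes>\<^bsub>H\<^esub> inv\<^bsub>H\<^esub> (u b)" if "((a, b), (c, d)) \<in> groth_rel G" for c d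
  proof -
    obtain k where [simp]: "c \<in> carrier G" "d \<in> carrier G" "k \<in> carrier G" and k: "a \<otimes> d \<otimes> k = c \<otimes> b \<otimes> k"
      using \<open>((a, b), (c, d)) \<in> groth_rel G\<close> by (auto simp: groth_rel_def)
    note [simp] = ab
    have "u a \<otimes>\<^bsub>H\<^esub> u d \<otimes>\<^bsub>H\<^esub> u k = u c \<otimes>\<^bsub>H\<^esub> u b \<otimes>\<^bsub>H\<^esub> u k"
      using arg_cong[OF k, of u] by (simp add: um)
    then have "u a \<otimes>\<^bsub>H\<^esub> u d = u c \<otimes>\<^bsub>H\<^esub> u b" by (simp add: uc)
    then show ?thesis by (rule H.quotient_eq[rotated 4]) (simp_all add: uc)
  qed
  have "(a, b) \<in> groth_rel G `` {(a, b)}"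
    using equiv_class_self[OF equiv_groth_rel] ab by simp
  then have ne: "groth_rel G `` {(a, b)} \<noteq> {}" by fast
  have "the_elem ((\<lambda>(a, b). u a \<otimes>\<^bsub>H\<^esub> inv\<^bsub>H\<^esub> (u b)) ` (groth_rel G `` {(a, b)})) =
      (\<lambda>(a, b). u a \<otimes>\<^bsub>H\<^esub> inv\<^bsub>H\<^esub> (u b)) (a, b)"
  proof (rule the_elem_image_unique[OF ne])
    fix y assume y: "y \<in> groth_rel G `` {(a, b)}"
    obtain c d where cd: "y = (c, d)" by (cases y)
    show "(\<lambda>(a, b). u a \<otimes>\<^bsub>H\<^esub> inv\<^bsub>H\<^esub> (u b)) y = (\<lambda>(a, b). u a \<otimes>\<^bsub>H\<^esub> inv\<^bsub>H\<^esub> (u b)) (a, b)"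
      using eq[of c d] y unfolding cd by (simp only: Image_singleton_iff case_prod_conv)
  qed
  then show ?thesis by (simp add: completion_lift_def)
qed

end

section \<open>The monoid of connected components\<close>

context permutative_category
begin

lemma equiv_component_rel: "equiv (Ob P) (component_rel P)"
proof -
  let ?R = "(\<lambda>f. (Src P f, Tgt P f)) ` Ar P \<union> (\<lambda>f. (Tgt P f, Src P f)) ` Ar P"
  have "sym (?R\<^sup>*)" by (rule sym_rtrancl) (auto simp: sym_def)
  then show ?thesis
    by (intro equivI) (auto simp: component_rel_def refl_on_def sym_def trans_def)
qed

lemma component_arrow: "u \<in> Hom P a b \<Longrightarrow> (a, b) \<in> component_rel P"
  using arr by (auto simp: component_rel_def Hom_def)

lemma component_add_left:
  assumes "(a, b) \<in> component_rel P" "c \<in> Ob P"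
  shows "(Add P a c, Add P b c) \<in> component_rel P"
proof -
  let ?R = "(\<lambda>f. (Src P f, Tgt P f)) ` Ar P \<union> (\<lambda>f. (Tgt P f, Src P f)) ` Ar P"
  have ab: "(a, b) \<in> ?R\<^sup>*" "a \<in> Ob P" "b \<in> Ob P" using assms(1) by (auto simp: component_rel_def)
  have "(Add P (Src P f) c, Add P (Tgt P f) c) \<in> component_rel P" if "f \<in> Ar P" for f
    using component_arrow[OF addA[OF _ idn[OF assms(2)]], of f] that by (simp add: Hom_def)
  then have step: "(Add P x c, Add P y c) \<in> component_rel P" if "(x, y) \<in> ?R" for x y
    using that equivE[OF equiv_component_rel] by (auto dest: symD)
  have "(Add P a c, Add P b c) \<in> component_rel P" using ab(1)
  proof induction
    case base
    then show ?case using equiv_component_rel add[OF ab(2) assms(2)] by (meson equivE refl_onD)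
  next
    case (step y z)
    then show ?case using \<open>\<And>x y. (x, y) \<in> ?R \<Longrightarrow> _\<close>[OF step(2)] equiv_component_rel by (meson equivE transD)
  qed
  then show ?thesis .
qed

text \<open>A change of the second summand is moved to the first place by the symmetry, which is
  itself an arrow and hence stays within a component.\<close>

lemma component_add:
  assumes "(a, a') \<in> component_rel P" "(b, b') \<in> component_rel P"
  shows "(Add P a b, Add P a' b') \<in> component_rel P"
proof -
  have ob: "a \<in> Ob P" "a' \<in> Ob P" "b \<in> Ob P" "b' \<in> Ob P" using assms by (auto simp: component_rel_def)
  note tr = transD[of "component_rel P"]
  have t: "trans (component_rel P)" using equiv_component_rel by (meson equivE)
  have "(Add P a b, Add P a' b) \<in> component_rel P" by (rule component_add_left) fact+
  moreover have "(Add P a' b, Add P b a') \<in> component_rel P" by (rule component_arrow[OF twist]) fact+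
  moreover have "(Add P b a', Add P b' a') \<in> component_rel P" by (rule component_add_left) fact+
  moreover have "(Add P b' a', Add P a' b') \<in> component_rel P" by (rule component_arrow[OF twist]) fact+
  ultimately show ?thesis using t by (meson transD)
qed

lemma components_mult:
  assumes "a \<in> Ob P" "b \<in> Ob P"
  shows "component_rel P `` {a} \<otimes>\<^bsub>components P\<^esub> component_rel P `` {b} = component_rel P `` {Add P a b}"
  unfolding components_def monoid.simps
proof (rule equiv_Image_eq[OF equiv_component_rel])
  show "{Add P a' b' |a' b'. a' \<in> component_rel P `` {a} \<and> b' \<in> component_rel P `` {b}} \<noteq> {}"
    using equiv_class_self[OF equiv_component_rel] assms by blast
qed (use component_add in blast)

lemma comm_monoid_components: "comm_monoid (components P)"
proof (rule comm_monoidI)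
  have car: "\<exists>a\<in>Ob P. x = component_rel P `` {a}" if "x \<in> carrier (components P)" for x
    using that by (auto simp: components_def quotient_def)
  have clo: "component_rel P `` {a} \<in> carrier (components P)" if "a \<in> Ob P" for a
    using that by (auto simp: components_def quotient_def)
  have one: "\<one>\<^bsub>components P\<^esub> = component_rel P `` {Zer P}" by (simp add: components_def)
  show "\<one>\<^bsub>components P\<^esub> \<in> carrier (components P)" unfolding one by (rule clo[OF zer])
  fix x y assume "x \<in> carrier (components P)" "y \<in> carrier (components P)"
  then obtain a b where xy: "x = component_rel P `` {a}" "y = component_rel P `` {b}"
    and ab [simp]: "a \<in> Ob P" "b \<in> Ob P" using car by blast
  show "x \<otimes>\<^bsub>components P\<^esub> y \<in> carrier (components P)" by (simp add: xy components_mult clo add)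
  show "\<one>\<^bsub>components P\<^esub> \<otimes>\<^bsub>components P\<^esub> x = x" unfolding one xy by (simp add: components_mult zer add_zer)
  show "x \<otimes>\<^bsub>components P\<^esub> y = y \<otimes>\<^bsub>components P\<^esub> x"
    using equiv_class_eq[OF equiv_component_rel component_arrow[OF twist[OF ab]]] by (simp add: xy components_mult)
  fix z assume "z \<in> carrier (components P)"
  then obtain c where z: "z = component_rel P `` {c}" and [simp]: "c \<in> Ob P" using car by blast
  show "x \<otimes>\<^bsub>components P\<^esub> y \<otimes>\<^bsub>components P\<^esub> z = x \<otimes>\<^bsub>components P\<^esub> (y \<otimes>\<^bsub>components P\<^esub> z)"
    by (simp add: xy z components_mult add add_assoc)
qed

end

section \<open>Classes of objects in K-theory\<close>

context K_theory_machine
begin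

text \<open>By the axiom \<open>\<pi>\<^sub>0_K\<close> the class of an object depends only on its
  connected component.\<close>

lemma K_class_arrow:
  assumes P: "small_permcat P" and u: "u \<in> Hom P a b"
  shows "K_class S K P a = K_class S K P b"
proof -
  interpret permutative_category P using P by (simp add: small_permcat_def)
  have "a \<in> Ob P" "b \<in> Ob P" using u arr by (auto simp: Hom_def)
  then show ?thesis
    using \<pi>\<^sub>0_K[OF P] equiv_class_eq[OF equiv_component_rel component_arrow[OF u]] by metis
qed

lemma K_class_closed:
  assumes P: "small_permcat P" and a: "a \<in> Ob P"
  shows "K_class S K P a \<in> carrier (hGrp S 0 (KOb K P))"
proof -
  interpret permutative_category P using P by (simp add: small_permcat_def)
  interpret C: comm_monoid "components P" by (rule comm_monoid_components)
  obtain \<phi> where \<phi>: "\<phi> \<in> iso (group_completion (components P)) (hGrp S 0 (KOb K P))"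
    "\<forall>a\<in>Ob P. \<phi> (to_completion (components P) (component_rel P `` {a})) = K_class S K P a"
    using \<pi>\<^sub>0_K[OF P] by blast
  have "component_rel P `` {a} \<in> carrier (components P)" using a by (auto simp: components_def quotient_def)
  then show ?thesis using \<phi> a C.to_completion_hom by (auto simp: iso_def hom_def Pi_iff simp flip: \<phi>(2))
qed

text \<open>\<open>K_class\<close> is defined through \<open>KMor\<close> on 0-morphisms, which says
  nothing about sums. Additivity comes from the isomorphism in \<open>\<pi>\<^sub>0_K\<close> and
  the definition of the sum of components.\<close>

lemma K_class_add:
  assumes P: "small_permcat P" and ab: "a \<in> Ob P" "b \<in> Ob P"
  shows "K_class S K P (Add P a b) = K_class S K P a \<otimes>\<^bsub>hGrp S 0 (KOb K P)\<^esub> K_class S K P b"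
proof -
  interpret permutative_category P using P by (simp add: small_permcat_def)
  interpret C: comm_monoid "components P" by (rule comm_monoid_components)
  obtain \<phi> where \<phi>: "\<phi> \<in> iso (group_completion (components P)) (hGrp S 0 (KOb K P))"
    "\<forall>a\<in>Ob P. \<phi> (to_completion (components P) (component_rel P `` {a})) = K_class S K P a"
    using \<pi>\<^sub>0_K[OF P] by blast
  have c: "component_rel P `` {a} \<in> carrier (components P)" if "a \<in> Ob P" for a
    using that by (auto simp: components_def quotient_def)
  let ?t = "to_completion (components P)"
  have t: "?t (component_rel P `` {Add P a b}) = ?t (component_rel P `` {a}) \<otimes>\<^bsub>group_completion (components P)\<^esub> ?t (component_rel P `` {b})"
    using C.to_completion_hom ab c by (simp add: hom_def flip: components_mult)
  have tc: "?t (component_rel P `` {a}) \<in> carrier (group_completion (components P))" if "a \<in> Ob P" for a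
    using C.to_completion_hom c[OF that] by (auto simp: hom_def)
  have "\<phi> (?t (component_rel P `` {Add P a b})) = \<phi> (?t (component_rel P `` {a})) \<otimes>\<^bsub>hGrp S 0 (KOb K P)\<^esub> \<phi> (?t (component_rel P `` {b}))"
    unfolding t using \<phi>(1) tc ab by (simp add: iso_def hom_def)
  then show ?thesis using \<phi>(2) ab add by simp
qed

text \<open>\<open>K_disc\<close> provides some isomorphism between these groups, but compatibility
  with spans requires the one that sends an element to the class of the corresponding object.
  Components of \<open>disc A\<close> are singletons and a group is its own completion, so the
  isomorphism in \<open>\<pi>\<^sub>0_K\<close> becomes this map.\<close>

lemma K_class_disc_iso:
  assumes A: "comm_group A" "small (carrier A)"
  shows "K_class S K (disc A) \<in> iso (A :: 'v monoid) (hGrp S 0 (KOb K (disc A)))"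
proof -
  interpret A: comm_group A by fact
  have P: "small_permcat (disc A)" by (rule small_permcat_disc[OF A])
  interpret permutative_category "disc A" using P by (simp add: small_permcat_def)
  interpret C: comm_monoid "components (disc A)" by (rule comm_monoid_components)
  obtain \<phi> where \<phi>: "\<phi> \<in> iso (group_completion (components (disc A))) (hGrp S 0 (KOb K (disc A)))"
    "\<forall>a\<in>Ob (disc A). \<phi> (to_completion (components (disc A)) (component_rel (disc A) `` {a})) = K_class S K (disc A) a"
    using \<pi>\<^sub>0_K[OF P] by blast
  let ?t = "\<lambda>a. to_completion (components (disc A)) {a}"
  define R where "R = (\<lambda>f. (Src (disc A) f, Tgt (disc A) f)) ` Ar (disc A) \<union> (\<lambda>f. (Tgt (disc A) f, Src (disc A) f)) ` Ar (disc A)"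
  \<comment> \<open>All arrows of \<open>disc A\<close> are identities, so zigzags are
    constant.\<close>
  have Id: "R \<subseteq> Id" by (simp add: R_def image_subset_iff)
  have eq: "a = b" if "(a, b) \<in> R\<^sup>*" for a b
    using that
  proof induction
    case (step y z)
    then show ?case using Id by blast
  qed simp
  have "(a, b) \<in> component_rel (disc A) \<longleftrightarrow> a \<in> carrier A \<and> b \<in> carrier A \<and> (a, b) \<in> R\<^sup>*" for a b
    by (simp only: component_rel_def R_def mem_Collect_eq case_prod_conv disc_fields(1))
  then have cr: "(a, b) \<in> component_rel (disc A) \<longleftrightarrow> a \<in> carrier A \<and> a = b" for a b
    using eq by blast
  have cls: "component_rel (disc A) `` {a} = {a}" if "a \<in> carrier A" for a
    using that by (auto simp: cr)
  have "carrier (components (disc A)) = (\<lambda>a. component_rel (disc A) `` {a}) ` carrier A"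
    by (auto simp: components_def quotient_def)
  also have "\<dots> = (\<lambda>a. {a}) ` carrier A" by (rule image_cong[OF refl cls])
  finally have car: "carrier (components (disc A)) = (\<lambda>a. {a}) ` carrier A" .
  have mult: "{a} \<otimes>\<^bsub>components (disc A)\<^esub> {b} = {a \<otimes>\<^bsub>A\<^esub> b}" if "a \<in> carrier A" "b \<in> carrier A" for a b
    using components_mult[of a b] that by (simp add: cls)
  have tc: "?t a \<in> carrier (group_completion (components (disc A)))" if "a \<in> carrier A" for a
    by (rule hom_in_carrier[OF C.to_completion_hom]) (use that car in simp)
  have "?t \<in> hom A (group_completion (components (disc A)))"
  proof (rule homI)
    show "?t (a \<otimes>\<^bsub>A\<^esub> b) = ?t a \<otimes>\<^bsub>group_completion (components (disc A))\<^esub> ?t b"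
      if "a \<in> carrier A" "b \<in> carrier A" for a b
      using hom_mult[OF C.to_completion_hom, of "{a}" "{b}"] mult[OF that] that car by simp
  qed (rule tc)
  moreover have "bij_betw ?t (carrier A) (carrier (group_completion (components (disc A))))"
  proof (rule bij_betw_imageI)
    show "inj_on ?t (carrier A)"
    proof (rule inj_onI)
      fix a b assume ab: "a \<in> carrier A" "b \<in> carrier A" "?t a = ?t b"
      then obtain k where "k \<in> carrier A" "{a} \<otimes>\<^bsub>components (disc A)\<^esub> {k} = {b} \<otimes>\<^bsub>components (disc A)\<^esub> {k}"
        using C.to_completion_eq[of "{a}" "{b}"] car by auto
      then show "a = b" using ab by (simp add: mult)
    qed
    have "x \<in> ?t ` carrier A" if x_in: "x \<in> carrier (group_completion (components (disc A)))" for x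
    proof -
      obtain a b where ab [simp]: "a \<in> carrier A" "b \<in> carrier A" and x: "x = groth_rel (components (disc A)) `` {({a}, {b})}"
        by (rule C.group_completion_carrierE[OF x_in]) (auto simp: car)
      \<comment> \<open>Surjectivity: in a group the formal difference of \<open>a\<close> and
        \<open>b\<close> is represented by an element, their actual quotient.\<close>
      have "x = ?t (a \<otimes>\<^bsub>A\<^esub> inv\<^bsub>A\<^esub> b)"
      proof -
        have one: "\<one>\<^bsub>components (disc A)\<^esub> = {\<one>\<^bsub>A\<^esub>}" using cls[of "\<one>\<^bsub>A\<^esub>"] by (simp add: components_def)
        have "{a} \<otimes>\<^bsub>components (disc A)\<^esub> {\<one>\<^bsub>A\<^esub>} \<otimes>\<^bsub>components (disc A)\<^esub> {\<one>\<^bsub>A\<^esub>} =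
          {a \<otimes>\<^bsub>A\<^esub> inv\<^bsub>A\<^esub> b} \<otimes>\<^bsub>components (disc A)\<^esub> {b} \<otimes>\<^bsub>components (disc A)\<^esub> {\<one>\<^bsub>A\<^esub>}"
          by (simp add: mult A.m_assoc)
        then show ?thesis
          unfolding x to_completion_def one by (subst C.groth_class_eq) (auto simp: car)
      qed
      then show ?thesis by (rule image_eqI) simp
    qed
    moreover have "?t ` carrier A \<subseteq> carrier (group_completion (components (disc A)))"
      using tc by blast
    ultimately show "?t ` carrier A = carrier (group_completion (components (disc A)))" by blast
  qed
  ultimately have "?t \<in> iso A (group_completion (components (disc A)))" by (simp add: iso_def)
  from iso_set_trans[OF this \<phi>(1)]
  have i: "\<phi> \<circ> ?t \<in> iso A (hGrp S 0 (KOb K (disc A)))" .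
  have e: "(\<phi> \<circ> ?t) a = K_class S K (disc A) a" if "a \<in> carrier A" for a
    using bspec[OF \<phi>(2), of a] that cls[OF that] by simp
  have "K_class S K (disc A) \<in> hom A (hGrp S 0 (KOb K (disc A)))"
  proof (rule homI)
    note h = iso_imp_homomorphism[OF i]
    show "K_class S K (disc A) a \<in> carrier (hGrp S 0 (KOb K (disc A)))" if "a \<in> carrier A" for a
      using hom_in_carrier[OF h that] e[OF that] by simp
    show "K_class S K (disc A) (a \<otimes>\<^bsub>A\<^esub> b) =
        K_class S K (disc A) a \<otimes>\<^bsub>hGrp S 0 (KOb K (disc A))\<^esub> K_class S K (disc A) b"
      if "a \<in> carrier A" "b \<in> carrier A" for a b
      using hom_mult[OF h that] e that by simp
  qed
  moreover have "bij_betw (K_class S K (disc A)) (carrier A) (carrier (hGrp S 0 (KOb K (disc A))))"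
    using i bij_betw_cong[of "carrier A", OF e] by (simp add: iso_def)
  ultimately show ?thesis by (simp add: iso_def)
qed

end

section \<open>Spans of finite G-sets\<close>

context group
begin

lemma fin_gset_iff: "fin_gset G A \<longleftrightarrow> (\<forall>g\<in>carrier G. snd A g permutes points A) \<and>
    (\<forall>g\<in>carrier G. \<forall>h\<in>carrier G. snd A (g \<otimes> h) = snd A g \<circ> snd A h) \<and> snd A \<in> extensional (carrier G)"
  by (auto simp: fin_gset_def hom_def sym_group_def Pi_iff)

lemma gset_points: "fin_gset G A \<Longrightarrow> g \<in> carrier G \<Longrightarrow> snd A g x \<in> points A \<longleftrightarrow> x \<in> points A"
  using permutes_in_image[of "snd A g" "points A" x] by (simp add: fin_gset_iff)

text \<open>\<open>gset_sum\<close> tests only upper bounds, so the number 0, which is not a point,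
  falls under its first case. A permutation of \<open>{1..n}\<close> fixes everything outside, hence
  respects the bound and 0; the latter keeps the second block above \<open>fst A\<close>.\<close>

lemma gset_le: "fin_gset G A \<Longrightarrow> g \<in> carrier G \<Longrightarrow> snd A g x \<le> fst A \<longleftrightarrow> x \<le> fst A"
  "fin_gset G A \<Longrightarrow> g \<in> carrier G \<Longrightarrow> snd A g x = 0 \<longleftrightarrow> x = 0"
proof -
  assume A: "fin_gset G A" "g \<in> carrier G"
  have "snd A g permutes points A" using A by (simp add: fin_gset_iff)
  then have *: "x \<notin> points A \<Longrightarrow> snd A g x = x" by (simp add: permutes_def)
  show "snd A g x \<le> fst A \<longleftrightarrow> x \<le> fst A" using * gset_points[OF A, of x] by auto
  show "snd A g x = 0 \<longleftrightarrow> x = 0" using * gset_points[OF A, of x] by auto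
qed

text \<open>The action preserves the two blocks, so injectivity can be checked blockwise;
  bijectivity follows from finiteness.\<close>

lemma fin_gset_sum:
  assumes A: "fin_gset G A" and B: "fin_gset G B"
  shows "fin_gset G (gset_sum G A B)"
  unfolding fin_gset_iff
proof (intro conjI ballI)
  show "snd (gset_sum G A B) \<in> extensional (carrier G)" by (simp add: gset_sum_def)
  fix g assume g [simp]: "g \<in> carrier G"
  let ?f = "snd (gset_sum G A B) g"
  have pA: "snd A g permutes points A" and pB: "snd B g permutes points B"
    using A B g by (auto simp: fin_gset_iff)
  have f: "?f x = (if x \<le> fst A then snd A g x else if x \<le> fst A + fst B then fst A + snd B g (x - fst A) else x)" for x
    by (simp add: gset_sum_def)
  show "?f permutes points (gset_sum G A B)"
  proof (rule bij_imp_permutes)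
    have "?f x \<in> points (gset_sum G A B)" if "x \<in> points (gset_sum G A B)" for x
      using that gset_le[OF A g, of x] gset_le[OF B g, of "x - fst A"]
      unfolding f by (auto simp: gset_sum_def)
    moreover have "inj_on ?f (points (gset_sum G A B))"
    proof (rule inj_onI)
      fix x y assume xy: "x \<in> points (gset_sum G A B)" "y \<in> points (gset_sum G A B)" "?f x = ?f y"
      have iA: "snd A g x = snd A g y \<Longrightarrow> x = y" by (rule injD[OF permutes_inj[OF pA]])
      have iB: "snd B g (x - fst A) = snd B g (y - fst A) \<Longrightarrow> x - fst A = y - fst A" by (rule injD[OF permutes_inj[OF pB]])
      have le: "x \<le> fst A + fst B" "y \<le> fst A + fst B" using xy by (auto simp: gset_sum_def)
      note eq = xy(3)[unfolded f]
      note gx = gset_le(1)[OF A g, of x] gset_le(2)[OF B g, of "x - fst A"]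
      note gy = gset_le(1)[OF A g, of y] gset_le(2)[OF B g, of "y - fst A"]
      show "x = y"
      proof (cases "x \<le> fst A")
        case x: True
        show ?thesis
        proof (cases "y \<le> fst A")
          case True
          with x eq show ?thesis by (intro iA) simp
        next
          case False
          then show ?thesis using x eq le gx(1) gy(2) by simp
        qed
      next
        case x: False
        show ?thesis
        proof (cases "y \<le> fst A")
          case True
          then show ?thesis using x eq le gy(1) gx(2) by simp
        next
          case False
          with x eq le have "snd B g (x - fst A) = snd B g (y - fst A)" by simp
          from iB[OF this] show ?thesis using x False by simp
        qed
      qed
    qed
    ultimately show "bij_betw ?f (points (gset_sum G A B)) (points (gset_sum G A B))"
      by (intro bij_betw_imageI endo_inj_surj) auto
    show "?f x = x" if "x \<notin> points (gset_sum G A B)" for x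
      using that gset_le(2)[OF A g, of x] unfolding f by (auto simp: gset_sum_def)
  qed
  fix h assume h [simp]: "h \<in> carrier G"
  show "snd (gset_sum G A B) (g \<otimes> h) = snd (gset_sum G A B) g \<circ> snd (gset_sum G A B) h"
  proof
    fix x
    have "snd A (g \<otimes> h) x = snd A g (snd A h x)" "snd B (g \<otimes> h) (x - fst A) = snd B g (snd B h (x - fst A))"
      using A B by (auto simp: fin_gset_iff)
    then show "snd (gset_sum G A B) (g \<otimes> h) x = (snd (gset_sum G A B) g \<circ> snd (gset_sum G A B) h) x"
      using gset_le[OF A h, of x] gset_le[OF B h, of "x - fst A"]
      by (cases "x \<le> fst A"; cases "x \<le> fst A + fst B") (auto simp: gset_sum_def)
  qed
qed

lemma fin_gset_empty: "fin_gset G (gset_empty G)"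
  by (auto simp: fin_gset_iff gset_empty_def permutes_def)

lemma gmaps_sum:
  assumes T: "fin_gset G T" "fin_gset G T'" and f: "f \<in> gmaps G T A" "f' \<in> gmaps G T' A"
  shows "(\<lambda>x\<in>points (gset_sum G T T'). if x \<le> fst T then f x else f' (x - fst T)) \<in> gmaps G (gset_sum G T T') A"
proof -
  have fp: "f x \<in> points A" "f' y \<in> points A" if "x \<in> points T" "y \<in> points T'" for x y
    using f that by (auto simp: gmaps_def)
  have p: "x \<in> points (gset_sum G T T') \<longleftrightarrow> x \<in> points T \<or> (\<not> x \<le> fst T \<and> x - fst T \<in> points T')" for x
    by (auto simp: gset_sum_def)
  have eq: "f (snd T g x) = snd A g (f x)" "f' (snd T' g y) = snd A g (f' y)"
    if "g \<in> carrier G" "x \<in> points T" "y \<in> points T'" for g x y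
    using f that by (auto simp: gmaps_def)
  have eq': "f (snd T g x) = snd A g (f x)" if "g \<in> carrier G" "x \<in> points T" for g x
    using f that by (auto simp: gmaps_def)
  have eq'': "f' (snd T' g x) = snd A g (f' x)" if "g \<in> carrier G" "x \<in> points T'" for g x
    using f that by (auto simp: gmaps_def)
  let ?h = "\<lambda>x. if x \<le> fst T then f x else f' (x - fst T)"
  have h: "?h x \<in> points A" if "x \<in> points (gset_sum G T T')" for x
    using that f unfolding p by (auto simp: gmaps_def PiE_iff)
  have act: "snd (gset_sum G T T') g x \<in> points (gset_sum G T T') \<and> ?h (snd (gset_sum G T T') g x) = snd A g (?h x)"
    if g: "g \<in> carrier G" and x: "x \<in> points (gset_sum G T T')" for g x
  proof
    show "snd (gset_sum G T T') g x \<in> points (gset_sum G T T')"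
      using gset_points[OF fin_gset_sum[OF T] g] x by blast
    show "?h (snd (gset_sum G T T') g x) = snd A g (?h x)"
      using x g eq'[OF g, of x] eq''[OF g, of "x - fst T"] gset_le(1)[OF T(1) g, of x] gset_le(2)[OF T(2) g, of "x - fst T"]
      unfolding p by (auto simp: gset_sum_def)
  qed
  show ?thesis
    unfolding gmaps_def using h act by auto
qed

lemma gmaps_compose:
  assumes "f \<in> gmaps G T U" "k \<in> gmaps G U A" "fin_gset G T"
  shows "(\<lambda>t\<in>points T. k (f t)) \<in> gmaps G T A"
proof -
  have f: "f t \<in> points U" "g \<in> carrier G \<Longrightarrow> f (snd T g t) = snd U g (f t)" if "t \<in> points T" for t g
    using assms(1) that by (auto simp: gmaps_def)
  have k: "k u \<in> points A" "g \<in> carrier G \<Longrightarrow> k (snd U g u) = snd A g (k u)" if "u \<in> points U" for u g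
    using assms(2) that by (auto simp: gmaps_def)
  show ?thesis
    unfolding gmaps_def using f k gset_points[OF assms(3)] by auto
qed

lemma gmaps_id: "fin_gset G A \<Longrightarrow> (\<lambda>x\<in>points A. x) \<in> gmaps G A A"
  unfolding gmaps_def using gset_points by auto

lemma span_sum_spans:
  assumes "X \<in> spans G A B" "Y \<in> spans G A B"
  shows "span_sum G X Y \<in> spans G A B"
  using assms fin_gset_sum[of "Apex X" "Apex Y"]
    gmaps_sum[of "Apex X" "Apex Y" "LLeg X" A "LLeg Y"] gmaps_sum[of "Apex X" "Apex Y" "RLeg X" B "RLeg Y"]
  by (simp add: spans_def span_sum_def Let_def)

lemma span_empty_spans: "span_empty G A B \<in> spans G A B"
  using fin_gset_empty by (auto simp: spans_def span_empty_def gmaps_def gset_empty_def)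

lemma span_id_spans: "fin_gset G A \<Longrightarrow> span_id A \<in> spans G A A"
  using gmaps_id by (simp add: spans_def span_id_def)

lemma span_comp_spans:
  assumes "pullback_choice G pb" "fin_gset G A" "fin_gset G B" "fin_gset G C"
    and XY: "X \<in> spans G A B" "Y \<in> spans G B C"
  shows "span_comp pb X Y \<in> spans G A C"
proof -
  obtain T p q where T: "pb X Y = (T, p, q)" by (cases "pb X Y") auto
  then have "fin_gset G T" "p \<in> gmaps G T (Apex X)" "q \<in> gmaps G T (Apex Y)"
    using assms unfolding pullback_choice_def by fastforce+
  then show ?thesis
    using XY gmaps_compose[of p T "Apex X" "LLeg X" A] gmaps_compose[of q T "Apex Y" "RLeg Y" C]
    by (simp add: spans_def span_comp_def T)
qed

lemma iso_rel_iff: "(X, Y) \<in> iso_rel G A B \<longleftrightarrow> X \<in> spans G A B \<and> Y \<in> spans G A B \<and>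
    (\<exists>f. f \<in> gmaps G (Apex X) (Apex Y) \<and> bij_betw f (points (Apex X)) (points (Apex Y)) \<and>
      (\<forall>x\<in>points (Apex X). LLeg Y (f x) = LLeg X x \<and> RLeg Y (f x) = RLeg X x))" (is "_ \<longleftrightarrow> ?R")
proof
  assume "(X, Y) \<in> iso_rel G A B"
  then obtain u where "u \<in> span_isos G A B" "X = ISrc u" "Y = ITgt u" by (auto simp: iso_rel_def)
  then show ?R by (auto simp: span_isos_def intro!: exI[of _ "IMap u"])
next
  assume ?R
  then obtain f where "X \<in> spans G A B" "Y \<in> spans G A B" "f \<in> gmaps G (Apex X) (Apex Y)"
    "bij_betw f (points (Apex X)) (points (Apex Y))"
    "\<forall>x\<in>points (Apex X). LLeg Y (f x) = LLeg X x \<and> RLeg Y (f x) = RLeg X x" by blast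
  then have "\<lparr>ISrc = X, ITgt = Y, IMap = f\<rparr> \<in> span_isos G A B" by (simp add: span_isos_def)
  then show "(X, Y) \<in> iso_rel G A B" unfolding iso_rel_def by (rule rev_image_eqI) simp
qed

text \<open>The relation is defined by the existence of a map in \<open>span_isos\<close>, so
  symmetry has content: the inverse of an equivariant bijection is equivariant because the bijection
  is injective.\<close>

lemma equiv_iso_rel: "equiv (spans G A B) (iso_rel G A B)"
proof (rule equivI)
  show "iso_rel G A B \<subseteq> spans G A B \<times> spans G A B" by (auto simp: iso_rel_iff)
  show "refl_on (spans G A B) (iso_rel G A B)"
  proof (rule refl_onI)
    fix X assume X: "X \<in> spans G A B"
    then have "(\<lambda>x\<in>points (Apex X). x) \<in> gmaps G (Apex X) (Apex X)" by (simp add: spans_def gmaps_id del: One_nat_def)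
    moreover have "bij_betw (\<lambda>x\<in>points (Apex X). x) (points (Apex X)) (points (Apex X))"
      by (auto simp: bij_betw_def inj_on_def)
    ultimately show "(X, X) \<in> iso_rel G A B"
      using X unfolding iso_rel_iff by (intro conjI exI[of _ "\<lambda>x\<in>points (Apex X). x"]) auto
  qed
  show "sym (iso_rel G A B)"
  proof (rule symI)
    fix X Y assume "(X, Y) \<in> iso_rel G A B"
    then obtain f where X: "X \<in> spans G A B" and Y: "Y \<in> spans G A B" and f: "f \<in> gmaps G (Apex X) (Apex Y)"
      and b: "bij_betw f (points (Apex X)) (points (Apex Y))"
      and l: "\<And>x. x \<in> points (Apex X) \<Longrightarrow> LLeg Y (f x) = LLeg X x \<and> RLeg Y (f x) = RLeg X x"
      unfolding iso_rel_iff by blast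
    \<comment> \<open>The restriction is needed for membership in \<open>gmaps\<close>, whose
      elements are \<open>undefined\<close> outside the points.\<close>
    let ?f = "\<lambda>y\<in>points (Apex Y). inv_into (points (Apex X)) f y"
    have i: "?f y \<in> points (Apex X)" "f (?f y) = y" if "y \<in> points (Apex Y)" for y
    proof -
      have "y \<in> f ` points (Apex X)" using b that by (simp add: bij_betw_def)
      then show "?f y \<in> points (Apex X)" "f (?f y) = y"
        using that inv_into_into[of y f "points (Apex X)"] f_inv_into_f[of y f "points (Apex X)"]
        by (simp_all only: restrict_apply if_True)
    qed
    have fx: "fin_gset G (Apex X)" "fin_gset G (Apex Y)" using X Y by (auto simp: spans_def)
    have "?f (snd (Apex Y) g y) = snd (Apex X) g (?f y)" if g: "g \<in> carrier G" and y: "y \<in> points (Apex Y)" for g y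
    proof -
      have gy: "snd (Apex Y) g y \<in> points (Apex Y)" using gset_points[OF fx(2) g] y by blast
      have gx: "snd (Apex X) g (?f y) \<in> points (Apex X)" using gset_points[OF fx(1) g] i(1)[OF y] by blast
      have "f (snd (Apex X) g (?f y)) = snd (Apex Y) g (f (?f y))"
        using f g i(1)[OF y] unfolding gmaps_def by blast
      then have "f (snd (Apex X) g (?f y)) = f (?f (snd (Apex Y) g y))" using i(2)[OF y] i(2)[OF gy] by simp
      then show ?thesis
        using b gx i(1)[OF gy] unfolding bij_betw_def inj_on_def by metis
    qed
    then have "?f \<in> gmaps G (Apex Y) (Apex X)" using i(1) unfolding gmaps_def by auto
    moreover have "bij_betw ?f (points (Apex Y)) (points (Apex X))"
      using bij_betw_inv_into[OF b] by (rule iffD1[OF bij_betw_cong, rotated]) simp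
    moreover have "LLeg X (?f y) = LLeg Y y \<and> RLeg X (?f y) = RLeg Y y" if "y \<in> points (Apex Y)" for y
      using l[OF i(1)[OF that]] i(2)[OF that] by simp
    ultimately show "(Y, X) \<in> iso_rel G A B" using X Y unfolding iso_rel_iff by blast
  qed
  show "trans (iso_rel G A B)"
  proof (rule transI)
    fix X Y Z assume "(X, Y) \<in> iso_rel G A B" "(Y, Z) \<in> iso_rel G A B"
    then obtain f g where s: "X \<in> spans G A B" "Z \<in> spans G A B"
      and f: "f \<in> gmaps G (Apex X) (Apex Y)" "bij_betw f (points (Apex X)) (points (Apex Y))"
      "\<And>x. x \<in> points (Apex X) \<Longrightarrow> LLeg Y (f x) = LLeg X x \<and> RLeg Y (f x) = RLeg X x"
      and g: "g \<in> gmaps G (Apex Y) (Apex Z)" "bij_betw g (points (Apex Y)) (points (Apex Z))"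
      "\<And>x. x \<in> points (Apex Y) \<Longrightarrow> LLeg Z (g x) = LLeg Y x \<and> RLeg Z (g x) = RLeg Y x"
      unfolding iso_rel_iff by blast
    let ?h = "\<lambda>x\<in>points (Apex X). g (f x)"
    have "?h \<in> gmaps G (Apex X) (Apex Z)" using gmaps_compose[OF f(1) g(1)] s by (simp add: spans_def)
    moreover have "bij_betw ?h (points (Apex X)) (points (Apex Z))"
      using bij_betw_trans[OF f(2) g(2)] by (rule iffD1[OF bij_betw_cong, rotated]) simp
    moreover have "f x \<in> points (Apex Y)" if "x \<in> points (Apex X)" for x
      using f(1) that by (auto simp: gmaps_def)
    then have "LLeg Z (?h x) = LLeg X x \<and> RLeg Z (?h x) = RLeg X x" if "x \<in> points (Apex X)" for x
      using f(3) g(3) that by simp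
    ultimately show "(X, Z) \<in> iso_rel G A B" using s unfolding iso_rel_iff by blast
  qed
qed

text \<open>For each \<open>n\<close> an action is an extensional function from the finite group to
  the permutations of \<open>{1..n}\<close>, so there are finitely many; the union over all
  \<open>n\<close> is countable.\<close>

lemma countable_fin_gset:
  assumes "finite (carrier G)"
  shows "countable {T. fin_gset G T}"
proof -
  have "{T. fin_gset G T} \<subseteq> (SIGMA n:UNIV. carrier G \<rightarrow>\<^sub>E {p. p permutes {1..n}})"
    by (auto simp: fin_gset_iff PiE_def Pi_iff)
  moreover have "countable \<dots>"
    by (rule countable_SIGMA) (use assms in \<open>simp_all add: countable_finite finite_PiE finite_permutations\<close>)
  ultimately show ?thesis by (rule countable_subset)
qed

lemma countable_spans:
  assumes "finite (carrier G)"
  shows "countable (spans G A B)" "countable (span_isos G A B)"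
proof -
  let ?S = "SIGMA T:{T. fin_gset G T}. (points T \<rightarrow>\<^sub>E points A) \<times> (points T \<rightarrow>\<^sub>E points B)"
  let ?m = "\<lambda>(T, l, r). \<lparr>Left = A, Right = B, Apex = T, LLeg = l, RLeg = r\<rparr>"
  have "X \<in> ?m ` ?S" if "X \<in> spans G A B" for X
    using that by (intro image_eqI[of _ _ "(Apex X, LLeg X, RLeg X)"]) (auto simp: spans_def gmaps_def)
  moreover have "countable ?S"
  proof (rule countable_SIGMA[OF countable_fin_gset[OF assms]])
    fix T show "countable ((points T \<rightarrow>\<^sub>E points A) \<times> (points T \<rightarrow>\<^sub>E points B))"
      by (intro countable_finite finite_cartesian_product finite_PiE) auto
  qed
  ultimately show 1: "countable (spans G A B)"
    by (meson countable_image countable_subset subsetI)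
  let ?U = "SIGMA X:spans G A B. SIGMA Y:spans G A B. points (Apex X) \<rightarrow>\<^sub>E points (Apex Y)"
  let ?n = "\<lambda>(X, Y, f). \<lparr>ISrc = X, ITgt = Y, IMap = f\<rparr>"
  have "u \<in> ?n ` ?U" if "u \<in> span_isos G A B" for u
    using that by (intro image_eqI[of _ _ "(ISrc u, ITgt u, IMap u)"]) (auto simp: span_isos_def gmaps_def)
  moreover have "countable ?U"
    by (rule countable_SIGMA[OF 1], rule countable_SIGMA[OF 1]) (intro countable_finite finite_PiE; simp)
  ultimately show "countable (span_isos G A B)"
    by (meson countable_image countable_subset subsetI)
qed

end

section \<open>The Burnside category\<close>

text \<open>\<open>pc\<close> is the standing assumption that spans compose strictly.
  \<open>E\<close> is a parameter with a defining equation so that the universe \<open>'v\<close>,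
  which \<open>G\<close> and \<open>pb\<close> do not mention, is fixed by the locale.\<close>

locale burnside = group G for G :: "'g monoid" (structure) +
  fixes pb :: "'g pullbacks" and E :: "('g gset, 'v) pccat"
  assumes fin: "finite (carrier G)" and univ: "universe TYPE('v)" and pbc: "pullback_choice G pb"
    and pc: "pc_category E" and E_def: "E = GE G pb"
begin

sublocale E: pc_category E by (rule pc)

abbreviation "fset \<equiv> fin_gset G"
abbreviation P :: "'g gset \<Rightarrow> 'g gset \<Rightarrow> ('v, 'v) permcat" where "P \<equiv> GE_hom G"
abbreviation e :: "'g gset \<Rightarrow> 'g gset \<Rightarrow> 'g gspan \<Rightarrow> 'v" where "e A B \<equiv> enc (spans G A B)"
abbreviation cls :: "'g gset \<Rightarrow> 'g gset \<Rightarrow> 'g gspan \<Rightarrow> 'g gspan set" where "cls A B X \<equiv> iso_rel G A B `` {X}"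

lemma E_fields: "PObj E = {A. fset A}" "PHom E = P" "PComp E = GE_comp G pb" "PUnit E A = e A A (span_id A)"
  by (simp_all add: E_def GE_def)

lemma small_P: "fset A \<Longrightarrow> fset B \<Longrightarrow> small_permcat (P A B)"
  using E.hom by (simp add: E_fields)

lemma perm_P: "fset A \<Longrightarrow> fset B \<Longrightarrow> permutative_category (P A B)"
  using small_P by (simp add: small_permcat_def)

lemma span_inj: "\<exists>f :: 'g gspan \<Rightarrow> 'v. inj_on f (spans G A B)"
  by (rule lesspoll_inj[OF countable_lesspoll_universe[OF univ countable_spans(1)[OF fin]]])

lemma span_iso_inj: "\<exists>f :: 'g gspan_iso \<Rightarrow> 'v. inj_on f (span_isos G A B)"
  by (rule lesspoll_inj[OF countable_lesspoll_universe[OF univ countable_spans(2)[OF fin]]])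

lemma dec_e: "X \<in> spans G A B \<Longrightarrow> dec (spans G A B) (e A B X) = X"
  by (rule dec_enc(2)[OF span_inj])

lemma e_eq_iff: "X \<in> spans G A B \<Longrightarrow> Y \<in> spans G A B \<Longrightarrow> e A B X = e A B Y \<longleftrightarrow> X = Y"
  by (rule inj_on_eq_iff[OF dec_enc(1)[OF span_inj]])

lemma span_category_fields: "Ob (span_category G A B) = spans G A B" "Ar (span_category G A B) = span_isos G A B"
    "Src (span_category G A B) = ISrc" "Tgt (span_category G A B) = ITgt"
    "Zer (span_category G A B) = span_empty G A B" "Add (span_category G A B) = span_sum G"
  by (simp_all add: span_category_def)

lemmas P_fields = encode_permcat_fields[where P = "span_category G A B" for A B,
    unfolded span_category_fields, OF span_inj span_iso_inj, folded GE_hom_def]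

lemma P_Ob: "Ob (P A B) = e A B ` spans G A B"
  by (rule P_fields(1))

lemma P_ObI: "X \<in> spans G A B \<Longrightarrow> e A B X \<in> Ob (P A B)"
  by (simp add: P_Ob)

lemma P_Add: "X \<in> spans G A B \<Longrightarrow> Y \<in> spans G A B \<Longrightarrow> Add (P A B) (e A B X) (e A B Y) = e A B (span_sum G X Y)"
  by (rule P_fields(8))

lemma P_Zer: "Zer (P A B) = e A B (span_empty G A B)"
  by (rule P_fields(7))

text \<open>Converts an arrow of the encoded hom category into an isomorphism of spans. Applied to
  the structure arrows supplied by \<open>pc\<close>, it yields the algebra of spans below with no
  computation of pullbacks.\<close>

lemma arrow_iso:
  assumes "u \<in> Hom (P A B) (e A B X) (e A B Y)" "X \<in> spans G A B" "Y \<in> spans G A B"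
  shows "(X, Y) \<in> iso_rel G A B"
proof -
  obtain w where w: "w \<in> span_isos G A B" "u = enc (span_isos G A B) w"
    using assms(1) by (auto simp: Hom_iff P_fields(2))
  have s: "ISrc w \<in> spans G A B" "ITgt w \<in> spans G A B" using w(1) by (auto simp: span_isos_def)
  have "e A B (ISrc w) = e A B X" "e A B (ITgt w) = e A B Y"
    using assms(1) P_fields(3)[OF w(1)] P_fields(4)[OF w(1)] by (simp_all add: Hom_iff w(2))
  then have "ISrc w = X" "ITgt w = Y" using s assms(2,3) by (simp_all add: e_eq_iff)
  then show ?thesis using w(1) by (auto simp: iso_rel_def)
qed

lemma iso_arrow:
  assumes "(X, Y) \<in> iso_rel G A B"
  obtains u where "u \<in> Hom (P A B) (e A B X) (e A B Y)"
proof -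
  obtain w where w: "w \<in> span_isos G A B" "X = ISrc w" "Y = ITgt w" using assms by (auto simp: iso_rel_def)
  then have "enc (span_isos G A B) w \<in> Hom (P A B) (e A B X) (e A B Y)"
    using P_fields(3)[OF w(1)] P_fields(4)[OF w(1)] by (simp add: Hom_iff P_fields(2))
  then show ?thesis by (rule that)
qed

lemma iso_spans: "(X, Y) \<in> iso_rel G A B \<Longrightarrow> X \<in> spans G A B \<and> Y \<in> spans G A B"
  by (simp add: iso_rel_iff)

lemma arrow_spans:
  assumes "u \<in> Ar (P A B)"
  obtains X Y where "(X, Y) \<in> iso_rel G A B" "Src (P A B) u = e A B X" "Tgt (P A B) u = e A B Y"
proof -
  obtain w where w: "w \<in> span_isos G A B" "u = enc (span_isos G A B) w"
    using assms by (auto simp: P_fields(2))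
  show ?thesis
    using that[of "ISrc w" "ITgt w"] P_fields(3)[OF w(1)] P_fields(4)[OF w(1)] w by (auto simp: iso_rel_def)
qed

lemma sum_cong:
  assumes AB: "fset A" "fset B" and X: "(X, X') \<in> iso_rel G A B" and Y: "(Y, Y') \<in> iso_rel G A B"
  shows "(span_sum G X Y, span_sum G X' Y') \<in> iso_rel G A B"
proof -
  obtain u where u: "u \<in> Hom (P A B) (e A B X) (e A B X')" by (rule iso_arrow[OF X])
  obtain v where v: "v \<in> Hom (P A B) (e A B Y) (e A B Y')" by (rule iso_arrow[OF Y])
  show ?thesis
    using permutative_category.addA[OF perm_P[OF AB] u v] iso_spans[OF X] iso_spans[OF Y]
    by (intro arrow_iso) (simp_all add: P_Add span_sum_spans)
qed

section \<open>Isomorphism classes of spans\<close>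

lemma cls_eq: "X \<in> spans G A B \<Longrightarrow> Y \<in> spans G A B \<Longrightarrow> cls A B X = cls A B Y \<longleftrightarrow> (X, Y) \<in> iso_rel G A B"
  by (rule eq_equiv_class_iff[OF equiv_iso_rel])

lemma cls_self: "X \<in> spans G A B \<Longrightarrow> X \<in> cls A B X"
  by (rule equiv_class_self[OF equiv_iso_rel])

lemma cls_carrier: "carrier (span_classes G A B) = cls A B ` spans G A B"
  by (auto simp: span_classes_def quotient_def)

lemma cls_mult:
  assumes "fset A" "fset B" "X \<in> spans G A B" "Y \<in> spans G A B"
  shows "cls A B X \<otimes>\<^bsub>span_classes G A B\<^esub> cls A B Y = cls A B (span_sum G X Y)"
  unfolding span_classes_def monoid.simps
proof (rule equiv_Image_eq[OF equiv_iso_rel])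
  show "{span_sum G X' Y' |X' Y'. X' \<in> cls A B X \<and> Y' \<in> cls A B Y} \<noteq> {}"
    using cls_self[OF assms(3)] cls_self[OF assms(4)] by fast
  fix s assume "s \<in> {span_sum G X' Y' |X' Y'. X' \<in> cls A B X \<and> Y' \<in> cls A B Y}"
  then obtain X' Y' where "s = span_sum G X' Y'" "(X, X') \<in> iso_rel G A B" "(Y, Y') \<in> iso_rel G A B" by blast
  then show "(span_sum G X Y, s) \<in> iso_rel G A B" using sum_cong[OF assms(1,2)] by metis
qed

lemma cls_one: "\<one>\<^bsub>span_classes G A B\<^esub> = cls A B (span_empty G A B)"
  by (simp add: span_classes_def)

text \<open>The strict unit and associativity laws of the hom category hold for spans on the nose,
  since the encoding is injective. Commutativity is witnessed by the symmetry and holds for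
  classes.\<close>

lemma comm_monoid_span_classes:
  assumes AB: "fset A" "fset B"
  shows "comm_monoid (span_classes G A B)"
proof -
  interpret P: permutative_category "P A B" by (rule perm_P[OF AB])
  let ?M = "span_classes G A B"
  show ?thesis
  proof (rule comm_monoidI)
    show "\<one>\<^bsub>?M\<^esub> \<in> carrier ?M" by (simp add: cls_one cls_carrier span_empty_spans)
    fix x y assume "x \<in> carrier ?M" "y \<in> carrier ?M"
    then obtain X Y where X: "X \<in> spans G A B" and Y: "Y \<in> spans G A B" and xy: "x = cls A B X" "y = cls A B Y"
      by (auto simp: cls_carrier)
    note m = cls_mult[OF AB]
    show "x \<otimes>\<^bsub>?M\<^esub> y \<in> carrier ?M" by (simp add: xy m X Y cls_carrier span_sum_spans)
    have "e A B (span_sum G (span_empty G A B) X) = e A B X"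
      using P.add_zer[OF P_ObI[OF X]] P_Add[OF span_empty_spans X] by (simp add: P_Zer)
    then show "\<one>\<^bsub>?M\<^esub> \<otimes>\<^bsub>?M\<^esub> x = x"
      by (simp add: cls_one xy m X span_empty_spans e_eq_iff span_sum_spans)
    have "(span_sum G X Y, span_sum G Y X) \<in> iso_rel G A B"
      using P.twist[OF P_ObI[OF X] P_ObI[OF Y]] X Y by (intro arrow_iso) (simp_all add: P_Add span_sum_spans)
    then show "x \<otimes>\<^bsub>?M\<^esub> y = y \<otimes>\<^bsub>?M\<^esub> x"
      by (simp add: xy m X Y cls_eq span_sum_spans)
    fix z assume "z \<in> carrier ?M"
    then obtain Z where Z: "Z \<in> spans G A B" and z: "z = cls A B Z" by (auto simp: cls_carrier)
    have "e A B (span_sum G (span_sum G X Y) Z) = e A B (span_sum G X (span_sum G Y Z))"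
      using P.add_assoc[OF P_ObI[OF X] P_ObI[OF Y] P_ObI[OF Z]] by (simp add: P_Add X Y Z span_sum_spans)
    then show "x \<otimes>\<^bsub>?M\<^esub> y \<otimes>\<^bsub>?M\<^esub> z = x \<otimes>\<^bsub>?M\<^esub> (y \<otimes>\<^bsub>?M\<^esub> z)"
      by (simp add: xy z m X Y Z span_sum_spans e_eq_iff)
  qed
qed

subsection \<open>Composition of spans\<close>

lemma comp_multilinear:
  assumes "fset A" "fset B" "fset C"
  shows "multilinear_functor (GE_comp G pb A B C :: 'v mfun)" "Srcs (GE_comp G pb A B C :: 'v mfun) = [P B C, P A B]"
    "Target (GE_comp G pb A B C :: 'v mfun) = P A C"
  using E.comp[of A B C] assms by (simp_all add: E_fields)

lemma FO_comp:
  assumes "X \<in> spans G A B" "Y \<in> spans G B C"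
  shows "FO (GE_comp G pb A B C) [e B C Y, e A B X] = e A C (span_comp pb X Y)"
  using assms by (simp add: GE_comp_def Let_def P_Ob dec_e)

context
  fixes A B C assumes ABC: "fset A" "fset B" "fset C"
begin

lemmas comp_closed = span_comp_spans[OF pbc ABC]

text \<open>The composition functor carries a pair of arrows to an arrow, that is, to an isomorphism
  of the composed spans.\<close>

lemma comp_cong:
  assumes X: "(X, X') \<in> iso_rel G A B" and Y: "(Y, Y') \<in> iso_rel G B C"
  shows "(span_comp pb X Y, span_comp pb X' Y') \<in> iso_rel G A C"
proof -
  obtain u where u: "u \<in> Hom (P A B) (e A B X) (e A B X')" by (rule iso_arrow[OF X])
  obtain v where v: "v \<in> Hom (P B C) (e B C Y) (e B C Y')" by (rule iso_arrow[OF Y])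
  note s = iso_spans[OF X] iso_spans[OF Y]
  have "[v, u] \<in> Ars (Srcs (GE_comp G pb A B C))"
    unfolding comp_multilinear[OF ABC] using u v by (simp add: Hom_iff)
  from multilinear_functor.FA[OF comp_multilinear(1)[OF ABC] this]
  have "FA (GE_comp G pb A B C) [v, u] \<in> Hom (P A C) (e A C (span_comp pb X Y)) (e A C (span_comp pb X' Y'))"
    unfolding comp_multilinear[OF ABC] using u v FO_comp s by (simp add: Hom_iff)
  then show ?thesis using s by (intro arrow_iso) (simp_all add: comp_closed)
qed

text \<open>The linearity constraint of the composition functor is an arrow between these spans.
  Variable 0 belongs to the span that is applied last, since \<open>PComp\<close> lists the later
  morphism first.\<close>

lemma comp_sum_right:
  assumes X: "X \<in> spans G A B" and Y: "Y \<in> spans G B C" "Y' \<in> spans G B C"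
  shows "(span_sum G (span_comp pb X Y) (span_comp pb X Y'), span_comp pb X (span_sum G Y Y')) \<in> iso_rel G A C"
proof -
  have "[e B C Y, e A B X] \<in> Obs (Srcs (GE_comp G pb A B C))"
    unfolding comp_multilinear[OF ABC] using X Y by (simp add: P_ObI)
  from multilinear_functor.Lin[OF comp_multilinear(1)[OF ABC] _ this, of 0 "e B C Y'"]
  have "Lin (GE_comp G pb A B C) 0 [e B C Y, e A B X] (e B C Y') \<in>
      Hom (P A C) (e A C (span_sum G (span_comp pb X Y) (span_comp pb X Y'))) (e A C (span_comp pb X (span_sum G Y Y')))"
    unfolding comp_multilinear[OF ABC] using X Y by (simp add: P_ObI P_Add FO_comp comp_closed span_sum_spans)
  then show ?thesis using X Y by (intro arrow_iso) (simp_all add: comp_closed span_sum_spans)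
qed

lemma comp_sum_left:
  assumes X: "X \<in> spans G A B" "X' \<in> spans G A B" and Y: "Y \<in> spans G B C"
  shows "(span_sum G (span_comp pb X Y) (span_comp pb X' Y), span_comp pb (span_sum G X X') Y) \<in> iso_rel G A C"
proof -
  have "[e B C Y, e A B X] \<in> Obs (Srcs (GE_comp G pb A B C))"
    unfolding comp_multilinear[OF ABC] using X Y by (simp add: P_ObI)
  from multilinear_functor.Lin[OF comp_multilinear(1)[OF ABC] _ this, of 1 "e A B X'"]
  have "Lin (GE_comp G pb A B C) 1 [e B C Y, e A B X] (e A B X') \<in>
      Hom (P A C) (e A C (span_sum G (span_comp pb X Y) (span_comp pb X' Y))) (e A C (span_comp pb (span_sum G X X') Y))"
    unfolding comp_multilinear[OF ABC] using X Y by (simp add: P_ObI P_Add FO_comp comp_closed span_sum_spans)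
  then show ?thesis using X Y by (intro arrow_iso) (simp_all add: comp_closed span_sum_spans)
qed

text \<open>The local function \<open>m\<close> of \<open>burnside_comp\<close>, named here so that
  its biadditivity can be stated.\<close>

definition "mcls p q = iso_rel G A C `` {span_comp pb X Y | X Y. X \<in> p \<and> Y \<in> q}"

lemma mcls:
  assumes X: "X \<in> spans G A B" and Y: "Y \<in> spans G B C"
  shows "mcls (cls A B X) (cls B C Y) = cls A C (span_comp pb X Y)"
  unfolding mcls_def
proof (rule equiv_Image_eq[OF equiv_iso_rel])
  show "{span_comp pb X' Y' |X' Y'. X' \<in> cls A B X \<and> Y' \<in> cls B C Y} \<noteq> {}"
    using cls_self[OF X] cls_self[OF Y] by fast
  fix s assume "s \<in> {span_comp pb X' Y' |X' Y'. X' \<in> cls A B X \<and> Y' \<in> cls B C Y}"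
  then obtain X' Y' where "s = span_comp pb X' Y'" "(X, X') \<in> iso_rel G A B" "(Y, Y') \<in> iso_rel G B C" by blast
  then show "(span_comp pb X Y, s) \<in> iso_rel G A C" using comp_cong by metis
qed

interpretation AB: comm_monoid "span_classes G A B" by (rule comm_monoid_span_classes[OF ABC(1,2)])
interpretation BC: comm_monoid "span_classes G B C" by (rule comm_monoid_span_classes[OF ABC(2,3)])
interpretation AC: comm_monoid "span_classes G A C" by (rule comm_monoid_span_classes[OF ABC(1,3)])

lemma mcls_closed:
  "p \<in> carrier (span_classes G A B) \<Longrightarrow> q \<in> carrier (span_classes G B C) \<Longrightarrow> mcls p q \<in> carrier (span_classes G A C)"
  by (auto simp: cls_carrier mcls comp_closed)

lemma mcls_mult:
  "\<lbrakk>p \<in> carrier (span_classes G A B); p' \<in> carrier (span_classes G A B); q \<in> carrier (span_classes G B C)\<rbrakk> \<Longrightarrow>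
    mcls (p \<otimes>\<^bsub>span_classes G A B\<^esub> p') q = mcls p q \<otimes>\<^bsub>span_classes G A C\<^esub> mcls p' q"
  "\<lbrakk>p \<in> carrier (span_classes G A B); q \<in> carrier (span_classes G B C); q' \<in> carrier (span_classes G B C)\<rbrakk> \<Longrightarrow>
    mcls p (q \<otimes>\<^bsub>span_classes G B C\<^esub> q') = mcls p q \<otimes>\<^bsub>span_classes G A C\<^esub> mcls p q'"
proof -
  note m = cls_mult[OF ABC(1,2)] cls_mult[OF ABC(2,3)] cls_mult[OF ABC(1,3)]
  show "mcls (p \<otimes>\<^bsub>span_classes G A B\<^esub> p') q = mcls p q \<otimes>\<^bsub>span_classes G A C\<^esub> mcls p' q"
    if pq: "p \<in> carrier (span_classes G A B)" "p' \<in> carrier (span_classes G A B)" "q \<in> carrier (span_classes G B C)"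
  proof -
    obtain X X' Y where s: "X \<in> spans G A B" "X' \<in> spans G A B" "Y \<in> spans G B C"
      and c: "p = cls A B X" "p' = cls A B X'" "q = cls B C Y"
      using pq unfolding cls_carrier by blast
    show ?thesis
      using comp_sum_left[OF s] cls_eq[of "span_sum G (span_comp pb X Y) (span_comp pb X' Y)" A C "span_comp pb (span_sum G X X') Y"] s
      by (simp add: c m mcls comp_closed span_sum_spans)
  qed
  show "mcls p (q \<otimes>\<^bsub>span_classes G B C\<^esub> q') = mcls p q \<otimes>\<^bsub>span_classes G A C\<^esub> mcls p q'"
    if pq: "p \<in> carrier (span_classes G A B)" "q \<in> carrier (span_classes G B C)" "q' \<in> carrier (span_classes G B C)"
  proof -
    obtain X Y Y' where s: "X \<in> spans G A B" "Y \<in> spans G B C" "Y' \<in> spans G B C"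
      and c: "p = cls A B X" "q = cls B C Y" "q' = cls B C Y'"
      using pq unfolding cls_carrier by blast
    show ?thesis
      using comp_sum_right[OF s] cls_eq[of "span_sum G (span_comp pb X Y) (span_comp pb X Y')" A C "span_comp pb X (span_sum G Y Y')"] s
      by (simp add: c m mcls comp_closed span_sum_spans)
  qed
qed

text \<open>Well-definedness of the biadditive extension: the saturated set in
  \<open>burnside_comp\<close> is a single class. Representatives of the two arguments are changed
  one at a time, through a mixed pair.\<close>

lemma burnside_comp_class:
  assumes p0: "p0 \<in> carrier (span_classes G A B)" "p0' \<in> carrier (span_classes G A B)"
    and q0: "q0 \<in> carrier (span_classes G B C)" "q0' \<in> carrier (span_classes G B C)"
  shows "burnside_comp G pb A B C (groth_rel (span_classes G B C) `` {(q0, q0')}) (groth_rel (span_classes G A B) `` {(p0, p0')}) =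
    groth_rel (span_classes G A C) `` {(mcls p0 q0 \<otimes>\<^bsub>span_classes G A C\<^esub> mcls p0' q0', mcls p0 q0' \<otimes>\<^bsub>span_classes G A C\<^esub> mcls p0' q0)}"
proof -
  let ?M = "span_classes G A C"
  let ?H = "group_completion ?M"
  interpret H: comm_group ?H by (rule AC.comm_group_group_completion)
  let ?c = "groth_rel (span_classes G A B) `` {(p0, p0')}" and ?d = "groth_rel (span_classes G B C) `` {(q0, q0')}"
  let ?S = "{(mcls P Q \<otimes>\<^bsub>?M\<^esub> mcls P' Q', mcls P Q' \<otimes>\<^bsub>?M\<^esub> mcls P' Q) | P P' Q Q'. (P, P') \<in> ?c \<and> (Q, Q') \<in> ?d}"
  have "burnside_comp G pb A B C ?d ?c = groth_rel ?M `` ?S"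
    unfolding burnside_comp_def Let_def mcls_def ..
  also have "\<dots> = groth_rel ?M `` {(mcls p0 q0 \<otimes>\<^bsub>?M\<^esub> mcls p0' q0', mcls p0 q0' \<otimes>\<^bsub>?M\<^esub> mcls p0' q0)}"
  proof (rule equiv_Image_eq[OF AC.equiv_groth_rel])
    have "(p0, p0') \<in> ?c" by (rule equiv_class_self[OF AB.equiv_groth_rel]) (simp add: p0)
    moreover have "(q0, q0') \<in> ?d" by (rule equiv_class_self[OF BC.equiv_groth_rel]) (simp add: q0)
    ultimately show "?S \<noteq> {}" by fast
    fix s assume "s \<in> ?S"
    then obtain p p' q q' where s: "s = (mcls p q \<otimes>\<^bsub>?M\<^esub> mcls p' q', mcls p q' \<otimes>\<^bsub>?M\<^esub> mcls p' q)"
      and p: "(p, p') \<in> ?c" and q: "(q, q') \<in> ?d" by fast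
    obtain k where pc: "p \<in> carrier (span_classes G A B)" "p' \<in> carrier (span_classes G A B)"
      and k: "k \<in> carrier (span_classes G A B)"
      and pk: "p0 \<otimes>\<^bsub>span_classes G A B\<^esub> p' \<otimes>\<^bsub>span_classes G A B\<^esub> k = p \<otimes>\<^bsub>span_classes G A B\<^esub> p0' \<otimes>\<^bsub>span_classes G A B\<^esub> k"
      using p by (auto simp: groth_rel_def)
    obtain l where qc: "q \<in> carrier (span_classes G B C)" "q' \<in> carrier (span_classes G B C)"
      and l: "l \<in> carrier (span_classes G B C)"
      and ql: "q0 \<otimes>\<^bsub>span_classes G B C\<^esub> q' \<otimes>\<^bsub>span_classes G B C\<^esub> l = q \<otimes>\<^bsub>span_classes G B C\<^esub> q0' \<otimes>\<^bsub>span_classes G B C\<^esub> l"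
      using q by (auto simp: groth_rel_def)
    \<comment> \<open>Products are compared in the group completion of the target, where
      \<open>b\<close> is biadditive and the images of the witnesses \<open>k\<close> and
      \<open>l\<close> cancel.\<close>
    define b where "b = (\<lambda>p q. to_completion ?M (mcls p q))"
    have bc: "b p q \<in> carrier ?H" if "p \<in> carrier (span_classes G A B)" "q \<in> carrier (span_classes G B C)" for p q
      unfolding b_def by (rule hom_in_carrier[OF AC.to_completion_hom mcls_closed[OF that]])
    have bl: "b (p \<otimes>\<^bsub>span_classes G A B\<^esub> p') q = b p q \<otimes>\<^bsub>?H\<^esub> b p' q"
      if "p \<in> carrier (span_classes G A B)" "p' \<in> carrier (span_classes G A B)" "q \<in> carrier (span_classes G B C)" for p p' q
      unfolding b_def mcls_mult(1)[OF that]
      by (rule hom_mult[OF AC.to_completion_hom mcls_closed mcls_closed]) (use that in simp_all)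
    have br: "b p (q \<otimes>\<^bsub>span_classes G B C\<^esub> q') = b p q \<otimes>\<^bsub>?H\<^esub> b p q'"
      if "p \<in> carrier (span_classes G A B)" "q \<in> carrier (span_classes G B C)" "q' \<in> carrier (span_classes G B C)" for p q q'
      unfolding b_def mcls_mult(2)[OF that]
      by (rule hom_mult[OF AC.to_completion_hom mcls_closed mcls_closed]) (use that in simp_all)
    have b1: "b p0 r \<otimes>\<^bsub>?H\<^esub> b p' r = b p r \<otimes>\<^bsub>?H\<^esub> b p0' r" if r: "r \<in> carrier (span_classes G B C)" for r
    proof -
      have "b p0 r \<otimes>\<^bsub>?H\<^esub> b p' r \<otimes>\<^bsub>?H\<^esub> b k r = b p r \<otimes>\<^bsub>?H\<^esub> b p0' r \<otimes>\<^bsub>?H\<^esub> b k r"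
        using arg_cong[OF pk, of "\<lambda>x. b x r"] by (simp add: bl pc k r p0)
      then show ?thesis by (simp add: bc pc p0 k r)
    qed
    have b2: "b r q0 \<otimes>\<^bsub>?H\<^esub> b r q' = b r q \<otimes>\<^bsub>?H\<^esub> b r q0'" if r: "r \<in> carrier (span_classes G A B)" for r
    proof -
      have "b r q0 \<otimes>\<^bsub>?H\<^esub> b r q' \<otimes>\<^bsub>?H\<^esub> b r l = b r q \<otimes>\<^bsub>?H\<^esub> b r q0' \<otimes>\<^bsub>?H\<^esub> b r l"
        using arg_cong[OF ql, of "b r"] by (simp add: br qc l r q0)
      then show ?thesis by (simp add: bc qc q0 l r)
    qed
    let ?xa = "b p0 q0 \<otimes>\<^bsub>?H\<^esub> b p0' q0'" and ?ya = "b p0 q0' \<otimes>\<^bsub>?H\<^esub> b p0' q0"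
    \<comment> \<open>The mixed pair: the first argument is already represented by
      \<open>(p, p')\<close>, the second still by \<open>(q0, q0')\<close>.\<close>
    let ?xb = "b p q0 \<otimes>\<^bsub>?H\<^esub> b p' q0'" and ?yb = "b p q0' \<otimes>\<^bsub>?H\<^esub> b p' q0"
    let ?x = "b p q \<otimes>\<^bsub>?H\<^esub> b p' q'" and ?y = "b p q' \<otimes>\<^bsub>?H\<^esub> b p' q"
    note cs = bc[OF p0(1) q0(1)] bc[OF p0(1) q0(2)] bc[OF p0(2) q0(1)] bc[OF p0(2) q0(2)]
      bc[OF pc(1) q0(1)] bc[OF pc(1) q0(2)] bc[OF pc(2) q0(1)] bc[OF pc(2) q0(2)]
      bc[OF pc(1) qc(1)] bc[OF pc(1) qc(2)] bc[OF pc(2) qc(1)] bc[OF pc(2) qc(2)]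
    have swap: "w \<otimes>\<^bsub>?H\<^esub> x \<otimes>\<^bsub>?H\<^esub> (y \<otimes>\<^bsub>?H\<^esub> z) = (w \<otimes>\<^bsub>?H\<^esub> z) \<otimes>\<^bsub>?H\<^esub> (y \<otimes>\<^bsub>?H\<^esub> x)"
      if "w \<in> carrier ?H" "x \<in> carrier ?H" "y \<in> carrier ?H" "z \<in> carrier ?H" for w x y z
      using that by (simp add: H.m_ac)
    have 1: "?xa \<otimes>\<^bsub>?H\<^esub> ?yb = ?xb \<otimes>\<^bsub>?H\<^esub> ?ya"
    proof -
      have "?xa \<otimes>\<^bsub>?H\<^esub> ?yb = (b p0 q0 \<otimes>\<^bsub>?H\<^esub> b p' q0) \<otimes>\<^bsub>?H\<^esub> (b p q0' \<otimes>\<^bsub>?H\<^esub> b p0' q0')" by (rule swap) (rule cs)+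
      also have "\<dots> = (b p q0 \<otimes>\<^bsub>?H\<^esub> b p0' q0) \<otimes>\<^bsub>?H\<^esub> (b p0 q0' \<otimes>\<^bsub>?H\<^esub> b p' q0')"
        by (simp only: b1[OF q0(1)] b1[OF q0(2)])
      also have "\<dots> = ?xb \<otimes>\<^bsub>?H\<^esub> ?ya" by (rule swap) (rule cs)+
      finally show ?thesis .
    qed
    have 2: "?xb \<otimes>\<^bsub>?H\<^esub> ?y = ?x \<otimes>\<^bsub>?H\<^esub> ?yb"
    proof -
      have "?xb \<otimes>\<^bsub>?H\<^esub> ?y = (b p q0 \<otimes>\<^bsub>?H\<^esub> b p q') \<otimes>\<^bsub>?H\<^esub> (b p' q \<otimes>\<^bsub>?H\<^esub> b p' q0')" using cs by (simp add: H.m_ac)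
      also have "\<dots> = (b p q \<otimes>\<^bsub>?H\<^esub> b p q0') \<otimes>\<^bsub>?H\<^esub> (b p' q0 \<otimes>\<^bsub>?H\<^esub> b p' q')"
        by (simp only: b2[OF pc(1)] b2[OF pc(2)])
      also have "\<dots> = ?x \<otimes>\<^bsub>?H\<^esub> ?yb" using cs by (simp add: H.m_ac)
      finally show ?thesis .
    qed
    have xc: "?xa \<in> carrier ?H" "?ya \<in> carrier ?H" "?xb \<in> carrier ?H" "?yb \<in> carrier ?H" "?x \<in> carrier ?H" "?y \<in> carrier ?H"
      using cs by simp_all
    have cancel: "x0 \<otimes>\<^bsub>?H\<^esub> y = x \<otimes>\<^bsub>?H\<^esub> y0"
      if "x0 \<otimes>\<^bsub>?H\<^esub> y1 = x1 \<otimes>\<^bsub>?H\<^esub> y0" "x1 \<otimes>\<^bsub>?H\<^esub> y = x \<otimes>\<^bsub>?H\<^esub> y1"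
        "x0 \<in> carrier ?H" "y0 \<in> carrier ?H" "x1 \<in> carrier ?H" "y1 \<in> carrier ?H" "x \<in> carrier ?H" "y \<in> carrier ?H"
      for x0 y0 x1 y1 x y
    proof -
      have "x0 \<otimes>\<^bsub>?H\<^esub> y \<otimes>\<^bsub>?H\<^esub> y1 = x0 \<otimes>\<^bsub>?H\<^esub> y1 \<otimes>\<^bsub>?H\<^esub> y" using that(3-) by (simp add: H.m_ac)
      also have "\<dots> = x1 \<otimes>\<^bsub>?H\<^esub> y \<otimes>\<^bsub>?H\<^esub> y0" unfolding that(1) using that(3-) by (simp add: H.m_ac)
      also have "\<dots> = x \<otimes>\<^bsub>?H\<^esub> y0 \<otimes>\<^bsub>?H\<^esub> y1" unfolding that(2) using that(3-) by (simp add: H.m_ac)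
      finally show ?thesis using that(3-) by simp
    qed
    have eq: "?xa \<otimes>\<^bsub>?H\<^esub> ?y = ?x \<otimes>\<^bsub>?H\<^esub> ?ya" by (rule cancel[OF 1 2 xc])
    note mc = mcls_closed[OF p0(1) q0(1)] mcls_closed[OF p0(1) q0(2)] mcls_closed[OF p0(2) q0(1)] mcls_closed[OF p0(2) q0(2)]
      mcls_closed[OF pc(1) qc(1)] mcls_closed[OF pc(1) qc(2)] mcls_closed[OF pc(2) qc(1)] mcls_closed[OF pc(2) qc(2)]
    have h: "to_completion ?M (x \<otimes>\<^bsub>?M\<^esub> y) = to_completion ?M x \<otimes>\<^bsub>?H\<^esub> to_completion ?M y"
      if "x \<in> carrier ?M" "y \<in> carrier ?M" for x y by (rule hom_mult[OF AC.to_completion_hom that])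
    let ?Xa = "mcls p0 q0 \<otimes>\<^bsub>?M\<^esub> mcls p0' q0'" and ?Ya = "mcls p0 q0' \<otimes>\<^bsub>?M\<^esub> mcls p0' q0"
    let ?X = "mcls p q \<otimes>\<^bsub>?M\<^esub> mcls p' q'" and ?Y = "mcls p q' \<otimes>\<^bsub>?M\<^esub> mcls p' q"
    \<comment> \<open>Back to the monoid: equality in the completion returns the witness
      \<open>m\<close> that \<open>groth_rel\<close> asks for.\<close>
    have "to_completion ?M (?Xa \<otimes>\<^bsub>?M\<^esub> ?Y) = to_completion ?M (?X \<otimes>\<^bsub>?M\<^esub> ?Ya)"
      using eq mc unfolding b_def by (simp add: h)
    then have "\<exists>m\<in>carrier ?M. ?Xa \<otimes>\<^bsub>?M\<^esub> ?Y \<otimes>\<^bsub>?M\<^esub> m = ?X \<otimes>\<^bsub>?M\<^esub> ?Ya \<otimes>\<^bsub>?M\<^esub> m"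
      using AC.to_completion_eq mc by simp
    then show "((?Xa, ?Ya), s) \<in> groth_rel ?M"
      unfolding groth_rel_def s using mc by simp
  qed
  finally show ?thesis .
qed

lemma burnside_comp_closed:
  assumes "c \<in> carrier (burnside_hom G A B)" "d \<in> carrier (burnside_hom G B C)"
  shows "burnside_comp G pb A B C d c \<in> carrier (burnside_hom G A C)"
proof -
  obtain p p' where p: "p \<in> carrier (span_classes G A B)" "p' \<in> carrier (span_classes G A B)"
    "c = groth_rel (span_classes G A B) `` {(p, p')}"
    using assms(1) unfolding burnside_hom_def by (rule AB.group_completion_carrierE)
  obtain q q' where q: "q \<in> carrier (span_classes G B C)" "q' \<in> carrier (span_classes G B C)"
    "d = groth_rel (span_classes G B C) `` {(q, q')}"
    using assms(2) unfolding burnside_hom_def by (rule BC.group_completion_carrierE)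
  show ?thesis
    unfolding p(3) q(3) burnside_comp_class[OF p(1,2) q(1,2)] burnside_hom_def
    using p q by (intro AC.groth_class_closed AC.m_closed mcls_closed)
qed

text \<open>A multilinear functor is strictly zero as soon as one entry is, so these are equalities
  of spans and not merely isomorphisms.\<close>

lemma comp_empty:
  "X \<in> spans G A B \<Longrightarrow> span_comp pb X (span_empty G B C) = span_empty G A C"
  "Y \<in> spans G B C \<Longrightarrow> span_comp pb (span_empty G A B) Y = span_empty G A C"
proof -
  show "span_comp pb X (span_empty G B C) = span_empty G A C" if X: "X \<in> spans G A B"
  proof -
    have "[e B C (span_empty G B C), e A B X] \<in> Obs (Srcs (GE_comp G pb A B C))"
      unfolding comp_multilinear[OF ABC] using X by (simp add: P_ObI span_empty_spans)
    from multilinear_functor.FO_zer[OF comp_multilinear(1)[OF ABC] this, of 0]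
    show ?thesis unfolding comp_multilinear[OF ABC] using X
      by (simp add: P_Zer FO_comp span_empty_spans e_eq_iff comp_closed)
  qed
  show "span_comp pb (span_empty G A B) Y = span_empty G A C" if Y: "Y \<in> spans G B C"
  proof -
    have "[e B C Y, e A B (span_empty G A B)] \<in> Obs (Srcs (GE_comp G pb A B C))"
      unfolding comp_multilinear[OF ABC] using Y by (simp add: P_ObI span_empty_spans)
    from multilinear_functor.FO_zer[OF comp_multilinear(1)[OF ABC] this, of 1]
    show ?thesis unfolding comp_multilinear[OF ABC] using Y
      by (simp add: P_Zer FO_comp span_empty_spans e_eq_iff comp_closed)
  qed
qed

text \<open>With the empty span as the negative part of both arguments, three of the four products
  vanish by \<open>comp_empty\<close>.\<close>

lemma burnside_comp_span_class:
  assumes X: "X \<in> spans G A B" and Y: "Y \<in> spans G B C"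
  shows "burnside_comp G pb A B C (span_class G B C Y) (span_class G A B X) = span_class G A C (span_comp pb X Y)"
proof -
  have c: "cls A B X \<in> carrier (span_classes G A B)" "cls B C Y \<in> carrier (span_classes G B C)"
    "cls A C (span_comp pb X Y) \<in> carrier (span_classes G A C)"
    using X Y comp_closed by (auto simp: cls_carrier)
  have "mcls (cls A B X) \<one>\<^bsub>span_classes G B C\<^esub> = \<one>\<^bsub>span_classes G A C\<^esub>"
    "mcls \<one>\<^bsub>span_classes G A B\<^esub> (cls B C Y) = \<one>\<^bsub>span_classes G A C\<^esub>"
    "mcls \<one>\<^bsub>span_classes G A B\<^esub> \<one>\<^bsub>span_classes G B C\<^esub> = \<one>\<^bsub>span_classes G A C\<^esub>"
    using X Y by (simp_all add: cls_one mcls span_empty_spans comp_empty)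
  then show ?thesis
    unfolding span_class_def to_completion_def
    using c by (simp add: burnside_comp_class mcls X Y)
qed

end

text \<open>The last fact expresses that \<open>c\<close> is a difference of two spans without using
  an inverse, in the form suited to cancellation in a target group.\<close>

lemma burnside_homE:
  assumes AB: "fset A" "fset B" and c: "c \<in> carrier (burnside_hom G A B)"
  obtains X Y where "X \<in> spans G A B" "Y \<in> spans G A B" "c = groth_rel (span_classes G A B) `` {(cls A B X, cls A B Y)}"
    "c \<otimes>\<^bsub>burnside_hom G A B\<^esub> span_class G A B Y = span_class G A B X"
proof -
  interpret M: comm_monoid "span_classes G A B" by (rule comm_monoid_span_classes[OF AB])
  obtain p q where pq: "p \<in> carrier (span_classes G A B)" "q \<in> carrier (span_classes G A B)"
    and c: "c = groth_rel (span_classes G A B) `` {(p, q)}"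
    using c unfolding burnside_hom_def by (rule M.group_completion_carrierE)
  obtain X Y where XY: "X \<in> spans G A B" "Y \<in> spans G A B" "p = cls A B X" "q = cls A B Y"
    using pq unfolding cls_carrier by blast
  show ?thesis
    by (rule that[OF XY(1,2)])
      (use M.groth_class_to_completion[OF pq] in \<open>simp_all add: c XY burnside_hom_def span_class_def\<close>)
qed

lemma span_class_carrier: "fset A \<Longrightarrow> fset B \<Longrightarrow> X \<in> spans G A B \<Longrightarrow> span_class G A B X \<in> carrier (burnside_hom G A B)"
  unfolding burnside_hom_def span_class_def
  by (rule hom_in_carrier[OF comm_monoid.to_completion_hom[OF comm_monoid_span_classes]]) (auto simp: cls_carrier)

lemma span_class_sum:
  assumes "fset A" "fset B" "X \<in> spans G A B" "Y \<in> spans G A B"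
  shows "span_class G A B (span_sum G X Y) = span_class G A B X \<otimes>\<^bsub>burnside_hom G A B\<^esub> span_class G A B Y"
  unfolding burnside_hom_def span_class_def cls_mult[OF assms, symmetric]
  by (rule hom_mult[OF comm_monoid.to_completion_hom[OF comm_monoid_span_classes]]) (use assms in \<open>auto simp: cls_carrier\<close>)

lemma span_class_iso: "(X, Y) \<in> iso_rel G A B \<Longrightarrow> span_class G A B X = span_class G A B Y"
  unfolding span_class_def using equiv_class_eq[OF equiv_iso_rel] by metis

end

section \<open>Spectral categories from K-theory\<close>

context closed_symmetric_monoidal
begin

text \<open>\<open>t\<close> is the name of \<open>\<tau>\<close>, a point of a function spectrum.
  Composing with a name is postcomposition with the named map; this turns naturality squares in
  \<open>Spec S\<close> into plain equations between maps.\<close>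

lemma Spec_comp_point_left:
  assumes t: "t \<in> sHom S I (sFun S Y Z)" "sEv S Y Z \<odot> (t \<boxdot> idt Y) = \<tau> \<odot> lun Y" "\<tau> \<in> sHom S Y Z"
    and g: "g \<in> sHom S W (sFun S X Y)" "sEv S X Y \<odot> (g \<boxdot> idt X) = \<gamma>" and X: "X \<in> sOb S"
  shows "sEv S X Z \<odot> ((SComp (Spec S) X Y Z \<odot> ((t \<boxdot> g) \<odot> luni W)) \<boxdot> idt X) = \<tau> \<odot> \<gamma>"
proof -
  note [simp] = sHomD[OF t(1)] sHomD[OF t(3)] sHomD[OF g(1)] X sHomD[OF Spec_comp_typed]
  have \<gamma>: "\<gamma> \<in> sHom S (W \<boxtimes> X) Y" unfolding g(2)[symmetric] by (rule sHomI) simp_all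
  note [simp] = sHomD[OF \<gamma>]
  have "sEv S X Z \<odot> ((SComp (Spec S) X Y Z \<odot> ((t \<boxdot> g) \<odot> luni W)) \<boxdot> idt X)
    = (sEv S X Z \<odot> ((SComp (Spec S) X Y Z \<odot> (t \<boxdot> g)) \<boxdot> idt X)) \<odot> (luni W \<boxdot> idt X)"
    by simp
  also have "\<dots> = (sEv S Y Z \<odot> ((t \<boxdot> \<gamma>) \<odot> assc I W X)) \<odot> (luni W \<boxdot> idt X)"
    by (subst Spec_comp[OF t(1) g(1)]) (simp_all add: g(2))
  also have "t \<boxdot> \<gamma> = (t \<boxdot> idt Y) \<odot> (idt I \<boxdot> \<gamma>)" by simp
  also have "(sEv S Y Z \<odot> (((t \<boxdot> idt Y) \<odot> (idt I \<boxdot> \<gamma>)) \<odot> assc I W X)) \<odot> (luni W \<boxdot> idt X)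
    = (sEv S Y Z \<odot> (t \<boxdot> idt Y)) \<odot> ((idt I \<boxdot> \<gamma>) \<odot> (assc I W X \<odot> (luni W \<boxdot> idt X)))"
    by (simp del: ten_cmp')
  also have "\<dots> = \<tau> \<odot> ((lun Y \<odot> (idt I \<boxdot> \<gamma>)) \<odot> (assc I W X \<odot> (luni W \<boxdot> idt X)))"
    unfolding t(2) by simp
  also have "lun Y \<odot> (idt I \<boxdot> \<gamma>) = \<gamma> \<odot> lun (W \<boxtimes> X)" by (rule lun_nat[OF \<gamma>])
  also have "\<tau> \<odot> ((\<gamma> \<odot> lun (W \<boxtimes> X)) \<odot> (assc I W X \<odot> (luni W \<boxdot> idt X)))
    = \<tau> \<odot> (\<gamma> \<odot> ((lun (W \<boxtimes> X) \<odot> assc I W X) \<odot> (luni W \<boxdot> idt X)))"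
    by simp
  also have "\<dots> = \<tau> \<odot> \<gamma>" by (simp add: lun_tensor)
  finally show ?thesis .
qed

text \<open>The counterpart for a name on the source side: composing with it is precomposition in
  the evaluated variable, and the unit cancels by the triangle.\<close>

lemma Spec_comp_point_right:
  assumes t: "t \<in> sHom S I (sFun S X Y)" "sEv S X Y \<odot> (t \<boxdot> idt X) = \<tau> \<odot> lun X" "\<tau> \<in> sHom S X Y"
    and g: "g \<in> sHom S W (sFun S Y Z)" "sEv S Y Z \<odot> (g \<boxdot> idt Y) = \<gamma>" and Z: "Z \<in> sOb S"
  shows "sEv S X Z \<odot> ((SComp (Spec S) X Y Z \<odot> ((g \<boxdot> t) \<odot> runi W)) \<boxdot> idt X) = \<gamma> \<odot> (idt W \<boxdot> \<tau>)"
proof -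
  note [simp] = sHomD[OF t(1)] sHomD[OF t(3)] sHomD[OF g(1)] Z sHomD[OF Spec_comp_typed]
  have "sEv S X Z \<odot> ((SComp (Spec S) X Y Z \<odot> ((g \<boxdot> t) \<odot> runi W)) \<boxdot> idt X)
    = (sEv S X Z \<odot> ((SComp (Spec S) X Y Z \<odot> (g \<boxdot> t)) \<boxdot> idt X)) \<odot> (runi W \<boxdot> idt X)"
    by simp
  also have "\<dots> = (sEv S Y Z \<odot> ((g \<boxdot> (\<tau> \<odot> lun X)) \<odot> assc W I X)) \<odot> (runi W \<boxdot> idt X)"
    by (subst Spec_comp[OF g(1) t(1)]) (simp_all add: t(2))
  also have "g \<boxdot> (\<tau> \<odot> lun X) = (g \<boxdot> idt Y) \<odot> ((idt W \<boxdot> \<tau>) \<odot> (idt W \<boxdot> lun X))" by simp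
  also have "(sEv S Y Z \<odot> (((g \<boxdot> idt Y) \<odot> ((idt W \<boxdot> \<tau>) \<odot> (idt W \<boxdot> lun X))) \<odot> assc W I X)) \<odot> (runi W \<boxdot> idt X)
    = (sEv S Y Z \<odot> (g \<boxdot> idt Y)) \<odot> ((idt W \<boxdot> \<tau>) \<odot> (((idt W \<boxdot> lun X) \<odot> assc W I X) \<odot> (runi W \<boxdot> idt X)))"
    by (simp del: ten_cmp')
  also have "\<dots> = \<gamma> \<odot> (idt W \<boxdot> \<tau>)"
    unfolding g(2) by (simp add: triangle)
  finally show ?thesis .
qed

end

locale K_theory = category_of_spectra S + K_theory_machine S K
  for S :: "('s, 't, 'h) spectra" and K :: "('v, 's, 't) machine"
begin

section \<open>Images under K of composites with small arities\<close>

lemma KOb_ob [simp]: "small_permcat A \<Longrightarrow> KOb K A \<in> sOb S"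
  by (rule KOb)

lemma Perm_morphism_small: "Perm_morphism f \<Longrightarrow> A \<in> set (Srcs f) \<Longrightarrow> small_permcat A"
  "Perm_morphism f \<Longrightarrow> small_permcat (Target f)"
  by (auto simp: Perm_morphism_def)

lemma KMor_arr:
  assumes "Perm_morphism f"
  shows "KMor K f \<in> sAr S" "sSrc S (KMor K f) = smash S (map (KOb K) (Srcs f))" "sTgt S (KMor K f) = KOb K (Target f)"
  using sHomD[OF KMor[OF assms]] by auto

lemma KMor_mcomp_1:
  assumes "Perm_morphism g" "Perm_morphism f" "Srcs g = [Target f]"
  shows "KMor K (mcomp g [f]) = KMor K g \<odot> KMor K f"
  using KMor_mcomp[of g "[f]"] assms KMor_arr[OF assms(2)] sHomD[OF KMor[OF assms(2)]] by simp

text \<open>For inner arities 2 and 1 \<open>regroup\<close> is an inverse associator, which is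
  moved to the left-hand side. In the variants that follow it is trivial or an inverse unit
  constraint.\<close>

lemma KMor_mcomp_2_1:
  assumes "Perm_morphism g" "Perm_morphism f" "Perm_morphism f'" "Srcs g = [Target f, Target f']"
    "Srcs f = [X, Y]" "Srcs f' = [Z]"
  shows "KMor K (mcomp g [f, f']) \<odot> assc (KOb K X) (KOb K Y) (KOb K Z) = KMor K g \<odot> (KMor K f \<boxdot> KMor K f')"
proof -
  have [simp]: "small_permcat X" "small_permcat Y" "small_permcat Z"
    using Perm_morphism_small assms by force+
  note [simp] = KMor_arr[OF assms(1)] KMor_arr[OF assms(2)] KMor_arr[OF assms(3)] assms(4-6)
    Perm_morphism_small(2)[OF assms(2)] Perm_morphism_small(2)[OF assms(3)]
  show ?thesis using KMor_mcomp[of g "[f, f']"] assms(1-3) by simp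
qed

lemma KMor_mcomp_1_2:
  assumes "Perm_morphism g" "Perm_morphism f" "Perm_morphism f'" "Srcs g = [Target f, Target f']"
    "Srcs f = [X]" "Srcs f' = [Y, Z]"
  shows "KMor K (mcomp g [f, f']) = KMor K g \<odot> (KMor K f \<boxdot> KMor K f')"
proof -
  have [simp]: "small_permcat X" "small_permcat Y" "small_permcat Z"
    using Perm_morphism_small assms by force+
  note [simp] = KMor_arr[OF assms(1)] KMor_arr[OF assms(2)] KMor_arr[OF assms(3)] assms(4-6)
    Perm_morphism_small(2)[OF assms(2)] Perm_morphism_small(2)[OF assms(3)]
  show ?thesis using KMor_mcomp[of g "[f, f']"] assms(1-3) by simp
qed

lemma KMor_mcomp_1_1:
  assumes "Perm_morphism g" "Perm_morphism f" "Perm_morphism f'" "Srcs g = [Target f, Target f']"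
    "Srcs f = [X]" "Srcs f' = [Y]"
  shows "KMor K (mcomp g [f, f']) = KMor K g \<odot> (KMor K f \<boxdot> KMor K f')"
proof -
  have [simp]: "small_permcat X" "small_permcat Y"
    using Perm_morphism_small assms by force+
  note [simp] = KMor_arr[OF assms(1)] KMor_arr[OF assms(2)] KMor_arr[OF assms(3)] assms(4-6)
    Perm_morphism_small(2)[OF assms(2)] Perm_morphism_small(2)[OF assms(3)]
  show ?thesis using KMor_mcomp[of g "[f, f']"] assms(1-3) by simp
qed

lemma KMor_mcomp_1_0:
  assumes "Perm_morphism g" "Perm_morphism f" "Perm_morphism f'" "Srcs g = [Target f, Target f']"
    "Srcs f = [X]" "Srcs f' = []"
  shows "KMor K (mcomp g [f, f']) \<odot> run (KOb K X) = KMor K g \<odot> (KMor K f \<boxdot> KMor K f')"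
proof -
  have [simp]: "small_permcat X"
    using Perm_morphism_small assms by force+
  note [simp] = KMor_arr[OF assms(1)] KMor_arr[OF assms(2)] KMor_arr[OF assms(3)] assms(4-6)
    Perm_morphism_small(2)[OF assms(2)] Perm_morphism_small(2)[OF assms(3)]
  show ?thesis using KMor_mcomp[of g "[f, f']"] assms(1-3) by simp
qed

lemma KMor_mcomp_0_1:
  assumes "Perm_morphism g" "Perm_morphism f" "Perm_morphism f'" "Srcs g = [Target f, Target f']"
    "Srcs f = []" "Srcs f' = [X]"
  shows "KMor K (mcomp g [f, f']) \<odot> lun (KOb K X) = KMor K g \<odot> (KMor K f \<boxdot> KMor K f')"
proof -
  have [simp]: "small_permcat X"
    using Perm_morphism_small assms by force+
  note [simp] = KMor_arr[OF assms(1)] KMor_arr[OF assms(2)] KMor_arr[OF assms(3)] assms(4-6)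
    Perm_morphism_small(2)[OF assms(2)] Perm_morphism_small(2)[OF assms(3)]
  show ?thesis using KMor_mcomp[of g "[f, f']"] assms(1-3) by simp
qed

lemma KMor_mcomp_0_0:
  assumes "Perm_morphism g" "Perm_morphism f" "Perm_morphism f'" "Srcs g = [Target f, Target f']"
    "Srcs f = []" "Srcs f' = []"
  shows "KMor K (mcomp g [f, f']) = KMor K g \<odot> ((KMor K f \<boxdot> KMor K f') \<odot> luni I)"
proof -
  note [simp] = KMor_arr[OF assms(1)] KMor_arr[OF assms(2)] KMor_arr[OF assms(3)] assms(4-6)
    Perm_morphism_small(2)[OF assms(2)] Perm_morphism_small(2)[OF assms(3)]
  show ?thesis using KMor_mcomp[of g "[f, f']"] assms(1-3) by simp
qed

text \<open>Each law is the image under K of the corresponding law of \<open>C\<close>; the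
  associator and unit constraints are those produced by \<open>regroup\<close>.\<close>

lemma K_cat_spectral:
  assumes "pc_category C"
  shows "spectral_category S (K_cat K C)"
proof -
  interpret C: pc_category C by fact
  have sm [simp]: "small_permcat (PHom C a b)" if "a \<in> PObj C" "b \<in> PObj C" for a b
    using C.hom that by simp
  have pm: "Perm_morphism (PComp C a b c)" "Srcs (PComp C a b c) = [PHom C b c, PHom C a b]"
    "Target (PComp C a b c) = PHom C a c"
    if "a \<in> PObj C" "b \<in> PObj C" "c \<in> PObj C" for a b c
    using C.comp[OF that] that by (auto simp: Perm_morphism_def)
  have pt: "Perm_morphism (mpoint (PHom C a a) (PUnit C a))" if "a \<in> PObj C" for a
    by (rule Perm_morphism_mpoint[OF sm[OF that that] C.unit[OF that]])
  have pi: "Perm_morphism (mid (PHom C a b))" if "a \<in> PObj C" "b \<in> PObj C" for a b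
    by (rule Perm_morphism_mid[OF sm[OF that]])
  show ?thesis
  proof (unfold_locales, unfold K_cat_def scat.simps)
    fix a b assume ab [simp]: "a \<in> PObj C" "b \<in> PObj C"
    show "KOb K (PHom C a b) \<in> sOb S" by simp
    show "KMor K (mpoint (PHom C a a) (PUnit C a)) \<in> sHom S (sUnit S) (KOb K (PHom C a a))"
      using KMor[OF pt[OF ab(1)]] by simp
    show "KMor K (PComp C a a b) \<odot> (idt (KOb K (PHom C a b)) \<boxdot> KMor K (mpoint (PHom C a a) (PUnit C a))) = run (KOb K (PHom C a b))"
      using KMor_mcomp_1_0[OF pm(1)[of a a b] pi[of a b] pt[of a]] C.unit_right[OF ab]
      by (simp add: pm KMor_mid)
    show "KMor K (PComp C a b b) \<odot> (KMor K (mpoint (PHom C b b) (PUnit C b)) \<boxdot> idt (KOb K (PHom C a b))) = lun (KOb K (PHom C a b))"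
      using KMor_mcomp_0_1[OF pm(1)[of a b b] pt[of b] pi[of a b]] C.unit_left[OF ab]
      by (simp add: pm KMor_mid)
    fix c assume c [simp]: "c \<in> PObj C"
    show "KMor K (PComp C a b c) \<in> sHom S (KOb K (PHom C b c) \<boxtimes> KOb K (PHom C a b)) (KOb K (PHom C a c))"
      using KMor[OF pm(1)[OF ab c]] by (simp add: pm)
    fix d assume d [simp]: "d \<in> PObj C"
    let ?X = "PHom C c d" and ?Y = "PHom C b c" and ?Z = "PHom C a b"
    have 1: "KMor K (mcomp (PComp C a b d) [PComp C b c d, mid ?Z]) \<odot> assc (KOb K ?X) (KOb K ?Y) (KOb K ?Z)
      = KMor K (PComp C a b d) \<odot> (KMor K (PComp C b c d) \<boxdot> KMor K (mid ?Z))"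
      by (rule KMor_mcomp_2_1) (simp_all add: pm pi)
    have 2: "KMor K (mcomp (PComp C a c d) [mid ?X, PComp C a b c])
      = KMor K (PComp C a c d) \<odot> (KMor K (mid ?X) \<boxdot> KMor K (PComp C a b c))"
      by (rule KMor_mcomp_1_2) (simp_all add: pm pi)
    show "KMor K (PComp C a b d) \<odot> (KMor K (PComp C b c d) \<boxdot> idt (KOb K ?Z)) =
        KMor K (PComp C a c d) \<odot> ((idt (KOb K ?X) \<boxdot> KMor K (PComp C a b c)) \<odot> assc (KOb K ?X) (KOb K ?Y) (KOb K ?Z))"
      using 1 2 C.assoc[OF ab c d] by (simp add: KMor_mid pm KMor_arr)
  qed
qed

text \<open>The adjunction defining \<open>\<Phi>\<close>, precomposed with a map \<open>g\<close>.
  With \<open>g\<close> the image of a functor into \<open>Perm_hom\<close> it serves morphism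
  spectra, with \<open>g\<close> the image of a 0-morphism it serves components of
  transformations.\<close>

lemma \<Phi>_hom:
  assumes ev: "Perm_morphism (ev A B)" and sm: "small_permcat A" "small_permcat (Perm_hom A B)"
    and g: "g \<in> sHom S W (KOb K (Perm_hom A B))"
  shows "SFhom (\<Phi> S K) A B \<odot> g \<in> sHom S W (sFun S (KOb K A) (KOb K B))"
    "sEv S (KOb K A) (KOb K B) \<odot> ((SFhom (\<Phi> S K) A B \<odot> g) \<boxdot> idt (KOb K A)) = KMor K (ev A B) \<odot> (g \<boxdot> idt (KOb K A))"
proof -
  have f: "Srcs (ev A B) = [Perm_hom A B, A]" "Target (ev A B) = B" by (simp_all add: ev_def)
  have e: "KMor K (ev A B) \<in> sHom S (KOb K (Perm_hom A B) \<boxtimes> KOb K A) (KOb K B)"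
    using KMor[OF ev] by (simp add: f)
  have \<Phi>: "SFhom (\<Phi> S K) A B = sCurry S (KOb K (Perm_hom A B)) (KOb K A) (KOb K B) (KMor K (ev A B))"
    by (simp add: \<Phi>_def)
  show "SFhom (\<Phi> S K) A B \<odot> g \<in> sHom S W (sFun S (KOb K A) (KOb K B))"
    unfolding \<Phi> by (rule cmp[OF g sCurry(1)[OF e]]) (use sm in simp_all)
  show "sEv S (KOb K A) (KOb K B) \<odot> ((SFhom (\<Phi> S K) A B \<odot> g) \<boxdot> idt (KOb K A)) = KMor K (ev A B) \<odot> (g \<boxdot> idt (KOb K A))"
    unfolding \<Phi> by (rule sCurry_cmp[OF e _ _ g]) (use sm in simp_all)
qed

subsection \<open>The action of the stable homotopy category on homotopy groups\<close>

text \<open>Naturality of the exterior product in its first factor: a class in the image of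
  \<open>w\<close> acts through the uncurried form of \<open>w\<close>.\<close>

lemma ho_act_uncurry:
  assumes w: "w \<in> sHom S W (sFun S X Y)" and X: "X \<in> sOb S" and Y: "Y \<in> sOb S"
    and xy: "x \<in> carrier (hGrp S 0 W)" "y \<in> carrier (hGrp S n X)"
  shows "ho_act S n X Y (hMap S 0 w x) y = hMap S n (sEv S X Y \<odot> (w \<boxdot> idt X)) (hPair S 0 n W X x y)"
proof -
  note [simp] = sHomD[OF w] X Y
  have i: "idt X \<in> sHom S X X" by (rule idn[OF X])
  have p: "hPair S 0 n W X x y \<in> carrier (hGrp S n (W \<boxtimes> X))"
    using hom_in_carrier[OF hPair_left[of W X y n 0] xy(1)] xy(2) by simp
  have "hPair S 0 n (sFun S X Y) X (hMap S 0 w x) y = hMap S n (w \<boxdot> idt X) (hPair S 0 n W X x y)"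
    using hPair_nat[OF w i xy] xy by (simp add: hMap_idn)
  then show ?thesis
    unfolding ho_act_def
    using hMap_cmp[of "w \<boxdot> idt X" "W \<boxtimes> X" "sFun S X Y \<boxtimes> X" "sEv S X Y" Y "hPair S 0 n W X x y" n] p
    by (simp add: sHom_def)
qed

text \<open>\<open>hPair_lun\<close> at the unit, inverted. A composite of a binary morphism with
  two 0-morphisms starts from the sphere through \<open>luni I\<close>, so the product of units has
  to be expressed in this way.\<close>

lemma hPair_one: "hPair S 0 0 I I (hOne S) (hOne S) = hMap S 0 (luni I) (hOne S)"
proof -
  let ?h = "hPair S 0 0 I I (hOne S) (hOne S)"
  have p: "?h \<in> carrier (hGrp S 0 (I \<boxtimes> I))"
    using hom_in_carrier[OF hPair_left[of I I "hOne S" 0 0] hOne] hOne by simp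
  have "hMap S 0 (luni I) (hMap S 0 (lun I) ?h) = hMap S 0 (luni I \<odot> lun I) ?h"
    by (rule hMap_cmp[symmetric, OF _ _ p]) (simp_all add: sHom_def)
  then show ?thesis using p hPair_lun[of I "hOne S" 0] hOne by (simp add: hMap_idn)
qed

text \<open>Objects are 0-morphisms, so K turns the evaluation of a bilinear functor at two objects
  into the exterior product of their classes followed by \<open>KMor K g\<close>.\<close>

lemma hPair_K_class:
  assumes g: "Perm_morphism g" "Srcs g = [A, B]" and a: "a \<in> Ob A" "b \<in> Ob B"
    and eq: "mcomp g [mpoint A a, mpoint B b] = mpoint (Target g) c"
  shows "hMap S 0 (KMor K g) (hPair S 0 0 (KOb K A) (KOb K B) (K_class S K A a) (K_class S K B b)) = K_class S K (Target g) c"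
proof -
  have sm [simp]: "small_permcat A" "small_permcat B" "small_permcat (Target g)"
    using Perm_morphism_small[OF g(1)] g(2) by auto
  note p = Perm_morphism_mpoint[OF sm(1) a(1)] Perm_morphism_mpoint[OF sm(2) a(2)]
  have m: "KMor K (mpoint A a) \<in> sHom S I (KOb K A)" "KMor K (mpoint B b) \<in> sHom S I (KOb K B)"
    using KMor[OF p(1)] KMor[OF p(2)] by simp_all
  have G: "KMor K g \<in> sHom S (KOb K A \<boxtimes> KOb K B) (KOb K (Target g))" using KMor[OF g(1)] by (simp add: g)
  note [simp] = sHomD[OF m(1)] sHomD[OF m(2)] sHomD[OF G]
  have L: "luni I \<in> sHom S I (I \<boxtimes> I)" by (simp add: sHom_def)
  have T: "KMor K (mpoint A a) \<boxdot> KMor K (mpoint B b) \<in> sHom S (I \<boxtimes> I) (KOb K A \<boxtimes> KOb K B)" by (rule tenA[OF m])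
  have "hPair S 0 0 (KOb K A) (KOb K B) (K_class S K A a) (K_class S K B b)
      = hMap S 0 (KMor K (mpoint A a) \<boxdot> KMor K (mpoint B b)) (hMap S 0 (luni I) (hOne S))"
    using hPair_nat[OF m hOne hOne] by (simp add: K_class_def hPair_one)
  also have "\<dots> = hMap S 0 ((KMor K (mpoint A a) \<boxdot> KMor K (mpoint B b)) \<odot> luni I) (hOne S)"
    by (rule hMap_cmp[symmetric, OF L T hOne])
  also have "hMap S 0 (KMor K g) \<dots> = hMap S 0 (KMor K g \<odot> ((KMor K (mpoint A a) \<boxdot> KMor K (mpoint B b)) \<odot> luni I)) (hOne S)"
    by (rule hMap_cmp[symmetric, OF cmp[OF L T] G hOne])
  also have "\<dots> = K_class S K (Target g) c"
    using KMor_mcomp_0_0[OF g(1) p] by (simp add: g eq K_class_def)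
  finally show ?thesis .
qed

end

section \<open>Mackey functors as PC-functors\<close>

lemma ev_fields: "Srcs (ev X Y) = [Perm_hom X Y, X]" "Target (ev X Y) = Y"
  by (simp_all add: ev_def)

text \<open>Composition in an opposite category is a swapped functor, and it occurs as the inner
  functor in the composition law of a Mackey functor. Its types are what
  \<open>mcomp_discrete\<close> asks for.\<close>

lemma typed_mswap:
  assumes f: "multilinear_functor f" "Srcs f = [X, Y]"
  shows "Srcs (mswap 0 f) = [Y, X]" "Target (mswap 0 f) = Target f"
    "\<And>x y. x \<in> Ob X \<Longrightarrow> y \<in> Ob Y \<Longrightarrow> FO (mswap 0 f) [y, x] = FO f [x, y]" "typed_mfun (mswap 0 f)"
proof -
  show S: "Srcs (mswap 0 f) = [Y, X]" "Target (mswap 0 f) = Target f"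
    using f(2) by (simp_all add: mswap_def swap_at_def)
  have pX: "permutative_category X" and pY: "permutative_category Y"
    using multilinear_functor.permutative(1)[OF f(1)] f(2) by auto
  note ob = permutative_category.arr[OF pX] permutative_category.arr[OF pY]
    permutative_category.add[OF pX] permutative_category.add[OF pY]
  have F: "FO (mswap 0 f) [y, x] = FO f [x, y]" if "x \<in> Ob X" "y \<in> Ob Y" for x y
    unfolding mswap_def using that f(2) by (simp add: swap_at_def)
  then show "\<And>x y. x \<in> Ob X \<Longrightarrow> y \<in> Ob Y \<Longrightarrow> FO (mswap 0 f) [y, x] = FO f [x, y]" .
  have FA: "FA (mswap 0 f) [v, u] = FA f [u, v]" if "u \<in> Ar X" "v \<in> Ar Y" for u v
    unfolding mswap_def using that f(2) by (simp add: swap_at_def)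
  have L0: "Lin (mswap 0 f) 0 [y, x] a = Lin f (Suc 0) [x, y] a" if "x \<in> Ob X" "y \<in> Ob Y" "a \<in> Ob Y" for x y a
    unfolding mswap_def using that f(2) by (simp add: swap_at_def)
  have L1: "Lin (mswap 0 f) (Suc 0) [y, x] a = Lin f 0 [x, y] a" if "x \<in> Ob X" "y \<in> Ob Y" "a \<in> Ob X" for x y a
    unfolding mswap_def using that f(2) by (simp add: swap_at_def)
  note t = multilinear_functor.FO[OF f(1)] multilinear_functor.FA[OF f(1)] multilinear_functor.Lin[OF f(1)]
  show "typed_mfun (mswap 0 f)"
  proof (unfold_locales; unfold S)
    fix xs assume "xs \<in> Obs [Y, X]"
    then show "FO (mswap 0 f) xs \<in> Ob (Target f)" using t(1) f(2) by (auto simp: F)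
  next
    fix us assume "us \<in> Ars [Y, X]"
    then obtain u v where uv: "us = [v, u]" "u \<in> Ar X" "v \<in> Ar Y" by auto
    show "FA (mswap 0 f) us \<in> Hom (Target f) (FO (mswap 0 f) (map2 Src [Y, X] us)) (FO (mswap 0 f) (map2 Tgt [Y, X] us))"
      using t(2)[of "[u, v]"] f(2) uv ob by (simp add: F FA)
  next
    fix i xs a' assume i: "i < length [Y, X]" and "xs \<in> Obs [Y, X]" and a: "a' \<in> Ob ([Y, X] ! i)"
    then obtain x y where xy: "xs = [y, x]" "x \<in> Ob X" "y \<in> Ob Y" by auto
    consider "i = 0" | "i = Suc 0" using i by fastforce
    then show "Lin (mswap 0 f) i xs a' \<in> Hom (Target f) (Add (Target f) (FO (mswap 0 f) xs) (FO (mswap 0 f) (xs[i := a'])))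
       (FO (mswap 0 f) (xs[i := Add ([Y, X] ! i) (xs ! i) a']))"
      using t(3)[of 0 "[x, y]" a'] t(3)[of "Suc 0" "[x, y]" a'] f(2) xy a ob
      by cases (simp_all add: F L0 L1)
  qed
qed

context burnside
begin

lemma PUnit_Ob: "fset A \<Longrightarrow> PUnit E A \<in> Ob (P A A)"
  by (simp add: E_fields P_ObI span_id_spans)

definition act :: "('g, 'v) mackey \<Rightarrow> 'g gset \<Rightarrow> 'g gset \<Rightarrow> 'v \<Rightarrow> 'v \<Rightarrow> 'v" where
  "act M A B x = MMap M A B (span_class G A B (dec (spans G A B) x))"

definition action :: "('g, 'v) mackey \<Rightarrow> 'g gset \<Rightarrow> 'g gset \<Rightarrow> 'v mfun" where
  "action M A B = mcomp (ev (disc (MOb M B)) (disc (MOb M A))) [mackey_pc_hom G M A B, mid (disc (MOb M B))]"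

section \<open>The action of spans on the values of a Mackey functor\<close>

context
  fixes M :: "('g, 'v) mackey"
  assumes M: "small_mackey_functor G pb M"
begin

lemma mackey: "mackey_functor G pb M"
  using M by (simp add: small_mackey_functor_def)

lemma M_ab: "fset A \<Longrightarrow> small_ab (MOb M A)"
  using M mackey_functor.ob[OF mackey] unfolding small_mackey_functor_def small_ab_def by blast

lemma M_cg: "fset A \<Longrightarrow> comm_group (MOb M A)"
  by (rule mackey_functor.ob[OF mackey])

lemma M_small: "fset A \<Longrightarrow> small_permcat (disc (MOb M A))"
  using M_ab by (simp add: small_ab_def small_permcat_disc)

lemma act_e: "X \<in> spans G A B \<Longrightarrow> act M A B (e A B X) = MMap M A B (span_class G A B X)"
  by (simp add: act_def dec_e)

lemma act_hom:
  assumes "fset A" "fset B" "x \<in> Ob (P A B)"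
  shows "act M A B x \<in> hom (MOb M B) (MOb M A)"
proof -
  obtain X where X: "X \<in> spans G A B" "x = e A B X" using assms(3) by (auto simp: P_Ob)
  show ?thesis
    unfolding X(2) act_e[OF X(1)]
    by (rule mackey_functor.map[OF mackey assms(1,2) span_class_carrier[OF assms(1,2) X(1)]])
qed

lemma act_closed:
  "fset A \<Longrightarrow> fset B \<Longrightarrow> x \<in> Ob (P A B) \<Longrightarrow> z \<in> carrier (MOb M B) \<Longrightarrow> act M A B x z \<in> carrier (MOb M A)"
  by (rule hom_in_carrier[OF act_hom])

lemma act_add:
  assumes "fset A" "fset B" "x \<in> Ob (P A B)" "y \<in> Ob (P A B)" "z \<in> carrier (MOb M B)"
  shows "act M A B (Add (P A B) x y) z = act M A B x z \<otimes>\<^bsub>MOb M A\<^esub> act M A B y z"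
proof -
  obtain X Y where X: "X \<in> spans G A B" "x = e A B X" and Y: "Y \<in> spans G A B" "y = e A B Y"
    using assms(3,4) by (auto simp: P_Ob)
  show ?thesis
    unfolding X(2) Y(2) P_Add[OF X(1) Y(1)] act_e[OF X(1)] act_e[OF Y(1)] act_e[OF span_sum_spans[OF X(1) Y(1)]]
      span_class_sum[OF assms(1,2) X(1) Y(1)]
    by (rule mackey_functor.additive[OF mackey assms(1,2) _ _ assms(5)]) (rule span_class_carrier; fact)+
qed

text \<open>The zero span is idempotent under sums, so by additivity its value is an idempotent of a
  group and hence trivial.\<close>

lemma act_zer:
  assumes "fset A" "fset B" "z \<in> carrier (MOb M B)"
  shows "act M A B (Zer (P A B)) z = \<one>\<^bsub>MOb M A\<^esub>"
proof -
  interpret A: comm_group "MOb M A" by (rule M_cg[OF assms(1)])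
  interpret permutative_category "P A B" by (rule perm_P[OF assms(1,2)])
  have "act M A B (Zer (P A B)) z \<otimes>\<^bsub>MOb M A\<^esub> act M A B (Zer (P A B)) z = act M A B (Zer (P A B)) z"
    using act_add[OF assms(1,2) zer zer assms(3)] add_zer[OF zer] by simp
  then show ?thesis
    using act_closed[OF assms(1,2) zer assms(3)] by (simp add: A.r_cancel_one')
qed

lemma act_arr:
  assumes "u \<in> Ar (P A B)"
  shows "act M A B (Src (P A B) u) = act M A B (Tgt (P A B) u)"
proof -
  obtain X Y where XY: "(X, Y) \<in> iso_rel G A B" "Src (P A B) u = e A B X" "Tgt (P A B) u = e A B Y"
    by (rule arrow_spans[OF assms])
  show ?thesis
    using iso_spans[OF XY(1)] by (simp add: XY(2,3) act_e span_class_iso[OF XY(1)])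
qed

lemma act_comp:
  assumes ABC: "fset A" "fset B" "fset C" and x: "x \<in> Ob (P A B)" and y: "y \<in> Ob (P B C)" and z: "z \<in> carrier (MOb M C)"
  shows "act M A C (FO (GE_comp G pb A B C) [y, x]) z = act M A B x (act M B C y z)"
proof -
  obtain X Y where X: "X \<in> spans G A B" "x = e A B X" and Y: "Y \<in> spans G B C" "y = e B C Y"
    using x y by (auto simp: P_Ob)
  have "act M A C (FO (GE_comp G pb A B C) [y, x]) z =
      MMap M A C (burnside_comp G pb A B C (span_class G B C Y) (span_class G A B X)) z"
    by (simp add: X Y FO_comp act_e comp_closed[OF ABC] burnside_comp_span_class[OF ABC])
  also have "\<dots> = MMap M A B (span_class G A B X) (MMap M B C (span_class G B C Y) z)"
    by (rule mackey_functor.comp[OF mackey ABC _ _ z]) (rule span_class_carrier; fact)+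
  finally show ?thesis by (simp add: X Y act_e)
qed

lemma act_id:
  assumes "fset A" "z \<in> carrier (MOb M A)"
  shows "act M A A (PUnit E A) z = z"
  using mackey_functor.id[OF mackey assms] by (simp add: E_fields act_e span_id_spans assms burnside_id_def)

context
  fixes A B
  assumes AB: "fset A" "fset B"
begin

lemmas M_abs = M_ab[OF AB(2)] M_ab[OF AB(1)]
lemmas M_cgs = M_cg[OF AB(2)] M_cg[OF AB(1)]

lemma mackey_pc_hom_lin_map:
  "mackey_pc_hom G M A B = lin_map [P A B] (Perm_hom (disc (MOb M B)) (disc (MOb M A)))
     (\<lambda>xs. hom_point (MOb M B) (MOb M A) (act M A B (hd xs)))"
  unfolding mackey_pc_hom_def lin_map_def Let_def act_def by (rule mk_mfun_cong) auto

lemma multiadditive_mackey_pc_hom: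
  "multiadditive [P A B] (Perm_hom (disc (MOb M B)) (disc (MOb M A)))
     (\<lambda>xs. hom_point (MOb M B) (MOb M A) (act M A B (hd xs)))"
proof -
  interpret P: permutative_category "P A B" by (rule perm_P[OF AB])
  have z: "hom_point (MOb M B) (MOb M A) (act M A B (Zer (P A B))) = Zer (Perm_hom (disc (MOb M B)) (disc (MOb M A)))"
    unfolding Zer_Perm_hom[OF univ M_abs] by (rule hom_point_cong[OF univ M_abs]) (rule act_zer[OF AB])
  have a: "hom_point (MOb M B) (MOb M A) (act M A B (Add (P A B) x y)) =
      Add (Perm_hom (disc (MOb M B)) (disc (MOb M A))) (hom_point (MOb M B) (MOb M A) (act M A B x)) (hom_point (MOb M B) (MOb M A) (act M A B y))"
    if "x \<in> Ob (P A B)" "y \<in> Ob (P A B)" for x y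
    unfolding Add_Perm_hom[OF univ M_abs act_hom[OF AB that(1)] act_hom[OF AB that(2)]]
    by (rule hom_point_cong[OF univ M_abs]) (rule act_add[OF AB that])
  show ?thesis
    using act_hom[OF AB] act_arr by (auto simp: multiadditive_def Ob_Perm_hom[OF univ M_abs] z a)
qed

lemma Perm_morphism_mackey_pc_hom: "Perm_morphism (mackey_pc_hom G M A B)"
proof -
  have "multilinear_functor (mackey_pc_hom G M A B)"
    unfolding mackey_pc_hom_lin_map
    by (rule multilinear_lin_map[OF _ Perm_hom_discrete[OF univ M_abs] multiadditive_mackey_pc_hom])
      (simp add: perm_P AB)
  then show ?thesis
    using small_P[OF AB] small_permcat_Perm_hom[OF univ M_abs]
    by (simp add: Perm_morphism_def) (simp add: mackey_pc_hom_lin_map)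
qed

lemma mackey_pc_hom_fields: "Srcs (mackey_pc_hom G M A B) = [P A B]"
  "Target (mackey_pc_hom G M A B) = Perm_hom (disc (MOb M B)) (disc (MOb M A))"
  "x \<in> Ob (P A B) \<Longrightarrow> FO (mackey_pc_hom G M A B) [x] = hom_point (MOb M B) (MOb M A) (act M A B x)"
  unfolding mackey_pc_hom_lin_map by simp_all

lemma action_lin_map:
  "action M A B = lin_map [P A B, disc (MOb M B)] (disc (MOb M A)) (\<lambda>xs. act M A B (xs ! 0) (xs ! 1))"
proof -
  let ?X = "disc (MOb M B)" and ?Y = "disc (MOb M A)"
  have perm: "permutative_category (P A B)" "permutative_category ?X"
    using perm_P[OF AB] M_small[OF AB(2)] by (simp_all add: small_permcat_def)
  have g: "multilinear_functor (ev ?X ?Y)" using Perm_morphism_ev[OF univ M_abs] by (simp add: Perm_morphism_def)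
  have fs: "multilinear_functor (mackey_pc_hom G M A B)" "multilinear_functor (mid ?X)"
    using Perm_morphism_mackey_pc_hom multilinear_mid[OF perm(2)] by (auto simp: Perm_morphism_def)
  have "action M A B = lin_map (concat (map Srcs [mackey_pc_hom G M A B, mid ?X])) (Target (ev ?X ?Y))
    (\<lambda>xs. FO (ev ?X ?Y) (map2 FO [mackey_pc_hom G M A B, mid ?X] (chop (map (length \<circ> Srcs) [mackey_pc_hom G M A B, mid ?X]) xs)))"
    unfolding action_def
    by (rule mcomp_discrete[OF g]) (use perm fs M_cgs in \<open>auto simp: ev_fields mackey_pc_hom_fields disc_discrete multilinear_typed\<close>)
  also have "\<dots> = lin_map [P A B, ?X] ?Y (\<lambda>xs. act M A B (xs ! 0) (xs ! 1))"
    unfolding ev_fields mackey_pc_hom_fields mid_fields list.map concat.simps append.simps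
    by (rule lin_map_cong)
      (use perm act_hom[OF AB] in \<open>auto simp: mackey_pc_hom_fields FO_ev[OF univ M_abs]\<close>)
  finally show ?thesis .
qed

lemma action_fields: "Srcs (action M A B) = [P A B, disc (MOb M B)]" "Target (action M A B) = disc (MOb M A)"
  "x \<in> Ob (P A B) \<Longrightarrow> z \<in> carrier (MOb M B) \<Longrightarrow> FO (action M A B) [x, z] = act M A B x z"
  unfolding action_lin_map by simp_all

lemma Perm_morphism_action: "Perm_morphism (action M A B)"
proof -
  have perm: "permutative_category (P A B)" "permutative_category (disc (MOb M B))"
    using perm_P[OF AB] M_small[OF AB(2)] by (simp_all add: small_permcat_def)
  have "multiadditive [P A B, disc (MOb M B)] (disc (MOb M A)) (\<lambda>xs. act M A B (xs ! 0) (xs ! 1))"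
    by (rule multiadditive_pairI)
      (use act_closed[OF AB] act_add[OF AB] act_zer[OF AB] act_arr hom_one'[OF M_cgs act_hom[OF AB]]
        hom_mult'[OF M_cgs act_hom[OF AB]] in simp_all)
  then have "multilinear_functor (action M A B)"
    unfolding action_lin_map
    by (intro multilinear_lin_map disc_discrete M_cgs) (use perm in auto)
  then show ?thesis
    using small_P[OF AB] M_small AB by (simp add: Perm_morphism_def action_fields)
qed

end

text \<open>Both sides of the composition law take values in a discrete category, so they are
  compared on objects, where the law is functoriality of \<open>M\<close> on classes of
  spans.\<close>

lemma mackey_pc_functor: "pc_functor (pc_op E) Perm (mackey_pc G M)"
proof (rule pc_functor.intro, unfold pc_op_def Perm_def mackey_pc_def pccat.simps pcfun.simps mem_Collect_eq E_fields, goal_cases)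
  case (1 a)
  then show ?case by (rule M_small)
next
  case (2 a b)
  then show ?case
    using Perm_morphism_mackey_pc_hom[OF 2(2,1)] mackey_pc_hom_fields[OF 2(2,1)] by (simp add: Perm_morphism_def)
next
  case a: (3 a)
  have "FO (mackey_pc_hom G M a a) [PUnit E a] = hom_point (MOb M a) (MOb M a) (act M a a (PUnit E a))"
    by (rule mackey_pc_hom_fields(3)[OF a a PUnit_Ob[OF a]])
  also have "\<dots> = hom_point (MOb M a) (MOb M a) (\<lambda>x. x)"
    by (rule hom_point_cong[OF univ M_ab[OF a] M_ab[OF a]]) (rule act_id[OF a])
  finally show ?case by (simp add: E_fields hom_point_def mid_disc[OF M_cg[OF a]])
next
  case abc: (4 a b c)
  let ?f = "GE_comp G pb c b a :: 'v mfun"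
  note cm = comp_multilinear[OF abc(3,2,1)]
  note sw = typed_mswap[OF cm(1,2)]
  have ml: "multilinear_functor (mackey_pc_hom G M y x)" if "fset x" "fset y" for x y
    using Perm_morphism_mackey_pc_hom[OF that(2,1)] by (simp add: Perm_morphism_def)
  note perm = perm_P[OF abc(3,2)] perm_P[OF abc(2,1)] perm_P[OF abc(3,1)]
  note sab = M_ab[OF abc(1)] M_ab[OF abc(2)] M_ab[OF abc(3)]
  let ?L = "mcomp (mackey_pc_hom G M c a) [mswap 0 ?f]"
  let ?R = "mcomp (Perm_comp (disc (MOb M a)) (disc (MOb M b)) (disc (MOb M c))) [mackey_pc_hom G M c b, mackey_pc_hom G M b a]"
  note mf = mackey_pc_hom_fields[OF abc(3,1)] mackey_pc_hom_fields[OF abc(3,2)] mackey_pc_hom_fields[OF abc(2,1)]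
  have pcf: "Srcs (Perm_comp X Y Z) = [Perm_hom Y Z, Perm_hom X Y]" "Target (Perm_comp X Y Z) = Perm_hom X Z" for X Y Z :: "('v, 'v) permcat"
    by (simp_all add: Perm_comp_def)
  have "?L = lin_map (concat (map Srcs [mswap 0 ?f])) (Target (mackey_pc_hom G M c a))
      (\<lambda>xs. FO (mackey_pc_hom G M c a) (map2 FO [mswap 0 ?f] (chop (map (length \<circ> Srcs) [mswap 0 ?f]) xs)))"
    by (rule mcomp_discrete[OF ml[OF abc(1,3)]])
      (use sw perm Perm_hom_discrete[OF univ sab(1,3)] in \<open>auto simp: mf cm\<close>)
  \<comment> \<open>The common normal form of the two sides: a span \<open>y\<close> from
    \<open>c\<close> to \<open>b\<close> and a span \<open>x\<close> from \<open>b\<close> to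
    \<open>a\<close> act contravariantly, first \<open>x\<close> and then \<open>y\<close>.\<close>
  also have "\<dots> = lin_map [P c b, P b a] (Perm_hom (disc (MOb M a)) (disc (MOb M c)))
      (\<lambda>xs. hom_point (MOb M a) (MOb M c) (\<lambda>z. act M c b (xs ! 0) (act M b a (xs ! 1) z)))"
    unfolding sw(1) mf list.map concat.simps append.simps
  proof (rule lin_map_cong, goal_cases)
    case (2 xs)
    then obtain y x where xs: "xs = [y, x]" "y \<in> Ob (P c b)" "x \<in> Ob (P b a)" by auto
    have "[x, y] \<in> Obs (Srcs ?f)" unfolding cm using xs by simp
    from multilinear_functor.FO[OF cm(1) this] have f: "FO ?f [x, y] \<in> Ob (P c a)" unfolding cm .
    have "FO (mackey_pc_hom G M c a) [FO ?f [x, y]] = hom_point (MOb M a) (MOb M c) (act M c a (FO ?f [x, y]))"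
      by (rule mf(3)[OF f])
    also have "\<dots> = hom_point (MOb M a) (MOb M c) (\<lambda>z. act M c b y (act M b a x z))"
      by (rule hom_point_cong[OF univ sab(1,3)]) (rule act_comp[OF abc(3,2,1) xs(2,3)])
    finally show ?case
      using xs sw(3)[OF xs(3,2)] by (simp add: sw(1))
  qed (use perm in auto)
  also have "\<dots> = lin_map (concat (map Srcs [mackey_pc_hom G M c b, mackey_pc_hom G M b a])) (Target (Perm_comp (disc (MOb M a)) (disc (MOb M b)) (disc (MOb M c))))
     (\<lambda>xs. FO (Perm_comp (disc (MOb M a)) (disc (MOb M b)) (disc (MOb M c)))
       (map2 FO [mackey_pc_hom G M c b, mackey_pc_hom G M b a] (chop (map (length \<circ> Srcs) [mackey_pc_hom G M c b, mackey_pc_hom G M b a]) xs)))"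
    unfolding mf pcf list.map concat.simps append.simps
    by (rule lin_map_cong)
      (use perm act_hom[OF abc(3,2)] act_hom[OF abc(2,1)] in \<open>auto simp: mf FO_Perm_comp[OF univ sab]\<close>)
  also have "\<dots> = ?R"
    by (rule mcomp_discrete[symmetric, OF multilinear_Perm_comp[OF univ sab]])
      (use perm ml[OF abc(2,3)] ml[OF abc(1,2)] Perm_hom_discrete[OF univ sab(1,3)] in \<open>auto simp: mf pcf multilinear_typed\<close>)
  finally show ?case .
qed

end

text \<open>Both composites are determined by their values on spans: \<open>\<eta> b\<close> after
  the action of a span, and the action after \<open>\<eta> a\<close>. These agree by naturality at
  the class of the span.\<close>

lemma mackey_pc_natural:
  assumes M: "small_mackey_functor G pb M" and N: "small_mackey_functor G pb N" and \<eta>: "mackey_natural G M N \<eta>"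
  shows "pc_natural (pc_op E) Perm (mackey_pc G M) (mackey_pc G N) (mackey_pc_nat M N \<eta>)"
proof (unfold_locales, unfold pc_op_def Perm_def mackey_pc_def mackey_pc_nat_def pccat.simps pcfun.simps mem_Collect_eq E_fields)
  have h: "\<eta> a \<in> hom (MOb M a) (MOb N a)" if "fset a" for a using \<eta> that unfolding mackey_natural_def by blast
  fix a assume a: "fset a"
  show "hom_point (MOb M a) (MOb N a) (\<eta> a) \<in> Ob (Perm_hom (disc (MOb M a)) (disc (MOb N a)))"
    unfolding Ob_Perm_hom[OF univ M_ab[OF M a] M_ab[OF N a]] using h[OF a] by simp
  fix b assume b: "fset b"
  let ?t = "\<lambda>a. hom_point (MOb M a) (MOb N a) (\<eta> a)"
  let ?Ma = "disc (MOb M a)" and ?Mb = "disc (MOb M b)" and ?Na = "disc (MOb N a)" and ?Nb = "disc (MOb N b)"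
  note sM = M_ab[OF M a] M_ab[OF M b] and sN = M_ab[OF N a] M_ab[OF N b]
  have ob: "?t b \<in> Ob (Perm_hom ?Mb ?Nb)" "?t a \<in> Ob (Perm_hom ?Ma ?Na)"
    unfolding Ob_Perm_hom[OF univ sM(2) sN(2)] Ob_Perm_hom[OF univ sM(1) sN(1)] using h[OF a] h[OF b] by simp_all
  have pt: "multilinear_functor (mpoint (Perm_hom ?Mb ?Nb) (?t b))" "multilinear_functor (mpoint (Perm_hom ?Ma ?Na) (?t a))"
    using ob Perm_hom_discrete[OF univ sM(2) sN(2)] Perm_hom_discrete[OF univ sM(1) sN(1)]
    by (auto intro: multilinear_mpoint discrete_permcat.permutative)
  have ml: "multilinear_functor (mackey_pc_hom G M b a)" "multilinear_functor (mackey_pc_hom G N b a)"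
    using Perm_morphism_mackey_pc_hom[OF M b a] Perm_morphism_mackey_pc_hom[OF N b a] by (auto simp: Perm_morphism_def)
  note mf = mackey_pc_hom_fields[OF M b a] mackey_pc_hom_fields[OF N b a]
  have pcf: "Srcs (Perm_comp X Y Z) = [Perm_hom Y Z, Perm_hom X Y]" "Target (Perm_comp X Y Z) = Perm_hom X Z" for X Y Z :: "('v, 'v) permcat"
    by (simp_all add: Perm_comp_def)
  let ?L = "[mpoint (Perm_hom ?Mb ?Nb) (?t b), mackey_pc_hom G M b a]"
  let ?R = "[mackey_pc_hom G N b a, mpoint (Perm_hom ?Ma ?Na) (?t a)]"
  have "mcomp (Perm_comp ?Ma ?Mb ?Nb) ?L = lin_map (concat (map Srcs ?L)) (Target (Perm_comp ?Ma ?Mb ?Nb))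
     (\<lambda>xs. FO (Perm_comp ?Ma ?Mb ?Nb) (map2 FO ?L (chop (map (length \<circ> Srcs) ?L) xs)))"
    by (rule mcomp_discrete[OF multilinear_Perm_comp[OF univ sM sN(2)]])
      (use perm_P[OF b a] ml pt Perm_hom_discrete[OF univ sM(1) sN(2)] in \<open>auto simp: mf pcf multilinear_typed\<close>)
  also have "\<dots> = lin_map [P b a] (Perm_hom ?Ma ?Nb) (\<lambda>xs. hom_point (MOb M a) (MOb N b) (\<lambda>z. \<eta> b (act M b a (hd xs) z)))"
    unfolding mf pcf mpoint_fields list.map concat.simps append.simps
    by (rule lin_map_cong)
      (use perm_P[OF b a] act_hom[OF M b a] h[OF b] in \<open>auto simp: mf FO_Perm_comp[OF univ sM sN(2)]\<close>)
  also have "\<dots> = lin_map [P b a] (Perm_hom ?Ma ?Nb) (\<lambda>xs. hom_point (MOb M a) (MOb N b) (\<lambda>z. act N b a (hd xs) (\<eta> a z)))"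
  proof (rule lin_map_cong)
    fix xs assume "xs \<in> Obs [P b a]"
    then obtain X where X: "xs = [e b a X]" "X \<in> spans G b a" by (auto simp: P_Ob)
    show "hom_point (MOb M a) (MOb N b) (\<lambda>z. \<eta> b (act M b a (hd xs) z)) =
        hom_point (MOb M a) (MOb N b) (\<lambda>z. act N b a (hd xs) (\<eta> a z))"
    proof (rule hom_point_cong[OF univ sM(1) sN(2)])
      fix z assume z: "z \<in> carrier (MOb M a)"
      show "\<eta> b (act M b a (hd xs) z) = act N b a (hd xs) (\<eta> a z)"
        using \<eta> a b z span_class_carrier[OF b a X(2)] unfolding X(1) list.sel act_e[OF M X(2)] act_e[OF N X(2)] mackey_natural_def
        by blast
    qed
  qed (use perm_P[OF b a] in auto)
  also have "\<dots> = lin_map (concat (map Srcs ?R)) (Target (Perm_comp ?Ma ?Na ?Nb))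
     (\<lambda>xs. FO (Perm_comp ?Ma ?Na ?Nb) (map2 FO ?R (chop (map (length \<circ> Srcs) ?R) xs)))"
    unfolding mf pcf mpoint_fields list.map concat.simps append.simps
    by (rule lin_map_cong)
      (use perm_P[OF b a] act_hom[OF N b a] h[OF a] in \<open>auto simp: mf FO_Perm_comp[OF univ sM(1) sN]\<close>)
  also have "\<dots> = mcomp (Perm_comp ?Ma ?Na ?Nb) ?R"
    by (rule mcomp_discrete[symmetric, OF multilinear_Perm_comp[OF univ sM(1) sN]])
      (use perm_P[OF b a] ml pt Perm_hom_discrete[OF univ sM(1) sN(2)] in \<open>auto simp: mf pcf multilinear_typed\<close>)
  finally show "mcomp (Perm_comp ?Ma ?Mb ?Nb) ?L = mcomp (Perm_comp ?Ma ?Na ?Nb) ?R" .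
qed

end

section \<open>The spectral Mackey functor of a Mackey functor\<close>

text \<open>The constraints of a \<open>lin_map\<close> are determined by its function, so
  exchanging variables only permutes the arguments. Three variables are those of an iterated
  action.\<close>

lemma mswap_lin_map:
  assumes perm: "permutative_category X" "permutative_category Y" "permutative_category Z"
  shows "mswap 0 (lin_map [X, Y, Z] B h) = lin_map [Y, X, Z] B (\<lambda>xs. h [xs ! 1, xs ! 0, xs ! 2])"
proof -
  have l: "xs \<in> listset [S, T, U] \<longleftrightarrow> (\<exists>x\<in>S. \<exists>y\<in>T. \<exists>z\<in>U. xs = [x, y, z])" for xs and S T U :: "'a set"
    by (auto simp: set_Cons_def)
  have lO: "Obs [X', Y', Z'] = listset [Ob X', Ob Y', Ob Z']" "Ars [X', Y', Z'] = listset [Ar X', Ar Y', Ar Z']"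
    for X' Y' Z' :: "('a, 'a) permcat" by simp_all
  have lin: "Lin (lin_map [X, Y, Z] B h) i [x, y, z] a = Idn B (h ([x, y, z][i := Add ([X, Y, Z] ! i) ([x, y, z] ! i) a]))"
    if "x \<in> Ob X" "y \<in> Ob Y" "z \<in> Ob Z" "i < 3" "a \<in> Ob ([X, Y, Z] ! i)" for x y z i a
    unfolding lin_map_def using that by (subst mk_mfun_fields(5)) (simp_all only: lO l, auto)
  have fa: "FA (lin_map [X, Y, Z] B h) [u, v, w] = Idn B (h [Src X u, Src Y v, Src Z w])"
    if "u \<in> Ar X" "v \<in> Ar Y" "w \<in> Ar Z" for u v w
    unfolding lin_map_def using that by (subst mk_mfun_fields(4)) (simp_all only: lO l, auto)
  have fo: "FO (lin_map [X, Y, Z] B h) [x, y, z] = h [x, y, z]" if "x \<in> Ob X" "y \<in> Ob Y" "z \<in> Ob Z" for x y z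
    by (rule lin_map_fields(3)) (use that in \<open>simp only: lO l, auto\<close>)
  have "mswap 0 (lin_map [X, Y, Z] B h) = mk_mfun [Y, X, Z] B (\<lambda>xs. FO (lin_map [X, Y, Z] B h) (swap_at 0 xs))
      (\<lambda>us. FA (lin_map [X, Y, Z] B h) (swap_at 0 us))
      (\<lambda>p xs a'. Lin (lin_map [X, Y, Z] B h) (if p = 0 then Suc 0 else if p = Suc 0 then 0 else p) (swap_at 0 xs) a')"
    by (simp add: mswap_def swap_at_def)
  also have "\<dots> = lin_map [Y, X, Z] B (\<lambda>xs. h [xs ! 1, xs ! 0, xs ! 2])"
    unfolding lin_map_def[of "[Y, X, Z]"]
  proof (rule mk_mfun_cong, goal_cases)
    case (1 xs)
    then obtain x y z where "xs = [y, x, z]" "x \<in> Ob X" "y \<in> Ob Y" "z \<in> Ob Z" unfolding lO l by blast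
    then show ?case by (simp add: swap_at_def fo)
  next
    case (2 us)
    then obtain u v w where "us = [v, u, w]" "u \<in> Ar X" "v \<in> Ar Y" "w \<in> Ar Z" unfolding lO l by blast
    then show ?case by (simp add: swap_at_def fa)
  next
    case (3 i xs a)
    then obtain x y z where xs: "xs = [y, x, z]" "x \<in> Ob X" "y \<in> Ob Y" "z \<in> Ob Z" unfolding lO l by blast
    consider "i = 0" | "i = 1" | "i = 2" using 3(1) by fastforce
    then show ?case using 3(3) xs by cases (simp_all add: swap_at_def lin)
  qed
  finally show ?thesis .
qed

locale K_burnside = K_theory S K + B: burnside G pb E
  for S :: "('s, 't, 'h) spectra" and K :: "('v, 's, 't) machine"
    and G :: "'g monoid" and pb :: "'g pullbacks" and E :: "('g gset, 'v) pccat"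
begin

abbreviation "fset \<equiv> fin_gset G"
abbreviation P :: "'g gset \<Rightarrow> 'g gset \<Rightarrow> ('v, 'v) permcat" where "P \<equiv> GE_hom G"

lemma GB_spectral: "spectral_category S (scat_op S (GB K G pb))"
  unfolding GB_def B.E_def[symmetric] by (rule scat_op_category[OF K_cat_spectral[OF B.pc]])

lemma op_fields: "SObj (scat_op S (GB K G pb)) = {A. fset A}" "SHom (scat_op S (GB K G pb)) a b = KOb K (P b a)"
  "SComp (scat_op S (GB K G pb)) a b c = KMor K (GE_comp G pb c b a) \<odot> symm (KOb K (P c b)) (KOb K (P b a))"
  "SUnit (scat_op S (GB K G pb)) a = KMor K (mpoint (P a a) (PUnit E a))"
  unfolding GB_def B.E_def[symmetric] by (simp_all add: scat_op_def K_cat_def B.E_fields)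

lemma Spec_fields: "SObj (Spec S) = sOb S" "SHom (Spec S) = sFun S"
  by (simp_all add: Spec_def)

lemma KP_ob [simp]: "fset a \<Longrightarrow> fset b \<Longrightarrow> KOb K (P a b) \<in> sOb S"
  by (rule KOb_ob[OF B.small_P])

lemma K_G_ob: "SFob (K_G S K G M) a = KOb K (disc (MOb M a))"
  by (simp add: K_G_def sfun_comp_def \<Phi>_def K_fun_def mackey_pc_def)

lemma K_G_hom_eq: "SFhom (K_G S K G M) a b = SFhom (\<Phi> S K) (disc (MOb M a)) (disc (MOb M b)) \<odot> KMor K (mackey_pc_hom G M b a)"
  by (simp add: K_G_def sfun_comp_def K_fun_def mackey_pc_def)

section \<open>Functoriality of \<open>K_G\<close>\<close>

context
  fixes M :: "('g, 'v) mackey"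
  assumes M: "small_mackey_functor G pb M"
begin

lemma KM_ob [simp]: "fset a \<Longrightarrow> KOb K (disc (MOb M a)) \<in> sOb S"
  by (rule KOb_ob[OF B.M_small[OF M]])

lemma KMor_action:
  assumes "fset a" "fset b"
  shows "KMor K (B.action M b a) \<in> sHom S (KOb K (P b a) \<boxtimes> KOb K (disc (MOb M a))) (KOb K (disc (MOb M b)))"
  using KMor[OF B.Perm_morphism_action[OF M assms(2,1)]] by (simp add: B.action_fields[OF M assms(2,1)])

text \<open>By \<open>\<Phi>_hom\<close> the evaluated map is K of \<open>ev\<close> after K of the
  functor \<open>M\<close>. Multifunctoriality identifies this with K of the composite that defines
  \<open>action\<close>.\<close>

lemma K_G_hom:
  assumes ab: "fset a" "fset b"
  shows "SFhom (K_G S K G M) a b \<in> sHom S (KOb K (P b a)) (sFun S (KOb K (disc (MOb M a))) (KOb K (disc (MOb M b))))"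
    "sEv S (KOb K (disc (MOb M a))) (KOb K (disc (MOb M b))) \<odot> (SFhom (K_G S K G M) a b \<boxdot> idt (KOb K (disc (MOb M a))))
      = KMor K (B.action M b a)"
proof -
  note sab = B.M_ab[OF M ab(1)] B.M_ab[OF M ab(2)]
  note mf = B.mackey_pc_hom_fields[OF M ab(2,1)]
  note ev = Perm_morphism_ev[OF B.univ sab]
  have g: "KMor K (mackey_pc_hom G M b a) \<in> sHom S (KOb K (P b a)) (KOb K (Perm_hom (disc (MOb M a)) (disc (MOb M b))))"
    using KMor[OF B.Perm_morphism_mackey_pc_hom[OF M ab(2,1)]] by (simp add: mf)
  note \<Phi> = \<Phi>_hom[OF ev B.M_small[OF M ab(1)] small_permcat_Perm_hom[OF B.univ sab] g]
  show "SFhom (K_G S K G M) a b \<in> sHom S (KOb K (P b a)) (sFun S (KOb K (disc (MOb M a))) (KOb K (disc (MOb M b))))"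
    unfolding K_G_hom_eq by (rule \<Phi>(1))
  have "KMor K (B.action M b a) = KMor K (ev (disc (MOb M a)) (disc (MOb M b))) \<odot>
      (KMor K (mackey_pc_hom G M b a) \<boxdot> KMor K (mid (disc (MOb M a))))"
    unfolding B.action_def
    by (rule KMor_mcomp_1_1[OF ev B.Perm_morphism_mackey_pc_hom[OF M ab(2,1)] Perm_morphism_mid[OF B.M_small[OF M ab(1)]]])
      (simp_all add: mf ev_fields)
  then show "sEv S (KOb K (disc (MOb M a))) (KOb K (disc (MOb M b))) \<odot> (SFhom (K_G S K G M) a b \<boxdot> idt (KOb K (disc (MOb M a))))
      = KMor K (B.action M b a)"
    unfolding K_G_hom_eq \<Phi>(2) by (simp add: KMor_mid B.M_small[OF M ab(1)])
qed

lemma action_unit: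
  assumes a: "fset a"
  shows "mcomp (B.action M a a) [mpoint (P a a) (PUnit E a), mid (disc (MOb M a))] = mid (disc (MOb M a))"
proof -
  let ?X = "disc (MOb M a)"
  note af = B.action_fields[OF M a a]
  have perm: "permutative_category (P a a)" "permutative_category ?X"
    using B.perm_P[OF a a] B.M_small[OF M a] by (simp_all add: small_permcat_def)
  have ml: "multilinear_functor (B.action M a a)" "multilinear_functor (mpoint (P a a) (PUnit E a))" "multilinear_functor (mid ?X)"
    using B.Perm_morphism_action[OF M a a] multilinear_mpoint[OF perm(1) B.PUnit_Ob[OF a]] multilinear_mid[OF perm(2)]
    by (simp_all add: Perm_morphism_def)
  have d: "discrete_permcat ?X" by (rule disc_discrete[OF B.M_cg[OF M a]])
  have "mcomp (B.action M a a) [mpoint (P a a) (PUnit E a), mid ?X] =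
      lin_map (concat (map Srcs [mpoint (P a a) (PUnit E a), mid ?X])) (Target (B.action M a a))
      (\<lambda>xs. FO (B.action M a a) (map2 FO [mpoint (P a a) (PUnit E a), mid ?X] (chop (map (length \<circ> Srcs) [mpoint (P a a) (PUnit E a), mid ?X]) xs)))"
    by (rule mcomp_discrete[OF ml(1)]) (use perm ml d in \<open>auto simp: af multilinear_typed\<close>)
  also have "\<dots> = lin_map [?X] ?X (FO (mid ?X))"
    unfolding af mpoint_fields mid_fields list.map concat.simps append.simps
    by (rule lin_map_cong) (use perm B.act_id[OF M a] B.PUnit_Ob[OF a] in \<open>auto simp: af\<close>)
  also have "\<dots> = mid ?X"
    using multilinear_discrete(1)[OF ml(3)] d by simp
  finally show ?thesis .
qed

text \<open>Composition of spans takes the later span first, whereas in the iterated action the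
  earlier span is outermost; hence the swap of the first two variables. The other two parts are used
  when \<open>KMor_mswap\<close> is applied.\<close>

lemma action_comp:
  assumes abc: "fset a" "fset b" "fset c"
  shows "mcomp (B.action M c a) [GE_comp G pb c b a, mid (disc (MOb M a))] =
      mswap 0 (mcomp (B.action M c b) [mid (P c b), B.action M b a])"
    "Perm_morphism (mcomp (B.action M c b) [mid (P c b), B.action M b a])"
    "Srcs (mcomp (B.action M c b) [mid (P c b), B.action M b a]) = [P c b, P b a, disc (MOb M a)]"
proof -
  let ?Ma = "disc (MOb M a)" and ?Mc = "disc (MOb M c)"
  let ?f = "GE_comp G pb c b a :: 'v mfun"
  note af = B.action_fields[OF M abc(3,1)] B.action_fields[OF M abc(3,2)] B.action_fields[OF M abc(2,1)]
  note cm = B.comp_multilinear[OF abc(3,2,1)]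
  have perm: "permutative_category (P b a)" "permutative_category (P c b)" "permutative_category ?Ma"
    using B.perm_P[OF abc(2,1)] B.perm_P[OF abc(3,2)] B.M_small[OF M abc(1)] by (simp_all add: small_permcat_def)
  have ml: "multilinear_functor (B.action M c a)" "multilinear_functor (B.action M c b)" "multilinear_functor (B.action M b a)"
    using B.Perm_morphism_action[OF M abc(3,1)] B.Perm_morphism_action[OF M abc(3,2)] B.Perm_morphism_action[OF M abc(2,1)]
    by (simp_all add: Perm_morphism_def)
  note mi = multilinear_mid[OF perm(2)] multilinear_mid[OF perm(3)]
  have d: "discrete_permcat ?Mc" by (rule disc_discrete[OF B.M_cg[OF M abc(3)]])
  have l: "xs \<in> listset [X, Y, Z] \<longleftrightarrow> (\<exists>x\<in>X. \<exists>y\<in>Y. \<exists>z\<in>Z. xs = [x, y, z])" for xs and X Y Z :: "'v set"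
    by (auto simp: set_Cons_def)
  have lO: "Obs [X', Y', Z'] = listset [Ob X', Ob Y', Ob Z']" for X' Y' Z' :: "('v, 'v) permcat" by simp
  have fob: "FO ?f [x, y] \<in> Ob (P c a)" if "x \<in> Ob (P b a)" "y \<in> Ob (P c b)" for x y
  proof -
    have "[x, y] \<in> Obs (Srcs ?f)" unfolding cm using that by simp
    from multilinear_functor.FO[OF cm(1) this] show ?thesis unfolding cm .
  qed
  let ?h = "\<lambda>xs. B.act M c b (xs ! 0) (B.act M b a (xs ! 1) (xs ! 2))"
  have "mcomp (B.action M c b) [mid (P c b), B.action M b a] =
      lin_map (concat (map Srcs [mid (P c b), B.action M b a])) (Target (B.action M c b))
      (\<lambda>xs. FO (B.action M c b) (map2 FO [mid (P c b), B.action M b a] (chop (map (length \<circ> Srcs) [mid (P c b), B.action M b a]) xs)))"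
    by (rule mcomp_discrete[OF ml(2)]) (use perm ml mi d in \<open>auto simp: af multilinear_typed\<close>)
  also have "\<dots> = lin_map [P c b, P b a, ?Ma] ?Mc ?h"
    unfolding af mid_fields list.map concat.simps append.simps
  proof (rule lin_map_cong, goal_cases)
    case (2 xs)
    then obtain y x z where "xs = [y, x, z]" "y \<in> Ob (P c b)" "x \<in> Ob (P b a)" "z \<in> carrier (MOb M a)"
      unfolding lO l disc_fields by blast
    then show ?case using B.act_closed[OF M abc(2,1)] by (simp add: af)
  qed (use perm in auto)
  finally have R: "mcomp (B.action M c b) [mid (P c b), B.action M b a] = lin_map [P c b, P b a, ?Ma] ?Mc ?h" .
  have "mcomp (B.action M c a) [?f, mid ?Ma] =
      lin_map (concat (map Srcs [?f, mid ?Ma])) (Target (B.action M c a))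
      (\<lambda>xs. FO (B.action M c a) (map2 FO [?f, mid ?Ma] (chop (map (length \<circ> Srcs) [?f, mid ?Ma]) xs)))"
    by (rule mcomp_discrete[OF ml(1)]) (use perm ml mi d cm in \<open>auto simp: af multilinear_typed\<close>)
  also have "\<dots> = lin_map [P b a, P c b, ?Ma] ?Mc (\<lambda>xs. ?h [xs ! 1, xs ! 0, xs ! 2])"
    unfolding af mid_fields cm list.map concat.simps append.simps
  proof (rule lin_map_cong, goal_cases)
    case (2 xs)
    then obtain x y z where xs: "xs = [x, y, z]" "x \<in> Ob (P b a)" "y \<in> Ob (P c b)" "z \<in> carrier (MOb M a)"
      unfolding lO l disc_fields by blast
    then show ?case
      using fob[OF xs(2,3)] B.act_comp[OF M abc(3,2,1) xs(3,2,4)] by (simp add: af cm)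
  qed (use perm in auto)
  finally show "mcomp (B.action M c a) [?f, mid ?Ma] = mswap 0 (mcomp (B.action M c b) [mid (P c b), B.action M b a])"
    unfolding R mswap_lin_map[OF perm(2,1,3)] .
  show "Srcs (mcomp (B.action M c b) [mid (P c b), B.action M b a]) = [P c b, P b a, ?Ma]"
    unfolding R by simp
  have lA: "Ars [X', Y', Z'] = listset [Ar X', Ar Y', Ar Z']" for X' Y' Z' :: "('v, 'v) permcat" by simp
  note hom1 = B.act_hom[OF M abc(2,1)] and hom2 = B.act_hom[OF M abc(3,2)]
  note cg = B.M_cg[OF M abc(1)] B.M_cg[OF M abc(2)] B.M_cg[OF M abc(3)]
  note zs = permutative_category.zer[OF perm(1)] permutative_category.zer[OF perm(2)]
  note as = permutative_category.arr[OF perm(1)] permutative_category.arr[OF perm(2)]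
  note ac = B.act_closed[OF M abc(2,1)] B.act_closed[OF M abc(3,2)]
  \<comment> \<open>\<open>KMor_mswap\<close> speaks of genuine multilinear functors, so the
    iterated action is verified to be multiadditive in each of its three variables.\<close>
  have ma: "multiadditive [P c b, P b a, ?Ma] ?Mc ?h"
    unfolding multiadditive_def
  proof (intro conjI ballI allI impI)
    fix us assume "us \<in> Ars [P c b, P b a, ?Ma]"
    then obtain v u w where "us = [v, u, w]" "v \<in> Ar (P c b)" "u \<in> Ar (P b a)" "w \<in> carrier (MOb M a)"
      unfolding lA l disc_fields by blast
    then show "?h (map2 Src [P c b, P b a, ?Ma] us) = ?h (map2 Tgt [P c b, P b a, ?Ma] us)"
      by (simp add: B.act_arr[OF M])
  next
    fix xs assume "xs \<in> Obs [P c b, P b a, ?Ma]"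
    then obtain y x z where xs: "xs = [y, x, z]" "y \<in> Ob (P c b)" "x \<in> Ob (P b a)" "z \<in> carrier (MOb M a)"
      unfolding lO l disc_fields by blast
    show "?h xs \<in> Ob ?Mc" using xs ac by simp
    fix i assume i: "i < length [P c b, P b a, ?Ma]"
    consider "i = 0" | "i = 1" | "i = 2" using i by fastforce
    note i = this
    show "?h xs = Zer ?Mc" if "xs ! i = Zer ([P c b, P b a, ?Ma] ! i)"
      using i
    proof cases
      case 1
      then show ?thesis using that xs ac(1) B.act_zer[OF M abc(3,2)] by simp
    next
      case 2
      then show ?thesis using that xs B.act_zer[OF M abc(2,1)] hom_one'[OF cg(2,3) hom2[OF xs(2)]] by simp
    next
      case 3
      then show ?thesis
        using that xs hom_one'[OF cg(1,2) hom1[OF xs(3)]] hom_one'[OF cg(2,3) hom2[OF xs(2)]] by simp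
    qed
    fix x' assume x': "x' \<in> Ob ([P c b, P b a, ?Ma] ! i)"
    show "?h (xs[i := Add ([P c b, P b a, ?Ma] ! i) (xs ! i) x']) = Add ?Mc (?h xs) (?h (xs[i := x']))"
      using i
    proof cases
      case 1
      then show ?thesis using x' xs ac(1) B.act_add[OF M abc(3,2)] by simp
    next
      case 2
      then show ?thesis using x' xs ac(1) B.act_add[OF M abc(2,1)] hom_mult'[OF cg(2,3) hom2[OF xs(2)]] by simp
    next
      case 3
      then show ?thesis
        using x' xs ac(1) hom_mult'[OF cg(1,2) hom1[OF xs(3)]] hom_mult'[OF cg(2,3) hom2[OF xs(2)]] by simp
    qed
  qed
  have "multilinear_functor (lin_map [P c b, P b a, ?Ma] ?Mc ?h)"
    by (rule multilinear_lin_map[OF _ d ma]) (use perm in auto)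
  then show "Perm_morphism (mcomp (B.action M c b) [mid (P c b), B.action M b a])"
    unfolding R using B.small_P[OF abc(3,2)] B.small_P[OF abc(2,1)] B.M_small[OF M abc(1)] B.M_small[OF M abc(3)]
    by (simp add: Perm_morphism_def)
qed

text \<open>Evaluated, the unit and composition laws are \<open>action_unit\<close> and
  \<open>action_comp\<close> under K. The swap in \<open>action_comp\<close> contributes a symmetry
  that cancels the one in the composition of \<open>scat_op\<close>.\<close>

lemma K_G_functor: "spectral_functor S (scat_op S (GB K G pb)) (Spec S) (K_G S K G M)"
proof (intro spectral_functor.intro GB_spectral Spec_category spectral_functor_axioms.intro,
    unfold op_fields Spec_fields K_G_ob mem_Collect_eq, goal_cases)
  case (1 a)
  then show ?case by (rule KM_ob)
next
  case (2 a b)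
  then show ?case by (rule K_G_hom(1))
next
  case a: (3 a)
  let ?X = "disc (MOb M a)"
  note pm = B.Perm_morphism_action[OF M a a] Perm_morphism_mpoint[OF B.small_P[OF a a] B.PUnit_Ob[OF a]]
    Perm_morphism_mid[OF B.M_small[OF M a]]
  note af = B.action_fields[OF M a a]
  have u: "KMor K (mpoint (P a a) (PUnit E a)) \<in> sHom S I (KOb K (P a a))" using KMor[OF pm(2)] by simp
  note [simp] = sHomD[OF u] sHomD[OF K_G_hom(1)[OF a a]] KM_ob[OF a] sHomD[OF Spec_unit(1)]
  have "sEv S (KOb K ?X) (KOb K ?X) \<odot> ((SFhom (K_G S K G M) a a \<odot> KMor K (mpoint (P a a) (PUnit E a))) \<boxdot> idt (KOb K ?X))
      = (sEv S (KOb K ?X) (KOb K ?X) \<odot> (SFhom (K_G S K G M) a a \<boxdot> idt (KOb K ?X))) \<odot> (KMor K (mpoint (P a a) (PUnit E a)) \<boxdot> idt (KOb K ?X))"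
    by simp
  also have "\<dots> = KMor K (B.action M a a) \<odot> (KMor K (mpoint (P a a) (PUnit E a)) \<boxdot> idt (KOb K ?X))"
    unfolding K_G_hom(2)[OF a a] ..
  also have "\<dots> = lun (KOb K ?X)"
    using KMor_mcomp_0_1[OF pm, of ?X] by (simp add: af action_unit[OF a] KMor_mid B.M_small[OF M a])
  also have "\<dots> = sEv S (KOb K ?X) (KOb K ?X) \<odot> (SUnit (Spec S) (KOb K ?X) \<boxdot> idt (KOb K ?X))"
    by (rule Spec_unit(2)[symmetric]) simp
  finally show ?case
    by (rule curry_eqI[rotated 4]) (simp_all add: sHom_def)
next
  case abc: (4 a b c)
  let ?A = "KOb K (disc (MOb M a))" and ?B = "KOb K (disc (MOb M b))" and ?C = "KOb K (disc (MOb M c))"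
  let ?Y = "KOb K (P c b)" and ?X = "KOb K (P b a)"
  let ?m = "KMor K (GE_comp G pb c b a)"
  note pm = B.Perm_morphism_action[OF M abc(3,1)] B.Perm_morphism_action[OF M abc(3,2)] B.Perm_morphism_action[OF M abc(2,1)]
    Perm_morphism_mid[OF B.M_small[OF M abc(1)]] Perm_morphism_mid[OF B.small_P[OF abc(3,2)]]
  note af = B.action_fields[OF M abc(3,1)] B.action_fields[OF M abc(3,2)] B.action_fields[OF M abc(2,1)]
  note cm = B.comp_multilinear[OF abc(3,2,1)]
  have pc: "Perm_morphism (GE_comp G pb c b a :: 'v mfun)"
    using cm B.small_P[OF abc(2,1)] B.small_P[OF abc(3,2)] B.small_P[OF abc(3,1)] by (simp add: Perm_morphism_def)
  have m: "?m \<in> sHom S (?X \<boxtimes> ?Y) (KOb K (P c a))" using KMor[OF pc] by (simp add: cm)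
  note F = K_G_hom[OF abc(1,3)] and F1 = K_G_hom[OF abc(2,3)] and F2 = K_G_hom[OF abc(1,2)]
  note [simp] = sHomD[OF m] sHomD[OF F(1)] sHomD[OF F1(1)] sHomD[OF F2(1)] KM_ob[OF abc(1)] KM_ob[OF abc(2)] KM_ob[OF abc(3)]
    sHomD[OF Spec_comp_typed] KP_ob[OF abc(2,1)] KP_ob[OF abc(3,2)]
    sHomD[OF KMor_action[OF abc(1,3)]] sHomD[OF KMor_action[OF abc(2,3)]] sHomD[OF KMor_action[OF abc(1,2)]]
  let ?L = "KMor K (B.action M c a) \<odot> (?m \<boxdot> idt ?A)"
  let ?R = "KMor K (B.action M c b) \<odot> (idt ?Y \<boxdot> KMor K (B.action M b a))"
  have 1: "KMor K (mcomp (B.action M c a) [GE_comp G pb c b a, mid (disc (MOb M a))]) \<odot> assc ?X ?Y ?A = ?L"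
    using KMor_mcomp_2_1[OF pm(1) pc pm(4)] by (simp add: af cm KMor_mid B.M_small[OF M abc(1)])
  have 2: "KMor K (mcomp (B.action M c b) [mid (P c b), B.action M b a]) = ?R"
    using KMor_mcomp_1_2[OF pm(2) pm(5) pm(3)] by (simp add: af KMor_mid B.small_P[OF abc(3,2)])
  \<comment> \<open>For three factors \<open>smash_swap\<close> at position 0 is the symmetry of the
    first two, conjugated by associators.\<close>
  have 3: "KMor K (mcomp (B.action M c a) [GE_comp G pb c b a, mid (disc (MOb M a))]) =
      ?R \<odot> (assc ?Y ?X ?A \<odot> ((symm ?X ?Y \<boxdot> idt ?A) \<odot> assci ?X ?Y ?A))"
    using KMor_mswap[OF action_comp(2)[OF abc], of 0] unfolding action_comp(1)[OF abc] 2
    by (simp add: action_comp(3)[OF abc] Let_def)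
  have 4: "?L = ?R \<odot> (assc ?Y ?X ?A \<odot> (symm ?X ?Y \<boxdot> idt ?A))"
    unfolding 1[symmetric] 3 by simp
  have "sEv S ?A ?C \<odot> ((SFhom (K_G S K G M) a c \<odot> (?m \<odot> symm ?Y ?X)) \<boxdot> idt ?A)
      = (sEv S ?A ?C \<odot> (SFhom (K_G S K G M) a c \<boxdot> idt ?A)) \<odot> ((?m \<boxdot> idt ?A) \<odot> (symm ?Y ?X \<boxdot> idt ?A))"
    by simp
  also have "\<dots> = ?L \<odot> (symm ?Y ?X \<boxdot> idt ?A)" unfolding F(2) by (simp del: ten_cmp')
  also have "\<dots> = ?R \<odot> assc ?Y ?X ?A" unfolding 4 by simp
  also have "\<dots> = (sEv S ?B ?C \<odot> (SFhom (K_G S K G M) b c \<boxdot> idt ?B)) \<odot> ((idt ?Y \<boxdot> KMor K (B.action M b a)) \<odot> assc ?Y ?X ?A)"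
    unfolding F1(2) by simp
  also have "\<dots> = sEv S ?B ?C \<odot> ((SFhom (K_G S K G M) b c \<boxdot> (sEv S ?A ?B \<odot> (SFhom (K_G S K G M) a b \<boxdot> idt ?A))) \<odot> assc ?Y ?X ?A)"
    unfolding F2(2) by simp
  also have "\<dots> = sEv S ?A ?C \<odot> ((SComp (Spec S) ?A ?B ?C \<odot> (SFhom (K_G S K G M) b c \<boxdot> SFhom (K_G S K G M) a b)) \<boxdot> idt ?A)"
    by (rule Spec_comp[OF F1(1) F2(1), symmetric]) simp_all
  finally show ?case
    by (rule curry_eqI[rotated 4]) (simp_all add: sHom_def)
qed

end

section \<open>Functoriality in natural transformations of Mackey functors\<close>

context
  fixes M N :: "('g, 'v) mackey" and \<eta> :: "'g gset \<Rightarrow> 'v \<Rightarrow> 'v"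
  assumes M: "small_mackey_functor G pb M" and N: "small_mackey_functor G pb N"
    and \<eta>: "\<forall>a. fset a \<longrightarrow> \<eta> a \<in> hom (MOb M a) (MOb N a)"
begin

text \<open>The component is the name of K of the homomorphism \<open>\<eta> a\<close>: it is the
  image under \<open>\<Phi>\<close> of a point of \<open>Perm_hom\<close>, and \<open>ev\<close> at
  that point is \<open>disc_fun\<close> of \<open>\<eta> a\<close>.\<close>

lemma K_G_nat:
  assumes a: "fset a"
  shows "K_G_nat S K G M N \<eta> a \<in> sHom S I (sFun S (KOb K (disc (MOb M a))) (KOb K (disc (MOb N a))))"
    "sEv S (KOb K (disc (MOb M a))) (KOb K (disc (MOb N a))) \<odot> (K_G_nat S K G M N \<eta> a \<boxdot> idt (KOb K (disc (MOb M a)))) =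
      KMor K (disc_fun (MOb M a) (MOb N a) (\<eta> a)) \<odot> lun (KOb K (disc (MOb M a)))"
    "KMor K (disc_fun (MOb M a) (MOb N a) (\<eta> a)) \<in> sHom S (KOb K (disc (MOb M a))) (KOb K (disc (MOb N a)))"
proof -
  let ?X = "disc (MOb M a)" and ?Y = "disc (MOb N a)" and ?p = "hom_point (MOb M a) (MOb N a) (\<eta> a)"
  let ?t = "mpoint (Perm_hom ?X ?Y) ?p"
  note sab = B.M_ab[OF M a] B.M_ab[OF N a] and cg = B.M_cg[OF M a] B.M_cg[OF N a]
  note h = \<eta>[rule_format, OF a] and sm = B.M_small[OF M a] B.M_small[OF N a] small_permcat_Perm_hom[OF B.univ sab]
  note ev = Perm_morphism_ev[OF B.univ sab]
  have ob: "?p \<in> Ob (Perm_hom ?X ?Y)" unfolding Ob_Perm_hom[OF B.univ sab] using h by simp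
  have perm: "permutative_category ?X" "permutative_category (Perm_hom ?X ?Y)" using sm by (simp_all add: small_permcat_def)
  have ml: "multilinear_functor (ev ?X ?Y)" "multilinear_functor ?t" "multilinear_functor (mid ?X)"
    using ev multilinear_mpoint[OF perm(2) ob] multilinear_mid[OF perm(1)] by (simp_all add: Perm_morphism_def)
  have d: "discrete_permcat ?Y" by (rule disc_discrete[OF cg(2)])
  have eq: "K_G_nat S K G M N \<eta> a = SFhom (\<Phi> S K) ?X ?Y \<odot> KMor K ?t"
    by (simp add: K_G_nat_def snat_whisker_def K_fun_def mackey_pc_def K_nat_def Perm_def mackey_pc_nat_def)
  have "mcomp (ev ?X ?Y) [?t, mid ?X] = lin_map (concat (map Srcs [?t, mid ?X])) (Target (ev ?X ?Y))
      (\<lambda>xs. FO (ev ?X ?Y) (map2 FO [?t, mid ?X] (chop (map (length \<circ> Srcs) [?t, mid ?X]) xs)))"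
    by (rule mcomp_discrete[OF ml(1)]) (use perm ml d in \<open>auto simp: ev_fields multilinear_typed\<close>)
  also have "\<dots> = disc_fun (MOb M a) (MOb N a) (\<eta> a)"
    unfolding ev_fields mpoint_fields mid_fields list.map concat.simps append.simps disc_fun_lin_map
    by (rule lin_map_cong) (use perm FO_ev[OF B.univ sab h] in auto)
  finally have mc: "mcomp (ev ?X ?Y) [?t, mid ?X] = disc_fun (MOb M a) (MOb N a) (\<eta> a)" .
  have t: "KMor K ?t \<in> sHom S I (KOb K (Perm_hom ?X ?Y))"
    using KMor[OF Perm_morphism_mpoint[OF sm(3) ob]] by simp
  note \<Phi> = \<Phi>_hom[OF ev sm(1,3) t]
  show "K_G_nat S K G M N \<eta> a \<in> sHom S I (sFun S (KOb K ?X) (KOb K ?Y))"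
    unfolding eq by (rule \<Phi>(1))
  show "sEv S (KOb K ?X) (KOb K ?Y) \<odot> (K_G_nat S K G M N \<eta> a \<boxdot> idt (KOb K ?X)) =
      KMor K (disc_fun (MOb M a) (MOb N a) (\<eta> a)) \<odot> lun (KOb K ?X)"
    unfolding eq \<Phi>(2)
    using KMor_mcomp_0_1[OF ev Perm_morphism_mpoint[OF sm(3) ob] Perm_morphism_mid[OF sm(1)], of ?X]
    by (simp add: ev_fields mc KMor_mid sm)
  show "KMor K (disc_fun (MOb M a) (MOb N a) (\<eta> a)) \<in> sHom S (KOb K ?X) (KOb K ?Y)"
    using KMor[OF Perm_morphism_disc_fun[OF B.univ sab h]] by simp
qed

text \<open>By uniqueness of adjoints a component is characterised by what it evaluates to.
  Identities and composites of transformations are recognised through this.\<close>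

lemma K_G_nat_eqI:
  assumes a: "fset a" and t: "t \<in> sHom S I (sFun S (KOb K (disc (MOb M a))) (KOb K (disc (MOb N a))))"
    "sEv S (KOb K (disc (MOb M a))) (KOb K (disc (MOb N a))) \<odot> (t \<boxdot> idt (KOb K (disc (MOb M a)))) =
      KMor K (disc_fun (MOb M a) (MOb N a) (\<eta> a)) \<odot> lun (KOb K (disc (MOb M a)))"
  shows "K_G_nat S K G M N \<eta> a = t"
  by (rule curry_eqI[OF K_G_nat(1)[OF a] t(1)]) (use a t(2) K_G_nat(2)[OF a] KM_ob[OF M a] KM_ob[OF N a] in simp_all)

end

end

context K_burnside
begin

text \<open>By \<open>Spec_comp_point_left\<close> and \<open>Spec_comp_point_right\<close> the two
  sides evaluate to K of \<open>\<eta> b\<close> after the action on \<open>M\<close>, and K of the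
  action on \<open>N\<close> after \<open>\<eta> a\<close>. Before K these composites agree because
  \<open>\<eta>\<close> commutes with the action of spans.\<close>

lemma K_G_natural:
  fixes M N :: "('g, 'v) mackey"
  assumes M: "small_mackey_functor G pb M" and N: "small_mackey_functor G pb N" and nat: "mackey_natural G M N \<eta>"
  shows "spectral_natural S (scat_op S (GB K G pb)) (Spec S) (K_G S K G M) (K_G S K G N) (K_G_nat S K G M N \<eta>)"
proof -
  have h': "\<forall>a. fset a \<longrightarrow> \<eta> a \<in> hom (MOb M a) (MOb N a)" using nat unfolding mackey_natural_def by blast
  note h = h'[rule_format] and t = K_G_nat[OF M N h']
  show ?thesis
  proof (intro spectral_natural.intro K_G_functor M N spectral_natural_axioms.intro,
      unfold op_fields Spec_fields K_G_ob mem_Collect_eq, goal_cases)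
    case (1 a)
    then show ?case by (rule t(1))
  next
    case ab: (2 a b)
    let ?Ma = "disc (MOb M a)" and ?Mb = "disc (MOb M b)" and ?Na = "disc (MOb N a)" and ?Nb = "disc (MOb N b)"
    let ?W = "KOb K (P b a)"
    note cgM = B.M_cg[OF M ab(1)] B.M_cg[OF M ab(2)] and cgN = B.M_cg[OF N ab(1)] B.M_cg[OF N ab(2)]
    note obs = KM_ob[OF M ab(1)] KM_ob[OF M ab(2)] KM_ob[OF N ab(1)] KM_ob[OF N ab(2)] KP_ob[OF ab(2,1)]
    note pa = B.Perm_morphism_action[OF M ab(2,1)] B.Perm_morphism_action[OF N ab(2,1)]
    note pd = Perm_morphism_disc_fun[OF B.univ B.M_ab[OF M ab(1)] B.M_ab[OF N ab(1)] h[OF ab(1)]]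
      Perm_morphism_disc_fun[OF B.univ B.M_ab[OF M ab(2)] B.M_ab[OF N ab(2)] h[OF ab(2)]]
    note pi = Perm_morphism_mid[OF B.small_P[OF ab(2,1)]]
    note af = B.action_fields[OF M ab(2,1)] B.action_fields[OF N ab(2,1)]
    have perm: "permutative_category (P b a)" "permutative_category ?Ma"
      using B.perm_P[OF ab(2,1)] B.M_small[OF M ab(1)] by (simp_all add: small_permcat_def)
    have ml: "multilinear_functor (B.action M b a)" "multilinear_functor (B.action N b a)"
      "multilinear_functor (disc_fun (MOb M a) (MOb N a) (\<eta> a))" "multilinear_functor (disc_fun (MOb M b) (MOb N b) (\<eta> b))"
      "multilinear_functor (mid (P b a))"
      using pa pd pi by (simp_all add: Perm_morphism_def)
    have d: "discrete_permcat ?Nb" by (rule disc_discrete[OF cgN(2)])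
    let ?h = "\<lambda>xs. B.act N b a (xs ! 0) (\<eta> a (xs ! 1))"
    have "mcomp (disc_fun (MOb M b) (MOb N b) (\<eta> b)) [B.action M b a] =
        lin_map (concat (map Srcs [B.action M b a])) (Target (disc_fun (MOb M b) (MOb N b) (\<eta> b)))
        (\<lambda>xs. FO (disc_fun (MOb M b) (MOb N b) (\<eta> b)) (map2 FO [B.action M b a] (chop (map (length \<circ> Srcs) [B.action M b a]) xs)))"
      by (rule mcomp_discrete[OF ml(4)]) (use perm ml d in \<open>auto simp: af multilinear_typed\<close>)
    also have "\<dots> = lin_map [P b a, ?Ma] ?Nb ?h"
      unfolding af disc_fun_fields list.map concat.simps append.simps
    proof (rule lin_map_cong, goal_cases)
      case (2 xs)
      then obtain X z where X: "xs = [B.e b a X, z]" "X \<in> spans G b a" "z \<in> carrier (MOb M a)"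
        by (auto simp: B.P_Ob)
      have ob: "B.e b a X \<in> Ob (P b a)" by (rule B.P_ObI[OF X(2)])
      have "\<eta> b (B.act M b a (B.e b a X) z) = B.act N b a (B.e b a X) (\<eta> a z)"
        using nat ab X(3) B.span_class_carrier[OF ab(2,1) X(2)]
        unfolding B.act_e[OF M X(2)] B.act_e[OF N X(2)] mackey_natural_def by blast
      then show ?case
        using ob X(3) B.act_closed[OF M ab(2,1) ob X(3)] by (simp add: X(1) af)
    qed (use perm in auto)
    also have "\<dots> = lin_map (concat (map Srcs [mid (P b a), disc_fun (MOb M a) (MOb N a) (\<eta> a)])) (Target (B.action N b a))
        (\<lambda>xs. FO (B.action N b a) (map2 FO [mid (P b a), disc_fun (MOb M a) (MOb N a) (\<eta> a)]
          (chop (map (length \<circ> Srcs) [mid (P b a), disc_fun (MOb M a) (MOb N a) (\<eta> a)]) xs)))"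
      unfolding af disc_fun_fields mid_fields list.map concat.simps append.simps
      by (rule lin_map_cong) (use perm hom_in_carrier[OF h[OF ab(1)]] in \<open>auto simp: af\<close>)
    also have "\<dots> = mcomp (B.action N b a) [mid (P b a), disc_fun (MOb M a) (MOb N a) (\<eta> a)]"
      by (rule mcomp_discrete[symmetric, OF ml(2)]) (use perm ml d in \<open>auto simp: af multilinear_typed\<close>)
    finally have eq: "KMor K (disc_fun (MOb M b) (MOb N b) (\<eta> b)) \<odot> KMor K (B.action M b a) =
        KMor K (B.action N b a) \<odot> (idt ?W \<boxdot> KMor K (disc_fun (MOb M a) (MOb N a) (\<eta> a)))"
      using KMor_mcomp_1[OF pd(2) pa(1)] KMor_mcomp_1_1[OF pa(2) pi pd(1)]
      by (simp add: af KMor_mid B.small_P[OF ab(2,1)])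
    note FM = K_G_hom[OF M ab] and FN = K_G_hom[OF N ab]
    note ta = t[OF ab(1)] and tb = t[OF ab(2)]
    note 1 = Spec_comp_point_left[OF tb FM obs(1)] and 2 = Spec_comp_point_right[OF ta FN obs(4)]
    note [simp] = obs sHomD[OF FM(1)] sHomD[OF FN(1)] sHomD[OF ta(1)] sHomD[OF tb(1)] sHomD[OF Spec_comp_typed]
    show ?case
      by (rule curry_eqI[OF _ _ obs(1,4)]) (simp_all only: 1 2 eq, simp_all add: sHom_def)
  qed
qed

lemma K_G_nat_id:
  fixes M :: "('g, 'v) mackey"
  assumes M: "small_mackey_functor G pb M" and a: "fset a"
  shows "K_G_nat S K G M M (\<lambda>_ x. x) a = SUnit (Spec S) (SFob (K_G S K G M) a)"
proof (rule K_G_nat_eqI[OF M M _ a])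
  note ob = KM_ob[OF M a]
  show "\<forall>b. fset b \<longrightarrow> (\<lambda>x. x) \<in> hom (MOb M b) (MOb M b)" by (simp add: hom_def)
  show "SUnit (Spec S) (SFob (K_G S K G M) a) \<in> sHom S I (sFun S (KOb K (disc (MOb M a))) (KOb K (disc (MOb M a))))"
    unfolding K_G_ob by (rule Spec_unit(1)[OF ob])
  show "sEv S (KOb K (disc (MOb M a))) (KOb K (disc (MOb M a))) \<odot> (SUnit (Spec S) (SFob (K_G S K G M) a) \<boxdot> idt (KOb K (disc (MOb M a)))) =
      KMor K (disc_fun (MOb M a) (MOb M a) (\<lambda>x. x)) \<odot> lun (KOb K (disc (MOb M a)))"
    unfolding K_G_ob Spec_unit(2)[OF ob] mid_disc[OF B.M_cg[OF M a], symmetric] KMor_mid[OF B.M_small[OF M a]]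
    using ob by simp
qed

text \<open>\<open>snat_comp\<close> composes names, so \<open>Spec_comp_point_left\<close>
  evaluates it to a composite of images under K, and K preserves composites of
  \<open>disc_fun\<close>.\<close>

lemma K_G_nat_comp:
  fixes M N L :: "('g, 'v) mackey"
  assumes M: "small_mackey_functor G pb M" and N: "small_mackey_functor G pb N" and L: "small_mackey_functor G pb L"
    and \<eta>: "mackey_natural G M N \<eta>" and \<theta>: "mackey_natural G N L \<theta>" and a: "fset a"
  shows "K_G_nat S K G M L (\<lambda>A x. \<theta> A (\<eta> A x)) a =
    snat_comp S (Spec S) (K_G S K G M) (K_G S K G N) (K_G S K G L) (K_G_nat S K G N L \<theta>) (K_G_nat S K G M N \<eta>) a"
proof (rule K_G_nat_eqI[OF M L _ a])
  have h': "\<forall>a. fset a \<longrightarrow> \<eta> a \<in> hom (MOb M a) (MOb N a)" using \<eta> unfolding mackey_natural_def by blast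
  have k': "\<forall>a. fset a \<longrightarrow> \<theta> a \<in> hom (MOb N a) (MOb L a)" using \<theta> unfolding mackey_natural_def by blast
  note h = h'[rule_format] and k = k'[rule_format]
  have "(\<lambda>x. \<theta> b (\<eta> b x)) \<in> hom (MOb M b) (MOb L b)" if "fset b" for b
    using hom_compose[OF h[OF that] k[OF that]] by (simp add: comp_def)
  then show "\<forall>b. fset b \<longrightarrow> (\<lambda>x. \<theta> b (\<eta> b x)) \<in> hom (MOb M b) (MOb L b)" by blast
  note t = K_G_nat[OF M N h' a] and u = K_G_nat[OF N L k' a]
  note obs = KM_ob[OF M a] KM_ob[OF N a] KM_ob[OF L a]
  note [simp] = obs sHomD[OF t(1)] sHomD[OF t(3)] sHomD[OF u(1)] sHomD[OF u(3)] sHomD[OF Spec_comp_typed]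
  show "snat_comp S (Spec S) (K_G S K G M) (K_G S K G N) (K_G S K G L) (K_G_nat S K G N L \<theta>) (K_G_nat S K G M N \<eta>) a
      \<in> sHom S I (sFun S (KOb K (disc (MOb M a))) (KOb K (disc (MOb L a))))"
    unfolding snat_comp_def K_G_ob by (simp add: sHom_def)
  note ab = B.M_ab[OF M a] B.M_ab[OF N a] B.M_ab[OF L a] and cg = B.M_cg[OF M a] B.M_cg[OF N a] B.M_cg[OF L a]
  have "KMor K (disc_fun (MOb M a) (MOb L a) (\<lambda>x. \<theta> a (\<eta> a x))) =
      KMor K (disc_fun (MOb N a) (MOb L a) (\<theta> a)) \<odot> KMor K (disc_fun (MOb M a) (MOb N a) (\<eta> a))"
    using KMor_mcomp_1[OF Perm_morphism_disc_fun[OF B.univ ab(2,3) k[OF a]] Perm_morphism_disc_fun[OF B.univ ab(1,2) h[OF a]]]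
    by (simp add: mcomp_disc_fun[OF cg h[OF a] k[OF a]])
  then show "sEv S (KOb K (disc (MOb M a))) (KOb K (disc (MOb L a))) \<odot>
      (snat_comp S (Spec S) (K_G S K G M) (K_G S K G N) (K_G S K G L) (K_G_nat S K G N L \<theta>) (K_G_nat S K G M N \<eta>) a
        \<boxdot> idt (KOb K (disc (MOb M a)))) =
      KMor K (disc_fun (MOb M a) (MOb L a) (\<lambda>x. \<theta> a (\<eta> a x))) \<odot> lun (KOb K (disc (MOb M a)))"
    unfolding snat_comp_def K_G_ob Spec_comp_point_left[OF u t(1,2) obs(1)] by simp
qed

subsection \<open>Homotopy Mackey functors\<close>

context
  fixes A B assumes AB: "fset A" "fset B"
begin

interpretation H: comm_group "hGrp S 0 (KOb K (P A B))" by (rule hGrp[OF KP_ob[OF AB]])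

text \<open>The inner function of \<open>burnside_to_\<pi>\<^sub>0\<close>, named so that it can be
  shown to be additive before it is extended to the completion.\<close>

definition "span_K_class p = the_elem ((\<lambda>X. K_class S K (P A B) (B.e A B X)) ` p)"

text \<open>Isomorphic spans are joined by an arrow of the hom category, and arrows preserve
  \<open>K_class\<close>, so the image of a class is a singleton.\<close>

lemma span_K_class:
  assumes X: "X \<in> spans G A B"
  shows "span_K_class (B.cls A B X) = K_class S K (P A B) (B.e A B X)"
  unfolding span_K_class_def
proof (rule the_elem_image_unique)
  show "B.cls A B X \<noteq> {}" using B.cls_self[OF X] by fast
  fix Y assume "Y \<in> B.cls A B X"
  then have "(X, Y) \<in> iso_rel G A B" by simp
  then obtain u where "u \<in> Hom (P A B) (B.e A B X) (B.e A B Y)" by (rule B.iso_arrow)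
  then show "K_class S K (P A B) (B.e A B Y) = K_class S K (P A B) (B.e A B X)"
    by (rule K_class_arrow[OF B.small_P[OF AB], symmetric])
qed

lemma span_K_class_hom: "span_K_class \<in> hom (span_classes G A B) (hGrp S 0 (KOb K (P A B)))"
proof (rule homI)
  fix p assume "p \<in> carrier (span_classes G A B)"
  then obtain X where X: "X \<in> spans G A B" "p = B.cls A B X" by (auto simp: B.cls_carrier)
  show "span_K_class p \<in> carrier (hGrp S 0 (KOb K (P A B)))"
    unfolding X(2) span_K_class[OF X(1)] by (rule K_class_closed[OF B.small_P[OF AB] B.P_ObI[OF X(1)]])
  fix q assume "q \<in> carrier (span_classes G A B)"
  then obtain Y where Y: "Y \<in> spans G A B" "q = B.cls A B Y" by (auto simp: B.cls_carrier)
  show "span_K_class (p \<otimes>\<^bsub>span_classes G A B\<^esub> q) = span_K_class p \<otimes>\<^bsub>hGrp S 0 (KOb K (P A B))\<^esub> span_K_class q"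
    unfolding X(2) Y(2) B.cls_mult[OF AB X(1) Y(1)] span_K_class[OF X(1)] span_K_class[OF Y(1)]
      span_K_class[OF B.span_sum_spans[OF X(1) Y(1)]] B.P_Add[OF X(1) Y(1), symmetric]
    by (rule K_class_add[OF B.small_P[OF AB] B.P_ObI[OF X(1)] B.P_ObI[OF Y(1)]])
qed

lemma burnside_to_\<pi>\<^sub>0:
  assumes "X \<in> spans G A B" "Y \<in> spans G A B"
  shows "burnside_to_\<pi>\<^sub>0 S K G A B (groth_rel (span_classes G A B) `` {(B.cls A B X, B.cls A B Y)}) =
    K_class S K (P A B) (B.e A B X) \<otimes>\<^bsub>hGrp S 0 (KOb K (P A B))\<^esub>
      inv\<^bsub>hGrp S 0 (KOb K (P A B))\<^esub> K_class S K (P A B) (B.e A B Y)"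
proof -
  interpret C: comm_monoid "span_classes G A B" by (rule B.comm_monoid_span_classes[OF AB])
  have c: "B.cls A B X \<in> carrier (span_classes G A B)" "B.cls A B Y \<in> carrier (span_classes G A B)"
    using assms by (auto simp: B.cls_carrier)
  have "burnside_to_\<pi>\<^sub>0 S K G A B = completion_lift (hGrp S 0 (KOb K (P A B))) span_K_class"
    unfolding burnside_to_\<pi>\<^sub>0_def span_K_class_def[abs_def] ..
  then show ?thesis
    using C.completion_lift[OF H.comm_group_axioms span_K_class_hom c] assms by (simp add: span_K_class)
qed

end

text \<open>A homotopy class of the morphism spectrum acts through \<open>action\<close>,
  additively. On the class of a span the value is given by \<open>hPair_K_class\<close>. A general
  \<open>c\<close> is a difference of spans \<open>X\<close> and \<open>X'\<close>; its value is
  found by adding the value at \<open>X'\<close> and cancelling.\<close>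

lemma homotopy_mackey_K_class:
  fixes M :: "('g, 'v) mackey"
  assumes M: "small_mackey_functor G pb M" and AB: "fset A" "fset B"
    and c: "c \<in> carrier (burnside_hom G A B)" and z: "z \<in> carrier (MOb M B)"
  shows "MMap (homotopy_mackey S K G 0 (K_G S K G M)) A B c (K_class S K (disc (MOb M B)) z) =
    K_class S K (disc (MOb M A)) (MMap M A B c z)"
proof -
  let ?W = "KOb K (P A B)" and ?X = "KOb K (disc (MOb M B))" and ?Y = "KOb K (disc (MOb M A))"
  let ?k = "\<lambda>X. K_class S K (P A B) (B.e A B X)" and ?z = "K_class S K (disc (MOb M B)) z"
  let ?\<eta> = "K_class S K (disc (MOb M A))"
  interpret W: comm_group "hGrp S 0 ?W" by (rule hGrp[OF KP_ob[OF AB]])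
  interpret Y: comm_group "hGrp S 0 ?Y" by (rule hGrp[OF KM_ob[OF M AB(1)]])
  interpret MA: comm_group "MOb M A" by (rule B.M_cg[OF M AB(1)])
  obtain X X' where X: "X \<in> spans G A B" "X' \<in> spans G A B"
    and c_eq: "c = groth_rel (span_classes G A B) `` {(B.cls A B X, B.cls A B X')}"
    and cX: "c \<otimes>\<^bsub>burnside_hom G A B\<^esub> span_class G A B X' = span_class G A B X"
    by (rule B.burnside_homE[OF AB c])
  have kc: "?k X \<in> carrier (hGrp S 0 ?W)" if "X \<in> spans G A B" for X
    by (rule K_class_closed[OF B.small_P[OF AB] B.P_ObI[OF that]])
  have zc: "?z \<in> carrier (hGrp S 0 ?X)"
    by (rule K_class_closed[OF B.M_small[OF M AB(2)]]) (simp add: z)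
  have E: "KMor K (B.action M A B) \<in> sHom S (?W \<boxtimes> ?X) ?Y" by (rule KMor_action[OF M AB(2,1)])
  \<comment> \<open>The action of homotopy classes of the morphism spectrum on the fixed class
    \<open>?z\<close>. It is a homomorphism because the exterior product is additive in its first
    factor.\<close>
  define f where "f = (\<lambda>w. hMap S 0 (KMor K (B.action M A B)) (hPair S 0 0 ?W ?X w ?z))"
  have "(\<lambda>w. hPair S 0 0 ?W ?X w ?z) \<in> hom (hGrp S 0 ?W) (hGrp S 0 (?W \<boxtimes> ?X))"
    using hPair_left[OF KP_ob[OF AB] KM_ob[OF M AB(2)] zc, of 0] by simp
  from hom_compose[OF this hMap[OF E]]
  have f: "f \<in> hom (hGrp S 0 ?W) (hGrp S 0 ?Y)" by (simp add: f_def comp_def)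
  have fk: "f (?k X) = ?\<eta> (MMap M A B (span_class G A B X) z)" if X: "X \<in> spans G A B" for X
  proof -
    note af = B.action_fields[OF M AB]
    have ob: "B.e A B X \<in> Ob (P A B)" by (rule B.P_ObI[OF X])
    have perm: "permutative_category (P A B)" "permutative_category (disc (MOb M B))" "permutative_category (disc (MOb M A))"
      using B.perm_P[OF AB] B.M_small[OF M AB(2)] B.M_small[OF M AB(1)] by (simp_all add: small_permcat_def)
    have d: "discrete_permcat (disc (MOb M A))" by (rule disc_discrete[OF B.M_cg[OF M AB(1)]])
    let ?fs = "[mpoint (P A B) (B.e A B X), mpoint (disc (MOb M B)) z]" and ?a = "B.act M A B (B.e A B X) z"
    have ac: "?a \<in> carrier (MOb M A)" by (rule B.act_closed[OF M AB ob z])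
    have ml: "multilinear_functor (B.action M A B)" "multilinear_functor (mpoint (P A B) (B.e A B X))"
      "multilinear_functor (mpoint (disc (MOb M B)) z)" "multilinear_functor (mpoint (disc (MOb M A)) ?a)"
      using B.Perm_morphism_action[OF M AB] multilinear_mpoint[OF perm(1) ob] multilinear_mpoint[OF perm(2)] z
        multilinear_mpoint[OF perm(3)] ac
      by (simp_all add: Perm_morphism_def)
    have "mcomp (B.action M A B) ?fs = lin_map (concat (map Srcs ?fs)) (Target (B.action M A B))
        (\<lambda>xs. FO (B.action M A B) (map2 FO ?fs (chop (map (length \<circ> Srcs) ?fs) xs)))"
      by (rule mcomp_discrete[OF ml(1)]) (use ml d in \<open>auto simp: af multilinear_typed\<close>)
    also have "\<dots> = lin_map [] (disc (MOb M A)) (FO (mpoint (disc (MOb M A)) ?a))"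
      unfolding af mpoint_fields list.map concat.simps append.simps
      by (rule lin_map_cong) (use ob z in \<open>auto simp: af\<close>)
    also have "\<dots> = mpoint (disc (MOb M A)) ?a"
      using multilinear_discrete(1)[OF ml(4)] d by simp
    finally have "mcomp (B.action M A B) ?fs = mpoint (Target (B.action M A B)) ?a" by (simp add: af)
    from hPair_K_class[OF B.Perm_morphism_action[OF M AB] af(1) ob _ this]
    show ?thesis using z unfolding f_def by (simp add: af B.act_e[OF M X])
  qed
  have \<eta>_iso: "?\<eta> \<in> iso (MOb M A) (hGrp S 0 ?Y)"
    using K_class_disc_iso B.M_ab[OF M AB(1)] by (simp add: small_ab_def)
  then have \<eta>_hom: "?\<eta> \<in> hom (MOb M A) (hGrp S 0 ?Y)" by (rule iso_imp_homomorphism)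
  have mc: "MMap M A B d z \<in> carrier (MOb M A)" if "d \<in> carrier (burnside_hom G A B)" for d
    by (rule hom_in_carrier[OF mackey_functor.map[OF B.mackey[OF M] AB that] z])
  note sc = B.span_class_carrier[OF AB X(1)] B.span_class_carrier[OF AB X(2)]
  have sum: "MMap M A B c z \<otimes>\<^bsub>MOb M A\<^esub> MMap M A B (span_class G A B X') z = MMap M A B (span_class G A B X) z"
    using mackey_functor.additive[OF B.mackey[OF M] AB c sc(2) z] by (simp add: cX)
  have w: "SFhom (K_G S K G M) B A \<in> sHom S ?W (sFun S ?X ?Y)" by (rule K_G_hom(1)[OF M AB(2,1)])
  have bc: "burnside_to_\<pi>\<^sub>0 S K G A B c = ?k X \<otimes>\<^bsub>hGrp S 0 ?W\<^esub> inv\<^bsub>hGrp S 0 ?W\<^esub> ?k X'"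
    unfolding c_eq by (rule burnside_to_\<pi>\<^sub>0[OF AB X])
  have bcc: "burnside_to_\<pi>\<^sub>0 S K G A B c \<in> carrier (hGrp S 0 ?W)" unfolding bc using kc X by simp
  have "MMap (homotopy_mackey S K G 0 (K_G S K G M)) A B c ?z =
      ho_act S 0 ?X ?Y (hMap S 0 (SFhom (K_G S K G M) B A) (burnside_to_\<pi>\<^sub>0 S K G A B c)) ?z"
    by (simp add: homotopy_mackey_def K_G_ob)
  also have "\<dots> = f (burnside_to_\<pi>\<^sub>0 S K G A B c)"
    unfolding f_def ho_act_uncurry[OF w KM_ob[OF M AB(2)] KM_ob[OF M AB(1)] bcc zc] K_G_hom(2)[OF M AB(2,1)] ..
  finally have 1: "MMap (homotopy_mackey S K G 0 (K_G S K G M)) A B c ?z = f (burnside_to_\<pi>\<^sub>0 S K G A B c)" .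
  \<comment> \<open>Both sides of the claim are compared after adding \<open>f (?k X')\<close>,
    where each becomes the value at the span \<open>X\<close>.\<close>
  have "f (burnside_to_\<pi>\<^sub>0 S K G A B c) \<otimes>\<^bsub>hGrp S 0 ?Y\<^esub> f (?k X') = f (burnside_to_\<pi>\<^sub>0 S K G A B c \<otimes>\<^bsub>hGrp S 0 ?W\<^esub> ?k X')"
    by (rule hom_mult[OF f bcc kc[OF X(2)], symmetric])
  also have "\<dots> = f (?k X)" unfolding bc using kc X by (simp add: W.m_assoc)
  also have "\<dots> = ?\<eta> (MMap M A B c z \<otimes>\<^bsub>MOb M A\<^esub> MMap M A B (span_class G A B X') z)"
    unfolding sum by (rule fk[OF X(1)])
  also have "\<dots> = ?\<eta> (MMap M A B c z) \<otimes>\<^bsub>hGrp S 0 ?Y\<^esub> f (?k X')"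
    unfolding fk[OF X(2)] by (rule hom_mult[OF \<eta>_hom mc[OF c] mc[OF sc(2)]])
  finally have "f (burnside_to_\<pi>\<^sub>0 S K G A B c) = ?\<eta> (MMap M A B c z)"
    using hom_in_carrier[OF f bcc] hom_in_carrier[OF f kc[OF X(2)]] hom_in_carrier[OF \<eta>_hom mc[OF c]] by simp
  then show ?thesis unfolding 1 .
qed

end

text \<open>Transport of structure: every \<open>x\<close> in \<open>N\<close> has the form
  \<open>\<eta> A z\<close>, and each Mackey law holds there because it holds for \<open>M\<close>
  at \<open>z\<close>. Since \<open>mackey_isomorphic\<close> demands two Mackey functors, this
  supplies the laws for the homotopy side.\<close>

lemma (in burnside) mackey_isomorphic_transport:
  assumes M: "mackey_functor G pb M" and N: "\<And>A. fset A \<Longrightarrow> comm_group (MOb N A)"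
    and iso: "\<And>A. fset A \<Longrightarrow> \<eta> A \<in> iso (MOb M A) (MOb N A)"
    and nat: "\<And>A B c z. \<lbrakk>fset A; fset B; c \<in> carrier (burnside_hom G A B); z \<in> carrier (MOb M B)\<rbrakk> \<Longrightarrow>
      MMap N A B c (\<eta> B z) = \<eta> A (MMap M A B c z)"
  shows "mackey_isomorphic G pb N M"
proof -
  interpret M: mackey_functor G pb M by fact
  have hom: "\<eta> A \<in> hom (MOb M A) (MOb N A)" if "fset A" for A by (rule iso_imp_homomorphism[OF iso[OF that]])
  have inv: "\<exists>z\<in>carrier (MOb M A). x = \<eta> A z" if "fset A" "x \<in> carrier (MOb N A)" for A x
    using iso[OF that(1)] that(2) unfolding iso_def bij_betw_def by blast
  have Mc: "MMap M A B c z \<in> carrier (MOb M A)" if "fset A" "fset B" "c \<in> carrier (burnside_hom G A B)" "z \<in> carrier (MOb M B)" for A B c z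
    by (rule hom_in_carrier[OF M.map[OF that(1-3)] that(4)])
  have Nfun: "mackey_functor G pb N"
  proof (rule mackey_functor.intro)
    fix A assume A: "fset A"
    show "comm_group (MOb N A)" by (rule N[OF A])
    fix x assume "x \<in> carrier (MOb N A)"
    then obtain z where z: "z \<in> carrier (MOb M A)" "x = \<eta> A z" using inv[OF A] by blast
    have "burnside_id G A \<in> carrier (burnside_hom G A A)"
      unfolding burnside_id_def by (rule span_class_carrier[OF A A span_id_spans[OF A]])
    then show "MMap N A A (burnside_id G A) x = x" using nat[OF A A _ z(1)] M.id[OF A z(1)] z(2) by simp
  next
    fix A B c assume AB: "fset A" "fset B" and c: "c \<in> carrier (burnside_hom G A B)"
    show "MMap N A B c \<in> hom (MOb N B) (MOb N A)"
    proof (rule homI)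
      fix x assume "x \<in> carrier (MOb N B)"
      then obtain z where z: "z \<in> carrier (MOb M B)" "x = \<eta> B z" using inv[OF AB(2)] by blast
      show "MMap N A B c x \<in> carrier (MOb N A)"
        unfolding z(2) nat[OF AB c z(1)] by (rule hom_in_carrier[OF hom[OF AB(1)] Mc[OF AB c z(1)]])
      fix y assume "y \<in> carrier (MOb N B)"
      then obtain w where w: "w \<in> carrier (MOb M B)" "y = \<eta> B w" using inv[OF AB(2)] by blast
      interpret MB: comm_group "MOb M B" by (rule M.ob[OF AB(2)])
      have "x \<otimes>\<^bsub>MOb N B\<^esub> y = \<eta> B (z \<otimes>\<^bsub>MOb M B\<^esub> w)"
        unfolding z(2) w(2) by (rule hom_mult[OF hom[OF AB(2)] z(1) w(1), symmetric])
      then have "MMap N A B c (x \<otimes>\<^bsub>MOb N B\<^esub> y) = \<eta> A (MMap M A B c (z \<otimes>\<^bsub>MOb M B\<^esub> w))"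
        using nat[OF AB c MB.m_closed[OF z(1) w(1)]] by simp
      also have "\<dots> = \<eta> A (MMap M A B c z) \<otimes>\<^bsub>MOb N A\<^esub> \<eta> A (MMap M A B c w)"
        unfolding hom_mult[OF M.map[OF AB c] z(1) w(1)]
        by (rule hom_mult[OF hom[OF AB(1)] Mc[OF AB c z(1)] Mc[OF AB c w(1)]])
      finally show "MMap N A B c (x \<otimes>\<^bsub>MOb N B\<^esub> y) = MMap N A B c x \<otimes>\<^bsub>MOb N A\<^esub> MMap N A B c y"
        by (simp add: z w nat[OF AB c])
    qed
    fix c' x assume c': "c' \<in> carrier (burnside_hom G A B)" and "x \<in> carrier (MOb N B)"
    then obtain z where z: "z \<in> carrier (MOb M B)" "x = \<eta> B z" using inv[OF AB(2)] by blast
    interpret BH: comm_group "burnside_hom G A B"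
      unfolding burnside_hom_def by (rule comm_monoid.comm_group_group_completion[OF comm_monoid_span_classes[OF AB]])
    show "MMap N A B (c \<otimes>\<^bsub>burnside_hom G A B\<^esub> c') x = MMap N A B c x \<otimes>\<^bsub>MOb N A\<^esub> MMap N A B c' x"
      unfolding z(2) nat[OF AB c z(1)] nat[OF AB c' z(1)] nat[OF AB BH.m_closed[OF c c'] z(1)] M.additive[OF AB c c' z(1)]
      by (rule hom_mult[OF hom[OF AB(1)] Mc[OF AB c z(1)] Mc[OF AB c' z(1)]])
  next
    fix A B C c d x assume ABC: "fset A" "fset B" "fset C" and c: "c \<in> carrier (burnside_hom G A B)"
      and d: "d \<in> carrier (burnside_hom G B C)" and "x \<in> carrier (MOb N C)"
    then obtain z where z: "z \<in> carrier (MOb M C)" "x = \<eta> C z" using inv[OF ABC(3)] by blast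
    show "MMap N A C (burnside_comp G pb A B C d c) x = MMap N A B c (MMap N B C d x)"
      unfolding z(2) nat[OF ABC(2,3) d z(1)] nat[OF ABC(1,2) c Mc[OF ABC(2,3) d z(1)]]
        nat[OF ABC(1,3) burnside_comp_closed[OF ABC c d] z(1)] M.comp[OF ABC c d z(1)] ..
  qed
  \<comment> \<open>The required isomorphism runs from \<open>N\<close> to \<open>M\<close>, so the
    given maps are inverted.\<close>
  let ?\<theta> = "\<lambda>A. inv_into (carrier (MOb M A)) (\<eta> A)"
  have th: "?\<theta> A \<in> iso (MOb N A) (MOb M A)" if "fset A" for A
    using group.iso_set_sym[OF _ iso[OF that]] M.ob[OF that] by (simp add: comm_group.axioms(2))
  have inj: "?\<theta> A (\<eta> A z) = z" if "fset A" "z \<in> carrier (MOb M A)" for A z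
    using iso[OF that(1)] that(2) by (auto simp: iso_def bij_betw_def inv_into_f_f)
  have "mackey_natural G N M ?\<theta>"
    unfolding mackey_natural_def
  proof (intro conjI allI impI ballI)
    show "?\<theta> A \<in> hom (MOb N A) (MOb M A)" if "fset A" for A by (rule iso_imp_homomorphism[OF th[OF that]])
    fix A B c x assume AB: "fset A" "fset B" and c: "c \<in> carrier (burnside_hom G A B)" and "x \<in> carrier (MOb N B)"
    then obtain z where z: "z \<in> carrier (MOb M B)" "x = \<eta> B z" using inv[OF AB(2)] by blast
    show "?\<theta> A (MMap N A B c x) = MMap M A B c (?\<theta> B x)"
      unfolding z(2) nat[OF AB c z(1)] inj[OF AB(2) z(1)] by (rule inj[OF AB(1) Mc[OF AB c z(1)]])
  qed
  then show ?thesis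
    unfolding mackey_isomorphic_def using Nfun M th by blast
qed

theorem corollary1p2:
  fixes G :: "'g monoid" and pb :: "'g pullbacks"
    and S :: "('s, 't, 'h) spectra" and K :: "('v, 's, 't) machine"
  assumes "group G" and "finite (carrier G)"
    and "universe TYPE('v)"
    and "category_of_spectra S" and "K_theory_machine S K"
    and "pullback_choice G pb" and "pc_category (GE G pb :: ('g gset, 'v) pccat)"
  shows
    "(\<forall>M :: ('g, 'v) mackey. small_mackey_functor G pb M \<longrightarrow>
        pc_functor (pc_op (GE G pb)) Perm (mackey_pc G M) \<and>
        spectral_functor S (scat_op S (GB K G pb)) (Spec S) (K_G S K G M) \<and>
        mackey_isomorphic G pb (homotopy_mackey S K G 0 (K_G S K G M)) M \<and>
        (\<forall>n A. n \<noteq> 0 \<longrightarrow> fin_gset G A \<longrightarrow>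
           carrier (MOb (homotopy_mackey S K G n (K_G S K G M)) A) =
           {\<one>\<^bsub>MOb (homotopy_mackey S K G n (K_G S K G M)) A\<^esub>}) \<and>
        (\<forall>A. fin_gset G A \<longrightarrow>
           K_G_nat S K G M M (\<lambda>_ x. x) A = SUnit (Spec S) (SFob (K_G S K G M) A))) \<and>
     (\<forall>(M :: ('g, 'v) mackey) N \<eta>.
        small_mackey_functor G pb M \<and> small_mackey_functor G pb N \<and> mackey_natural G M N \<eta> \<longrightarrow>
        pc_natural (pc_op (GE G pb)) Perm (mackey_pc G M) (mackey_pc G N) (mackey_pc_nat M N \<eta>) \<and>
        spectral_natural S (scat_op S (GB K G pb)) (Spec S) (K_G S K G M) (K_G S K G N)
          (K_G_nat S K G M N \<eta>)) \<and>
     (\<forall>(M :: ('g, 'v) mackey) N L \<eta> \<theta> A.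
        small_mackey_functor G pb M \<and> small_mackey_functor G pb N \<and> small_mackey_functor G pb L \<and>
        mackey_natural G M N \<eta> \<and> mackey_natural G N L \<theta> \<and> fin_gset G A \<longrightarrow>
        K_G_nat S K G M L (\<lambda>A x. \<theta> A (\<eta> A x)) A =
        snat_comp S (Spec S) (K_G S K G M) (K_G S K G N) (K_G S K G L)
          (K_G_nat S K G N L \<theta>) (K_G_nat S K G M N \<eta>) A)"
proof -
  interpret B: burnside G pb "GE G pb :: ('g gset, 'v) pccat"
    using assms by (intro burnside.intro burnside_axioms.intro refl)
  interpret K_burnside S K G pb "GE G pb :: ('g gset, 'v) pccat"
    using assms by (intro K_burnside.intro K_theory.intro B.burnside_axioms)
  have iso: "mackey_isomorphic G pb (homotopy_mackey S K G 0 (K_G S K G M)) M"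
    if M: "small_mackey_functor G pb M" for M :: "('g, 'v) mackey"
  proof (rule B.mackey_isomorphic_transport[OF B.mackey[OF M], where \<eta> = "\<lambda>A. K_class S K (disc (MOb M A))"])
    have ob: "MOb (homotopy_mackey S K G 0 (K_G S K G M)) A = hGrp S 0 (KOb K (disc (MOb M A)))" for A
      by (simp add: homotopy_mackey_def K_G_ob)
    fix A assume A: "fin_gset G A"
    show "comm_group (MOb (homotopy_mackey S K G 0 (K_G S K G M)) A)"
      unfolding ob by (rule hGrp[OF KM_ob[OF M A]])
    show "K_class S K (disc (MOb M A)) \<in> iso (MOb M A) (MOb (homotopy_mackey S K G 0 (K_G S K G M)) A)"
      unfolding ob using K_class_disc_iso B.M_ab[OF M A] by (simp add: small_ab_def)
  qed (rule homotopy_mackey_K_class[OF M])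
  \<comment> \<open>The value at \<open>A\<close> is the spectrum
    \<open>KOb K (disc (MOb M A))\<close>, to which \<open>K_disc\<close> applies in every nonzero
    degree.\<close>
  have zero: "carrier (MOb (homotopy_mackey S K G n (K_G S K G M)) A) = {\<one>\<^bsub>MOb (homotopy_mackey S K G n (K_G S K G M)) A\<^esub>}"
    if M: "small_mackey_functor G pb M" and "n \<noteq> 0" and A: "fin_gset G A" for M :: "('g, 'v) mackey" and n A
    using K_disc[of "MOb M A"] B.M_ab[OF M A] \<open>n \<noteq> 0\<close>
    by (simp add: homotopy_mackey_def K_G_ob small_ab_def Eilenberg_MacLane_def)
  show ?thesis
  proof (intro conjI allI impI, goal_cases)
    case (1 M)
    then show ?case by (rule B.mackey_pc_functor)
  next
    case (2 M)
    then show ?case by (rule K_G_functor)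
  next
    case (3 M)
    then show ?case by (rule iso)
  next
    case (4 M n A)
    then show ?case by (rule zero)
  next
    case (5 M A)
    then show ?case by (rule K_G_nat_id)
  next
    case (6 M N \<eta>)
    then show ?case by (elim conjE) (rule B.mackey_pc_natural)
  next
    case (7 M N \<eta>)
    then show ?case by (elim conjE) (rule K_G_natural)
  next
    case (8 M N L \<eta> \<theta> A)
    then show ?case by (elim conjE) (rule K_G_nat_comp)
  qed
qed

end
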